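(* Let $(R,\mathfrak m,k)$ be a Noetherian local ring of dimension $d>0$ with infinite residue field. Let $F_1,\dots,F_q$ be free $R$-modules of finite ranks $r_1,\dots,r_q\ge1$ and let $\phi_i:F_i\to F_i$ be an endomorphism for $1\le i\le q$. Then the homology of $K_\bullet(\phi_1,\dots,\phi_q)$ is of finite length as an $R$-module if and only if $(\det(\phi_1),\dots,\det(\phi_q))$ is a finite colength ideal of $R$, in which case there is an equality of Euler-Poincaré characteristics $$\chi\big(K_\bullet(\phi_1,\dots,\phi_q)\big)=\chi\big(K_\bullet(\det(\phi_1),\dots,\det(\phi_q))\big).$$ Further, if (in this case) $R$ is Cohen-Macaulay and $q=d$, then both complexes are acyclic (have zero homology in positive degrees), and hence $$\lambda\big(H_0(\phi_1,\dots,\phi_d)\big)=\lambda\left(\frac{R}{(\det(\phi_1),\dots,\det(\phi_d))}\right).$$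
   Context: $K_\bullet(\phi_i)$ is the complex $0\to F_i\xrightarrow{\phi_i}F_i\to0$ (in homological degrees $1,0$), $K_\bullet(\phi_1,\dots,\phi_q)=K_\bullet(\phi_1)\otimes_R\cdots\otimes_RK_\bullet(\phi_q)$, and $H_\bullet(\phi_1,\dots,\phi_q)$ is its homology. $K_\bullet(\det(\phi_1),\dots,\det(\phi_q))$ is the usual Koszul complex over $R$ on these elements. An ideal $I$ has finite colength if $R/I$ has finite length (possibly zero). $\lambda$ denotes length. For a bounded complex with finite length homology, $\chi$ denotes the alternating sum $\sum_i(-1)^i\lambda(H_i)$ of the lengths of its homology modules. *)

theory Defs
  imports
    "HOL-Algebra.Ring_Divisibility"
    "HOL-Algebra.Module"
    "HOL-Combinatorics.Permutations"
    "HOL-Library.Extended_Nat"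
    "HOL-Library.FuncSet"
begin

section \<open>Local rings, dimension and depth\<close>

definition noetherian_local_ring :: "('a, 'c) ring_scheme \<Rightarrow> 'a set \<Rightarrow> bool" where
  "noetherian_local_ring R \<mm> \<longleftrightarrow>
     cring R \<and> noetherian_ring R \<and> maximalideal \<mm> R \<and> (\<forall>J. maximalideal J R \<longrightarrow> J = \<mm>)"

definition krull_dim :: "('a, 'c) ring_scheme \<Rightarrow> enat" where
  "krull_dim R = Sup {enat n | n. \<exists>P :: nat \<Rightarrow> 'a set.
     (\<forall>i\<le>n. primeideal (P i) R) \<and> (\<forall>i<n. P i \<subset> P (Suc i))}"

definition regular_sequence :: "('a, 'c) ring_scheme \<Rightarrow> 'a list \<Rightarrow> bool" where
  "regular_sequence R xs \<longleftrightarrow>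
     set xs \<subseteq> carrier R \<and>
     (\<forall>i<length xs. \<forall>a\<in>carrier R.
        xs ! i \<otimes>\<^bsub>R\<^esub> a \<in> genideal R (set (take i xs)) \<longrightarrow> a \<in> genideal R (set (take i xs))) \<and>
     genideal R (set xs) \<noteq> carrier R"

definition depth :: "('a, 'c) ring_scheme \<Rightarrow> 'a set \<Rightarrow> enat" where
  "depth R \<mm> = Sup {enat (length xs) | xs. regular_sequence R xs \<and> set xs \<subseteq> \<mm>}"

definition cohen_macaulay_local :: "('a, 'c) ring_scheme \<Rightarrow> 'a set \<Rightarrow> bool" where
  "cohen_macaulay_local R \<mm> \<longleftrightarrow> noetherian_local_ring R \<mm> \<and> depth R \<mm> = krull_dim R"


section \<open>Modules\<close>

text \<open>The record \<^type>\<open>module\<close> extends \<^type>\<open>ring\<close>, so every module carries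
  multiplication and unit fields that the locale \<^locale>\<open>module\<close> ignores; they are left
  unspecified below.\<close>

definition linear_maps ::
    "('a, 'c) ring_scheme \<Rightarrow> ('a, 'm) module \<Rightarrow> ('a, 'n) module \<Rightarrow> ('m \<Rightarrow> 'n) set" where
  "linear_maps R M N = {f. f \<in> carrier M \<rightarrow> carrier N \<and>
     (\<forall>x\<in>carrier M. \<forall>y\<in>carrier M. f (x \<oplus>\<^bsub>M\<^esub> y) = f x \<oplus>\<^bsub>N\<^esub> f y) \<and>
     (\<forall>a\<in>carrier R. \<forall>x\<in>carrier M. f (a \<odot>\<^bsub>M\<^esub> x) = a \<odot>\<^bsub>N\<^esub> f x)}"

definition ring_as_module :: "('a, 'c) ring_scheme \<Rightarrow> ('a, 'a) module" where
  "ring_as_module R = \<lparr>carrier = carrier R, monoid.mult = monoid.mult R, one = one R,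
     ring.zero = ring.zero R, ring.add = ring.add R, smult = monoid.mult R\<rparr>"

definition zero_submodule :: "('a, 'm) module \<Rightarrow> ('a, 'm) module" where
  "zero_submodule M = M\<lparr>carrier := {\<zero>\<^bsub>M\<^esub>}\<rparr>"

text \<open>The set of all \<open>a x\<close>, with \<open>x\<close> in a coset \<open>U\<close>, may be strictly smaller than a
  coset (e.g. for \<open>a = 0\<close>); adding \<open>N\<close> repairs this.\<close>

definition quotient_module :: "('a, 'm) module \<Rightarrow> 'm set \<Rightarrow> ('a, 'm set) module" where
  "quotient_module M N = \<lparr>carrier = a_rcosets\<^bsub>M\<^esub> N, monoid.mult = undefined, one = undefined,
     ring.zero = N, ring.add = (\<lambda>U V. set_add M U V),
     smult = (\<lambda>a U. set_add M N ((\<lambda>x. a \<odot>\<^bsub>M\<^esub> x) ` U))\<rparr>"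

definition submodule_span :: "('a, 'c) ring_scheme \<Rightarrow> ('a, 'm) module \<Rightarrow> 'm set \<Rightarrow> 'm set" where
  "submodule_span R M S = \<Inter>{N. submodule N R M \<and> S \<subseteq> N}"

definition direct_sum_module :: "'i set \<Rightarrow> ('i \<Rightarrow> ('a, 'm) module) \<Rightarrow> ('a, 'i \<Rightarrow> 'm) module" where
  \<comment> \<open>only for finite index sets\<close>
  "direct_sum_module I M = \<lparr>carrier = (\<Pi>\<^sub>E i\<in>I. carrier (M i)), monoid.mult = undefined, one = undefined,
     ring.zero = (\<lambda>i\<in>I. \<zero>\<^bsub>M i\<^esub>), ring.add = (\<lambda>x y. \<lambda>i\<in>I. x i \<oplus>\<^bsub>M i\<^esub> y i),
     smult = (\<lambda>a x. \<lambda>i\<in>I. a \<odot>\<^bsub>M i\<^esub> x i)\<rparr>"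

definition module_length :: "('a, 'c) ring_scheme \<Rightarrow> ('a, 'm) module \<Rightarrow> enat" where
  "module_length R M = Sup {enat n | n. \<exists>N :: nat \<Rightarrow> 'm set.
     (\<forall>i\<le>n. submodule (N i) R M) \<and> (\<forall>i<n. N i \<subset> N (Suc i))}"

definition finite_length :: "('a, 'c) ring_scheme \<Rightarrow> ('a, 'm) module \<Rightarrow> bool" where
  "finite_length R M \<longleftrightarrow> module_length R M < \<infinity>"

definition quotient_by_ideal :: "('a, 'c) ring_scheme \<Rightarrow> 'a set \<Rightarrow> ('a, 'a set) module" where
  "quotient_by_ideal R I = quotient_module (ring_as_module R) I"

definition finite_colength :: "('a, 'c) ring_scheme \<Rightarrow> 'a set \<Rightarrow> bool" where
  "finite_colength R I \<longleftrightarrow> finite_length R (quotient_by_ideal R I)"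


section \<open>Free modules and determinants of endomorphisms\<close>

definition module_basis ::
    "('a, 'c) ring_scheme \<Rightarrow> ('a, 'm) module \<Rightarrow> nat \<Rightarrow> (nat \<Rightarrow> 'm) \<Rightarrow> bool" where
  "module_basis R M r b \<longleftrightarrow> b \<in> {..<r} \<rightarrow> carrier M \<and>
     (\<forall>x\<in>carrier M. \<exists>!c. c \<in> {..<r} \<rightarrow>\<^sub>E carrier R \<and> x = (\<Oplus>\<^bsub>M\<^esub>j\<in>{..<r}. c j \<odot>\<^bsub>M\<^esub> b j))"

definition free_module_of_rank ::
    "('a, 'c) ring_scheme \<Rightarrow> ('a, 'm) module \<Rightarrow> nat \<Rightarrow> bool" where
  "free_module_of_rank R M r \<longleftrightarrow> module R M \<and> (\<exists>b. module_basis R M r b)"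

definition coordinates ::
    "('a, 'c) ring_scheme \<Rightarrow> ('a, 'm) module \<Rightarrow> nat \<Rightarrow> (nat \<Rightarrow> 'm) \<Rightarrow> 'm \<Rightarrow> nat \<Rightarrow> 'a" where
  "coordinates R M r b x =
     (THE c. c \<in> {..<r} \<rightarrow>\<^sub>E carrier R \<and> x = (\<Oplus>\<^bsub>M\<^esub>j\<in>{..<r}. c j \<odot>\<^bsub>M\<^esub> b j))"

definition matrix_det :: "('a, 'c) ring_scheme \<Rightarrow> nat \<Rightarrow> (nat \<Rightarrow> nat \<Rightarrow> 'a) \<Rightarrow> 'a" where
  "matrix_det R r A = (\<Oplus>\<^bsub>R\<^esub>p\<in>{p. p permutes {..<r}}.
     (if evenperm p then \<one>\<^bsub>R\<^esub> else \<ominus>\<^bsub>R\<^esub> \<one>\<^bsub>R\<^esub>) \<otimes>\<^bsub>R\<^esub> (\<Otimes>\<^bsub>R\<^esub>i\<in>{..<r}. A i (p i)))"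

text \<open>The determinant of an endomorphism is the determinant of its matrix with respect to any
  basis; over a nonzero commutative ring neither the rank nor the value depends on that choice.\<close>

definition endo_det :: "('a, 'c) ring_scheme \<Rightarrow> ('a, 'm) module \<Rightarrow> ('m \<Rightarrow> 'm) \<Rightarrow> 'a" where
  "endo_det R M \<phi> =
     (let (r, b) = (SOME (r, b). module_basis R M r b)
      in matrix_det R r (\<lambda>i j. coordinates R M r b (\<phi> (b j)) i))"


section \<open>Tensor products of finite families of modules\<close>

text \<open>The tensor product of modules \<open>M\<^sub>0, \<dots>, M\<^sub>q\<^sub>-\<^sub>1\<close> is the free module on tuples
  \<open>(x\<^sub>0, \<dots>, x\<^sub>q\<^sub>-\<^sub>1)\<close> modulo the relations making the tuple multilinear. An iterated binary
  tensor product is not available, as each step would change the type of the elements.\<close>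

definition tuples :: "nat \<Rightarrow> (nat \<Rightarrow> ('a, 'm) module) \<Rightarrow> (nat \<Rightarrow> 'm) set" where
  "tuples q M = (\<Pi>\<^sub>E i\<in>{..<q}. carrier (M i))"

definition free_module_on :: "('a, 'c) ring_scheme \<Rightarrow> 't set \<Rightarrow> ('a, 't \<Rightarrow> 'a) module" where
  "free_module_on R T = \<lparr>carrier = {f. (\<forall>t\<in>T. f t \<in> carrier R) \<and> (\<forall>t. t \<notin> T \<longrightarrow> f t = \<zero>\<^bsub>R\<^esub>)
       \<and> finite {t. f t \<noteq> \<zero>\<^bsub>R\<^esub>}},
     monoid.mult = undefined, one = undefined,
     ring.zero = (\<lambda>t. \<zero>\<^bsub>R\<^esub>), ring.add = (\<lambda>f g t. f t \<oplus>\<^bsub>R\<^esub> g t), smult = (\<lambda>a f t. a \<otimes>\<^bsub>R\<^esub> f t)\<rparr>"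

definition free_gen :: "('a, 'c) ring_scheme \<Rightarrow> 't \<Rightarrow> 't \<Rightarrow> 'a" where
  "free_gen R t = (\<lambda>s. if s = t then \<one>\<^bsub>R\<^esub> else \<zero>\<^bsub>R\<^esub>)"

definition multilinear_relations ::
    "('a, 'c) ring_scheme \<Rightarrow> nat \<Rightarrow> (nat \<Rightarrow> ('a, 'm) module) \<Rightarrow> ((nat \<Rightarrow> 'm) \<Rightarrow> 'a) set" where
  "multilinear_relations R q M = (let F = free_module_on R (tuples q M); e = free_gen R in
     {e (x(i := u \<oplus>\<^bsub>M i\<^esub> v)) \<ominus>\<^bsub>F\<^esub> (e (x(i := u)) \<oplus>\<^bsub>F\<^esub> e (x(i := v))) | x i u v.
        x \<in> tuples q M \<and> i < q \<and> u \<in> carrier (M i) \<and> v \<in> carrier (M i)} \<union>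
     {e (x(i := a \<odot>\<^bsub>M i\<^esub> u)) \<ominus>\<^bsub>F\<^esub> a \<odot>\<^bsub>F\<^esub> e (x(i := u)) | x i a u.
        x \<in> tuples q M \<and> i < q \<and> a \<in> carrier R \<and> u \<in> carrier (M i)})"

definition tensor_kernel ::
    "('a, 'c) ring_scheme \<Rightarrow> nat \<Rightarrow> (nat \<Rightarrow> ('a, 'm) module) \<Rightarrow> ((nat \<Rightarrow> 'm) \<Rightarrow> 'a) set" where
  "tensor_kernel R q M =
     submodule_span R (free_module_on R (tuples q M)) (multilinear_relations R q M)"

definition tensor_product ::
    "('a, 'c) ring_scheme \<Rightarrow> nat \<Rightarrow> (nat \<Rightarrow> ('a, 'm) module) \<Rightarrow>
       ('a, ((nat \<Rightarrow> 'm) \<Rightarrow> 'a) set) module" where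
  "tensor_product R q M =
     quotient_module (free_module_on R (tuples q M)) (tensor_kernel R q M)"

definition pure_tensor ::
    "('a, 'c) ring_scheme \<Rightarrow> nat \<Rightarrow> (nat \<Rightarrow> ('a, 'm) module) \<Rightarrow> (nat \<Rightarrow> 'm) \<Rightarrow>
       ((nat \<Rightarrow> 'm) \<Rightarrow> 'a) set" where
  "pure_tensor R q M x = tensor_kernel R q M +>\<^bsub>free_module_on R (tuples q M)\<^esub> free_gen R x"

text \<open>The linear map on the tensor product (whose elements are cosets \<open>U\<close>) induced by a
  multilinear map \<open>g\<close> into \<open>N\<close>: the linear extension of \<open>g\<close> is constant on each coset.\<close>

definition tensor_lift ::
    "('a, 'c) ring_scheme \<Rightarrow> ('a, 'n) module \<Rightarrow> ((nat \<Rightarrow> 'm) \<Rightarrow> 'n) \<Rightarrow>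
       ((nat \<Rightarrow> 'm) \<Rightarrow> 'a) set \<Rightarrow> 'n" where
  "tensor_lift R N g U =
     the_elem ((\<lambda>f. \<Oplus>\<^bsub>N\<^esub>x\<in>{x. f x \<noteq> \<zero>\<^bsub>R\<^esub>}. f x \<odot>\<^bsub>N\<^esub> g x) ` U)"

definition tensor_map ::
    "('a, 'c) ring_scheme \<Rightarrow> nat \<Rightarrow> (nat \<Rightarrow> ('a, 'n) module) \<Rightarrow> (nat \<Rightarrow> 'm \<Rightarrow> 'n) \<Rightarrow>
       ((nat \<Rightarrow> 'm) \<Rightarrow> 'a) set \<Rightarrow> ((nat \<Rightarrow> 'n) \<Rightarrow> 'a) set" where
  "tensor_map R q N \<psi> =
     tensor_lift R (tensor_product R q N) (\<lambda>x. pure_tensor R q N (\<lambda>i\<in>{..<q}. \<psi> i (x i)))"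


section \<open>Chain complexes\<close>

text \<open>Complexes are concentrated in nonnegative degrees; \<open>bdry C n\<close> maps degree \<open>n + 1\<close> to
  degree \<open>n\<close>.\<close>

record ('a, 'm) chain_complex =
  obj :: "nat \<Rightarrow> ('a, 'm) module"
  bdry :: "nat \<Rightarrow> 'm \<Rightarrow> 'm"

fun cycles :: "('a, 'm) chain_complex \<Rightarrow> nat \<Rightarrow> 'm set" where
  "cycles C 0 = carrier (obj C 0)"
| "cycles C (Suc n) = {x \<in> carrier (obj C (Suc n)). bdry C n x = \<zero>\<^bsub>obj C n\<^esub>}"

definition boundaries :: "('a, 'm) chain_complex \<Rightarrow> nat \<Rightarrow> 'm set" where
  "boundaries C n = bdry C n ` carrier (obj C (Suc n))"

definition homology :: "('a, 'm) chain_complex \<Rightarrow> nat \<Rightarrow> ('a, 'm set) module" where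
  "homology C n = quotient_module ((obj C n)\<lparr>carrier := cycles C n\<rparr>) (boundaries C n)"

definition finite_length_homology :: "('a, 'c) ring_scheme \<Rightarrow> ('a, 'm) chain_complex \<Rightarrow> bool" where
  "finite_length_homology R C \<longleftrightarrow> (\<forall>n. finite_length R (homology C n))"

definition acyclic_complex :: "('a, 'm) chain_complex \<Rightarrow> bool" where
  "acyclic_complex C \<longleftrightarrow> (\<forall>n>0. carrier (homology C n) = {\<zero>\<^bsub>homology C n\<^esub>})"

text \<open>Only meaningful for bounded complexes with homology of finite length.\<close>

definition euler_char :: "('a, 'c) ring_scheme \<Rightarrow> ('a, 'm) chain_complex \<Rightarrow> int" where
  "euler_char R C = (\<Sum>n | module_length R (homology C n) \<noteq> 0.
     (-1) ^ n * int (the_enat (module_length R (homology C n))))"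

text \<open>The tensor product of complexes: degree \<open>n\<close> is the direct sum, over all
  \<open>J = (j\<^sub>0, \<dots>, j\<^sub>q\<^sub>-\<^sub>1)\<close> of total degree \<open>n\<close>, of the tensor products of the \<open>(C\<^sub>i)\<^sub>j\<close> with
  \<open>j = j\<^sub>i\<close>, and the boundary of \<open>x\<^sub>0 \<otimes> \<dots> \<otimes> x\<^sub>q\<^sub>-\<^sub>1\<close> in the summand \<open>J\<close> is the sum over \<open>i\<close> of
  \<open>(-1)\<close> to the power \<open>j\<^sub>0 + \<dots> + j\<^sub>i\<^sub>-\<^sub>1\<close> times \<open>x\<^sub>0 \<otimes> \<dots> \<otimes> \<partial> x\<^sub>i \<otimes> \<dots> \<otimes> x\<^sub>q\<^sub>-\<^sub>1\<close>. The definition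
  below collects the contributions landing in a given summand \<open>J\<close> of the target.\<close>

definition multidegrees :: "nat \<Rightarrow> nat \<Rightarrow> (nat \<Rightarrow> nat) set" where
  "multidegrees q n = {J \<in> {..<q} \<rightarrow>\<^sub>E UNIV. (\<Sum>i<q. J i) = n}"

definition tensor_complex ::
    "('a, 'c) ring_scheme \<Rightarrow> nat \<Rightarrow> (nat \<Rightarrow> ('a, 'm) chain_complex) \<Rightarrow>
       ('a, (nat \<Rightarrow> nat) \<Rightarrow> ((nat \<Rightarrow> 'm) \<Rightarrow> 'a) set) chain_complex" where
  "tensor_complex R q C = (let T = (\<lambda>J. tensor_product R q (\<lambda>i. obj (C i) (J i))) in
     \<lparr>obj = (\<lambda>n. direct_sum_module (multidegrees q n) T),
      bdry = (\<lambda>n x. \<lambda>J\<in>multidegrees q n. \<Oplus>\<^bsub>T J\<^esub>i\<in>{..<q}.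
        ((\<ominus>\<^bsub>R\<^esub> \<one>\<^bsub>R\<^esub>) [^]\<^bsub>R\<^esub> (\<Sum>k<i. J k)) \<odot>\<^bsub>T J\<^esub>
          tensor_map R q (\<lambda>k. obj (C k) (J k))
            (\<lambda>k. if k = i then bdry (C i) (J i) else (\<lambda>y. y)) (x (J(i := Suc (J i)))))\<rparr>)"


section \<open>Koszul complexes\<close>

definition koszul1 :: "('a, 'm) module \<Rightarrow> ('m \<Rightarrow> 'm) \<Rightarrow> ('a, 'm) chain_complex" where
  "koszul1 F \<phi> = \<lparr>obj = (\<lambda>n. if n \<le> 1 then F else zero_submodule F),
     bdry = (\<lambda>n. if n = 0 then \<phi> else (\<lambda>_. \<zero>\<^bsub>F\<^esub>))\<rparr>"

definition koszul ::
    "('a, 'c) ring_scheme \<Rightarrow> nat \<Rightarrow> (nat \<Rightarrow> ('a, 'm) module) \<Rightarrow> (nat \<Rightarrow> 'm \<Rightarrow> 'm) \<Rightarrow>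
       ('a, (nat \<Rightarrow> nat) \<Rightarrow> ((nat \<Rightarrow> 'm) \<Rightarrow> 'a) set) chain_complex" where
  "koszul R q F \<phi> = tensor_complex R q (\<lambda>i. koszul1 (F i) (\<phi> i))"

text \<open>The usual Koszul complex on ring elements \<open>a\<^sub>0, \<dots>, a\<^sub>q\<^sub>-\<^sub>1\<close> is the tensor product of the
  complexes \<open>0 \<rightarrow> R \<rightarrow> R \<rightarrow> 0\<close> given by multiplication with the \<open>a\<^sub>i\<close>.\<close>

definition koszul_elements ::
    "('a, 'c) ring_scheme \<Rightarrow> nat \<Rightarrow> (nat \<Rightarrow> 'a) \<Rightarrow>
       ('a, (nat \<Rightarrow> nat) \<Rightarrow> ((nat \<Rightarrow> 'a) \<Rightarrow> 'a) set) chain_complex" where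
  "koszul_elements R q a = koszul R q (\<lambda>_. ring_as_module R) (\<lambda>i x. a i \<otimes>\<^bsub>R\<^esub> x)"

end

theory Submission
  imports Defs "HOL-Library.Function_Algebras" "HOL-Library.Poly_Mapping" "HOL-Library.Multiset" "Jordan_Normal_Form.Determinant"
begin

text \<open>The complex of a list of endomorphisms is the mapping cone of the first one, acting on a
  power of the complex \<open>C\<close> of the others. So its Euler characteristic is the alternating sum,
  over the homology modules \<open>H\<close> of \<open>C\<close>, of the numbers \<open>\<lambda>(coker A) - \<lambda>(ker A)\<close> for the
  matrix \<open>A\<close> acting on \<open>H\<^sup>r\<close>. This number is the same for \<open>A\<close> on \<open>H\<^sup>r\<close> and for \<open>det A\<close> on
  \<open>H\<close>: by additivity one may assume \<open>H = R / p\<close> with \<open>p\<close> prime; if \<open>R / p\<close> has finite length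
  both numbers are zero, and otherwise \<open>R / p\<close> is a domain in which every nonzero element has finite
  colength, where Gaussian elimination makes \<open>A\<close> triangular. Hence the head of the list may be
  replaced by its determinant, and rotating the list replaces all of them.

  The determinants act null-homotopically, so the homology has finite length if they generate an
  ideal of finite colength; for the converse, an element that kills the cokernel of \<open>A\<close> on \<open>M\<^sup>r\<close>
  has a power that kills \<open>M / det A M\<close>. If \<open>\<mm>\<close> contains a regular sequence whose length is the
  number of endomorphisms, the positive homology vanishes by induction on the sequence, since powers
  of \<open>\<mm>\<close> annihilate the homology.\<close>

section \<open>Submodules of modules of functions and lengths of their quotients\<close>

text \<open>The matrix calculus takes place over a ring given by a type, while \<open>R\<close> is a
  record with a carrier. So \<open>R\<close> is written as \<open>P / a\<close> for a ring type
  \<open>P\<close>, and every module in sight as a subquotient \<open>Z / B\<close> of a module of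
  functions with values in \<open>P\<close>. This also keeps types fixed where the argument changes
  modules or rings: all homology modules of a complex lie in one ambient module, a power of a module
  only adds an index, and passing from \<open>P / a\<close> to \<open>P / (a, x)\<close> only
  enlarges \<open>a\<close>.

  Lengths of kernels and of cokernels are not additive by themselves, and the homology of the
  remaining factors need not have finite length; only the difference of the two lengths passes
  through a filtration with quotients \<open>R / p\<close>. On such a quotient the obstacle to
  elimination is division: clearing a column multiplies rows by the pivot \<open>b\<close>, which
  adds the cokernel length of a power of \<open>b\<close> to both sides of the equation. That length
  can be subtracted only if it is finite, which is why all nonzero elements must have finite
  colength.\<close>

definition sm :: "'p::comm_ring_1 \<Rightarrow> ('i \<Rightarrow> 'p) \<Rightarrow> 'i \<Rightarrow> 'p" where
  "sm c x = (\<lambda>i. c * x i)"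

lemma sm_apply: "sm c x i = c * x i"
  by (simp add: sm_def)

lemma sm_sm: "sm c (sm e x) = sm (c * e) x"
  and sm_add: "sm c (x + y) = sm c x + sm c y"
  and sm_diff: "sm c (x - y) = sm c x - sm c y"
  and sm_add_left: "sm (c + e) x = sm c x + sm e x"
  and sm_one [simp]: "sm 1 x = x"
  and sm_zero [simp]: "sm 0 x = 0"
  and sm_zero_right [simp]: "sm c 0 = 0"
  and sm_minus_one: "sm (- 1) x = - x"
  by (auto simp: fun_eq_iff sm_apply algebra_simps)

lemma sum_fun_apply: "(\<Sum>i\<in>I. f i) x = (\<Sum>i\<in>I. f i x)"
  by (induction I rule: infinite_finite_induct) auto

lemma sm_sum: "sm c (\<Sum>i\<in>I. f i) = (\<Sum>i\<in>I. sm c (f i))"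
  by (simp add: fun_eq_iff sm_apply sum_fun_apply sum_distrib_left)

definition submod :: "('i \<Rightarrow> 'p::comm_ring_1) set \<Rightarrow> bool" where
  "submod S \<longleftrightarrow> 0 \<in> S \<and> (\<forall>x\<in>S. \<forall>y\<in>S. x + y \<in> S) \<and> (\<forall>c. \<forall>x\<in>S. sm c x \<in> S)"

lemma submodI:
  assumes "0 \<in> S" "\<And>x y. x \<in> S \<Longrightarrow> y \<in> S \<Longrightarrow> x + y \<in> S" "\<And>c x. x \<in> S \<Longrightarrow> sm c x \<in> S"
  shows "submod S"
  using assms by (auto simp: submod_def)

lemma submod_0: "submod S \<Longrightarrow> 0 \<in> S"
  and submod_add: "submod S \<Longrightarrow> x \<in> S \<Longrightarrow> y \<in> S \<Longrightarrow> x + y \<in> S"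
  and submod_sm: "submod S \<Longrightarrow> x \<in> S \<Longrightarrow> sm c x \<in> S"
  by (auto simp: submod_def)

lemma submod_minus: "submod S \<Longrightarrow> x \<in> S \<Longrightarrow> - x \<in> S"
  using submod_sm[of S x "-1"] by (simp add: sm_minus_one)

lemma submod_diff: "submod S \<Longrightarrow> x \<in> S \<Longrightarrow> y \<in> S \<Longrightarrow> x - y \<in> S"
  using submod_add[of S x "- y"] submod_minus[of S y] by simp

lemma submod_sum: "submod S \<Longrightarrow> (\<And>i. i \<in> I \<Longrightarrow> f i \<in> S) \<Longrightarrow> (\<Sum>i\<in>I. f i) \<in> S"
  by (induction I rule: infinite_finite_induct) (auto simp: submod_0 submod_add)

lemma submod_diff_cancel: "submod S \<Longrightarrow> x - y \<in> S \<Longrightarrow> x \<in> S \<longleftrightarrow> y \<in> S"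
  using submod_add[of S "x - y" y] submod_diff[of S x "x - y"] by auto

lemma submod_add_cancel: "submod S \<Longrightarrow> y \<in> S \<Longrightarrow> x + y \<in> S \<longleftrightarrow> x \<in> S"
  using submod_diff_cancel[of S "x + y" x] by simp

lemma submod_UNIV [simp]: "submod UNIV"
  by (simp add: submod_def)

lemma submod_Int: "submod S \<Longrightarrow> submod T \<Longrightarrow> submod (S \<inter> T)"
  by (auto simp: submod_def)

definition msum :: "('i \<Rightarrow> 'p::comm_ring_1) set \<Rightarrow> ('i \<Rightarrow> 'p) set \<Rightarrow> ('i \<Rightarrow> 'p) set" where
  "msum S T = {x. \<exists>s\<in>S. \<exists>t\<in>T. x = s + t}"

lemma msumI: "s \<in> S \<Longrightarrow> t \<in> T \<Longrightarrow> s + t \<in> msum S T"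
  by (auto simp: msum_def)

lemma msumE:
  assumes "x \<in> msum S T"
  obtains s t where "s \<in> S" "t \<in> T" "x = s + t"
  using assms by (auto simp: msum_def)

lemma submod_msum: assumes "submod S" "submod T" shows "submod (msum S T)"
proof (rule submodI)
  show "0 \<in> msum S T" using msumI[OF submod_0[OF assms(1)] submod_0[OF assms(2)]] by simp
next
  fix x y assume "x \<in> msum S T" "y \<in> msum S T"
  then obtain s t s' t' where "s \<in> S" "t \<in> T" "x = s + t" "s' \<in> S" "t' \<in> T" "y = s' + t'"
    by (metis msumE)
  moreover have "x + y = (s + s') + (t + t')" using calculation by (simp add: algebra_simps)
  ultimately show "x + y \<in> msum S T" using assms by (metis msumI submod_add)
next
  fix c x assume "x \<in> msum S T"
  then show "sm c x \<in> msum S T" using assms by (metis msumE msumI submod_sm sm_add)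
qed

lemma msum_left: "submod T \<Longrightarrow> S \<subseteq> msum S T"
  using msumI[of _ S 0 T] by (auto simp: submod_0)

lemma msum_right: "submod S \<Longrightarrow> T \<subseteq> msum S T"
  using msumI[of 0 S _ T] by (auto simp: submod_0)

lemma msum_least: "submod X \<Longrightarrow> S \<subseteq> X \<Longrightarrow> T \<subseteq> X \<Longrightarrow> msum S T \<subseteq> X"
  by (auto simp: msum_def intro!: submod_add)

lemma msum_mono: "S \<subseteq> S' \<Longrightarrow> T \<subseteq> T' \<Longrightarrow> msum S T \<subseteq> msum S' T'"
  unfolding msum_def by blast

lemma msum_absorb: assumes "submod Z" "submod B" "B \<subseteq> Z" shows "msum Z B = Z"
  by (intro equalityI msum_least msum_left assms order_refl)

definition lin :: "(('i \<Rightarrow> 'p::comm_ring_1) \<Rightarrow> 'j \<Rightarrow> 'p) \<Rightarrow> bool" where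
  "lin f \<longleftrightarrow> (\<forall>x y. f (x + y) = f x + f y) \<and> (\<forall>c x. f (sm c x) = sm c (f x))"

lemma linI: "(\<And>x y. f (x + y) = f x + f y) \<Longrightarrow> (\<And>c x. f (sm c x) = sm c (f x)) \<Longrightarrow> lin f"
  by (simp add: lin_def)

lemma lin_add: "lin f \<Longrightarrow> f (x + y) = f x + f y"
  and lin_sm: "lin f \<Longrightarrow> f (sm c x) = sm c (f x)"
  by (auto simp: lin_def)

lemma lin_0: "lin f \<Longrightarrow> f 0 = 0"
  using lin_sm[of f 0 0] by simp

lemma lin_diff: "lin f \<Longrightarrow> f (x - y) = f x - f y"
  using lin_add[of f x "sm (-1) y"] lin_sm[of f "-1" y] by (simp add: sm_minus_one)

lemma lin_minus: "lin f \<Longrightarrow> f (- y) = - f y"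
  using lin_sm[of f "-1" y] by (simp add: sm_minus_one)

lemma lin_sum: "lin f \<Longrightarrow> f (\<Sum>i\<in>I. g i) = (\<Sum>i\<in>I. f (g i))"
  by (induction I rule: infinite_finite_induct) (auto simp: lin_add lin_0)

lemma lin_sm_const: "lin (sm c)"
  by (auto intro!: linI simp: sm_add sm_sm mult.commute)

lemma lin_id: "lin (\<lambda>x. x)"
  by (auto intro!: linI)

lemma lin_comp: "lin f \<Longrightarrow> lin g \<Longrightarrow> lin (\<lambda>x. f (g x))"
  by (auto simp: lin_def)

lemma submod_image: assumes "lin f" "submod S" shows "submod (f ` S)"
proof (rule submodI)
  show "0 \<in> f ` S" using assms by (metis image_eqI lin_0 submod_0)
next
  fix x y assume "x \<in> f ` S" "y \<in> f ` S"
  then show "x + y \<in> f ` S" using assms by (auto simp: lin_add[symmetric] submod_add)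
next
  fix c x assume "x \<in> f ` S"
  then show "sm c x \<in> f ` S" using assms by (auto simp: lin_sm[symmetric] submod_sm)
qed

lemma submod_vimage: "lin f \<Longrightarrow> submod Z \<Longrightarrow> submod S \<Longrightarrow> submod {z \<in> Z. f z \<in> S}"
  unfolding submod_def lin_def[of f] using lin_0[of f] by (auto simp: lin_def)

section \<open>Chains of submodules and the additivity of length\<close>

fun ch :: "('i \<Rightarrow> 'p::comm_ring_1) set \<Rightarrow> nat \<Rightarrow> ('i \<Rightarrow> 'p) set \<Rightarrow> bool" where
  "ch B 0 X \<longleftrightarrow> submod X \<and> B \<subseteq> X"
| "ch B (Suc k) X \<longleftrightarrow> submod X \<and> (\<exists>Y. ch B k Y \<and> Y \<subset> X)"

text \<open>The length of the quotient \<open>Z / B\<close>; here \<open>ch B k Z\<close> says that some chain of submodules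
  between \<open>B\<close> and \<open>Z\<close> ends at \<open>Z\<close> and has \<open>k\<close> strict inclusions.\<close>

definition len :: "('i \<Rightarrow> 'p::comm_ring_1) set \<Rightarrow> ('i \<Rightarrow> 'p) set \<Rightarrow> enat" where
  "len Z B = Sup {enat k | k. ch B k Z}"

lemma ch_submod: "ch B k X \<Longrightarrow> submod X"
  by (cases k) auto

lemma ch_sub: "ch B k X \<Longrightarrow> B \<subseteq> X"
  by (induction k arbitrary: X) force+

lemma ch_up: "ch B k X \<Longrightarrow> X \<subseteq> Y \<Longrightarrow> submod Y \<Longrightarrow> ch B k Y"
  by (cases k) force+

lemma ch_Suc_imp: "ch B (Suc k) X \<Longrightarrow> ch B k X"
  by (metis ch.simps(2) ch_up psubset_imp_subset)

lemma ch_down: "ch B k X \<Longrightarrow> j \<le> k \<Longrightarrow> ch B j X"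
proof (induction k)
  case 0 then show ?case by simp
next
  case (Suc k)
  show ?case
  proof (cases "j = Suc k")
    case True then show ?thesis using Suc.prems by blast
  next
    case False
    then show ?thesis using Suc.IH[OF ch_Suc_imp[OF Suc.prems(1)]] Suc.prems(2) by simp
  qed
qed

text \<open>Chains can be shortened, so the chain lengths form an initial segment, and their
  supremum reaches \<open>k\<close> exactly if some chain does. Together with
  \<open>enat_eqI\<close> this turns identities between lengths into statements about finite chains,
  and infinite length needs no separate treatment.\<close>

lemma enat_le_len_iff:
  assumes "submod Z" "B \<subseteq> Z"
  shows "enat k \<le> len Z B \<longleftrightarrow> ch B k Z"
proof
  assume "ch B k Z" then show "enat k \<le> len Z B"
    unfolding len_def by (auto intro!: Sup_upper)
next
  assume k: "enat k \<le> len Z B"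
  show "ch B k Z"
  proof (rule ccontr)
    assume no: "\<not> ch B k Z"
    have "k \<noteq> 0" using no assms by (cases k) auto
    have "j \<le> k - 1" if "ch B j Z" for j
    proof (rule ccontr)
      assume "\<not> j \<le> k - 1"
      then have "k \<le> j" by simp
      then show False using no ch_down[OF that] by blast
    qed
    then have "len Z B \<le> enat (k - 1)"
      unfolding len_def by (auto intro!: Sup_least)
    then show False using k \<open>k \<noteq> 0\<close> by (cases "len Z B") auto
  qed
qed

lemma enat_eqI: assumes "\<And>k. enat k \<le> a \<longleftrightarrow> enat k \<le> b" shows "a = (b::enat)"
proof (cases a)
  case (enat m) show ?thesis
  proof (cases b)
    case e: (enat n) then show ?thesis using enat assms[of n] assms[of m] by simp
  next
    case infinity then show ?thesis using enat assms[of "Suc m"] by simp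
  qed
next
  case infinity then show ?thesis using assms[of "Suc (the_enat b)"] by (cases b) auto
qed

lemma enat_le_add_iff: "enat k \<le> a + b \<longleftrightarrow> (\<exists>i j. i + j = k \<and> enat i \<le> a \<and> enat j \<le> b)"
proof
  assume k: "enat k \<le> a + b"
  show "\<exists>i j. i + j = k \<and> enat i \<le> a \<and> enat j \<le> b"
  proof (cases "enat k \<le> a")
    case True then show ?thesis by (intro exI[of _ k] exI[of _ 0]) (auto simp: enat_0)
  next
    case False
    then obtain m where m: "a = enat m" "m < k" by (cases a) auto
    then have "enat (k - m) \<le> b" using k by (cases b) auto
    then show ?thesis using m by (intro exI[of _ m] exI[of _ "k - m"]) auto
  qed
next
  assume "\<exists>i j. i + j = k \<and> enat i \<le> a \<and> enat j \<le> b"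
  then show "enat k \<le> a + b" by (metis add_mono plus_enat_simps(1))
qed

lemma ch_append: "ch Y j Z \<Longrightarrow> ch B k Y \<Longrightarrow> ch B (j + k) Z"
proof (induction j arbitrary: Z)
  case 0 then show ?case by (auto intro: ch_up)
next
  case (Suc j) then show ?case by auto
qed

text \<open>The modular law. In \<open>ch_split\<close> it says that a strict inclusion stays strict
  after intersecting with \<open>Y\<close> or after adding \<open>Y\<close>.\<close>

lemma modular_eq:
  assumes "submod X" "submod Y" "submod Z" "X \<subseteq> Z" "Z \<inter> Y \<subseteq> X" "Z \<subseteq> msum X Y"
  shows "X = Z"
proof
  show "Z \<subseteq> X"
  proof
    fix z assume z: "z \<in> Z"
    then obtain x y where xy: "x \<in> X" "y \<in> Y" "z = x + y" using assms(6) by (metis subsetD msumE)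
    then have "y = z - x" by simp
    then have "y \<in> Z" using z xy assms(3,4) submod_diff by blast
    then have "y \<in> X" using xy assms(5) by blast
    then show "z \<in> X" using xy assms(1) submod_add by blast
  qed
qed fact

text \<open>Each step of the chain is charged to the intersections with \<open>Y\<close> or, if
  these agree, to the sums with \<open>Y\<close>, which then differ by \<open>modular_eq\<close>;
  the two counts add up to \<open>n\<close>.\<close>

lemma ch_split:
  assumes "submod Y" "B \<subseteq> Y"
  shows "ch B n Z \<Longrightarrow> \<exists>j k. j + k = n \<and> ch Y j (msum Z Y) \<and> ch B k (Z \<inter> Y)"
proof (induction n arbitrary: Z)
  case 0
  then show ?case using assms by (auto simp: submod_msum submod_Int msum_right)
next
  case (Suc n)
  then obtain X where X: "ch B n X" "X \<subset> Z" "submod Z" by auto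
  from Suc.IH[OF X(1)] obtain j k where jk: "j + k = n" "ch Y j (msum X Y)" "ch B k (X \<inter> Y)" by blast
  have sX: "submod X" using X(1) ch_submod by blast
  have s: "submod (msum Z Y)" "submod (Z \<inter> Y)" using X assms by (simp_all add: submod_msum submod_Int)
  have le: "msum X Y \<subseteq> msum Z Y" "X \<inter> Y \<subseteq> Z \<inter> Y"
    using X(2) msum_mono[of X Z Y Y] by blast+
  show ?case
  proof (cases "X \<inter> Y = Z \<inter> Y")
    case True
    have "msum X Y \<noteq> msum Z Y"
      using modular_eq[OF sX assms(1) X(3)] X(2) True msum_left[OF assms(1), of Z] by blast
    then have "ch Y (Suc j) (msum Z Y)" using jk(2) le s by auto
    moreover have "ch B k (Z \<inter> Y)" using jk(3) True by simp
    ultimately show ?thesis using jk(1) by (intro exI[of _ "Suc j"] exI[of _ k]) simp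
  next
    case False
    then have "ch B (Suc k) (Z \<inter> Y)" using jk(3) le s by auto
    moreover have "ch Y j (msum Z Y)" using jk(2) le s by (blast intro: ch_up)
    ultimately show ?thesis using jk(1) by (intro exI[of _ j] exI[of _ "Suc k"]) simp
  qed
qed

lemma len_add:
  assumes "submod Y" "submod Z" "B \<subseteq> Y" "Y \<subseteq> Z"
  shows "len Z B = len Z Y + len Y B"
proof (rule enat_eqI)
  fix n
  have eq: "msum Z Y = Z" "Z \<inter> Y = Y" using assms by (auto simp: msum_absorb)
  have BZ: "B \<subseteq> Z" using assms by simp
  have "ch B n Z \<longleftrightarrow> (\<exists>j k. j + k = n \<and> ch Y j Z \<and> ch B k Y)"
  proof
    assume "ch B n Z"
    from ch_split[OF assms(1,3) this] show "\<exists>j k. j + k = n \<and> ch Y j Z \<and> ch B k Y" by (simp add: eq)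
  next
    assume "\<exists>j k. j + k = n \<and> ch Y j Z \<and> ch B k Y"
    then show "ch B n Z" using ch_append by blast
  qed
  then show "enat n \<le> len Z B \<longleftrightarrow> enat n \<le> len Z Y + len Y B"
    by (simp add: enat_le_add_iff enat_le_len_iff assms BZ)
qed

text \<open>\<open>f\<close> induces an isomorphism from \<open>Z / B\<close> to
  \<open>Z' / B'\<close>. Surjectivity is asked for only modulo \<open>B'\<close>, so that later
  applications may choose preimages up to boundaries. Chains are carried forward by images and back
  by preimages.\<close>

lemma len_iso:
  assumes f: "lin f" and s: "submod Z" "submod B'" "submod Z'" "B' \<subseteq> Z'" "B \<subseteq> Z"
    and im: "\<And>z. z \<in> Z \<Longrightarrow> f z \<in> Z'" and onto: "Z' \<subseteq> msum (f ` Z) B'"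
    and ker: "\<And>z. z \<in> Z \<Longrightarrow> f z \<in> B' \<longleftrightarrow> z \<in> B"
  shows "len Z B = len Z' B'"
proof (rule enat_eqI)
  fix k
  have fwd: "ch B k X \<Longrightarrow> X \<subseteq> Z \<Longrightarrow> ch B' k (msum (f ` X) B')" for k X
  proof (induction k arbitrary: X)
    case 0 then show ?case by (auto simp: submod_msum submod_image f s msum_right)
  next
    case (Suc k)
    then obtain Y where Y: "ch B k Y" "Y \<subset> X" and sX: "submod X" by auto
    have sY: "submod Y" "B \<subseteq> Y" using Y(1) ch_submod ch_sub by blast+
    have YZ: "Y \<subseteq> Z" using Y(2) Suc.prems(2) by blast
    obtain x where x: "x \<in> X" "x \<notin> Y" using Y(2) by blast
    have "f x \<in> msum (f ` X) B'" using msum_left[OF s(2), of "f ` X"] x(1) by blast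
    moreover have "f x \<notin> msum (f ` Y) B'"
    proof
      assume "f x \<in> msum (f ` Y) B'"
      then obtain y b where y: "y \<in> Y" "b \<in> B'" "f x = f y + b" by (auto elim!: msumE)
      have "f (x - y) = b" using y(3) by (simp add: lin_diff[OF f])
      moreover have "x - y \<in> Z" using x(1) y(1) YZ Suc.prems(2) s(1) submod_diff by blast
      ultimately have "x - y \<in> B" using ker y(2) by blast
      then have "x - y \<in> Y" using sY by blast
      then show False using submod_diff_cancel[OF sY(1)] x(2) y(1) by blast
    qed
    moreover have "msum (f ` Y) B' \<subseteq> msum (f ` X) B'" using Y(2) by (intro msum_mono) auto
    ultimately have "msum (f ` Y) B' \<subset> msum (f ` X) B'" by blast
    moreover have "submod (msum (f ` X) B')" by (intro submod_msum submod_image f sX s)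
    ultimately show ?case using Suc.IH[OF Y(1) YZ] by auto
  qed
  have bwd: "ch B' k X \<Longrightarrow> X \<subseteq> Z' \<Longrightarrow> ch B k {z \<in> Z. f z \<in> X}" for k X
  proof (induction k arbitrary: X)
    case 0 then show ?case using ker s(5) by (auto intro!: submod_vimage f s)
  next
    case (Suc k)
    then obtain Y where Y: "ch B' k Y" "Y \<subset> X" and sX: "submod X" by auto
    have sY: "submod Y" "B' \<subseteq> Y" using Y(1) ch_submod ch_sub by blast+
    have YZ: "Y \<subseteq> Z'" using Y(2) Suc.prems(2) by blast
    obtain x where x: "x \<in> X" "x \<notin> Y" using Y(2) by blast
    then obtain z b where z: "z \<in> Z" "b \<in> B'" "x = f z + b"
      using onto Suc.prems(2) by (blast elim!: msumE)
    have bX: "b \<in> Y" "b \<in> X" using z(2) sY Y(2) by blast+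
    have "f z \<in> X" "f z \<notin> Y" using x z(3) submod_add_cancel[OF sX bX(2)] submod_add_cancel[OF sY(1) bX(1)] by auto
    then have "{z \<in> Z. f z \<in> Y} \<subset> {z \<in> Z. f z \<in> X}" using z(1) Y(2) by blast
    moreover have "submod {z \<in> Z. f z \<in> X}" by (intro submod_vimage f sX s)
    ultimately show ?case using Suc.IH[OF Y(1) YZ] by auto
  qed
  have "ch B k Z \<longleftrightarrow> ch B' k Z'"
  proof
    assume "ch B k Z"
    from fwd[OF this] have "ch B' k (msum (f ` Z) B')" by simp
    moreover have "msum (f ` Z) B' \<subseteq> Z'" using im s by (intro msum_least) auto
    ultimately show "ch B' k Z'" using s(3) by (rule ch_up)
  next
    assume "ch B' k Z'"
    from bwd[OF this] show "ch B k Z" using s(1) by (auto intro: ch_up)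
  qed
  then show "enat k \<le> len Z B \<longleftrightarrow> enat k \<le> len Z' B'"
    by (simp add: enat_le_len_iff s)
qed

lemma len_eq_0_iff: assumes "submod Z" "submod B" "B \<subseteq> Z" shows "len Z B = 0 \<longleftrightarrow> Z = B"
proof -
  have "len Z B = 0 \<longleftrightarrow> \<not> enat 1 \<le> len Z B"
    by (cases "len Z B") (auto simp: zero_enat_def)
  also have "enat 1 \<le> len Z B \<longleftrightarrow> ch B 1 Z" using assms by (simp add: enat_le_len_iff)
  also have "ch B 1 Z \<longleftrightarrow> Z \<noteq> B" using assms by auto
  finally show ?thesis by blast
qed

lemma len_self [simp]: "submod Z \<Longrightarrow> len Z Z = 0"
  by (simp add: len_eq_0_iff)

lemma len_mono:
  assumes "submod Z" "submod Z'" "submod B'" "B \<subseteq> B'" "B' \<subseteq> Z'" "Z' \<subseteq> Z"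
  shows "len Z' B' \<le> len Z B"
proof -
  have "len Z B = len Z Z' + len Z' B" using assms by (intro len_add) auto
  also have "len Z' B = len Z' B' + len B' B" using assms by (intro len_add) auto
  finally show ?thesis by (metis add.commute add.left_commute le_iff_add)
qed

lemma len_second_iso:
  assumes "submod Y" "submod S" shows "len (msum Y S) S = len Y (Y \<inter> S)"
proof (rule len_iso[symmetric, where f = "\<lambda>x. x"])
  show "msum Y S \<subseteq> msum ((\<lambda>x. x) ` Y) S" by simp
  show "\<And>z. z \<in> Y \<Longrightarrow> z \<in> msum Y S" using msum_left[OF assms(2)] by blast
qed (use assms in \<open>auto simp: lin_id submod_msum msum_right\<close>)

section \<open>Euler characteristics of endomorphisms\<close>

definition endo :: "(('i \<Rightarrow> 'p::comm_ring_1) \<Rightarrow> 'i \<Rightarrow> 'p) \<Rightarrow> ('i \<Rightarrow> 'p) set \<Rightarrow> ('i \<Rightarrow> 'p) set \<Rightarrow> bool" where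
  "endo f Z B \<longleftrightarrow> lin f \<and> submod Z \<and> submod B \<and> B \<subseteq> Z \<and> (\<forall>z\<in>Z. f z \<in> Z) \<and> (\<forall>z\<in>B. f z \<in> B)"

definition cokl :: "(('i \<Rightarrow> 'p::comm_ring_1) \<Rightarrow> 'i \<Rightarrow> 'p) \<Rightarrow> ('i \<Rightarrow> 'p) set \<Rightarrow> ('i \<Rightarrow> 'p) set \<Rightarrow> enat" where
  "cokl f Z B = len Z (msum (f ` Z) B)"

definition kerl :: "(('i \<Rightarrow> 'p::comm_ring_1) \<Rightarrow> 'i \<Rightarrow> 'p) \<Rightarrow> ('i \<Rightarrow> 'p) set \<Rightarrow> ('i \<Rightarrow> 'p) set \<Rightarrow> enat" where
  "kerl f Z B = len {z \<in> Z. f z \<in> B} B"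

text \<open>As \<open>the_enat\<close> is unspecified at infinity, the number carries meaning only
  where both lengths are finite; hence the finiteness premises of
  \<open>eul_additive\<close>.\<close>

definition eul :: "(('i \<Rightarrow> 'p::comm_ring_1) \<Rightarrow> 'i \<Rightarrow> 'p) \<Rightarrow> ('i \<Rightarrow> 'p) set \<Rightarrow> ('i \<Rightarrow> 'p) set \<Rightarrow> int" where
  "eul f Z B = int (the_enat (cokl f Z B)) - int (the_enat (kerl f Z B))"

lemma endoI:
  "lin f \<Longrightarrow> submod Z \<Longrightarrow> submod B \<Longrightarrow> B \<subseteq> Z \<Longrightarrow> (\<And>z. z \<in> Z \<Longrightarrow> f z \<in> Z) \<Longrightarrow> (\<And>z. z \<in> B \<Longrightarrow> f z \<in> B) \<Longrightarrow> endo f Z B"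
  by (auto simp: endo_def)

lemma endoD:
  assumes "endo f Z B"
  shows "lin f" "submod Z" "submod B" "B \<subseteq> Z" "\<And>z. z \<in> Z \<Longrightarrow> f z \<in> Z" "\<And>z. z \<in> B \<Longrightarrow> f z \<in> B"
  using assms by (auto simp: endo_def)

lemma endo_image: assumes "endo f Z B" shows "submod (msum (f ` Z) B)" "msum (f ` Z) B \<subseteq> Z"
    "B \<subseteq> msum (f ` Z) B" "submod {z \<in> Z. f z \<in> B}" "B \<subseteq> {z \<in> Z. f z \<in> B}"
proof -
  note e = endoD[OF assms]
  show "submod (msum (f ` Z) B)" by (intro submod_msum submod_image e)
  show "msum (f ` Z) B \<subseteq> Z" by (intro msum_least e image_subsetI)
  show "B \<subseteq> msum (f ` Z) B" by (intro msum_right submod_image e)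
  show "submod {z \<in> Z. f z \<in> B}" by (intro submod_vimage e)
  show "B \<subseteq> {z \<in> Z. f z \<in> B}" using e(4,6) by blast
qed

text \<open>Here \<open>e1\<close>, \<open>e2\<close> and \<open>\<delta>\<close> are the lengths of the images of the map from the
  cokernel on \<open>Y / B\<close> to that on \<open>Z / B\<close>, of the map from the kernel on \<open>Z / B\<close> to that on
  \<open>Z / Y\<close>, and of the connecting homomorphism.\<close>

lemma snake:
  assumes Z: "endo f Z B" and Y: "endo f Y B" and YZ: "Y \<subseteq> Z"
  obtains e1 e2 \<delta> where "cokl f Z B = cokl f Z Y + e1" "cokl f Y B = e1 + \<delta>"
    "kerl f Z B = e2 + kerl f Y B" "kerl f Z Y = \<delta> + e2"
proof -
  note z = endoD[OF Z] and y = endoD[OF Y]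
  have ZY: "endo f Z Y" using z y YZ by (intro endoI)
  define S where "S = msum (f ` Z) B"
  have S: "submod S" "S \<subseteq> Z" "B \<subseteq> S" unfolding S_def by (rule endo_image[OF Z])+
  define W where "W = msum (f ` Y) B"
  have W: "submod W" "W \<subseteq> Y" "B \<subseteq> W" unfolding W_def by (rule endo_image[OF Y])+
  have WS: "W \<subseteq> Y \<inter> S" using W(2) msum_mono[OF image_mono[OF YZ] order_refl] unfolding S_def W_def by blast
  have SY: "submod (Y \<inter> S)" by (intro submod_Int y S)
  have eq: "msum Y S = msum (f ` Z) Y"
  proof
    show "msum Y S \<subseteq> msum (f ` Z) Y" unfolding S_def
      by (intro msum_least submod_msum submod_image z y msum_mono order_refl msum_right)
    show "msum (f ` Z) Y \<subseteq> msum Y S"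
    proof (rule msum_least)
      show "submod (msum Y S)" by (intro submod_msum y S)
      show "f ` Z \<subseteq> msum Y S" using msum_right[OF y(2)] msum_left[OF z(3), of "f ` Z"] unfolding S_def by blast
      show "Y \<subseteq> msum Y S" by (rule msum_left[OF S(1)])
    qed
  qed
  define e1 where "e1 = len (msum Y S) S"
  define \<delta> where "\<delta> = len (Y \<inter> S) W"
  define K where "K = {z \<in> Z. f z \<in> B}"
  define L where "L = {z \<in> Z. f z \<in> Y}"
  have K: "submod K" "B \<subseteq> K" "K \<subseteq> Z" unfolding K_def using endo_image(4,5)[OF Z] by auto
  have L: "submod L" "Y \<subseteq> L" "L \<subseteq> Z" unfolding L_def using endo_image(4,5)[OF ZY] by auto
  have KY: "{z \<in> Y. f z \<in> B} = K \<inter> Y" unfolding K_def using YZ by blast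
  have sKY: "submod (K \<inter> Y)" by (intro submod_Int K y)
  have sK: "submod (msum K Y)" by (intro submod_msum K y)
  have KYL: "msum K Y \<subseteq> L"
    by (rule msum_least) (use L K_def L_def y in auto)
  define e2 where "e2 = len (msum K Y) Y"
  have 1: "cokl f Z B = cokl f Z Y + e1"
    unfolding cokl_def eq[symmetric] S_def[symmetric] e1_def
    by (rule len_add) (use submod_msum[OF y(2) S(1)] z S msum_right[OF y(2)] msum_least[OF z(2) YZ S(2)] in auto)
  have "cokl f Y B = len Y (Y \<inter> S) + \<delta>"
    unfolding cokl_def W_def[symmetric] \<delta>_def by (rule len_add) (use SY WS y in auto)
  then have 2: "cokl f Y B = e1 + \<delta>" by (simp add: e1_def len_second_iso[OF y(2) S(1)])
  have "kerl f Z B = len K (K \<inter> Y) + len (K \<inter> Y) B"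
    unfolding kerl_def K_def[symmetric] by (rule len_add) (use K sKY y in auto)
  then have 3: "kerl f Z B = e2 + kerl f Y B"
    by (simp add: e2_def len_second_iso[OF K(1) y(2)] kerl_def KY)
  \<comment> \<open>The connecting homomorphism: \<open>u\<close> goes to the class of
    \<open>f u\<close> in \<open>Y / W\<close>. On \<open>L\<close> its kernel is
    \<open>K + Y\<close>, and its image is the part of \<open>Y\<close> that lies in
    \<open>S\<close>.\<close>
  have iso: "len L (msum K Y) = len (Y \<inter> S) W"
  proof (rule len_iso[OF z(1) L(1) W(1) SY WS KYL])
    fix u assume "u \<in> L"
    then have u: "u \<in> Z" "f u \<in> Y" by (auto simp: L_def)
    then show "f u \<in> Y \<inter> S" using msum_left[OF z(3), of "f ` Z"] unfolding S_def by blast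
    show "f u \<in> W \<longleftrightarrow> u \<in> msum K Y"
    proof
      assume "f u \<in> W"
      then obtain v b where v: "v \<in> Y" "b \<in> B" "f u = f v + b" unfolding W_def by (auto elim: msumE)
      then have "f (u - v) = b" by (simp add: lin_diff[OF z(1)])
      moreover have "u - v \<in> Z" using u v YZ z(2) submod_diff by blast
      ultimately have "u - v \<in> K" using v(2) by (simp add: K_def)
      then show "u \<in> msum K Y" using msumI[of "u - v" K v Y] v(1) by simp
    next
      assume "u \<in> msum K Y"
      then obtain k v where k: "k \<in> K" "v \<in> Y" "u = k + v" by (auto elim: msumE)
      have "f u = f v + f k" using k(3) by (simp add: lin_add[OF z(1)])
      then show "f u \<in> W" using k msumI[of "f v" "f ` Y" "f k" B] by (auto simp: W_def K_def)
    qed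
  next
    show "Y \<inter> S \<subseteq> msum (f ` L) W"
    proof
      fix w assume w: "w \<in> Y \<inter> S"
      then obtain u b where u: "u \<in> Z" "b \<in> B" "w = f u + b" unfolding S_def by (auto elim: msumE)
      have "b \<in> Y" using u(2) y(4) by blast
      then have "f u \<in> Y" using w u(3) submod_add_cancel[OF y(2)] by auto
      then have "f u \<in> f ` L" using u(1) by (simp add: L_def)
      moreover have "b \<in> W" using u(2) W(3) by blast
      ultimately show "w \<in> msum (f ` L) W" using u(3) by (simp add: msumI)
    qed
  qed
  have "kerl f Z Y = len L (msum K Y) + e2"
    unfolding kerl_def L_def[symmetric] e2_def by (rule len_add) (use L KYL sK y msum_right[OF K(1)] in auto)
  then have 4: "kerl f Z Y = \<delta> + e2" by (simp add: iso \<delta>_def)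
  show ?thesis by (rule that[OF 1 2 3 4])
qed

text \<open>The three auxiliary lengths of \<open>snake\<close> cancel in the alternating sum. The
  finiteness premises make each of them a natural number.\<close>

lemma eul_additive:
  assumes "endo f Z B" "endo f Y B" "Y \<subseteq> Z"
    and "cokl f Y B \<noteq> \<infinity>" "kerl f Y B \<noteq> \<infinity>" "cokl f Z Y \<noteq> \<infinity>" "kerl f Z Y \<noteq> \<infinity>"
  shows "eul f Z B = eul f Y B + eul f Z Y"
proof -
  from snake[OF assms(1-3)] obtain e1 e2 \<delta> where
    eq: "cokl f Z B = cokl f Z Y + e1" "cokl f Y B = e1 + \<delta>"
    "kerl f Z B = e2 + kerl f Y B" "kerl f Z Y = \<delta> + e2" by blast
  obtain n1 n\<delta> where n: "e1 = enat n1" "\<delta> = enat n\<delta>"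
    using assms(4) eq(2) by (cases e1; cases \<delta>) auto
  obtain n2 where n2: "e2 = enat n2" using assms(7) eq(4) by (cases e2) auto
  obtain c k where "cokl f Z Y = enat c" "kerl f Y B = enat k" using assms by fastforce
  then show ?thesis by (simp add: eul_def eq n n2)
qed

text \<open>The image of \<open>f\<close> on \<open>Z / B\<close> is \<open>Z / B\<close> modulo the
  kernel. Subtracting its length from that of \<open>Z / B\<close> gives the cokernel in one reading
  and the kernel in the other.\<close>

lemma eul_finite_length:
  assumes e: "endo f Z B" and fin: "len Z B \<noteq> \<infinity>"
  shows "cokl f Z B \<noteq> \<infinity>" "kerl f Z B \<noteq> \<infinity>" "eul f Z B = 0"
proof -
  note z = endoD[OF e] and i = endo_image[OF e]
  have a: "len Z B = cokl f Z B + len (msum (f ` Z) B) B"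
    unfolding cokl_def by (rule len_add) (use z i in auto)
  have b: "len Z B = len Z {z \<in> Z. f z \<in> B} + kerl f Z B"
    unfolding kerl_def by (rule len_add) (use z i in auto)
  have c: "len Z {z \<in> Z. f z \<in> B} = len (msum (f ` Z) B) B"
    by (rule len_iso[OF z(1,2,3) i(1,3)]) (use z msum_left[OF z(3), of "f ` Z"] in auto)
  show "cokl f Z B \<noteq> \<infinity>" "kerl f Z B \<noteq> \<infinity>" using fin a b by (metis plus_eq_infty_iff_enat)+
  then show "eul f Z B = 0" using a b c fin
    by (cases "cokl f Z B"; cases "kerl f Z B"; cases "len (msum (f ` Z) B) B") (auto simp: eul_def)
qed

lemma endo_iso:
  assumes e: "endo f Z B" and e': "endo f' Z' B'" and g: "lin g"
    and im: "\<And>z. z \<in> Z \<Longrightarrow> g z \<in> Z'" and onto: "Z' \<subseteq> msum (g ` Z) B'"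
    and ker: "\<And>z. z \<in> Z \<Longrightarrow> g z \<in> B' \<longleftrightarrow> z \<in> B"
    and comm: "\<And>z. z \<in> Z \<Longrightarrow> g (f z) - f' (g z) \<in> B'"
  shows "cokl f Z B = cokl f' Z' B'" "kerl f Z B = kerl f' Z' B'" "eul f Z B = eul f' Z' B'"
proof -
  note z = endoD[OF e] and z' = endoD[OF e'] and i = endo_image[OF e] and i' = endo_image[OF e']
  have c: "g (f z) \<in> B' \<longleftrightarrow> f' (g z) \<in> B'" if "z \<in> Z" for z
    using submod_diff_cancel[OF z'(3) comm[OF that]] .
  show 1: "cokl f Z B = cokl f' Z' B'"
    unfolding cokl_def
  proof (rule len_iso[OF g z(2) i'(1) z'(2) i'(2) i(2) im])
    have "msum (g ` Z) B' \<subseteq> msum (g ` Z) (msum (f' ` Z') B')" by (intro msum_mono order_refl i')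
    then show "Z' \<subseteq> msum (g ` Z) (msum (f' ` Z') B')" using onto by blast
    fix x assume x: "x \<in> Z"
    show "g x \<in> msum (f' ` Z') B' \<longleftrightarrow> x \<in> msum (f ` Z) B"
    proof
      assume "g x \<in> msum (f' ` Z') B'"
      then obtain y b where y: "y \<in> Z'" "b \<in> B'" "g x = f' y + b" by (auto elim: msumE)
      obtain w b2 where w: "w \<in> Z" "b2 \<in> B'" "y = g w + b2" using onto y(1) by (blast elim: msumE)
      have "g (x - f w) = - (g (f w) - f' (g w)) + (f' b2 + b)"
        using y(3) w(3) by (simp add: lin_diff[OF g] lin_add[OF z'(1)])
      also have "\<dots> \<in> B'" using comm[OF w(1)] y(2) w(2) z'(3,6) by (metis submod_add submod_minus)
      finally have "x - f w \<in> B" using ker[of "x - f w"] x w(1) z(2,5) submod_diff by blast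
      then show "x \<in> msum (f ` Z) B" using msumI[of "f w" "f ` Z" "x - f w" B] w(1) by simp
    next
      assume "x \<in> msum (f ` Z) B"
      then obtain w b where w: "w \<in> Z" "b \<in> B" "x = f w + b" by (auto elim: msumE)
      have "g x = f' (g w) + ((g (f w) - f' (g w)) + g b)" using w(3) by (simp add: lin_add[OF g])
      moreover have "(g (f w) - f' (g w)) + g b \<in> B'"
        using comm[OF w(1)] ker[of b] w(2) z(4) z'(3) submod_add by blast
      ultimately show "g x \<in> msum (f' ` Z') B'" using im[OF w(1)] by (metis imageI msumI)
    qed
  qed
  show 2: "kerl f Z B = kerl f' Z' B'"
    unfolding kerl_def
  proof (rule len_iso[OF g i(4) z'(3) i'(4) i'(5) i(5)])
    fix x assume "x \<in> {z \<in> Z. f z \<in> B}"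
    then have x: "x \<in> Z" "f x \<in> B" by auto
    show "g x \<in> B' \<longleftrightarrow> x \<in> B" by (rule ker[OF x(1)])
    have "g (f x) \<in> B'" using ker[of "f x"] x z(5) by blast
    then show "g x \<in> {z \<in> Z'. f' z \<in> B'}" using c[OF x(1)] im[OF x(1)] by blast
  next
    show "{z \<in> Z'. f' z \<in> B'} \<subseteq> msum (g ` {z \<in> Z. f z \<in> B}) B'"
    proof
      fix y assume "y \<in> {z \<in> Z'. f' z \<in> B'}"
      then have y: "y \<in> Z'" "f' y \<in> B'" by auto
      obtain w b where w: "w \<in> Z" "b \<in> B'" "y = g w + b" using onto y(1) by (blast elim: msumE)
      have "f' (g w) + f' b \<in> B'" using y(2) w(3) by (simp add: lin_add[OF z'(1)])
      then have "f' (g w) \<in> B'" using submod_add_cancel[OF z'(3) z'(6)[OF w(2)]] by blast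
      then have "f w \<in> B" using c[OF w(1)] ker[of "f w"] z(5)[OF w(1)] by blast
      then show "y \<in> msum (g ` {z \<in> Z. f z \<in> B}) B'" using w by (auto intro!: msumI)
    qed
  qed
  show "eul f Z B = eul f' Z' B'" by (simp add: eul_def 1 2)
qed

text \<open>The image of \<open>f g\<close> lies in the image of \<open>f\<close>, and since
  \<open>f\<close> is injective on \<open>Z / B\<close>, it identifies the cokernel of
  \<open>g\<close> with the quotient of these two images.\<close>

lemma cokl_comp:
  assumes f: "endo f Z B" and g: "endo g Z B" and inj: "\<And>z. z \<in> Z \<Longrightarrow> f z \<in> B \<Longrightarrow> z \<in> B"
  shows "cokl (\<lambda>x. f (g x)) Z B = cokl f Z B + cokl g Z B"
proof -
  note z = endoD[OF f] and zg = endoD[OF g] and i = endo_image[OF f] and ig = endo_image[OF g]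
  have fg: "endo (\<lambda>x. f (g x)) Z B" by (rule endoI[OF lin_comp[OF z(1) zg(1)] z(2,3,4)]) (use z zg in auto)
  note ifg = endo_image[OF fg]
  have sub: "msum ((\<lambda>x. f (g x)) ` Z) B \<subseteq> msum (f ` Z) B" by (rule msum_mono) (use zg in auto)
  have "len Z (msum (g ` Z) B) = len (msum (f ` Z) B) (msum ((\<lambda>x. f (g x)) ` Z) B)"
  proof (rule len_iso[OF z(1,2) ifg(1) i(1) sub ig(2)])
    fix x assume x: "x \<in> Z"
    show "f x \<in> msum (f ` Z) B" using x msum_left[OF z(3), of "f ` Z"] by blast
    show "f x \<in> msum ((\<lambda>x. f (g x)) ` Z) B \<longleftrightarrow> x \<in> msum (g ` Z) B"
    proof
      assume "f x \<in> msum ((\<lambda>x. f (g x)) ` Z) B"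
      then obtain w b where w: "w \<in> Z" "b \<in> B" "f x = f (g w) + b" by (auto elim: msumE)
      then have "f (x - g w) \<in> B" by (simp add: lin_diff[OF z(1)])
      moreover have "x - g w \<in> Z" using x w(1) z(2) zg(5) submod_diff by blast
      ultimately have "x - g w \<in> B" using inj by blast
      then show "x \<in> msum (g ` Z) B" using msumI[of "g w" "g ` Z" "x - g w" B] w(1) by simp
    next
      assume "x \<in> msum (g ` Z) B"
      then obtain w b where w: "w \<in> Z" "b \<in> B" "x = g w + b" by (auto elim: msumE)
      then show "f x \<in> msum ((\<lambda>x. f (g x)) ` Z) B" using z(6)
        by (auto simp: lin_add[OF z(1)] intro!: msumI)
    qed
  next
    show "msum (f ` Z) B \<subseteq> msum (f ` Z) (msum ((\<lambda>x. f (g x)) ` Z) B)"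
      by (intro msum_mono order_refl ifg)
  qed
  moreover have "len Z (msum ((\<lambda>x. f (g x)) ` Z) B) = len Z (msum (f ` Z) B) + len (msum (f ` Z) B) (msum ((\<lambda>x. f (g x)) ` Z) B)"
    by (rule len_add) (use i z ifg sub in auto)
  ultimately show ?thesis by (simp add: cokl_def)
qed

section \<open>Noetherian local rings and their finitely generated modules\<close>

definition idl :: "'p::comm_ring_1 set \<Rightarrow> bool" where
  "idl J \<longleftrightarrow> 0 \<in> J \<and> (\<forall>x\<in>J. \<forall>y\<in>J. x + y \<in> J) \<and> (\<forall>c. \<forall>x\<in>J. c * x \<in> J)"

lemma idlD: assumes "idl J" shows "0 \<in> J" "x \<in> J \<Longrightarrow> y \<in> J \<Longrightarrow> x + y \<in> J" "x \<in> J \<Longrightarrow> c * x \<in> J"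
    "x \<in> J \<Longrightarrow> x * c \<in> J" "x \<in> J \<Longrightarrow> - x \<in> J" "x \<in> J \<Longrightarrow> y \<in> J \<Longrightarrow> x - y \<in> J"
proof -
  show 1: "0 \<in> J" "\<And>x y. x \<in> J \<Longrightarrow> y \<in> J \<Longrightarrow> x + y \<in> J" "\<And>x c. x \<in> J \<Longrightarrow> c * x \<in> J"
    using assms by (auto simp: idl_def)
  show "x \<in> J \<Longrightarrow> x * c \<in> J" using 1(3)[of x c] by (simp add: mult.commute)
  show 2: "\<And>x. x \<in> J \<Longrightarrow> - x \<in> J" using 1(3)[of _ "-1"] by simp
  show "x \<in> J \<Longrightarrow> y \<in> J \<Longrightarrow> x - y \<in> J" using 1(2)[of x "-y"] 2 by simp
qed

lemma idl_sum: "idl J \<Longrightarrow> (\<And>i. i \<in> I \<Longrightarrow> f i \<in> J) \<Longrightarrow> (\<Sum>i\<in>I. f i) \<in> J"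
  by (induction I rule: infinite_finite_induct) (auto simp: idlD)

lemma idl_diff_cancel: "idl J \<Longrightarrow> x - y \<in> J \<Longrightarrow> x \<in> J \<longleftrightarrow> y \<in> J"
  using idlD(2)[of J "x - y" y] idlD(6)[of J x "x - y"] by auto

text \<open>The functions modulo \<open>base a I\<close> form the free module over
  \<open>P / a\<close> with basis \<open>I\<close>: values outside \<open>I\<close> are discarded. A
  submodule that contains it is therefore a submodule of this free module.\<close>

definition base :: "'p::comm_ring_1 set \<Rightarrow> 'i set \<Rightarrow> ('i \<Rightarrow> 'p) set" where
  "base a I = {x. \<forall>i\<in>I. x i \<in> a}"

lemma base_sm: "idl a \<Longrightarrow> c \<in> a \<Longrightarrow> sm c x \<in> base a I"
  by (auto simp: base_def idlD sm_apply)

section \<open>The maximal condition, associated primes and Nakayama's lemma\<close>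

definition noeth :: "('i \<Rightarrow> 'p::comm_ring_1) set \<Rightarrow> bool" where
  "noeth B0 \<longleftrightarrow> (\<forall>S. S \<noteq> {} \<longrightarrow> (\<forall>X\<in>S. submod X \<and> B0 \<subseteq> X) \<longrightarrow> (\<exists>X\<in>S. \<forall>Y\<in>S. X \<subseteq> Y \<longrightarrow> Y = X))"

lemma noethD:
  assumes "noeth B0" "X0 \<in> S" "\<And>X. X \<in> S \<Longrightarrow> submod X" "\<And>X. X \<in> S \<Longrightarrow> B0 \<subseteq> X"
  shows "\<exists>X\<in>S. \<forall>Y\<in>S. X \<subseteq> Y \<longrightarrow> Y = X"
proof -
  have "S \<noteq> {}" "\<forall>X\<in>S. submod X \<and> B0 \<subseteq> X" using assms(2,3,4) by auto
  then show "\<exists>X\<in>S. \<forall>Y\<in>S. X \<subseteq> Y \<longrightarrow> Y = X" using assms(1) unfolding noeth_def by meson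
qed

definition cyc :: "('i \<Rightarrow> 'p::comm_ring_1) \<Rightarrow> ('i \<Rightarrow> 'p) set" where
  "cyc z = {x. \<exists>c. x = sm c z}"

lemma submod_cyc: "submod (cyc z)"
proof (rule submodI)
  show "0 \<in> cyc z" unfolding cyc_def mem_Collect_eq by (rule exI[of _ 0]) simp
  show "x + y \<in> cyc z" if xy: "x \<in> cyc z" "y \<in> cyc z" for x y
  proof -
    obtain c e where "x = sm c z" "y = sm e z" using xy unfolding cyc_def by auto
    then have "x + y = sm (c + e) z" by (simp add: sm_add_left)
    then show ?thesis unfolding cyc_def by blast
  qed
  show "sm c x \<in> cyc z" if "x \<in> cyc z" for c x
    using that unfolding cyc_def by (auto simp: sm_sm)
qed

lemma self_in_cyc: "z \<in> cyc z"
  unfolding cyc_def mem_Collect_eq by (rule exI[of _ 1]) simp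

lemma cyc_least: "submod X \<Longrightarrow> z \<in> X \<Longrightarrow> cyc z \<subseteq> X"
  by (auto simp: cyc_def submod_sm)

text \<open>The exponent is uniform over \<open>Z\<close>. For submodules above
  \<open>base a I\<close> with \<open>I\<close> finite this is the same as finite length, by
  \<open>tors_finite_length\<close> and \<open>finite_length_tors\<close>.\<close>

definition tors :: "'p::comm_ring_1 set \<Rightarrow> ('i \<Rightarrow> 'p) set \<Rightarrow> ('i \<Rightarrow> 'p) set \<Rightarrow> bool" where
  "tors m Z B \<longleftrightarrow> (\<forall>x\<in>m. \<exists>k. \<forall>z\<in>Z. sm (x ^ k) z \<in> B)"

lemma torsD: "tors m Z B \<Longrightarrow> x \<in> m \<Longrightarrow> \<exists>k. \<forall>z\<in>Z. sm (x ^ k) z \<in> B"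
  by (simp add: tors_def)

text \<open>The local ring is \<open>P / a\<close>, for a commutative ring \<open>P\<close> given as a type, and \<open>m\<close> is the
  preimage of its maximal ideal.\<close>

locale noeth_loc =
  fixes a m :: "'p::comm_ring_1 set"
  assumes a: "idl a" and m: "idl m" and am: "a \<subseteq> m" and m1: "1 \<notin> m"
    and unit: "\<And>c. c \<notin> m \<Longrightarrow> \<exists>e. c * e - 1 \<in> a"
    and idl_max: "\<And>S. S \<noteq> {} \<Longrightarrow> (\<And>J. J \<in> S \<Longrightarrow> idl J \<and> a \<subseteq> J) \<Longrightarrow> \<exists>J\<in>S. \<forall>J'\<in>S. J \<subseteq> J' \<longrightarrow> J' = J"
begin

text \<open>For a new coordinate \<open>i\<close>, a submodule \<open>X\<close> has an ideal
  \<open>p X\<close> of values at \<open>i\<close> and a submodule \<open>k X\<close> of functions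
  that lie in \<open>X\<close> once they are set to zero at \<open>i\<close>. If \<open>Y\<close>
  contains \<open>X\<close> and agrees with it in both, then \<open>Y = X\<close>; so one maximizes
  \<open>p\<close> first and then \<open>k\<close>.\<close>

lemma noeth_base: "finite I \<Longrightarrow> noeth (base a I)"
proof (induction I rule: finite_induct)
  case empty
  have u: "base a {} = UNIV" by (simp add: base_def)
  show ?case unfolding noeth_def u
  proof (intro allI impI)
    fix S :: "('a \<Rightarrow> 'p) set set"
    assume "S \<noteq> {}" and S: "\<forall>X\<in>S. submod X \<and> UNIV \<subseteq> X"
    then obtain X where "X \<in> S" by blast
    moreover have "Y = UNIV" if "Y \<in> S" for Y using S that by blast
    ultimately show "\<exists>X\<in>S. \<forall>Y\<in>S. X \<subseteq> Y \<longrightarrow> Y = X" by metis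
  qed
next
  case (insert i I)
  show ?case unfolding noeth_def
  proof (intro allI impI)
    fix S :: "('a \<Rightarrow> 'p) set set"
    assume ne: "S \<noteq> {}" and S: "\<forall>X\<in>S. submod X \<and> base a (insert i I) \<subseteq> X"
    define p where "p X = (\<lambda>x. x i) ` X" for X :: "('a \<Rightarrow> 'p) set"
    define k where "k X = {x. x(i := 0) \<in> X}" for X :: "('a \<Rightarrow> 'p) set"
    have pI: "idl (p X) \<and> a \<subseteq> p X" if "X \<in> S" for X
    proof
      have X: "submod X" "base a (insert i I) \<subseteq> X" using S that by auto
      show "idl (p X)" unfolding idl_def p_def
      proof (intro conjI ballI allI)
        show "0 \<in> (\<lambda>x. x i) ` X" using submod_0[OF X(1)] by (intro image_eqI[where x = 0]) auto
      next
        fix x y assume "x \<in> (\<lambda>x. x i) ` X" "y \<in> (\<lambda>x. x i) ` X"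
        then obtain u v where "u \<in> X" "v \<in> X" "x = u i" "y = v i" by auto
        then show "x + y \<in> (\<lambda>x. x i) ` X"
          using submod_add[OF X(1)] by (intro image_eqI[where x = "u + v"]) auto
      next
        fix c x assume "x \<in> (\<lambda>x. x i) ` X"
        then obtain u where "u \<in> X" "x = u i" by auto
        then show "c * x \<in> (\<lambda>x. x i) ` X"
          using submod_sm[OF X(1)] by (intro image_eqI[where x = "sm c u"]) (auto simp: sm_apply)
      qed
      show "a \<subseteq> p X"
      proof
        fix c assume c: "c \<in> a"
        have "(\<lambda>_. c) \<in> X" using X(2) c by (auto simp: base_def)
        then show "c \<in> p X" unfolding p_def by (metis imageI)
      qed
    qed
    have kI: "submod (k X) \<and> base a I \<subseteq> k X" if "X \<in> S" for X
    proof
      have X: "submod X" "base a (insert i I) \<subseteq> X" using S that by auto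
      have e: "(x + y)(i := 0) = x(i := 0) + y(i := 0)" "(sm c x)(i := 0) = sm c (x(i := 0))" for x y :: "'a \<Rightarrow> 'p" and c
        by (auto simp: fun_eq_iff sm_apply)
      have e0: "(0 :: 'a \<Rightarrow> 'p)(i := 0) = 0" by (auto simp: fun_eq_iff)
      show "submod (k X)" unfolding k_def
        by (rule submodI; unfold mem_Collect_eq e e0) (use X(1) submod_0 submod_add submod_sm in blast)+
      show "base a I \<subseteq> k X" using X(2) insert.hyps(2) idlD(1)[OF a] by (auto simp: k_def base_def subset_iff)
    qed
    obtain X1 where X1: "X1 \<in> S" "\<And>Y. Y \<in> S \<Longrightarrow> p X1 \<subseteq> p Y \<Longrightarrow> p Y = p X1"
    proof -
      have "p ` S \<noteq> {}" "\<And>J. J \<in> p ` S \<Longrightarrow> idl J \<and> a \<subseteq> J" using ne pI by auto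
      from idl_max[OF this] show ?thesis using that by auto
    qed
    define S1 where "S1 = {X \<in> S. p X = p X1}"
    obtain X where X: "X \<in> S1" "\<And>Y. Y \<in> S1 \<Longrightarrow> k X \<subseteq> k Y \<Longrightarrow> k Y = k X"
    proof -
      have "X1 \<in> S1" using X1 by (simp add: S1_def)
      then have "k X1 \<in> k ` S1" by blast
      moreover have "\<And>K. K \<in> k ` S1 \<Longrightarrow> submod K" "\<And>K. K \<in> k ` S1 \<Longrightarrow> base a I \<subseteq> K" using kI by (auto simp: S1_def)
      ultimately have "\<exists>K\<in>k ` S1. \<forall>L\<in>k ` S1. K \<subseteq> L \<longrightarrow> L = K" by (rule noethD[OF insert.IH])
      then show ?thesis using that unfolding bex_simps ball_simps by meson
    qed
    have XS: "X \<in> S" and pX: "p X = p X1" using X(1) by (auto simp: S1_def)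
    show "\<exists>X\<in>S. \<forall>Y\<in>S. X \<subseteq> Y \<longrightarrow> Y = X"
    proof (intro bexI[OF _ XS] ballI impI)
      fix Y assume Y: "Y \<in> S" "X \<subseteq> Y"
      have "p X \<subseteq> p Y" using Y(2) by (auto simp: p_def)
      then have pY: "p Y = p X1" using X1(2)[OF Y(1)] pX by simp
      then have "Y \<in> S1" using Y(1) by (simp add: S1_def)
      moreover have "k X \<subseteq> k Y" using Y(2) by (auto simp: k_def)
      ultimately have kY: "k Y = k X" by (rule X(2))
      have sX: "submod X" and sY: "submod Y" using S XS Y(1) by auto
      show "Y = X"
      proof
        show "Y \<subseteq> X"
        proof
          fix y assume y: "y \<in> Y"
          then have "y i \<in> p X" using pY pX by (auto simp: p_def)
          then obtain x where x: "x \<in> X" "x i = y i" by (auto simp: p_def)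
          have "y - x \<in> Y" using sY y x Y(2) submod_diff by blast
          moreover have e: "(y - x)(i := 0) = y - x" using x(2) by (auto simp: fun_eq_iff)
          ultimately have "y - x \<in> k Y" by (simp add: k_def)
          then have "y - x \<in> k X" using kY by simp
          then have "y - x \<in> X" unfolding k_def mem_Collect_eq e .
          then show "y \<in> X" using submod_diff_cancel[OF sX] x(1) by blast
        qed
      qed fact
    qed
  qed
qed

lemma one_minus_notin: "x \<in> m \<Longrightarrow> 1 - x * p \<notin> m"
  using m m1 idlD(2)[OF m, of "1 - x * p" "x * p"] idlD(4)[OF m] by auto

lemma unit_cancel:
  assumes "c \<notin> m" "submod Y" "base a I \<subseteq> Y" "sm c z \<in> Y" shows "z \<in> Y"
proof -
  obtain e where e: "c * e - 1 \<in> a" using unit[OF assms(1)] by blast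
  have "sm (c * e - 1) z \<in> Y" using base_sm[OF a e] assms(3) by blast
  moreover have "sm (c * e) z \<in> Y" using submod_sm[OF assms(2,4), of e] by (simp add: sm_sm mult.commute)
  moreover have "z = sm (c * e) z - sm (c * e - 1) z" by (auto simp: fun_eq_iff sm_apply algebra_simps)
  ultimately show ?thesis using submod_diff[OF assms(2)] by metis
qed

lemma colon_idl: "submod Y \<Longrightarrow> idl {c. sm c z \<in> Y}"
  unfolding idl_def by (auto simp: sm_add_left submod_add submod_0 sm_sm[symmetric] intro: submod_sm)

text \<open>An annihilator that is maximal among those of nonzero classes of \<open>Z / Y\<close> is
  prime. This associated prime supplies the next cyclic layer in the filtrations below.\<close>

lemma ass_prime:
  assumes "submod Y" "base a I \<subseteq> Y" "Y \<subset> Z" "submod Z"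
  shows "\<exists>z p. z \<in> Z \<and> z \<notin> Y \<and> p = {c. sm c z \<in> Y} \<and> idl p \<and> a \<subseteq> p \<and> 1 \<notin> p \<and> p \<subseteq> m \<and>
    (\<forall>c d. c * d \<in> p \<longrightarrow> c \<in> p \<or> d \<in> p)"
proof -
  define S where "S = (\<lambda>z. {c. sm c z \<in> Y}) ` (Z - Y)"
  have "S \<noteq> {}" using assms by (auto simp: S_def)
  moreover have "\<And>J. J \<in> S \<Longrightarrow> idl J \<and> a \<subseteq> J"
    using colon_idl[OF assms(1)] base_sm[OF a, of _ _ I] assms(2) by (fastforce simp: S_def)
  ultimately obtain p where p: "p \<in> S" "\<And>J. J \<in> S \<Longrightarrow> p \<subseteq> J \<Longrightarrow> J = p" using idl_max[of S] by blast
  then obtain z where z: "z \<in> Z" "z \<notin> Y" "p = {c. sm c z \<in> Y}" by (auto simp: S_def)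
  have ip: "idl p" "a \<subseteq> p" using p(1) \<open>\<And>J. J \<in> S \<Longrightarrow> idl J \<and> a \<subseteq> J\<close> by auto
  have p1: "1 \<notin> p" using z by simp
  have "c \<in> p \<or> d \<in> p" if cd: "c * d \<in> p" for c d
  proof (rule ccontr)
    assume no: "\<not> (c \<in> p \<or> d \<in> p)"
    have "sm d z \<in> Z - Y" using no z submod_sm[OF assms(4)] by auto
    then have "{c. sm c (sm d z) \<in> Y} \<in> S" by (auto simp: S_def)
    moreover have "p \<subseteq> {c. sm c (sm d z) \<in> Y}"
    proof
      fix e assume "e \<in> p"
      then have "e * d \<in> p" by (rule idlD(4)[OF ip(1)])
      then show "e \<in> {c. sm c (sm d z) \<in> Y}" by (simp add: z(3) sm_sm)
    qed
    ultimately have "{c. sm c (sm d z) \<in> Y} = p" by (rule p(2))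
    moreover have "sm c (sm d z) \<in> Y" using cd by (simp add: z(3) sm_sm)
    ultimately show False using no by blast
  qed
  moreover have "p \<subseteq> m"
  proof
    fix c assume c: "c \<in> p"
    show "c \<in> m"
    proof (rule ccontr)
      assume "c \<notin> m"
      from unit_cancel[OF this assms(1,2), of z] c z show False by simp
    qed
  qed
  ultimately show ?thesis using z ip p1 by (intro exI[of _ z] exI[of _ p] conjI) auto
qed

lemma prime_power:
  assumes "idl p" "1 \<notin> p" "\<forall>c d. c * d \<in> p \<longrightarrow> c \<in> p \<or> d \<in> p" "x ^ k \<in> p" shows "x \<in> p"
  using assms(4) by (induction k) (use assms in auto)

text \<open>Take \<open>Y\<close> maximal with \<open>Y / B\<close> of finite length. If
  \<open>Y\<close> were not \<open>Z\<close>, an associated prime of \<open>Z / Y\<close> would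
  contain \<open>m\<close> by nilpotence, and the cyclic layer it belongs to would be
  simple.\<close>

lemma tors_finite_length:
  assumes I: "finite I" and s: "submod Z" "submod B" "base a I \<subseteq> B" "B \<subseteq> Z" and t: "tors m Z B"
  shows "len Z B \<noteq> \<infinity>"
proof -
  define S where "S = {Y. submod Y \<and> B \<subseteq> Y \<and> Y \<subseteq> Z \<and> len Y B \<noteq> \<infinity>}"
  have "B \<in> S" using s by (simp add: S_def zero_enat_def)
  moreover have "submod X" "base a I \<subseteq> X" if "X \<in> S" for X using that s(3) unfolding S_def by blast+
  ultimately have "\<exists>Y\<in>S. \<forall>X\<in>S. Y \<subseteq> X \<longrightarrow> X = Y" by (rule noethD[OF noeth_base[OF I]])
  then obtain Y where Y: "Y \<in> S" "\<forall>X\<in>S. Y \<subseteq> X \<longrightarrow> X = Y" by (rule bexE)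
  have y: "submod Y" "B \<subseteq> Y" "Y \<subseteq> Z" "len Y B \<noteq> \<infinity>" using Y(1) by (auto simp: S_def)
  have bY: "base a I \<subseteq> Y" using y s by blast
  have "Y = Z"
  proof (rule ccontr)
    assume "Y \<noteq> Z"
    then have "Y \<subset> Z" using y by blast
    from ass_prime[OF y(1) bY this s(1)] obtain z where "\<exists>p. z \<in> Z \<and> z \<notin> Y \<and> p = {c. sm c z \<in> Y} \<and>
      idl p \<and> a \<subseteq> p \<and> 1 \<notin> p \<and> p \<subseteq> m \<and> (\<forall>c d. c * d \<in> p \<longrightarrow> c \<in> p \<or> d \<in> p)" ..
    then obtain p where zp: "z \<in> Z \<and> z \<notin> Y \<and> p = {c. sm c z \<in> Y} \<and>
      idl p \<and> a \<subseteq> p \<and> 1 \<notin> p \<and> p \<subseteq> m \<and> (\<forall>c d. c * d \<in> p \<longrightarrow> c \<in> p \<or> d \<in> p)" ..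
    note z = zp[THEN conjunct1] zp[THEN conjunct2, THEN conjunct1] zp[THEN conjunct2, THEN conjunct2, THEN conjunct1]
    have p1: "idl p" using zp by (elim conjE)
    have p2: "1 \<notin> p" using zp by (elim conjE)
    have p3: "\<forall>c d. c * d \<in> p \<longrightarrow> c \<in> p \<or> d \<in> p" using zp by (elim conjE)
    note p = p1 p2 p3
    have mz: "sm x z \<in> Y" if x: "x \<in> m" for x
    proof -
      obtain k where k: "\<forall>z\<in>Z. sm (x ^ k) z \<in> B" using torsD[OF t x] ..
      from bspec[OF k z(1)] have "sm (x ^ k) z \<in> Y" by (rule subsetD[OF y(2)])
      then have "x ^ k \<in> p" by (simp add: z(3))
      from prime_power[OF p this] show ?thesis by (simp add: z(3))
    qed
    define X where "X = msum Y (cyc z)"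
    have X: "submod X" "Y \<subseteq> X" "z \<in> X" "X \<subseteq> Z"
      unfolding X_def by (rule submod_msum[OF y(1) submod_cyc] msum_left[OF submod_cyc]
        subsetD[OF msum_right[OF y(1)] self_in_cyc] msum_least[OF s(1) y(3) cyc_least[OF s(1) z(1)]])+
    \<comment> \<open>Simplicity of \<open>X / Y\<close>: if \<open>V\<close> is strictly larger
      than some \<open>U\<close> above \<open>Y\<close>, then \<open>V\<close> contains a multiple
      of \<open>z\<close> by an element outside \<open>m\<close>, hence \<open>z\<close>
      itself.\<close>
    have "\<not> ch Y 2 X"
    proof
      assume "ch Y 2 X"
      then obtain V where V: "ch Y 1 V" "V \<subset> X" by (auto simp: numeral_2_eq_2)
      then obtain U where U: "submod U" "Y \<subseteq> U" "U \<subset> V" "submod V" by auto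
      obtain v where v: "v \<in> V" "v \<notin> U" using U by blast
      then have "v \<in> X" using V by blast
      then obtain u c where uc: "u \<in> Y" "v = u + sm c z" unfolding X_def by (auto elim!: msumE simp: cyc_def)
      have uV: "u \<in> V" "u \<in> U" using uc U by blast+
      have "sm c z \<in> V" "sm c z \<notin> U"
        using v uc submod_diff[OF U(4) v(1) uV(1)] submod_add[OF U(1) uV(2), of "sm c z"] by auto
      then have "c \<notin> m" using subsetD[OF U(2) mz[of c]] by auto
      moreover have "base a I \<subseteq> V" using bY U by simp
      ultimately have "z \<in> V" using unit_cancel[OF _ U(4) _ \<open>sm c z \<in> V\<close>] by simp
      then have "X \<subseteq> V"
        unfolding X_def using U by (intro msum_least[OF U(4)] cyc_least[OF U(4)]) auto
      then show False using V by blast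
    qed
    then have "\<not> enat 2 \<le> len X Y" using enat_le_len_iff[OF X(1,2)] by blast
    then have "len X Y \<noteq> \<infinity>" by (cases "len X Y") auto
    moreover have "len X B = len X Y + len Y B" by (rule len_add) (use X y in auto)
    ultimately have "len X B \<noteq> \<infinity>" using y(4) by (simp add: plus_eq_infty_iff_enat)
    then have "X \<in> S" using X y by (auto simp: S_def)
    then have "X = Y" using Y(2)[rule_format] X(2) by simp
    then show False using X(3) z(2) by blast
  qed
  then show ?thesis using y by simp
qed

text \<open>In place of a list of generators, a maximal proper submodule \<open>Y\<close> above
  \<open>B\<close> is used: \<open>N\<close> is generated over \<open>Y\<close> by one element
  \<open>z\<close>, and the hypothesis puts \<open>(1 - x p) z\<close> into \<open>Y\<close> for
  some \<open>p\<close>, where \<open>1 - x p\<close> is invertible modulo \<open>a\<close>.\<close>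

lemma nakayama:
  assumes I: "finite I" and s: "submod N" "submod B" "base a I \<subseteq> B" "B \<subseteq> N" and x: "x \<in> m"
    and N: "N \<subseteq> msum (sm x ` N) B"
  shows "N = B"
proof (rule ccontr)
  assume ne: "N \<noteq> B"
  define S where "S = {Y. submod Y \<and> B \<subseteq> Y \<and> Y \<subset> N}"
  have "B \<in> S" using s ne by (auto simp: S_def)
  moreover have "submod X" "base a I \<subseteq> X" if "X \<in> S" for X using that s(3) unfolding S_def by blast+
  ultimately have "\<exists>Y\<in>S. \<forall>X\<in>S. Y \<subseteq> X \<longrightarrow> X = Y" by (rule noethD[OF noeth_base[OF I]])
  then obtain Y where Y: "Y \<in> S" "\<forall>X\<in>S. Y \<subseteq> X \<longrightarrow> X = Y" by (rule bexE)
  have y: "submod Y" "B \<subseteq> Y" "Y \<subset> N" using Y(1) by (auto simp: S_def)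
  obtain z where z: "z \<in> N" "z \<notin> Y" using y by blast
  define X where "X = msum Y (cyc z)"
  have X: "submod X" "Y \<subseteq> X" "z \<in> X" "X \<subseteq> N"
    unfolding X_def by (rule submod_msum[OF y(1) submod_cyc] msum_left[OF submod_cyc]
      subsetD[OF msum_right[OF y(1)] self_in_cyc]
      msum_least[OF s(1) psubset_imp_subset[OF y(3)] cyc_least[OF s(1) z(1)]])+
  have "X = N"
  proof (rule ccontr)
    assume "X \<noteq> N"
    then have "X \<in> S" using X y by (auto simp: S_def)
    then have "X = Y" using Y(2)[rule_format] X(2) by simp
    then show False using X(3) z(2) by blast
  qed
  obtain n b where n: "n \<in> N" "b \<in> B" "z = sm x n + b" using N z(1) by (blast elim: msumE)
  then obtain u p where u: "u \<in> Y" "n = u + sm p z" using \<open>X = N\<close> unfolding X_def by (auto elim!: msumE simp: cyc_def)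
  have "sm (1 - x * p) z = z - sm x (sm p z)" by (auto simp: fun_eq_iff sm_apply algebra_simps)
  also have "\<dots> = sm x u + b" using n(3) u(2) by (simp add: sm_add algebra_simps)
  also have "\<dots> \<in> Y" using submod_add[OF y(1) submod_sm[OF y(1) u(1)] subsetD[OF y(2) n(2)]] .
  finally have "sm (1 - x * p) z \<in> Y" .
  moreover have "base a I \<subseteq> Y" using s(3) y(2) by (rule order_trans)
  ultimately have "z \<in> Y" using unit_cancel[OF one_minus_notin[OF x] y(1)] by simp
  then show False using z by blast
qed

text \<open>Finite length makes the decreasing submodules \<open>x ^ k Z + B\<close> stationary, and
  Nakayama's lemma identifies the stationary value with \<open>B\<close>.\<close>

lemma finite_length_tors:
  assumes I: "finite I" and s: "submod Z" "submod B" "base a I \<subseteq> B" "B \<subseteq> Z" and fin: "len Z B \<noteq> \<infinity>"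
  shows "tors m Z B"
  unfolding tors_def
proof
  fix x assume x: "x \<in> m"
  define N where "N k = msum (sm (x ^ k) ` Z) B" for k
  have im: "submod (sm (x ^ k) ` Z)" for k by (rule submod_image[OF lin_sm_const s(1)])
  have N: "submod (N k)" "B \<subseteq> N k" "N k \<subseteq> Z" for k
  proof -
    show "submod (N k)" unfolding N_def by (rule submod_msum[OF im s(2)])
    show "B \<subseteq> N k" unfolding N_def by (rule msum_right[OF im])
    have "sm (x ^ k) ` Z \<subseteq> Z" using submod_sm[OF s(1)] by blast
    then show "N k \<subseteq> Z" unfolding N_def by (rule msum_least[OF s(1) _ s(4)])
  qed
  have step: "N (Suc k) \<subseteq> N k" for k
  proof
    fix v assume "v \<in> N (Suc k)"
    then obtain z b where "z \<in> Z" "b \<in> B" "v = sm (x ^ Suc k) z + b" unfolding N_def by (auto elim: msumE)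
    moreover have "sm (x ^ Suc k) z = sm (x ^ k) (sm x z)" by (simp add: sm_sm mult.commute)
    ultimately have "v = sm (x ^ k) (sm x z) + b" "sm x z \<in> Z" "b \<in> B" using submod_sm[OF s(1)] by simp_all
    then show "v \<in> N k" unfolding N_def using msumI[OF imageI[of "sm x z" Z "sm (x ^ k)"]] by simp
  qed
  have "\<exists>k. N k = N (Suc k)"
  proof (rule ccontr)
    assume "\<nexists>k. N k = N (Suc k)"
    then have str: "N (Suc k) \<subset> N k" for k using step by blast
    have "ch B j (N k)" for j k
    proof (induction j arbitrary: k)
      case 0 then show ?case using N by simp
    next
      case (Suc j)
      have "ch B j (N (Suc k))" by (rule Suc.IH)
      then show ?case using N(1)[of k] str[of k] unfolding ch.simps by blast
    qed
    from this[of _ 0] have "ch B j Z" for j using ch_up[OF _ N(3) s(1)] by blast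
    then have "enat j \<le> len Z B" for j using enat_le_len_iff[OF s(1,4)] by blast
    then have "enat (Suc (the_enat (len Z B))) \<le> len Z B" by blast
    then show False using fin by (cases "len Z B") auto
  qed
  then obtain k where k: "N k = N (Suc k)" by blast
  have "N k \<subseteq> msum (sm x ` N k) B"
  proof
    fix v assume "v \<in> N k"
    then obtain z b where z: "z \<in> Z" "b \<in> B" "v = sm (x ^ Suc k) z + b" unfolding k unfolding N_def by (auto elim: msumE)
    have "sm (x ^ Suc k) z = sm x (sm (x ^ k) z)" by (simp add: sm_sm)
    moreover have "sm (x ^ k) z \<in> N k" unfolding N_def using z(1) msum_left[OF s(2)] by blast
    ultimately show "v \<in> msum (sm x ` N k) B" using z(2,3) msumI[OF imageI[of "sm (x ^ k) z" "N k" "sm x"]] by simp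
  qed
  then have "N k = B" using nakayama[OF I N(1) s(2,3) N(2) x] by blast
  then show "\<exists>k. \<forall>z\<in>Z. sm (x ^ k) z \<in> B" using msum_left[OF s(2)] unfolding N_def by blast
qed

end

section \<open>Matrices acting on powers of a module\<close>

definition sl :: "(nat \<times> 'i \<Rightarrow> 'p) \<Rightarrow> nat \<Rightarrow> 'i \<Rightarrow> 'p" where
  "sl x j = (\<lambda>i. x (j, i))"

text \<open>The r-th power, encoded by functions on pairs so that no type depends on
  \<open>r\<close>. Slices from \<open>r\<close> on are unconstrained in every power and thus
  disappear in the quotient of two powers.\<close>

definition pw :: "nat \<Rightarrow> ('i \<Rightarrow> 'p) set \<Rightarrow> (nat \<times> 'i \<Rightarrow> 'p) set" where
  "pw r Z = {x. \<forall>j<r. sl x j \<in> Z}"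

definition mact :: "'p::comm_ring_1 mat \<Rightarrow> (nat \<times> 'i \<Rightarrow> 'p) \<Rightarrow> nat \<times> 'i \<Rightarrow> 'p" where
  "mact A x = (\<lambda>(j, i). if j < dim_row A then \<Sum>k<dim_col A. A $$ (j, k) * x (k, i) else 0)"

lemma sl_apply: "sl x j i = x (j, i)"
  by (simp add: sl_def)

lemma sl_add: "sl (x + y) j = sl x j + sl y j"
  and sl_diff: "sl (x - y) j = sl x j - sl y j"
  and sl_sm: "sl (sm c x) j = sm c (sl x j)"
  and sl_0: "sl 0 j = 0"
  by (auto simp: fun_eq_iff sl_apply sm_apply)

lemma sl_mact: "j < dim_row A \<Longrightarrow> sl (mact A x) j = (\<Sum>k<dim_col A. sm (A $$ (j, k)) (sl x k))"
  by (simp add: fun_eq_iff sl_apply mact_def sum_fun_apply sm_apply)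

lemma pwI: "(\<And>j. j < r \<Longrightarrow> sl x j \<in> Z) \<Longrightarrow> x \<in> pw r Z"
  and pwD: "x \<in> pw r Z \<Longrightarrow> j < r \<Longrightarrow> sl x j \<in> Z"
  by (auto simp: pw_def)

lemma submod_pw: assumes "submod Z" shows "submod (pw r Z)"
proof (rule submodI)
  show "0 \<in> pw r Z" by (rule pwI) (simp add: sl_0 submod_0[OF assms])
  show "x + y \<in> pw r Z" if "x \<in> pw r Z" "y \<in> pw r Z" for x y
    by (rule pwI) (simp add: sl_add submod_add[OF assms] pwD[OF that(1)] pwD[OF that(2)])
  show "sm c x \<in> pw r Z" if "x \<in> pw r Z" for c x
    by (rule pwI) (simp add: sl_sm submod_sm[OF assms] pwD[OF that])
qed

lemma pw_mono: "Y \<subseteq> Z \<Longrightarrow> pw r Y \<subseteq> pw r Z"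
  by (auto simp: pw_def)

lemma base_pw: "base a I \<subseteq> B \<Longrightarrow> base a ({..<r} \<times> I) \<subseteq> pw r B"
  by (auto simp: pw_def base_def sl_def subset_iff)

lemma lin_mact: "lin (mact A)"
  by (rule linI) (auto simp: fun_eq_iff mact_def sm_apply algebra_simps sum.distrib sum_distrib_left)

lemma mact_pw:
  assumes "A \<in> carrier_mat r s" "submod Z" "x \<in> pw s Z" shows "mact A x \<in> pw r Z"
proof (rule pwI)
  fix j assume "j < r"
  then show "sl (mact A x) j \<in> Z" using assms
    by (auto simp: sl_mact intro!: submod_sum submod_sm pwD[OF assms(3)])
qed

lemma endo_mact:
  assumes "A \<in> carrier_mat r r" "submod Z" "submod B" "B \<subseteq> Z"
  shows "endo (mact A) (pw r Z) (pw r B)"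
  by (rule endoI[OF lin_mact submod_pw[OF assms(2)] submod_pw[OF assms(3)] pw_mono[OF assms(4)]])
    (rule mact_pw[OF assms(1,2)] mact_pw[OF assms(1,3)], assumption)+

lemma endo_sm: "submod Z \<Longrightarrow> submod B \<Longrightarrow> B \<subseteq> Z \<Longrightarrow> endo (sm c) Z B"
  by (rule endoI[OF lin_sm_const]) (auto intro: submod_sm)

lemma mact_mult:
  assumes "A \<in> carrier_mat r s" "C \<in> carrier_mat s t"
  shows "mact (A * C) x = mact A (mact C x)"
proof -
  have "(\<Sum>k<t. (A * C) $$ (j, k) * x (k, i)) = (\<Sum>l<s. A $$ (j, l) * (\<Sum>k<t. C $$ (l, k) * x (k, i)))"
    if "j < r" for i j
  proof -
    have "(\<Sum>k<t. (A * C) $$ (j, k) * x (k, i)) = (\<Sum>k<t. \<Sum>l<s. A $$ (j, l) * C $$ (l, k) * x (k, i))"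
      using assms that by (intro sum.cong) (auto simp: scalar_prod_def sum_distrib_right lessThan_atLeast0)
    also have "\<dots> = (\<Sum>l<s. \<Sum>k<t. A $$ (j, l) * C $$ (l, k) * x (k, i))" by (rule sum.swap)
    finally show ?thesis by (simp add: sum_distrib_left mult.assoc)
  qed
  then show ?thesis using assms by (auto simp: fun_eq_iff mact_def)
qed

lemma sl_mact_smult_one: "j < r \<Longrightarrow> sl (mact (c \<cdot>\<^sub>m 1\<^sub>m r) x) j = sm c (sl x j)"
  by (auto simp: fun_eq_iff sl_apply mact_def sm_apply sum.remove[of "{..<r}" j] intro!: sum.neutral)

lemma mact_smult_one_diff:
  assumes "submod B" shows "sm c x - mact (c \<cdot>\<^sub>m 1\<^sub>m r) x \<in> pw r B"
  by (rule pwI) (simp add: sl_diff sl_mact_smult_one sl_sm submod_0[OF assms])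

text \<open>The two adjugate identities. They hold only modulo \<open>pw r B\<close>, because
  \<open>mact\<close> sets the slices from \<open>r\<close> on to zero while \<open>sm\<close> does
  not.\<close>

lemma adj_mact:
  assumes "A \<in> carrier_mat r r" "submod B"
  shows "sm (det A) x - mact A (mact (adj_mat A) x) \<in> pw r B"
    "sm (det A) x - mact (adj_mat A) (mact A x) \<in> pw r B"
  using mact_smult_one_diff[OF assms(2), of "det A" x r] adj_mat[OF assms(1)] assms(1)
  by (simp_all add: mact_mult[symmetric, where r = r and s = r and t = r])

lemma cokl_inverse:
  assumes "endo f Z B" "\<And>z. z \<in> Z \<Longrightarrow> g z \<in> Z" "\<And>z. z \<in> Z \<Longrightarrow> z - f (g z) \<in> B"
  shows "cokl f Z B = 0"
proof -
  have "Z \<subseteq> msum (f ` Z) B"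
  proof
    fix z assume "z \<in> Z"
    from msumI[OF imageI[OF assms(2)[OF this], of f] assms(3)[OF this]] show "z \<in> msum (f ` Z) B" by simp
  qed
  then have "msum (f ` Z) B = Z" using endo_image(2)[OF assms(1)] by (rule antisym[rotated])
  then show ?thesis using endoD(2)[OF assms(1)] by (simp add: cokl_def)
qed

lemma kerl_inj:
  assumes "endo f Z B" "\<And>z. z \<in> Z \<Longrightarrow> f z \<in> B \<Longrightarrow> z \<in> B"
  shows "kerl f Z B = 0"
proof -
  have "{z \<in> Z. f z \<in> B} = B" using assms(2) endoD(4,6)[OF assms(1)] by blast
  then show ?thesis using endoD(3)[OF assms(1)] by (simp add: kerl_def)
qed

lemma kerl_inverse:
  assumes "endo f Z B" "\<And>z. z \<in> B \<Longrightarrow> g z \<in> B" "\<And>z. z \<in> Z \<Longrightarrow> z - g (f z) \<in> B"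
  shows "kerl f Z B = 0"
  by (rule kerl_inj[OF assms(1)]) (use assms(2,3) submod_diff_cancel[OF endoD(3)[OF assms(1)]] in blast)

text \<open>A subquotient \<open>X / Y\<close> on which multiplication by \<open>c\<close> is zero for \<open>c \<in> p\<close>, and injective
  with cokernel of finite length otherwise.\<close>

locale dom_piece =
  fixes p :: "'p::comm_ring_1 set" and X Y :: "('i \<Rightarrow> 'p) set"
  assumes p: "idl p" "1 \<notin> p" and prime: "\<And>c d. c * d \<in> p \<Longrightarrow> c \<in> p \<or> d \<in> p"
    and XY: "submod X" "submod Y" "Y \<subseteq> X"
    and inj: "\<And>c x. c \<notin> p \<Longrightarrow> x \<in> X \<Longrightarrow> sm c x \<in> Y \<Longrightarrow> x \<in> Y"
    and cokl_finite: "\<And>c. c \<notin> p \<Longrightarrow> cokl (sm c) X Y \<noteq> \<infinity>"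
begin

text \<open>Applying the adjugate reduces injectivity of \<open>A\<close> to that of
  \<open>det A\<close> on each slice.\<close>

lemma mact_inj:
  assumes A: "A \<in> carrier_mat r r" "det A \<notin> p" and x: "x \<in> pw r X" "mact A x \<in> pw r Y"
  shows "x \<in> pw r Y"
proof (rule pwI)
  fix j assume j: "j < r"
  have "mact (adj_mat A) (mact A x) \<in> pw r Y" by (rule mact_pw[OF _ XY(2) x(2)]) (use adj_mat(1)[OF A(1)] in simp)
  then have "sm (det A) x \<in> pw r Y"
    using adj_mact(2)[OF A(1) XY(2), of x] submod_diff_cancel[OF submod_pw[OF XY(2)]] by blast
  then have "sm (det A) (sl x j) \<in> Y" using pwD[OF _ j] by (metis sl_sm)
  then show "sl x j \<in> Y" using inj[OF A(2) pwD[OF x(1) j]] by blast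
qed

lemma notin_mult: "c \<notin> p \<Longrightarrow> d \<notin> p \<Longrightarrow> c * d \<notin> p"
  using prime by blast

lemma notin_power: "c \<notin> p \<Longrightarrow> c ^ n \<notin> p"
  by (induction n) (use p notin_mult in auto)

lemma cokl_sm_mult: "c \<notin> p \<Longrightarrow> cokl (sm (c * d)) X Y = cokl (sm c) X Y + cokl (sm d) X Y"
  using cokl_comp[OF endo_sm[OF XY, of c] endo_sm[OF XY, of d]] inj[of c] by (simp add: sm_sm)

lemma cokl_mact_mult:
  assumes "A \<in> carrier_mat r r" "C \<in> carrier_mat r r" "det A \<notin> p"
  shows "cokl (mact (A * C)) (pw r X) (pw r Y) = cokl (mact A) (pw r X) (pw r Y) + cokl (mact C) (pw r X) (pw r Y)"
proof -
  have "mact (A * C) = (\<lambda>x::nat \<times> 'i \<Rightarrow> 'p. mact A (mact C x))" by (rule ext) (rule mact_mult[OF assms(1,2)])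
  then show ?thesis using cokl_comp[OF endo_mact[OF assms(1) XY] endo_mact[OF assms(2) XY]] mact_inj[OF assms(1,3)] by simp
qed

lemma cokl_mact_unit:
  assumes "A \<in> carrier_mat r r" "det A = 1"
  shows "cokl (mact A) (pw r X) (pw r Y) = 0"
proof (rule cokl_inverse[OF endo_mact[OF assms(1) XY]])
  show "mact (adj_mat A) z \<in> pw r X" if "z \<in> pw r X" for z
    by (rule mact_pw[OF _ XY(1) that]) (use adj_mat(1)[OF assms(1)] in simp)
  show "z - mact A (mact (adj_mat A) z) \<in> pw r Y" for z
    using adj_mact(1)[OF assms(1) XY(2), of z] assms(2) by simp
qed

text \<open>The vectors supported on the first coordinate modulo \<open>Y\<close> form a stable
  submodule \<open>W\<close>, on which \<open>T\<close> acts through its corner entry; the quotient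
  carries the minor. As the minor acts injectively, the connecting homomorphism of
  \<open>snake\<close> vanishes and the cokernel lengths add.\<close>

lemma cokl_block:
  assumes T: "T \<in> carrier_mat (Suc r) (Suc r)" and T0: "\<And>i. 0 < i \<Longrightarrow> i \<le> r \<Longrightarrow> T $$ (i, 0) = 0"
    and d: "det (mat_delete T 0 0) \<notin> p"
  shows "cokl (mact T) (pw (Suc r) X) (pw (Suc r) Y) =
    cokl (sm (T $$ (0, 0))) X Y + cokl (mact (mat_delete T 0 0)) (pw r X) (pw r Y)"
proof -
  let ?Z = "pw (Suc r) X" and ?B = "pw (Suc r) Y" and ?T' = "mat_delete T 0 0"
  have T': "?T' \<in> carrier_mat r r" using T by (metis mat_delete_carrier diff_Suc_1)
  define W where "W = {x \<in> ?Z. \<forall>j<r. sl x (Suc j) \<in> Y}"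
  have e: "endo (mact T) ?Z ?B" by (rule endo_mact[OF T XY])
  have sZ: "submod ?Z" by (rule submod_pw[OF XY(1)])
  have slT: "sl (mact T x) j = (\<Sum>k<Suc r. sm (T $$ (j, k)) (sl x k))" if "j \<le> r" for x :: "nat \<times> 'i \<Rightarrow> 'p" and j
    using that T by (subst sl_mact) auto
  have slT': "sl (mact T x) (Suc j) = (\<Sum>k<r. sm (T $$ (Suc j, Suc k)) (sl x (Suc k)))" if "j < r" for x :: "nat \<times> 'i \<Rightarrow> 'p" and j
    using slT[of "Suc j" x] T0[of "Suc j"] that by (simp add: sum.lessThan_Suc_shift del: sum.lessThan_Suc)
  have W: "submod W"
  proof (rule submodI)
    show "0 \<in> W" unfolding W_def using submod_0[OF sZ] submod_0[OF XY(2)] by (auto simp: sl_0)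
    show "x + y \<in> W" if "x \<in> W" "y \<in> W" for x y
      using that submod_add[OF sZ] submod_add[OF XY(2)] unfolding W_def by (auto simp: sl_add)
    show "sm c x \<in> W" if "x \<in> W" for c x
      using that submod_sm[OF sZ] submod_sm[OF XY(2)] unfolding W_def by (auto simp: sl_sm)
  qed
  have WZ: "W \<subseteq> ?Z" by (auto simp: W_def)
  have BW: "?B \<subseteq> W" unfolding W_def using pw_mono[OF XY(3), of "Suc r"] pwD[of _ "Suc r" Y] by auto
  have TW: "mact T x \<in> W" if "x \<in> W" for x
    using that mact_pw[OF T XY(1), of x] XY(2) unfolding W_def by (auto simp: slT' intro!: submod_sum submod_sm)
  have eW: "endo (mact T) W ?B" by (rule endoI[OF lin_mact W submod_pw[OF XY(2)] BW TW mact_pw[OF T XY(2)]])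
  have eZW: "endo (mact T) ?Z W" by (rule endoI[OF lin_mact sZ W WZ mact_pw[OF T XY(1)] TW])
  define sh :: "(nat \<times> 'i \<Rightarrow> 'p) \<Rightarrow> nat \<times> 'i \<Rightarrow> 'p" where "sh x = (\<lambda>(j, i). x (Suc j, i))" for x
  define un :: "(nat \<times> 'i \<Rightarrow> 'p) \<Rightarrow> nat \<times> 'i \<Rightarrow> 'p" where "un x = (\<lambda>(j, i). if j = 0 then 0 else x (j - 1, i))" for x
  have lsh: "lin sh" by (rule linI) (auto simp: sh_def fun_eq_iff sm_apply)
  have slsh: "sl (sh x) j = sl x (Suc j)" for x j by (simp add: sl_def sh_def)
  have shZ: "sh z \<in> pw r X" if "z \<in> ?Z" for z by (rule pwI) (use pwD[OF that] in \<open>simp add: slsh\<close>)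
  have shker: "sh z \<in> pw r Y \<longleftrightarrow> z \<in> W" if "z \<in> ?Z" for z
    using that by (simp add: pw_def slsh W_def)
  have onto: "pw r X \<subseteq> msum (sh ` ?Z) (pw r Y)"
  proof
    fix x assume x: "x \<in> pw r X"
    have "un x \<in> ?Z"
    proof (rule pwI)
      fix j assume "j < Suc r"
      then show "sl (un x) j \<in> X" using pwD[OF x, of "j - 1"] submod_0[OF XY(1)]
        by (cases j) (auto simp: sl_def un_def zero_fun_def)
    qed
    moreover have "sh (un x) = x" by (auto simp: fun_eq_iff sh_def un_def)
    ultimately show "x \<in> msum (sh ` ?Z) (pw r Y)"
      using msumI[OF imageI submod_0[OF submod_pw[OF XY(2)]], of "un x" ?Z sh] by simp
  qed
  have comm: "sh (mact T z) - mact ?T' (sh z) \<in> pw r Y" for z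
  proof (rule pwI)
    fix j assume j: "j < r"
    have "sl (mact ?T' (sh z)) j = (\<Sum>k<r. sm (?T' $$ (j, k)) (sl z (Suc k)))"
      using j T T' by (simp add: sl_mact slsh)
    also have "\<dots> = (\<Sum>k<r. sm (T $$ (Suc j, Suc k)) (sl z (Suc k)))"
      using j T by (intro sum.cong) (auto simp: mat_delete_def)
    finally show "sl (sh (mact T z) - mact ?T' (sh z)) j \<in> Y"
      using submod_0[OF XY(2)] j by (simp add: sl_diff slsh slT')
  qed
  note iso1 = endo_iso[OF eZW endo_mact[OF T' XY] lsh shZ onto shker comm]
  define inc :: "('i \<Rightarrow> 'p) \<Rightarrow> nat \<times> 'i \<Rightarrow> 'p" where "inc x = (\<lambda>(j, i). if j = 0 then x i else 0)" for x
  have linc: "lin inc" by (rule linI) (auto simp: inc_def fun_eq_iff sm_apply)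
  have slinc: "sl (inc x) j = (if j = 0 then x else 0)" for x j by (auto simp: sl_def inc_def fun_eq_iff)
  have iso2: "cokl (sm (T $$ (0, 0))) X Y = cokl (mact T) W ?B"
  proof (rule endo_iso(1)[OF endo_sm[OF XY] eW linc])
    show "inc z \<in> W" if "z \<in> X" for z
      using that submod_0[OF XY(1)] submod_0[OF XY(2)] by (auto simp: W_def pw_def slinc)
    show "inc z \<in> ?B \<longleftrightarrow> z \<in> Y" for z
      using submod_0[OF XY(2)] by (auto simp: pw_def slinc)
    show "W \<subseteq> msum (inc ` X) ?B"
    proof
      fix x assume x: "x \<in> W"
      have "sl x 0 \<in> X" using x pwD[of x "Suc r" X 0] by (simp add: W_def)
      moreover have "x - inc (sl x 0) \<in> ?B"
      proof (rule pwI)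
        fix j assume "j < Suc r"
        then show "sl (x - inc (sl x 0)) j \<in> Y" using x submod_0[OF XY(2)]
          by (cases j) (auto simp: sl_diff slinc W_def)
      qed
      ultimately show "x \<in> msum (inc ` X) ?B" using msumI[OF imageI, of "sl x 0" X "x - inc (sl x 0)" ?B inc] by simp
    qed
    show "inc (sm (T $$ (0, 0)) z) - mact T (inc z) \<in> ?B" for z
    proof (rule pwI)
      fix j assume j: "j < Suc r"
      have "sl (mact T (inc z)) j = sm (T $$ (j, 0)) z"
        using j by (simp add: slT slinc sum.lessThan_Suc_shift del: sum.lessThan_Suc)
      then show "sl (inc (sm (T $$ (0, 0)) z) - mact T (inc z)) j \<in> Y"
        using j T0[of j] submod_0[OF XY(2)] by (cases "j = 0") (auto simp: sl_diff slinc)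
    qed
  qed
  have k0: "kerl (mact T) ?Z W = 0"
    using iso1(2) kerl_inj[OF endo_mact[OF T' XY]] mact_inj[OF T' d] by simp
  from snake[OF e eW WZ] obtain e1 e2 \<delta> where s: "cokl (mact T) ?Z ?B = cokl (mact T) ?Z W + e1"
    "cokl (mact T) W ?B = e1 + \<delta>" "kerl (mact T) ?Z W = \<delta> + e2" .
  have "\<delta> = 0" using s(3) k0 by simp
  then show ?thesis using s(1,2) iso1(1) iso2 by (simp add: add.commute)
qed

text \<open>Induction on the size. With a pivot \<open>b\<close> outside \<open>p\<close>, a
  multiple of \<open>A\<close> becomes block triangular, at the cost of a factor of determinant
  \<open>b ^ r\<close>. The cokernel length of that factor is known from the induction hypothesis
  and is cancelled at the end.\<close>

lemma cokl_det:
  "A \<in> carrier_mat r r \<Longrightarrow> det A \<notin> p \<Longrightarrow> cokl (mact A) (pw r X) (pw r Y) = cokl (sm (det A)) X Y"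
proof (induction r arbitrary: A)
  case 0
  have u: "pw 0 S = UNIV" for S :: "('i \<Rightarrow> 'p) set" by (simp add: pw_def)
  have "cokl (mact A) (pw 0 X) (pw 0 Y) = 0"
    by (rule cokl_inverse[OF endo_mact[OF 0(1) XY], where g = "\<lambda>x. x"]) (simp_all add: u)
  moreover have "cokl (sm (det A)) X Y = 0"
    by (rule cokl_inverse[OF endo_sm[OF XY], where g = "\<lambda>x. x"]) (use 0(1) submod_0[OF XY(2)] in simp_all)
  ultimately show ?case by simp
next
  case (Suc r)
  have piv: "cokl (mact A) (pw (Suc r) X) (pw (Suc r) Y) = cokl (sm (det A)) X Y"
    if A: "A \<in> carrier_mat (Suc r) (Suc r)" and dA: "det A \<notin> p" and a0: "A $$ (0, 0) \<notin> p" for A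
  proof -
    define b where "b = A $$ (0, 0)"
    \<comment> \<open>Elimination without division: \<open>D\<close> multiplies all rows but the
      first by the pivot, and \<open>L\<close> then subtracts from row \<open>i\<close> the first
      row times the entry \<open>A $$ (i, 0)\<close>. Their determinants are \<open>b ^ r\<close>
      and 1.\<close>
    define L where "L = mat (Suc r) (Suc r) (\<lambda>(i, j). if i = j then 1 else if j = 0 then - A $$ (i, 0) else 0)"
    define D where "D = mat (Suc r) (Suc r) (\<lambda>(i, j). if i = j then if i = 0 then 1 else b else 0)"
    have car: "L \<in> carrier_mat (Suc r) (Suc r)" "D \<in> carrier_mat (Suc r) (Suc r)" by (auto simp: L_def D_def)
    have dm: "prod_list (map f [0..<Suc r]) = f 0 * c ^ r" if "\<And>i. 0 < i \<Longrightarrow> i \<le> r \<Longrightarrow> f i = c" for f :: "nat \<Rightarrow> 'p" and c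
    proof -
      have "prod_list (map f [1..<Suc n]) = c ^ n" if "n \<le> r" for n
        using that by (induction n) (use \<open>\<And>i. 0 < i \<Longrightarrow> i \<le> r \<Longrightarrow> f i = c\<close> in \<open>auto simp: mult.commute\<close>)
      then show ?thesis by (subst upt_conv_Cons) (auto simp del: upt_Suc)
    qed
    have dL: "det L = 1"
    proof -
      have "det L = prod_list (diag_mat L)" by (rule det_lower_triangular[OF _ car(1)]) (auto simp: L_def)
      also have "diag_mat L = map (\<lambda>i. 1) [0..<Suc r]" by (rule nth_equalityI) (auto simp: diag_mat_def L_def simp del: upt_Suc)
      finally show ?thesis using dm[of "\<lambda>_. 1" 1] by (simp del: upt_Suc)
    qed
    have dD: "det D = b ^ r"
    proof -
      have "det D = prod_list (diag_mat D)" by (rule det_lower_triangular[OF _ car(2)]) (auto simp: D_def)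
      also have "diag_mat D = map (\<lambda>i. if i = 0 then 1 else b) [0..<Suc r]"
        by (rule nth_equalityI) (auto simp: diag_mat_def D_def simp del: upt_Suc)
      finally show ?thesis using dm[of "\<lambda>i. if i = 0 then 1 else b" b] by (simp del: upt_Suc)
    qed
    define T where "T = L * (D * A)"
    have carT: "T \<in> carrier_mat (Suc r) (Suc r)" unfolding T_def using car A by simp
    have DA: "(D * A) $$ (i, j) = (if i = 0 then A $$ (0, j) else b * A $$ (i, j))" if "i \<le> r" "j \<le> r" for i j
    proof -
      have "(D * A) $$ (i, j) = (\<Sum>k<Suc r. D $$ (i, k) * A $$ (k, j))"
        using that car A by (auto simp: scalar_prod_def lessThan_atLeast0)
      also have "\<dots> = D $$ (i, i) * A $$ (i, j)"
        using that by (subst sum.remove[of _ i]) (auto intro!: sum.neutral simp: D_def)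
      finally show ?thesis using that by (simp add: D_def)
    qed
    have Ti: "T $$ (i, 0) = 0" if "0 < i" "i \<le> r" for i
    proof -
      have Lk: "T $$ (i, 0) = (\<Sum>k<Suc r. L $$ (i, k) * (D * A) $$ (k, 0))" if "i \<le> r" for i
        unfolding T_def using that car A by (auto simp: scalar_prod_def lessThan_atLeast0)
      have "T $$ (i, 0) = L $$ (i, 0) * (D * A) $$ (0, 0) + (\<Sum>k<r. L $$ (i, Suc k) * (D * A) $$ (Suc k, 0))"
        using that by (subst Lk) (auto simp: sum.lessThan_Suc_shift simp del: sum.lessThan_Suc)
      also have "(\<Sum>k<r. L $$ (i, Suc k) * (D * A) $$ (Suc k, 0)) = L $$ (i, i) * (D * A) $$ (i, 0)"
        using that by (subst sum.remove[of _ "i - 1"]) (auto intro!: sum.neutral simp: L_def split: if_splits)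
      finally show "T $$ (i, 0) = 0" using that by (simp add: DA L_def b_def)
    qed
    have T00: "T $$ (0, 0) = b"
    proof -
      have "T $$ (0, 0) = (\<Sum>k<Suc r. L $$ (0, k) * (D * A) $$ (k, 0))"
        unfolding T_def using car A by (auto simp: scalar_prod_def lessThan_atLeast0)
      then show ?thesis by (auto simp: sum.lessThan_Suc_shift DA L_def b_def simp del: sum.lessThan_Suc intro!: sum.neutral)
    qed
    have carT': "mat_delete T 0 0 \<in> carrier_mat r r" using carT by (metis mat_delete_carrier diff_Suc_1)
    have dT: "det T = b ^ r * det A"
      unfolding T_def using car A by (simp add: det_mult[where n = "Suc r"] dL dD)
    have "det T = (\<Sum>i<Suc r. T $$ (i, 0) * cofactor T i 0)" by (rule laplace_expansion_column[OF carT]) simp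
    also have "\<dots> = b * det (mat_delete T 0 0)"
      by (simp add: sum.lessThan_Suc_shift T00 cofactor_def del: sum.lessThan_Suc) (auto intro!: sum.neutral simp: Ti)
    \<comment> \<open>Comparing the expansion along the cleared column with the product formula. As
      \<open>p\<close> is prime and contains neither \<open>b\<close> nor \<open>det A\<close>, the
      determinant of the minor is also outside \<open>p\<close>, which the induction hypothesis
      requires.\<close>
    finally have dT': "b ^ r * det A = b * det (mat_delete T 0 0)" using dT by simp
    have bp: "b \<notin> p" "b ^ r \<notin> p" using a0 notin_power by (auto simp: b_def)
    then have "b ^ r * det A \<notin> p" using dA notin_mult by blast
    then have d': "det (mat_delete T 0 0) \<notin> p" unfolding dT' using idlD(3)[OF p(1)] by blast
    have D': "mat_delete D 0 0 = b \<cdot>\<^sub>m 1\<^sub>m r" by (rule eq_matI) (auto simp: mat_delete_def D_def)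
    \<comment> \<open>\<open>D\<close> is itself block triangular with minor \<open>b\<close> times
      the identity of size \<open>r\<close>, so the induction hypothesis covers it.\<close>
    have cD: "cokl (mact D) (pw (Suc r) X) (pw (Suc r) Y) = cokl (sm (b ^ r)) X Y"
    proof -
      have bI: "b \<cdot>\<^sub>m 1\<^sub>m r \<in> carrier_mat r r" "det (b \<cdot>\<^sub>m 1\<^sub>m r) = b ^ r" by (simp_all add: det_smult)
      have "cokl (mact D) (pw (Suc r) X) (pw (Suc r) Y) = cokl (sm (D $$ (0, 0))) X Y + cokl (mact (mat_delete D 0 0)) (pw r X) (pw r Y)"
        by (rule cokl_block[OF car(2)]) (use bp bI in \<open>auto simp: D_def D'[unfolded D_def]\<close>)
      also have "cokl (mact (mat_delete D 0 0)) (pw r X) (pw r Y) = cokl (sm (b ^ r)) X Y"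
        unfolding D' using Suc.IH[OF bI(1)] bp bI(2) by simp
      also have "cokl (sm (D $$ (0, 0))) X Y = 0"
        by (rule cokl_inverse[OF endo_sm[OF XY], where g = "\<lambda>x. x"]) (use submod_0[OF XY(2)] in \<open>simp_all add: D_def\<close>)
      finally show ?thesis by simp
    qed
    have "cokl (mact T) (pw (Suc r) X) (pw (Suc r) Y) = cokl (sm (b ^ r)) X Y + cokl (mact A) (pw (Suc r) X) (pw (Suc r) Y)"
    proof -
      have DAc: "D * A \<in> carrier_mat (Suc r) (Suc r)" using car A by simp
      show ?thesis unfolding T_def
        using cokl_mact_mult[OF car(1) DAc] cokl_mact_mult[OF car(2) A] cokl_mact_unit[OF car(1) dL] p(2) dL dD bp cD by simp
    qed
    moreover have "cokl (mact T) (pw (Suc r) X) (pw (Suc r) Y) = cokl (sm b) X Y + cokl (sm (det (mat_delete T 0 0))) X Y"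
      using cokl_block[OF carT Ti d'] T00 Suc.IH[OF carT' d'] by simp
    moreover have "cokl (sm b) X Y + cokl (sm (det (mat_delete T 0 0))) X Y = cokl (sm (b ^ r)) X Y + cokl (sm (det A)) X Y"
      using cokl_sm_mult[OF bp(1)] cokl_sm_mult[OF bp(2)] dT' by metis
    \<comment> \<open>The length belonging to \<open>b ^ r\<close> occurs on both sides; being
      finite, it cancels.\<close>
    ultimately show ?thesis using cokl_finite[OF bp(2)]
      by (cases "cokl (sm (b ^ r)) X Y") (auto simp: enat_add_left_cancel)
  qed
  show ?case
  proof (cases "A $$ (0, 0) \<in> p")
    case False then show ?thesis using piv Suc.prems by blast
  next
    case True
    \<comment> \<open>If the whole first column were in \<open>p\<close>, Laplace expansion would
      put \<open>det A\<close> into \<open>p\<close>. Adding the row found here to the first one, by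
      a matrix of determinant 1, gives a pivot outside \<open>p\<close>, since the old one lies in
      \<open>p\<close>.\<close>
    have "\<exists>i<Suc r. A $$ (i, 0) \<notin> p"
    proof (rule ccontr)
      assume "\<not> (\<exists>i<Suc r. A $$ (i, 0) \<notin> p)"
      then have "(\<Sum>i<Suc r. A $$ (i, 0) * cofactor A i 0) \<in> p"
        by (intro idl_sum[OF p(1)] idlD(4)[OF p(1)]) auto
      then show False using Suc.prems laplace_expansion_column[OF Suc.prems(1), of 0] by simp
    qed
    then obtain i where i: "i < Suc r" "A $$ (i, 0) \<notin> p" by blast
    have i0: "i \<noteq> 0" using True i(2) by (cases "i = 0") auto
    let ?E = "addrow_mat (Suc r) (1 :: 'p) 0 i"
    have E: "?E \<in> carrier_mat (Suc r) (Suc r)" "det ?E = 1" using i i0 by (auto simp: det_addrow_mat)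
    have EA: "?E * A \<in> carrier_mat (Suc r) (Suc r)" "det (?E * A) = det A"
      using E Suc.prems(1) by (auto simp: det_mult[OF E(1) Suc.prems(1)])
    have "(?E * A) $$ (0, 0) = A $$ (i, 0) + A $$ (0, 0)"
      using addrow_mat[OF Suc.prems(1) i(1), of 1 0] Suc.prems(1) by (metis carrier_matD(1) carrier_matD(2) index_mat_addrow(1) mult_1 zero_less_Suc)
    then have "(?E * A) $$ (0, 0) \<notin> p" using True i(2) idlD(6)[OF p(1), of "A $$ (i, 0) + A $$ (0, 0)" "A $$ (0, 0)"] by auto
    then have "cokl (mact (?E * A)) (pw (Suc r) X) (pw (Suc r) Y) = cokl (sm (det A)) X Y"
      using piv[OF EA(1)] EA(2) Suc.prems(2) by simp
    then show ?thesis using cokl_mact_mult[OF E(1) Suc.prems(1)] cokl_mact_unit[OF E] E(2) p(2) by simp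
  qed
qed

text \<open>For a determinant outside \<open>p\<close> both kernels vanish, so the cokernel lengths
  of \<open>cokl_det\<close> are all that is left.\<close>

lemma eul_det_piece:
  assumes "A \<in> carrier_mat r r" "det A \<notin> p"
  shows "eul (mact A) (pw r X) (pw r Y) = eul (sm (det A)) X Y"
proof -
  have "kerl (mact A) (pw r X) (pw r Y) = 0" by (rule kerl_inj[OF endo_mact[OF assms(1) XY]]) (rule mact_inj[OF assms])
  moreover have "kerl (sm (det A)) X Y = 0" by (rule kerl_inj[OF endo_sm[OF XY]]) (rule inj[OF assms(2)])
  ultimately show ?thesis by (simp add: eul_def cokl_det[OF assms])
qed

end

section \<open>The determinant computes the Euler characteristic\<close>

context noeth_loc begin

text \<open>A one-dimensional domain: if \<open>d\<close> has finite colength then so has every nonzero \<open>c\<close>.  The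
  colengths of \<open>(c, d\<^sup>n)\<close> equal the lengths of \<open>(d\<^sup>n : c) / d\<^sup>n\<close>, which are bounded by an
  Artin-Rees argument; so \<open>(c, d\<^sup>n)\<close> is stationary, and equal to \<open>(c)\<close> by Nakayama.\<close>

lemma colength_finite:
  assumes I: "finite I" and X: "submod X" and Y: "submod Y" "base a I \<subseteq> Y" and Xz: "X = msum Y (cyc z)"
    and p: "p = {c. sm c z \<in> Y}" "idl p" "\<And>c d. c * d \<in> p \<Longrightarrow> c \<in> p \<or> d \<in> p"
    and d: "d \<in> m" "d \<notin> p" "cokl (sm d) X Y \<noteq> \<infinity>" and c: "c \<notin> p"
  shows "cokl (sm c) X Y \<noteq> \<infinity>"
proof -
  have YX: "Y \<subseteq> X" unfolding Xz by (rule msum_left[OF submod_cyc])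
  have memX: "\<exists>u s. u \<in> Y \<and> x = u + sm s z" if "x \<in> X" for x
    using that unfolding Xz by (auto elim!: msumE simp: cyc_def)
  have zX: "sm s z \<in> X" for s
    unfolding Xz using msum_right[OF Y(1), of "cyc z"] by (auto simp: cyc_def)
  have one: "sm e (u + sm s z) \<in> Y \<longleftrightarrow> e * s \<in> p" if "u \<in> Y" for e u s
    using submod_add_cancel[OF Y(1) submod_sm[OF Y(1) that, of e], of "sm (e * s) z"]
    by (simp add: p(1) sm_add sm_sm add.commute)
  have inj: "x \<in> Y" if h: "e \<notin> p" "x \<in> X" "sm e x \<in> Y" for e x
  proof -
    obtain u s where u: "u \<in> Y" "x = u + sm s z" using memX[OF h(2)] by blast
    then have "s \<in> p" using one h p(3) by blast
    then show ?thesis using u submod_add[OF Y(1)] p(1) by blast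
  qed
  have p1: "1 \<notin> p" using d(2) idlD(3)[OF p(2), of 1 d] by auto
  have dn: "d ^ n \<notin> p" for n by (induction n) (use p1 p(3) d(2) in auto)
  define D where "D n = msum (sm (d ^ n) ` X) Y" for n
  have imX: "submod (sm e ` X)" "sm e ` X \<subseteq> X" for e
    by (rule submod_image[OF lin_sm_const X]) (use submod_sm[OF X] in blast)
  have D: "submod (D n)" "Y \<subseteq> D n" "D n \<subseteq> X" for n
    unfolding D_def by (rule submod_msum[OF imX(1) Y(1)] msum_right[OF imX(1)] msum_least[OF X imX(2) YX])+
  have memD: "x \<in> D n" if "y \<in> X" "x - sm (d ^ n) y \<in> Y" for x y n
    using msumI[OF imageI[OF that(1)] that(2), of "sm (d ^ n)"] by (simp add: D_def)
  have memD': "\<exists>y\<in>X. x - sm (d ^ n) y \<in> Y" if x: "x \<in> D n" for x n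
  proof -
    obtain y t where "y \<in> X" "t \<in> Y" "x = sm (d ^ n) y + t" using x unfolding D_def by (auto elim!: msumE)
    then show ?thesis by (intro bexI[of _ y]) auto
  qed
  have D0: "D 0 = X" using D(3)[of 0] memD[of _ _ 0] submod_0[OF Y(1)] by auto
  have Dstep: "D (k + j) \<subseteq> D k" for k j
  proof
    fix x assume "x \<in> D (k + j)"
    then obtain y where "y \<in> X" "x - sm (d ^ (k + j)) y \<in> Y" using memD' by blast
    then have "sm (d ^ j) y \<in> X" "x - sm (d ^ k) (sm (d ^ j) y) \<in> Y"
      using submod_sm[OF X] by (simp_all add: sm_sm power_add)
    then show "x \<in> D k" by (rule memD)
  qed
  obtain l where l: "cokl (sm d) X Y = enat l" using d(3) by auto
  \<comment> \<open>Multiplication by \<open>d ^ n\<close> identifies \<open>X / (d X + Y)\<close>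
    with the n-th layer; it is injective because \<open>d ^ n\<close> is not in
    \<open>p\<close>.\<close>
  have l1: "len (D n) (D (Suc n)) = enat l" for n
  proof -
    note e1 = endo_image[OF endo_sm[OF X Y(1) YX, of d]]
    have "len X (msum (sm d ` X) Y) = len (D n) (D (Suc n))"
    proof (rule len_iso[OF lin_sm_const[of "d ^ n"] X D(1) D(1) _ e1(2)])
      show "D (Suc n) \<subseteq> D n" using Dstep[of n 1] by simp
      show "sm (d ^ n) x \<in> D n" if "x \<in> X" for x by (rule memD[OF that]) (simp add: submod_0[OF Y(1)])
      show "D n \<subseteq> msum (sm (d ^ n) ` X) (D (Suc n))"
        using msum_mono[OF order_refl D(2)[of "Suc n"], of "sm (d ^ n) ` X"] by (simp add: D_def)
      fix x assume x: "x \<in> X"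
      show "sm (d ^ n) x \<in> D (Suc n) \<longleftrightarrow> x \<in> msum (sm d ` X) Y"
      proof
        assume "sm (d ^ n) x \<in> D (Suc n)"
        then obtain y where y: "y \<in> X" "sm (d ^ n) x - sm (d ^ Suc n) y \<in> Y" using memD' by blast
        then have "sm (d ^ n) (x - sm d y) \<in> Y" by (simp add: sm_diff sm_sm mult.commute)
        then have "x - sm d y \<in> Y" using inj[OF dn[of n]] x y(1) submod_diff[OF X] submod_sm[OF X] by blast
        from msumI[OF imageI[OF y(1)] this, of "sm d"] show "x \<in> msum (sm d ` X) Y" by simp
      next
        assume "x \<in> msum (sm d ` X) Y"
        then obtain y b where y: "y \<in> X" "b \<in> Y" "x = sm d y + b" by (auto elim!: msumE)
        show "sm (d ^ n) x \<in> D (Suc n)"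
          by (rule memD[OF y(1)]) (use submod_sm[OF Y(1) y(2)] in \<open>simp add: y(3) sm_add sm_sm mult.commute\<close>)
      qed
    qed
    then show ?thesis using l by (simp add: cokl_def)
  qed
  have lj: "len (D k) (D (k + j)) = enat (j * l)" for k j
  proof (induction j)
    case 0 then show ?case using D(1) by (simp add: zero_enat_def)
  next
    case (Suc j)
    have "len (D k) (D (k + Suc j)) = len (D k) (D (k + j)) + len (D (k + j)) (D (k + Suc j))"
      by (rule len_add) (use D(1) Dstep Dstep[of "k + j" 1] in auto)
    then show ?case using Suc l1[of "k + j"] by (simp add: add.commute)
  qed
  \<comment> \<open>The colon ideal of \<open>(c) + p\<close> by \<open>d ^ n\<close>. These ideals
    increase with \<open>n\<close>, and the index \<open>n0\<close> from which they are constant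
    serves as the Artin-Rees number.\<close>
  define Q where "Q n = {s. \<exists>u. d ^ n * s - c * u \<in> p}" for n
  have Q: "idl (Q n) \<and> a \<subseteq> Q n" for n
  proof
    have "0 \<in> Q n" unfolding Q_def mem_Collect_eq by (rule exI[of _ 0]) (simp add: idlD(1)[OF p(2)])
    moreover have "s + t \<in> Q n" if st: "s \<in> Q n" "t \<in> Q n" for s t
    proof -
      obtain u v where u: "d ^ n * s - c * u \<in> p" and v: "d ^ n * t - c * v \<in> p" using st unfolding Q_def by blast
      from idlD(2)[OF p(2) u v] show ?thesis unfolding Q_def mem_Collect_eq
        by (intro exI[of _ "u + v"]) (simp add: algebra_simps)
    qed
    moreover have "e * s \<in> Q n" if s: "s \<in> Q n" for s e
    proof -
      obtain u where u: "d ^ n * s - c * u \<in> p" using s unfolding Q_def by blast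
      from idlD(3)[OF p(2) u, of e] show ?thesis unfolding Q_def mem_Collect_eq
        by (intro exI[of _ "e * u"]) (simp add: algebra_simps)
    qed
    ultimately show "idl (Q n)" unfolding idl_def by blast
    have "a \<subseteq> p" using base_sm[OF a] Y(2) unfolding p(1) by blast
    then show "a \<subseteq> Q n" unfolding Q_def using idlD(3)[OF p(2)] by (auto intro!: exI[of _ 0])
  qed
  have Qstep: "Q n \<subseteq> Q (n + j)" for n j
  proof
    fix s assume "s \<in> Q n"
    then obtain u where "d ^ n * s - c * u \<in> p" unfolding Q_def by blast
    from idlD(3)[OF p(2) this, of "d ^ j"] show "s \<in> Q (n + j)" unfolding Q_def mem_Collect_eq
      by (intro exI[of _ "d ^ j * u"]) (simp add: algebra_simps power_add)
  qed
  obtain n0 where n0: "\<And>n. Q n0 \<subseteq> Q n \<Longrightarrow> Q n = Q n0"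
  proof -
    have "\<exists>J\<in>range Q. \<forall>J'\<in>range Q. J \<subseteq> J' \<longrightarrow> J' = J" by (rule idl_max) (use Q in auto)
    then show ?thesis using that by auto
  qed
  \<comment> \<open>Write \<open>c x = d ^ (n0 + n) y\<close>. The coefficient \<open>t\<close> of
    \<open>y\<close> lies in \<open>Q (n0 + n) = Q n0\<close>, so \<open>d ^ n0 t = c w\<close>
    modulo \<open>p\<close>; cancelling \<open>c\<close> shows that \<open>x\<close> is
    \<open>d ^ n w z\<close> modulo \<open>Y\<close>.\<close>
  have ker: "{x \<in> X. sm c x \<in> D (n0 + n)} \<subseteq> D n" for n
  proof
    fix x assume "x \<in> {x \<in> X. sm c x \<in> D (n0 + n)}"
    then have x: "x \<in> X" "sm c x \<in> D (n0 + n)" by auto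
    obtain y where y: "y \<in> X" "sm c x - sm (d ^ (n0 + n)) y \<in> Y" using memD'[OF x(2)] by blast
    obtain u s where us: "u \<in> Y" "x = u + sm s z" using memX[OF x(1)] by blast
    obtain v t where vt: "v \<in> Y" "y = v + sm t z" using memX[OF y(1)] by blast
    have "sm (c * s - d ^ (n0 + n) * t) z = (sm c x - sm (d ^ (n0 + n)) y) - (sm c u - sm (d ^ (n0 + n)) v)"
      unfolding us(2) vt(2) by (auto simp: fun_eq_iff sm_apply algebra_simps)
    also have "\<dots> \<in> Y"
      by (rule submod_diff[OF Y(1) y(2) submod_diff[OF Y(1) submod_sm[OF Y(1) us(1)] submod_sm[OF Y(1) vt(1)]]])
    finally have ct: "c * s - d ^ (n0 + n) * t \<in> p" by (simp add: p(1))
    from idlD(5)[OF p(2) ct] have "t \<in> Q (n0 + n)" unfolding Q_def by (auto intro!: exI[of _ s])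
    then have "t \<in> Q n0" using n0[OF Qstep] by blast
    then obtain w where w: "d ^ n0 * t - c * w \<in> p" unfolding Q_def by blast
    have "c * (s - d ^ n * w) = (c * s - d ^ (n0 + n) * t) + d ^ n * (d ^ n0 * t - c * w)"
      by (simp add: algebra_simps power_add)
    also have "\<dots> \<in> p" by (intro idlD(2)[OF p(2)] idlD(3)[OF p(2)] ct w)
    finally have "s - d ^ n * w \<in> p" using p(3) c by blast
    then have "sm (s - d ^ n * w) z \<in> Y" by (simp add: p(1))
    moreover have "x - sm (d ^ n) (sm w z) = u + sm (s - d ^ n * w) z"
      unfolding us(2) by (auto simp: fun_eq_iff sm_apply algebra_simps)
    ultimately have "x - sm (d ^ n) (sm w z) \<in> Y" using submod_add[OF Y(1) us(1)] by simp
    then show "x \<in> D n" by (rule memD[OF zX])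
  qed
  define C where "C n = msum (sm c ` X) (D n)" for n
  have C: "submod (C n)" "D n \<subseteq> C n" "C n \<subseteq> X" "C (Suc n) \<subseteq> C n" for n
    unfolding C_def by (rule submod_msum[OF imX(1) D(1)] msum_right[OF imX(1)] msum_least[OF X imX(2) D(3)]
        msum_mono[OF order_refl Dstep[of n 1, simplified]])+
  \<comment> \<open>On \<open>X / D (n0 + n)\<close>, which has finite length, the kernel and
    cokernel of \<open>c\<close> are equally long. By \<open>ker\<close> the kernel lies in
    \<open>D n / D (n0 + n)\<close>, whose length \<open>n0 * l\<close> does not depend on
    \<open>n\<close>.\<close>
  have lenC: "len X (C n) \<noteq> \<infinity>" "len X (C (n0 + n)) \<le> enat (n0 * l)" for n
  proof -
    have fin: "len X (D n) \<noteq> \<infinity>" for n using lj[of 0 n] D0 by simp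
    note e = eul_finite_length[OF endo_sm[OF X D(1) D(3)] fin, of c]
    show "len X (C n) \<noteq> \<infinity>" using e(1) by (simp add: C_def cokl_def)
    have sub: "D (n0 + n) \<subseteq> {x \<in> X. sm c x \<in> D (n0 + n)}"
      using D(3)[of "n0 + n"] submod_sm[OF D(1)[of "n0 + n"]] by blast
    have "cokl (sm c) X (D (n0 + n)) = kerl (sm c) X (D (n0 + n))"
      using e[of "n0 + n"] by (auto simp: eul_def)
    then have "len X (C (n0 + n)) = kerl (sm c) X (D (n0 + n))" by (simp add: C_def cokl_def)
    also have "\<dots> \<le> len (D n) (D (n0 + n))"
      unfolding kerl_def by (rule len_mono[OF D(1) submod_vimage[OF lin_sm_const X D(1)] D(1) order_refl sub ker])
    also have "\<dots> = enat (n0 * l)" using lj[of n n0] by (simp add: add.commute)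
    finally show "len X (C (n0 + n)) \<le> enat (n0 * l)" .
  qed
  have "\<exists>n. C n = C (Suc n)"
  proof (rule ccontr)
    assume "\<nexists>n. C n = C (Suc n)"
    then have str: "C (Suc n) \<subset> C n" for n using C(4) by blast
    have ch: "ch (C (k + j)) j (C k)" for j k
    proof (induction j arbitrary: k)
      case 0 then show ?case using C by simp
    next
      case (Suc j)
      have "ch (C (Suc k + j)) j (C (Suc k))" by (rule Suc.IH)
      then show ?case using C(1)[of k] str[of k] by auto
    qed
    \<comment> \<open>The index has the form \<open>n0 + n\<close> to which the bound applies, and
      the number of steps exceeds \<open>n0 * l\<close>.\<close>
    have "ch (C (n0 + Suc (n0 * l))) (n0 + Suc (n0 * l)) X"
      using ch_up[OF ch[of 0 "n0 + Suc (n0 * l)"] C(3) X] by simp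
    then have "enat (n0 + Suc (n0 * l)) \<le> len X (C (n0 + Suc (n0 * l)))" using enat_le_len_iff[OF X C(3)] by blast
    also have "\<dots> \<le> enat (n0 * l)" by (rule lenC(2))
    finally show False by simp
  qed
  then obtain n where n: "C n = C (Suc n)" by blast
  let ?B = "msum (sm c ` X) Y"
  have B: "submod ?B" "Y \<subseteq> ?B" by (rule submod_msum[OF imX(1) Y(1)]) (rule msum_right[OF imX(1)])
  have "C n = ?B"
  proof (rule nakayama[OF I C(1) B(1) _ _ d(1)])
    show "base a I \<subseteq> ?B" using Y(2) B(2) by simp
    show "?B \<subseteq> C n" unfolding C_def by (rule msum_mono[OF order_refl D(2)])
    \<comment> \<open>Since \<open>C n = C (Suc n)\<close>, an element is \<open>c y\<close> plus an
      element of \<open>d ^ Suc n X + Y\<close>. One factor \<open>d\<close> splits off, and this is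
      the premise of Nakayama's lemma for \<open>d\<close>.\<close>
    show "C n \<subseteq> msum (sm d ` C n) ?B"
    proof
      fix x assume "x \<in> C n"
      then obtain y w where y: "y \<in> X" "w \<in> D (Suc n)" "x = sm c y + w" unfolding n unfolding C_def by (auto elim!: msumE)
      obtain v where v: "v \<in> X" "w - sm (d ^ Suc n) v \<in> Y" using memD'[OF y(2)] by blast
      have "sm (d ^ n) v \<in> D n" by (rule memD[OF v(1)]) (simp add: submod_0[OF Y(1)])
      then have "sm (d ^ n) v \<in> C n" using C(2) by blast
      moreover have "sm c y + (w - sm (d ^ Suc n) v) \<in> ?B" by (rule msumI[OF imageI[OF y(1)] v(2)])
      moreover have "x = sm d (sm (d ^ n) v) + (sm c y + (w - sm (d ^ Suc n) v))"
        by (simp add: y(3) sm_sm)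
      ultimately show "x \<in> msum (sm d ` C n) ?B" using msumI[OF imageI] by metis
    qed
  qed
  then show ?thesis using lenC(1)[of n] by (simp add: cokl_def)
qed

text \<open>On \<open>Z / B\<close> the map \<open>g\<close> is a two-sided inverse of
  \<open>f\<close> up to the factor \<open>x ^ k\<close>, so \<open>x ^ k\<close> kills both
  cokernel and kernel, and \<open>tors_finite_length\<close> applies.\<close>

lemma cokl_kerl_finite:
  assumes I: "finite I" and e: "endo f Z B" and B: "base a I \<subseteq> B"
    and g: "\<And>x. x \<in> m \<Longrightarrow> \<exists>k g. (\<forall>z\<in>Z. g z \<in> Z) \<and> (\<forall>z\<in>B. g z \<in> B) \<and>
      (\<forall>z\<in>Z. sm (x ^ k) z - f (g z) \<in> B \<and> sm (x ^ k) z - g (f z) \<in> B)"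
  shows "cokl f Z B \<noteq> \<infinity>" "kerl f Z B \<noteq> \<infinity>"
proof -
  note z = endoD[OF e] and i = endo_image[OF e]
  show "cokl f Z B \<noteq> \<infinity>" unfolding cokl_def
  proof (rule tors_finite_length[OF I z(2) i(1) _ i(2)])
    show "base a I \<subseteq> msum (f ` Z) B" using B i(3) by simp
    show "tors m Z (msum (f ` Z) B)" unfolding tors_def
    proof
      fix x assume "x \<in> m"
      from g[OF this] obtain k g where g: "\<forall>z\<in>Z. g z \<in> Z" "\<forall>z\<in>Z. sm (x ^ k) z - f (g z) \<in> B \<and> sm (x ^ k) z - g (f z) \<in> B" by auto
      show "\<exists>k. \<forall>z\<in>Z. sm (x ^ k) z \<in> msum (f ` Z) B"
      proof (intro exI[of _ k] ballI)
        fix z assume z: "z \<in> Z"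
        have "f (g z) \<in> f ` Z" "sm (x ^ k) z - f (g z) \<in> B" using g z by auto
        from msumI[OF this] show "sm (x ^ k) z \<in> msum (f ` Z) B" by simp
      qed
    qed
  qed
  show "kerl f Z B \<noteq> \<infinity>" unfolding kerl_def
  proof (rule tors_finite_length[OF I i(4) z(3) B i(5)])
    show "tors m {z \<in> Z. f z \<in> B} B" unfolding tors_def
    proof
      fix x assume "x \<in> m"
      from g[OF this] obtain k g where g: "\<forall>z\<in>B. g z \<in> B" "\<forall>z\<in>Z. sm (x ^ k) z - f (g z) \<in> B \<and> sm (x ^ k) z - g (f z) \<in> B" by auto
      show "\<exists>k. \<forall>z\<in>{z \<in> Z. f z \<in> B}. sm (x ^ k) z \<in> B"
      proof (intro exI[of _ k] ballI)
        fix z assume "z \<in> {z \<in> Z. f z \<in> B}"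
        then have "g (f z) \<in> B" "sm (x ^ k) z - g (f z) \<in> B" using g by auto
        then show "sm (x ^ k) z \<in> B" using submod_diff_cancel[OF z(3)] by blast
      qed
    qed
  qed
qed

text \<open>Every element of \<open>m\<close> acts nilpotently modulo \<open>c\<close> on \<open>Z / B\<close>. The elements \<open>e\<close> must not
  depend on \<open>z\<close>, so that the condition passes to submodules.\<close>

definition dtors :: "('i \<Rightarrow> 'p) set \<Rightarrow> ('i \<Rightarrow> 'p) set \<Rightarrow> 'p \<Rightarrow> bool" where
  "dtors Z B c \<longleftrightarrow> (\<forall>x\<in>m. \<exists>k e. \<forall>z\<in>Z. sm (x ^ k) z - sm (e * c) z \<in> B)"

lemma dtorsD: "dtors Z B c \<Longrightarrow> x \<in> m \<Longrightarrow> \<exists>k e. \<forall>z\<in>Z. sm (x ^ k) z - sm (e * c) z \<in> B"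
  by (simp add: dtors_def)

lemma dtors_mono: assumes "dtors Z B c" "Z' \<subseteq> Z" "B \<subseteq> B'" shows "dtors Z' B' c"
  unfolding dtors_def
proof
  fix x assume "x \<in> m"
  from dtorsD[OF assms(1) this] obtain k e where "\<forall>z\<in>Z. sm (x ^ k) z - sm (e * c) z \<in> B" by blast
  then show "\<exists>k e. \<forall>z\<in>Z'. sm (x ^ k) z - sm (e * c) z \<in> B'" using assms(2,3) by blast
qed

lemma finite_sm:
  assumes I: "finite I" and s: "submod Z" "submod B" "B \<subseteq> Z" "base a I \<subseteq> B" and d: "dtors Z B c"
  shows "cokl (sm c) Z B \<noteq> \<infinity>" "kerl (sm c) Z B \<noteq> \<infinity>"
proof -
  have g: "\<exists>k g. (\<forall>z\<in>Z. g z \<in> Z) \<and> (\<forall>z\<in>B. g z \<in> B) \<and>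
      (\<forall>z\<in>Z. sm (x ^ k) z - sm c (g z) \<in> B \<and> sm (x ^ k) z - g (sm c z) \<in> B)" if "x \<in> m" for x
  proof -
    obtain k e where ke: "\<forall>z\<in>Z. sm (x ^ k) z - sm (e * c) z \<in> B" using dtorsD[OF d \<open>x \<in> m\<close>] by blast
    show ?thesis
      by (rule exI[of _ k], rule exI[of _ "sm e"]) (use ke submod_sm[OF s(1)] submod_sm[OF s(2)] in \<open>auto simp: sm_sm mult.commute\<close>)
  qed
  show "cokl (sm c) Z B \<noteq> \<infinity>" "kerl (sm c) Z B \<noteq> \<infinity>"
    by (rule cokl_kerl_finite[OF I endo_sm[OF s(1,2,3)] s(4)], erule g)+
qed

text \<open>The inverse up to \<open>x ^ k\<close> is \<open>e\<close> times the adjugate, because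
  \<open>x ^ k\<close> acts as \<open>e * det A\<close>. That one \<open>e\<close> serves all
  elements of \<open>Z\<close> is used here, as all slices are treated at once.\<close>

lemma finite_mact:
  fixes Z B :: "('i \<Rightarrow> 'p) set"
  assumes I: "finite I" and s: "submod Z" "submod B" "B \<subseteq> Z" "base a I \<subseteq> B" and d: "dtors Z B (det A)"
    and A: "A \<in> carrier_mat r r"
  shows "cokl (mact A) (pw r Z) (pw r B) \<noteq> \<infinity>" "kerl (mact A) (pw r Z) (pw r B) \<noteq> \<infinity>"
proof -
  have adj: "adj_mat A \<in> carrier_mat r r" using adj_mat(1)[OF A] .
  have g: "\<exists>k g. (\<forall>z\<in>pw r Z. g z \<in> pw r Z) \<and> (\<forall>z\<in>pw r B. g z \<in> pw r B) \<and>
      (\<forall>z\<in>pw r Z. sm (x ^ k) z - mact A (g z) \<in> pw r B \<and> sm (x ^ k) z - g (mact A z) \<in> pw r B)" if "x \<in> m" for x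
  proof -
    obtain k e where ke: "\<forall>z\<in>Z. sm (x ^ k) z - sm (e * det A) z \<in> B" using dtorsD[OF d \<open>x \<in> m\<close>] by blast
    define g where "g z = sm e (mact (adj_mat A) z)" for z :: "nat \<times> 'i \<Rightarrow> 'p"
    have 1: "sm (x ^ k) z - sm e (sm (det A) z) \<in> pw r B" if "z \<in> pw r Z" for z
      by (rule pwI) (use ke pwD[OF that] in \<open>simp add: sl_diff sl_sm sm_sm\<close>)
    have 2: "sm e (sm (det A) z) - mact A (g z) \<in> pw r B" for z
      using submod_sm[OF submod_pw[OF s(2)] adj_mact(1)[OF A s(2), of z], of e]
      by (simp add: g_def sm_diff lin_sm[OF lin_mact])
    have 3: "sm e (sm (det A) z) - g (mact A z) \<in> pw r B" for z
      using submod_sm[OF submod_pw[OF s(2)] adj_mact(2)[OF A s(2), of z], of e]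
      by (simp add: g_def sm_diff)
    have 4: "g z \<in> pw r S" if "z \<in> pw r S" "submod S" for z and S :: "('i \<Rightarrow> 'p) set"
      unfolding g_def by (rule submod_sm[OF submod_pw[OF that(2)] mact_pw[OF adj that(2,1)]])
    have 5: "sm (x ^ k) z - mact A (g z) \<in> pw r B \<and> sm (x ^ k) z - g (mact A z) \<in> pw r B" if "z \<in> pw r Z" for z
      using submod_add[OF submod_pw[OF s(2)] 1[OF that] 2[of z]] submod_add[OF submod_pw[OF s(2)] 1[OF that] 3[of z]] by simp
    show ?thesis by (rule exI[of _ k], rule exI[of _ g]) (use 4 s 5 in blast)
  qed
  have fin: "finite ({..<r} \<times> I)" using I by simp
  show "cokl (mact A) (pw r Z) (pw r B) \<noteq> \<infinity>" "kerl (mact A) (pw r Z) (pw r B) \<noteq> \<infinity>"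
    by (rule cokl_kerl_finite[OF fin endo_mact[OF A s(1,2,3)] base_pw[OF s(4)]], erule g)+
qed

text \<open>Three cases. If \<open>det A\<close> is in \<open>p\<close>, nilpotence forces
  \<open>m\<close> into \<open>p\<close>, the layer has finite length and both sides are zero. If
  \<open>det A\<close> is a unit, both maps are bijective. Otherwise the layer is a one-dimensional
  domain by \<open>colength_finite\<close>, and \<open>dom_piece\<close> applies.\<close>

lemma eul_det_cyclic:
  fixes X Y :: "('i \<Rightarrow> 'p) set"
  assumes I: "finite I" and X: "submod X" and Y: "submod Y" "base a I \<subseteq> Y" and Xz: "X = msum Y (cyc z)"
    and p: "p = {c. sm c z \<in> Y}" "idl p" "1 \<notin> p" "p \<subseteq> m" "\<And>c d. c * d \<in> p \<Longrightarrow> c \<in> p \<or> d \<in> p"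
    and A: "A \<in> carrier_mat r r" and d: "dtors X Y (det A)"
  shows "eul (mact A) (pw r X) (pw r Y) = eul (sm (det A)) X Y"
proof -
  have YX: "Y \<subseteq> X" unfolding Xz by (rule msum_left[OF submod_cyc])
  have zX: "z \<in> X" unfolding Xz by (rule subsetD[OF msum_right[OF Y(1)] self_in_cyc])
  have memX: "\<exists>u s. u \<in> Y \<and> x = u + sm s z" if "x \<in> X" for x
    using that unfolding Xz by (auto elim!: msumE simp: cyc_def)
  have one: "sm e (u + sm s z) \<in> Y \<longleftrightarrow> e * s \<in> p" if "u \<in> Y" for e u s
    using submod_add_cancel[OF Y(1) submod_sm[OF Y(1) that, of e], of "sm (e * s) z"]
    by (simp add: p(1) sm_add sm_sm add.commute)
  have fin: "finite ({..<r} \<times> I)" using I by simp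
  consider "det A \<in> p" | "det A \<notin> m" | "det A \<in> m" "det A \<notin> p" by blast
  then show ?thesis
  proof cases
    case 1
    have mp: "x \<in> p" if "x \<in> m" for x
    proof -
      obtain k e where ke: "\<forall>z\<in>X. sm (x ^ k) z - sm (e * det A) z \<in> Y" using dtorsD[OF d \<open>x \<in> m\<close>] by blast
      have "e * det A \<in> p" using idlD(3)[OF p(2) 1] .
      then have "sm (e * det A) z \<in> Y" by (simp add: p(1))
      then have "sm (x ^ k) z \<in> Y" using ke zX submod_diff_cancel[OF Y(1)] by blast
      then have "x ^ k \<in> p" by (simp add: p(1))
      then show ?thesis using prime_power[OF p(2,3)] p(5) by blast
    qed
    have kill: "sm x v \<in> Y" if h: "x \<in> m" "v \<in> X" for x v
    proof -
      obtain u s where us: "u \<in> Y" "v = u + sm s z" using memX[OF h(2)] by blast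
      then show ?thesis using one idlD(4)[OF p(2) mp[OF h(1)]] by blast
    qed
    have "tors m X Y" unfolding tors_def
      by (rule ballI, rule exI[of _ 1]) (simp add: kill)
    then have "len X Y \<noteq> \<infinity>" using tors_finite_length[OF I X Y YX] by blast
    then have "eul (sm (det A)) X Y = 0" by (rule eul_finite_length(3)[OF endo_sm[OF X Y(1) YX]])
    moreover have "tors m (pw r X) (pw r Y)" unfolding tors_def
      by (rule ballI, rule exI[of _ 1]) (simp add: pw_def sl_sm kill)
    then have "len (pw r X) (pw r Y) \<noteq> \<infinity>"
      using tors_finite_length[OF fin submod_pw[OF X] submod_pw[OF Y(1)] base_pw[OF Y(2)] pw_mono[OF YX]] by blast
    then have "eul (mact A) (pw r X) (pw r Y) = 0" by (rule eul_finite_length(3)[OF endo_mact[OF A X Y(1) YX]])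
    ultimately show ?thesis by simp
  next
    case 2
    obtain e where e: "det A * e - 1 \<in> a" using unit[OF 2] by blast
    have e1: "v - sm (det A) (sm e v) \<in> Y" "v - sm e (sm (det A) v) \<in> Y" for v
    proof -
      have "sm (- (det A * e - 1)) v \<in> Y" using base_sm[OF a idlD(5)[OF a e]] Y(2) by blast
      moreover have "v - sm (det A) (sm e v) = sm (- (det A * e - 1)) v" "v - sm e (sm (det A) v) = sm (- (det A * e - 1)) v"
        by (auto simp: fun_eq_iff sm_apply algebra_simps)
      ultimately show "v - sm (det A) (sm e v) \<in> Y" "v - sm e (sm (det A) v) \<in> Y" by auto
    qed
    have "cokl (sm (det A)) X Y = 0" by (rule cokl_inverse[OF endo_sm[OF X Y(1) YX] submod_sm[OF X] e1(1)])
    moreover have "kerl (sm (det A)) X Y = 0" by (rule kerl_inverse[OF endo_sm[OF X Y(1) YX] submod_sm[OF Y(1)] e1(2)])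
    moreover define g where "g = (\<lambda>v :: nat \<times> 'i \<Rightarrow> 'p. sm e (mact (adj_mat A) v))"
    have gS: "g v \<in> pw r S" if "v \<in> pw r S" "submod S" for v and S :: "('i \<Rightarrow> 'p) set"
      unfolding g_def by (rule submod_sm[OF submod_pw[OF that(2)] mact_pw[OF adj_mat(1)[OF A] that(2,1)]])
    have v1: "v - sm e (sm (det A) v) \<in> pw r Y" for v :: "nat \<times> 'i \<Rightarrow> 'p"
      by (rule pwI) (use e1(2) in \<open>simp add: sl_diff sl_sm\<close>)
    have g1: "v - mact A (g v) \<in> pw r Y" "v - g (mact A v) \<in> pw r Y" for v
    proof -
      have "sm e (sm (det A) v) - mact A (g v) \<in> pw r Y"
        using submod_sm[OF submod_pw[OF Y(1)] adj_mact(1)[OF A Y(1), of v], of e]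
        by (simp add: g_def sm_diff lin_sm[OF lin_mact])
      from submod_add[OF submod_pw[OF Y(1)] v1[of v] this] show "v - mact A (g v) \<in> pw r Y" by simp
      have "sm e (sm (det A) v) - g (mact A v) \<in> pw r Y"
        using submod_sm[OF submod_pw[OF Y(1)] adj_mact(2)[OF A Y(1), of v], of e]
        by (simp add: g_def sm_diff)
      from submod_add[OF submod_pw[OF Y(1)] v1[of v] this] show "v - g (mact A v) \<in> pw r Y" by simp
    qed
    note eA = endo_mact[OF A X Y(1) YX]
    have "cokl (mact A) (pw r X) (pw r Y) = 0" by (rule cokl_inverse[OF eA gS[OF _ X] g1(1)])
    moreover have "kerl (mact A) (pw r X) (pw r Y) = 0" by (rule kerl_inverse[OF eA gS[OF _ Y(1)] g1(2)])
    ultimately show ?thesis by (simp add: eul_def)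
  next
    case 3
    interpret dom_piece p X Y
    proof
      show "idl p" "1 \<notin> p" "\<And>c d. c * d \<in> p \<Longrightarrow> c \<in> p \<or> d \<in> p" "submod X" "submod Y" "Y \<subseteq> X" by fact+
      show "cokl (sm c) X Y \<noteq> \<infinity>" if "c \<notin> p" for c
        by (rule colength_finite[OF I X Y Xz p(1,2,5) 3 finite_sm(1)[OF I X Y(1) YX Y(2) d] that])
      show "x \<in> Y" if h: "c \<notin> p" "x \<in> X" "sm c x \<in> Y" for c x
      proof -
        obtain u s where us: "u \<in> Y" "x = u + sm s z" using memX[OF h(2)] by blast
        then have "s \<in> p" using one h p(5) by blast
        then show ?thesis using us submod_add[OF Y(1)] p(1) by blast
      qed
    qed
    show ?thesis by (rule eul_det_piece[OF A 3(2)])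
  qed
qed

text \<open>Let \<open>Y\<close> be maximal among the submodules for which the equality holds. If it
  were not \<open>Z\<close>, an associated prime of \<open>Z / Y\<close> would give a cyclic layer
  above \<open>Y\<close>, and both sides are additive; \<open>dtors\<close> passes to the layers and
  provides the finiteness for this.\<close>

theorem eul_det:
  assumes I: "finite I" and s: "submod Z" "submod B" "B \<subseteq> Z" "base a I \<subseteq> B" and A: "A \<in> carrier_mat r r"
    and d: "dtors Z B (det A)"
  shows "eul (mact A) (pw r Z) (pw r B) = eul (sm (det A)) Z B"
proof -
  define S where "S = {Y. submod Y \<and> B \<subseteq> Y \<and> Y \<subseteq> Z \<and> eul (mact A) (pw r Y) (pw r B) = eul (sm (det A)) Y B}"
  have "eul (mact A) (pw r B) (pw r B) = 0"
    by (rule eul_finite_length(3)[OF endo_mact[OF A s(2,2) order_refl]]) (simp add: submod_pw s(2))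
  moreover have "eul (sm (det A)) B B = 0"
    by (rule eul_finite_length(3)[OF endo_sm[OF s(2,2) order_refl]]) (simp add: s(2))
  ultimately have "B \<in> S" using s by (simp add: S_def)
  moreover have "submod X" "base a I \<subseteq> X" if "X \<in> S" for X using that s(4) unfolding S_def by blast+
  ultimately have "\<exists>Y\<in>S. \<forall>X\<in>S. Y \<subseteq> X \<longrightarrow> X = Y" by (rule noethD[OF noeth_base[OF I]])
  then obtain Y where YS: "Y \<in> S" and mx: "\<forall>X\<in>S. Y \<subseteq> X \<longrightarrow> X = Y" by (rule bexE)
  have Y: "submod Y" "B \<subseteq> Y" "Y \<subseteq> Z" and eY: "eul (mact A) (pw r Y) (pw r B) = eul (sm (det A)) Y B"
    using YS by (auto simp: S_def)
  have bY: "base a I \<subseteq> Y" using s(4) Y(2) by simp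
  have "Y = Z"
  proof (rule ccontr)
    assume "Y \<noteq> Z"
    then have "Y \<subset> Z" using Y by blast
    from ass_prime[OF Y(1) bY this s(1)] obtain z where "\<exists>p. z \<in> Z \<and> z \<notin> Y \<and> p = {c. sm c z \<in> Y} \<and>
      idl p \<and> a \<subseteq> p \<and> 1 \<notin> p \<and> p \<subseteq> m \<and> (\<forall>c d. c * d \<in> p \<longrightarrow> c \<in> p \<or> d \<in> p)" ..
    then obtain p where zp: "z \<in> Z \<and> z \<notin> Y \<and> p = {c. sm c z \<in> Y} \<and>
      idl p \<and> a \<subseteq> p \<and> 1 \<notin> p \<and> p \<subseteq> m \<and> (\<forall>c d. c * d \<in> p \<longrightarrow> c \<in> p \<or> d \<in> p)" ..
    have z1: "z \<in> Z" using zp by (elim conjE)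
    have z2: "z \<notin> Y" using zp by (elim conjE)
    note z = z1 z2
    have p1: "p = {c. sm c z \<in> Y}" using zp by (elim conjE)
    have p2: "idl p" using zp by (elim conjE)
    have p3: "1 \<notin> p" using zp by (elim conjE)
    have p4: "p \<subseteq> m" using zp by (elim conjE)
    have p5: "\<forall>c d. c * d \<in> p \<longrightarrow> c \<in> p \<or> d \<in> p" using zp by (elim conjE)
    define X where "X = msum Y (cyc z)"
    have X: "submod X" "Y \<subseteq> X" "z \<in> X" "X \<subseteq> Z"
      unfolding X_def by (rule submod_msum[OF Y(1) submod_cyc] msum_left[OF submod_cyc]
        subsetD[OF msum_right[OF Y(1)] self_in_cyc] msum_least[OF s(1) Y(3) cyc_least[OF s(1) z(1)]])+
    have BX: "B \<subseteq> X" using Y(2) X(2) by simp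
    have dX: "dtors X Y (det A)" and dY: "dtors Y B (det A)"
      by (rule dtors_mono[OF d X(4) Y(2)]) (rule dtors_mono[OF d Y(3) order_refl])
    have e1: "eul (mact A) (pw r X) (pw r Y) = eul (sm (det A)) X Y"
      by (rule eul_det_cyclic[OF I X(1) Y(1) bY X_def p1 p2 p3 p4 p5[rule_format] A dX])
    have "eul (sm (det A)) X B = eul (sm (det A)) Y B + eul (sm (det A)) X Y"
      by (rule eul_additive[OF endo_sm[OF X(1) s(2) BX] endo_sm[OF Y(1) s(2) Y(2)] X(2)
            finite_sm[OF I Y(1) s(2) Y(2) s(4) dY] finite_sm[OF I X(1) Y(1) X(2) bY dX]])
    moreover have "eul (mact A) (pw r X) (pw r B) = eul (mact A) (pw r Y) (pw r B) + eul (mact A) (pw r X) (pw r Y)"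
      by (rule eul_additive[OF endo_mact[OF A X(1) s(2) BX] endo_mact[OF A Y(1) s(2) Y(2)] pw_mono[OF X(2)]
            finite_mact[OF I Y(1) s(2) Y(2) s(4) dY A] finite_mact[OF I X(1) Y(1) X(2) bY dX A]])
    ultimately have "X \<in> S" using X BX e1 eY by (simp add: S_def)
    then have "X = Y" using mx[rule_format] X(2) by simp
    then show False using X(3) z(2) by blast
  qed
  then show ?thesis using eY by simp
qed

end

section \<open>Koszul complexes of matrices\<close>

text \<open>The complex of a list of square matrices consists of functions on lists of pairs \<open>(b, k)\<close>,
  one for each matrix: \<open>b\<close> tells whether the factor is in degree 1, and \<open>k\<close> is a coordinate. Cycles
  and boundaries of degree \<open>n\<close> are taken modulo the ideal \<open>a\<close> and constrain only the values in
  the relevant degrees, so that all of them live in the same module of functions.\<close>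

fun kd :: "'p::comm_ring_1 mat list \<Rightarrow> ((bool \<times> nat) list \<Rightarrow> 'p) \<Rightarrow> (bool \<times> nat) list \<Rightarrow> 'p" where
  "kd [] x l = 0"
| "kd (A # fs) x [] = 0"
| "kd (A # fs) x ((b, k) # l) =
    (if b then - kd fs (\<lambda>l'. x ((b, k) # l')) l
     else kd fs (\<lambda>l'. x ((b, k) # l')) l + (\<Sum>j<dim_row A. A $$ (k, j) * x ((True, j) # l)))"

text \<open>Integer valued, so that the degree \<open>n - 1\<close> in \<open>hlen_Cons\<close>
  makes sense for \<open>n = 0\<close>.\<close>

fun hdeg :: "(bool \<times> nat) list \<Rightarrow> int" where
  "hdeg [] = 0"
| "hdeg ((b, k) # l) = (if b then 1 else 0) + hdeg l"

fun idx :: "'p mat list \<Rightarrow> (bool \<times> nat) list set" where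
  "idx [] = {[]}"
| "idx (A # fs) = {(b, k) # l | b k l. k < dim_row A \<and> l \<in> idx fs}"

definition sq :: "'p mat list \<Rightarrow> bool" where
  "sq fs \<longleftrightarrow> (\<forall>A\<in>set fs. A \<in> carrier_mat (dim_row A) (dim_row A))"

lemma sq_Cons: "sq (A # fs) \<longleftrightarrow> A \<in> carrier_mat (dim_row A) (dim_row A) \<and> sq fs"
  by (auto simp: sq_def)

lemma finite_idx: "finite (idx fs)"
proof (induction fs)
  case Nil then show ?case by simp
next
  case (Cons A fs)
  have "idx (A # fs) = (\<lambda>((b, k), l). (b, k) # l) ` ((UNIV \<times> {..<dim_row A}) \<times> idx fs)" by force
  then show ?case using Cons by simp
qed

lemma hdeg_bounds: "l \<in> idx fs \<Longrightarrow> 0 \<le> hdeg l \<and> hdeg l \<le> int (length fs)"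
  by (induction fs arbitrary: l) force+

lemma lin_kd: "lin (kd fs)"
proof -
  have "kd fs (x + y) l = kd fs x l + kd fs y l \<and> kd fs (sm c x) l = c * kd fs x l" for x y c l
  proof (induction fs arbitrary: x y l)
    case Nil then show ?case by simp
  next
    case (Cons A fs)
    show ?case
    proof (cases l)
      case Nil then show ?thesis by simp
    next
      case (Cons h l')
      obtain b k where h: "h = (b, k)" by (cases h)
      have e: "(\<lambda>l''. (x + y) ((b, k) # l'')) = (\<lambda>l''. x ((b, k) # l'')) + (\<lambda>l''. y ((b, k) # l''))"
        "(\<lambda>l''. sm c x ((b, k) # l'')) = sm c (\<lambda>l''. x ((b, k) # l''))" by (auto simp: fun_eq_iff sm_apply)
      have IH: "kd fs (u + v) l = kd fs u l + kd fs v l" "kd fs (sm c u) l = c * kd fs u l" for u v l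
        using Cons.IH by blast+
      show ?thesis unfolding Cons h kd.simps e IH
        by (auto simp: sm_apply algebra_simps sum.distrib sum_distrib_left)
    qed
  qed
  then show ?thesis by (intro linI) (auto simp: fun_eq_iff sm_apply)
qed

text \<open>The value of the differential at \<open>l\<close> involves only arguments one degree
  higher. This locality is what permits cycles and boundaries to leave all other degrees
  unconstrained.\<close>

lemma kd_mod:
  assumes a: "idl a"
  shows "l \<in> idx fs \<Longrightarrow> (\<And>l'. l' \<in> idx fs \<Longrightarrow> hdeg l' = hdeg l + 1 \<Longrightarrow> x l' \<in> a) \<Longrightarrow> kd fs x l \<in> a"
proof (induction fs arbitrary: x l)
  case Nil then show ?case using idlD(1)[OF a] by simp
next
  case (Cons A fs)
  from Cons.prems(1) obtain b k l' where l: "l = (b, k) # l'" "k < dim_row A" "l' \<in> idx fs" by auto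
  have 1: "kd fs (\<lambda>l''. x ((b, k) # l'')) l' \<in> a"
    by (rule Cons.IH[OF l(3)]) (rule Cons.prems(2), use l in auto)
  have 2: "(\<Sum>j<dim_row A. A $$ (k, j) * x ((True, j) # l')) \<in> a" if "\<not> b"
    by (intro idl_sum[OF a] idlD(3)[OF a] Cons.prems(2)) (use l that in auto)
  show ?case using 1 2 by (auto simp: l idlD[OF a])
qed

text \<open>Locality again, from \<open>kd_mod\<close> for the zero ideal and a difference.\<close>

lemma kd_cong:
  assumes "l \<in> idx fs" "\<And>l'. l' \<in> idx fs \<Longrightarrow> x l' = y l'" shows "kd fs x l = kd fs y l"
proof -
  have "idl {0 :: 'a}" by (simp add: idl_def)
  from kd_mod[OF this assms(1), of "x - y"] assms(2) have "kd fs (x - y) l = 0" by simp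
  then show ?thesis by (simp add: lin_diff[OF lin_kd])
qed

text \<open>The identity holds on all lists and over \<open>P\<close> itself, before reduction
  modulo any ideal, so it survives every change of \<open>a\<close>.\<close>

lemma kd_kd: "kd fs (kd fs x) l = 0"
proof (induction fs arbitrary: x l)
  case Nil then show ?case by simp
next
  case (Cons A fs)
  show ?case
  proof (cases l)
    case Nil then show ?thesis by simp
  next
    case (Cons h l')
    obtain b k where h: "h = (b, k)" by (cases h)
    define X where "X c j = (\<lambda>l''. x ((c, j) # l''))" for c j
    have T: "(\<lambda>l''. kd (A # fs) x ((True, j) # l'')) = - kd fs (X True j)" for j
      by (auto simp: fun_eq_iff X_def)
    have F: "(\<lambda>l''. kd (A # fs) x ((False, j) # l'')) = kd fs (X False j) + (\<Sum>i<dim_row A. sm (A $$ (j, i)) (X True i))" for j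
      by (auto simp: fun_eq_iff X_def sum_fun_apply sm_apply)
    show ?thesis
    proof (cases b)
      case True
      then have "kd (A # fs) (kd (A # fs) x) l = - kd fs (- kd fs (X True k)) l'" using T by (simp add: Cons h)
      then show ?thesis by (simp add: lin_minus[OF lin_kd] Cons.IH)
    next
      case False
      then have "kd (A # fs) (kd (A # fs) x) l =
          kd fs (kd fs (X False k) + (\<Sum>i<dim_row A. sm (A $$ (k, i)) (X True i))) l' +
          (\<Sum>j<dim_row A. A $$ (k, j) * - kd fs (X True j) l')"
        using F by (simp add: Cons h X_def)
      also have "\<dots> = 0"
        by (simp add: lin_add[OF lin_kd] lin_sum[OF lin_kd] lin_sm[OF lin_kd] Cons.IH sum_fun_apply sm_apply sum_negf)
      finally show ?thesis .
    qed
  qed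
qed

section \<open>Cycles, boundaries and homology lengths in coordinates\<close>

definition Zc :: "'p::comm_ring_1 set \<Rightarrow> 'p mat list \<Rightarrow> int \<Rightarrow> ((bool \<times> nat) list \<Rightarrow> 'p) set" where
  "Zc a fs n = {x. \<forall>l\<in>idx fs. hdeg l + 1 = n \<longrightarrow> kd fs x l \<in> a}"

definition Bc :: "'p::comm_ring_1 set \<Rightarrow> 'p mat list \<Rightarrow> int \<Rightarrow> ((bool \<times> nat) list \<Rightarrow> 'p) set" where
  "Bc a fs n = {x. \<exists>y. \<forall>l\<in>idx fs. hdeg l = n \<longrightarrow> x l - kd fs y l \<in> a}"

lemma ZcI: "(\<And>l. l \<in> idx fs \<Longrightarrow> hdeg l + 1 = n \<Longrightarrow> kd fs x l \<in> a) \<Longrightarrow> x \<in> Zc a fs n"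
  and ZcD: "x \<in> Zc a fs n \<Longrightarrow> l \<in> idx fs \<Longrightarrow> hdeg l + 1 = n \<Longrightarrow> kd fs x l \<in> a"
  by (auto simp: Zc_def)

lemma BcI: "(\<And>l. l \<in> idx fs \<Longrightarrow> hdeg l = n \<Longrightarrow> x l - kd fs y l \<in> a) \<Longrightarrow> x \<in> Bc a fs n"
  by (auto simp: Bc_def)

lemma BcD: "x \<in> Bc a fs n \<Longrightarrow> \<exists>y. \<forall>l\<in>idx fs. hdeg l = n \<longrightarrow> x l - kd fs y l \<in> a"
  by (simp add: Bc_def)

lemma submod_Zc: assumes a: "idl a" shows "submod (Zc a fs n)"
proof (rule submodI)
  show "0 \<in> Zc a fs n" by (rule ZcI) (simp add: lin_0[OF lin_kd] idlD(1)[OF a])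
  show "x + y \<in> Zc a fs n" if "x \<in> Zc a fs n" "y \<in> Zc a fs n" for x y
    by (rule ZcI) (simp add: lin_add[OF lin_kd] idlD(2)[OF a] ZcD[OF that(1)] ZcD[OF that(2)])
  show "sm c x \<in> Zc a fs n" if "x \<in> Zc a fs n" for c x
    by (rule ZcI) (simp add: lin_sm[OF lin_kd] sm_apply idlD(3)[OF a] ZcD[OF that])
qed

lemma submod_Bc: assumes a: "idl a" shows "submod (Bc a fs n)"
proof (rule submodI)
  show "0 \<in> Bc a fs n" by (rule BcI[where y = 0]) (simp add: lin_0[OF lin_kd] idlD(1)[OF a])
  show "x + x' \<in> Bc a fs n" if h: "x \<in> Bc a fs n" "x' \<in> Bc a fs n" for x x'
  proof -
    obtain y y' where y: "\<forall>l\<in>idx fs. hdeg l = n \<longrightarrow> x l - kd fs y l \<in> a" "\<forall>l\<in>idx fs. hdeg l = n \<longrightarrow> x' l - kd fs y' l \<in> a"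
      using BcD[OF h(1)] BcD[OF h(2)] by blast
    have e: "(x + x') l - kd fs (y + y') l = (x l - kd fs y l) + (x' l - kd fs y' l)" for l
      by (simp add: lin_add[OF lin_kd])
    show ?thesis by (rule BcI[where y = "y + y'"]) (unfold e, use y idlD(2)[OF a] in blast)
  qed
  show "sm c x \<in> Bc a fs n" if h: "x \<in> Bc a fs n" for c x
  proof -
    obtain y where y: "\<forall>l\<in>idx fs. hdeg l = n \<longrightarrow> x l - kd fs y l \<in> a" using BcD[OF h] by blast
    have e: "sm c x l - kd fs (sm c y) l = c * (x l - kd fs y l)" for l
      by (simp add: lin_sm[OF lin_kd] sm_apply algebra_simps)
    show ?thesis by (rule BcI[where y = "sm c y"]) (unfold e, use y idlD(3)[OF a] in blast)
  qed
qed

lemma Bc_sub_Zc: assumes a: "idl a" shows "Bc a fs n \<subseteq> Zc a fs n"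
proof
  fix x assume "x \<in> Bc a fs n"
  then obtain y where y: "\<forall>l\<in>idx fs. hdeg l = n \<longrightarrow> x l - kd fs y l \<in> a" using BcD by blast
  show "x \<in> Zc a fs n"
  proof (rule ZcI)
    fix l assume l: "l \<in> idx fs" "hdeg l + 1 = n"
    have "kd fs (x - kd fs y) l \<in> a" by (rule kd_mod[OF a l(1)]) (use y l in auto)
    then show "kd fs x l \<in> a" by (simp add: lin_diff[OF lin_kd] kd_kd)
  qed
qed

text \<open>With \<open>finite_idx\<close> this places the homology between submodules of a finite
  free module over \<open>P / a\<close>, where the results on Noetherian local rings apply.\<close>

lemma base_Bc: assumes a: "idl a" shows "base a (idx fs) \<subseteq> Bc a fs n"
  by (auto simp: base_def lin_0[OF lin_kd] intro!: BcI[where y = 0])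

definition hlen :: "'p::comm_ring_1 set \<Rightarrow> 'p mat list \<Rightarrow> int \<Rightarrow> enat" where
  "hlen a fs n = len (Zc a fs n) (Bc a fs n)"

lemma Bc_outside: "n < 0 \<or> n > int (length fs) \<Longrightarrow> x \<in> Bc a fs n"
  using hdeg_bounds[of _ fs] by (intro BcI) fastforce

lemma hlen_outside: assumes "idl a" "n < 0 \<or> n > int (length fs)" shows "hlen a fs n = 0"
proof -
  have "Bc a fs n = UNIV" using Bc_outside[OF assms(2)] by auto
  moreover have "Zc a fs n = UNIV" using Bc_sub_Zc[OF assms(1), of fs n] calculation by auto
  ultimately show ?thesis by (simp add: hlen_def)
qed

text \<open>The two components of the mapping cone: in degree \<open>n\<close> the
  \<open>False\<close> part is a tuple of n-chains of the tail and the \<open>True\<close> part a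
  tuple of chains of degree \<open>n - 1\<close>.\<close>

definition parts :: "bool \<Rightarrow> ((bool \<times> nat) list \<Rightarrow> 'p) \<Rightarrow> nat \<times> (bool \<times> nat) list \<Rightarrow> 'p" where
  "parts b x = (\<lambda>(j, l). x ((b, j) # l))"

definition glue :: "(nat \<times> (bool \<times> nat) list \<Rightarrow> 'p) \<Rightarrow> (nat \<times> (bool \<times> nat) list \<Rightarrow> 'p::comm_ring_1) \<Rightarrow> (bool \<times> nat) list \<Rightarrow> 'p" where
  "glue x0 x1 l = (case l of [] \<Rightarrow> 0 | (b, k) # l' \<Rightarrow> if b then x1 (k, l') else x0 (k, l'))"

lemma sl_parts: "sl (parts b x) j = (\<lambda>l. x ((b, j) # l))"
  by (simp add: sl_def parts_def)

lemma parts_glue [simp]: "parts True (glue x0 x1) = x1" "parts False (glue x0 x1) = x0"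
  by (auto simp: fun_eq_iff parts_def glue_def)

lemma lin_parts: "lin (parts b)"
  by (rule linI) (auto simp: fun_eq_iff parts_def sm_apply)

lemma lin_glue0: "lin (\<lambda>x. glue x 0)"
  by (rule linI) (auto simp: fun_eq_iff glue_def sm_apply split: list.splits)

lemma sl_mact_parts:
  assumes "A \<in> carrier_mat (dim_row A) (dim_row A)" "k < dim_row A"
  shows "sl (mact A x) k l = (\<Sum>j<dim_row A. A $$ (k, j) * sl x j l)"
proof -
  have "dim_col A = dim_row A" using assms(1) by (metis carrier_matD(2))
  then show ?thesis using assms(2) by (simp add: sl_mact sum_fun_apply sm_apply)
qed

lemma kd_True: "kd (A # fs) x ((True, k) # l) = - kd fs (sl (parts True x) k) l"
  by (simp add: sl_parts)

lemma kd_False: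
  assumes "A \<in> carrier_mat (dim_row A) (dim_row A)" "k < dim_row A"
  shows "kd (A # fs) x ((False, k) # l) = kd fs (sl (parts False x) k) l + sl (mact A (parts True x)) k l"
  by (simp add: sl_mact_parts[OF assms] sl_parts)

lemma mem_idx_Cons: "(b, k) # l \<in> idx (A # fs) \<longleftrightarrow> k < dim_row A \<and> l \<in> idx fs"
  by auto

text \<open>The cone differential sends \<open>(x0, x1)\<close> to
  \<open>(d x0 + A x1, - d x1)\<close>, where \<open>x0\<close> is the \<open>False\<close> part and
  \<open>x1\<close> the \<open>True\<close> part; \<open>Bc_Cons\<close> rests on the same
  formula.\<close>

lemma Zc_Cons:
  assumes A: "A \<in> carrier_mat (dim_row A) (dim_row A)"
  shows "x \<in> Zc a (A # fs) n \<longleftrightarrow>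
    (\<forall>k<dim_row A. \<forall>l\<in>idx fs. hdeg l + 1 = n - 1 \<longrightarrow> - kd fs (sl (parts True x) k) l \<in> a) \<and>
    (\<forall>k<dim_row A. \<forall>l\<in>idx fs. hdeg l + 1 = n \<longrightarrow> kd fs (sl (parts False x) k) l + sl (mact A (parts True x)) k l \<in> a)"
  (is "_ \<longleftrightarrow> ?T \<and> ?F")
proof
  assume x: "x \<in> Zc a (A # fs) n"
  have ?T
  proof (intro allI impI ballI)
    fix k l assume "k < dim_row A" "l \<in> idx fs" "hdeg l + 1 = n - 1"
    then show "- kd fs (sl (parts True x) k) l \<in> a"
      using ZcD[OF x, of "(True, k) # l"] unfolding kd_True mem_idx_Cons by simp
  qed
  moreover have ?F
  proof (intro allI impI ballI)
    fix k l assume "k < dim_row A" "l \<in> idx fs" "hdeg l + 1 = n"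
    then show "kd fs (sl (parts False x) k) l + sl (mact A (parts True x)) k l \<in> a"
      using ZcD[OF x, of "(False, k) # l"] kd_False[OF A, of k fs x l]
      by (simp add: mem_idx_Cons del: kd.simps idx.simps)
  qed
  ultimately show "?T \<and> ?F" by blast
next
  assume TF: "?T \<and> ?F"
  show "x \<in> Zc a (A # fs) n"
  proof (rule ZcI)
    fix l assume l: "l \<in> idx (A # fs)" "hdeg l + 1 = n"
    then obtain b k l' where l': "l = (b, k) # l'" "k < dim_row A" "l' \<in> idx fs" by auto
    show "kd (A # fs) x l \<in> a"
    proof (cases b)
      case True
      then have "hdeg l' + 1 = n - 1" using l(2) l'(1) by simp
      then have "- kd fs (sl (parts True x) k) l' \<in> a" using TF l' by blast
      moreover have "l = (True, k) # l'" using l'(1) True by simp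
      ultimately show ?thesis by (simp add: kd_True del: kd.simps)
    next
      case False
      then have "hdeg l' + 1 = n" using l(2) l'(1) by simp
      then show ?thesis using TF l' False kd_False[OF A l'(2), of fs x l'] by (simp del: kd.simps)
    qed
  qed
qed

lemma Bc_Cons:
  assumes A: "A \<in> carrier_mat (dim_row A) (dim_row A)"
  shows "x \<in> Bc a (A # fs) n \<longleftrightarrow> (\<exists>y.
    (\<forall>k<dim_row A. \<forall>l\<in>idx fs. hdeg l = n - 1 \<longrightarrow> sl (parts True x) k l + kd fs (sl (parts True y) k) l \<in> a) \<and>
    (\<forall>k<dim_row A. \<forall>l\<in>idx fs. hdeg l = n \<longrightarrow>
      sl (parts False x) k l - (kd fs (sl (parts False y) k) l + sl (mact A (parts True y)) k l) \<in> a))"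
  (is "_ \<longleftrightarrow> (\<exists>y. ?T y \<and> ?F y)")
proof
  assume "x \<in> Bc a (A # fs) n"
  then obtain y where y: "\<forall>l\<in>idx (A # fs). hdeg l = n \<longrightarrow> x l - kd (A # fs) y l \<in> a" using BcD by blast
  have "?T y"
  proof (intro allI impI ballI)
    fix k l assume "k < dim_row A" "l \<in> idx fs" "hdeg l = n - 1"
    then show "sl (parts True x) k l + kd fs (sl (parts True y) k) l \<in> a"
      using y[rule_format, of "(True, k) # l"] unfolding kd_True mem_idx_Cons by (simp add: sl_parts)
  qed
  moreover have "?F y"
  proof (intro allI impI ballI)
    fix k l assume "k < dim_row A" "l \<in> idx fs" "hdeg l = n"
    then show "sl (parts False x) k l - (kd fs (sl (parts False y) k) l + sl (mact A (parts True y)) k l) \<in> a"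
      using y[rule_format, of "(False, k) # l"] kd_False[OF A, of k fs y l]
      by (simp add: sl_parts mem_idx_Cons del: kd.simps idx.simps)
  qed
  ultimately show "\<exists>y. ?T y \<and> ?F y" by blast
next
  assume "\<exists>y. ?T y \<and> ?F y"
  then obtain y where TF: "?T y" "?F y" by blast
  show "x \<in> Bc a (A # fs) n"
  proof (rule BcI[where y = y])
    fix l assume l: "l \<in> idx (A # fs)" "hdeg l = n"
    then obtain b k l' where l': "l = (b, k) # l'" "k < dim_row A" "l' \<in> idx fs" by auto
    show "x l - kd (A # fs) y l \<in> a"
    proof (cases b)
      case True
      then have "hdeg l' = n - 1" using l(2) l'(1) by simp
      then show ?thesis using TF(1) l' True by (simp add: sl_parts)
    next
      case False
      then have "hdeg l' = n" using l(2) l'(1) by simp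
      then show ?thesis using TF(2) l' False kd_False[OF A l'(2), of fs y l'] by (simp add: sl_parts del: kd.simps)
    qed
  qed
qed

text \<open>The long exact sequence of the mapping cone of \<open>A\<close>, in terms of lengths.\<close>

lemma hlen_Cons:
  assumes a: "idl a" and A: "A \<in> carrier_mat (dim_row A) (dim_row A)"
  shows "hlen a (A # fs) n =
    cokl (mact A) (pw (dim_row A) (Zc a fs n)) (pw (dim_row A) (Bc a fs n)) +
    kerl (mact A) (pw (dim_row A) (Zc a fs (n - 1))) (pw (dim_row A) (Bc a fs (n - 1)))"
proof -
  let ?r = "dim_row A" and ?Z = "Zc a (A # fs) n" and ?B = "Bc a (A # fs) n"
  let ?Zn = "pw ?r (Zc a fs n)" and ?Bn = "pw ?r (Bc a fs n)"
  let ?Zm = "pw ?r (Zc a fs (n - 1))" and ?Bm = "pw ?r (Bc a fs (n - 1))"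
  note sZ = submod_Zc[OF a] and sB = submod_Bc[OF a] and BZ = Bc_sub_Zc[OF a]
  have em: "endo (mact A) ?Zm ?Bm" by (rule endo_mact[OF A sZ sB BZ])
  have en: "endo (mact A) ?Zn ?Bn" by (rule endo_mact[OF A sZ sB BZ])
  \<comment> \<open>Cycles whose \<open>True\<close> part is a boundary. The quotient of all cycles
    by \<open>W\<close> is the kernel of \<open>A\<close> in degree \<open>n - 1\<close>, and
    \<open>W\<close> modulo boundaries is the cokernel of \<open>A\<close> in degree
    \<open>n\<close>.\<close>
  define W where "W = {x \<in> ?Z. parts True x \<in> ?Bm}"
  have W: "submod W" unfolding W_def by (rule submod_vimage[OF lin_parts sZ submod_pw[OF sB]])
  have WZ: "W \<subseteq> ?Z" by (auto simp: W_def)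
  have pwBm: "x \<in> ?Bm \<Longrightarrow> \<exists>u. \<forall>k<?r. \<forall>l\<in>idx fs. hdeg l = n - 1 \<longrightarrow> sl x k l - kd fs (u k) l \<in> a" for x
  proof -
    assume "x \<in> ?Bm"
    then have "\<forall>k. \<exists>u. k < ?r \<longrightarrow> (\<forall>l\<in>idx fs. hdeg l = n - 1 \<longrightarrow> sl x k l - kd fs u l \<in> a)"
      using BcD pwD by blast
    from choice[OF this] show ?thesis by blast
  qed
  have BW: "?B \<subseteq> W"
  proof
    fix x assume x: "x \<in> ?B"
    then obtain y where y: "\<forall>k<?r. \<forall>l\<in>idx fs. hdeg l = n - 1 \<longrightarrow> sl (parts True x) k l + kd fs (sl (parts True y) k) l \<in> a"
      unfolding Bc_Cons[OF A] by blast
    have "parts True x \<in> ?Bm"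
    proof (rule pwI, rule BcI)
      fix k l assume "k < ?r" "l \<in> idx fs" "hdeg l = n - 1"
      then show "sl (parts True x) k l - kd fs (- sl (parts True y) k) l \<in> a"
        using y by (simp add: lin_minus[OF lin_kd])
    qed
    then show "x \<in> W" using x BZ by (auto simp: W_def)
  qed
  have "len ?Z W = len {y \<in> ?Zm. mact A y \<in> ?Bm} ?Bm"
  proof (rule len_iso[OF lin_parts[of True] sZ submod_pw[OF sB] endo_image(4,5)[OF em] WZ])
    fix x assume x: "x \<in> ?Z"
    note x' = x[unfolded Zc_Cons[OF A]]
    have "parts True x \<in> ?Zm"
      by (rule pwI, rule ZcI) (use x' idlD(5)[OF a, of "- _"] in fastforce)
    moreover have "mact A (parts True x) \<in> ?Bm"
    proof (rule pwI, rule BcI)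
      fix k l assume "k < ?r" "l \<in> idx fs" "hdeg l = n - 1"
      then show "sl (mact A (parts True x)) k l - kd fs (- sl (parts False x) k) l \<in> a"
        using x' by (simp add: lin_minus[OF lin_kd] add.commute)
    qed
    ultimately show "parts True x \<in> {y \<in> ?Zm. mact A y \<in> ?Bm}" by simp
    show "parts True x \<in> ?Bm \<longleftrightarrow> x \<in> W" using x by (simp add: W_def)
  next
    show "{y \<in> ?Zm. mact A y \<in> ?Bm} \<subseteq> msum (parts True ` ?Z) ?Bm"
    proof
      fix y assume "y \<in> {y \<in> ?Zm. mact A y \<in> ?Bm}"
      then have y: "y \<in> ?Zm" "mact A y \<in> ?Bm" by auto
      obtain u where u: "\<forall>k<?r. \<forall>l\<in>idx fs. hdeg l = n - 1 \<longrightarrow> sl (mact A y) k l - kd fs (u k) l \<in> a"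
        using pwBm[OF y(2)] by blast
      \<comment> \<open>\<open>A y\<close> is the boundary of \<open>u\<close>, so
        \<open>- u\<close> as \<open>False\<close> part completes \<open>y\<close> to a cycle of the
        cone.\<close>
      define x where "x = glue (\<lambda>(k, l). - u k l) y"
      have slu: "sl (\<lambda>(k, l). - u k l) k = - u k" for k by (auto simp: sl_def fun_eq_iff)
      have "x \<in> ?Z" unfolding Zc_Cons[OF A] x_def parts_glue slu
      proof (intro conjI allI impI ballI)
        fix k l assume "k < ?r" "l \<in> idx fs" "hdeg l + 1 = n - 1"
        then show "- kd fs (sl y k) l \<in> a" using idlD(5)[OF a ZcD[OF pwD[OF y(1)]]] by blast
      next
        fix k l assume "k < ?r" "l \<in> idx fs" "hdeg l + 1 = n"
        then show "kd fs (- u k) l + sl (mact A y) k l \<in> a" using u by (simp add: lin_minus[OF lin_kd])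
      qed
      moreover have "parts True x = y" by (simp add: x_def)
      ultimately show "y \<in> msum (parts True ` ?Z) ?Bm"
        using msumI[OF imageI submod_0[OF submod_pw[OF sB]], of x ?Z "parts True"] by simp
    qed
  qed
  moreover have "len ?Zn (msum (mact A ` ?Zn) ?Bn) = len W ?B"
  proof (rule len_iso[OF lin_glue0 submod_pw[OF sZ] sB W BW endo_image(2)[OF en]])
    fix z assume z: "z \<in> ?Zn"
    have m0: "mact A 0 = 0" "parts True (0 :: (bool \<times> nat) list \<Rightarrow> 'a) = 0" by (rule lin_0[OF lin_mact]) (rule lin_0[OF lin_parts])
    have "glue z 0 \<in> ?Z" unfolding Zc_Cons[OF A] parts_glue m0 sl_0
      using ZcD[OF pwD[OF z]] by (auto simp: lin_0[OF lin_kd] idlD(1)[OF a])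
    then show "glue z 0 \<in> W" using submod_0[OF submod_pw[OF sB]] by (simp add: W_def)
    show "glue z 0 \<in> ?B \<longleftrightarrow> z \<in> msum (mact A ` ?Zn) ?Bn"
    proof
      assume "glue z 0 \<in> ?B"
      then obtain y where y: "\<forall>k<?r. \<forall>l\<in>idx fs. hdeg l = n - 1 \<longrightarrow> kd fs (sl (parts True y) k) l \<in> a"
        "\<forall>k<?r. \<forall>l\<in>idx fs. hdeg l = n \<longrightarrow> sl z k l - (kd fs (sl (parts False y) k) l + sl (mact A (parts True y)) k l) \<in> a"
        unfolding Bc_Cons[OF A] parts_glue by (auto simp: sl_0)
      have "parts True y \<in> ?Zn" by (rule pwI, rule ZcI) (use y(1) in auto)
      moreover have "z - mact A (parts True y) \<in> ?Bn"
      proof (rule pwI, rule BcI)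
        fix k l assume "k < ?r" "l \<in> idx fs" "hdeg l = n"
        then show "sl (z - mact A (parts True y)) k l - kd fs (sl (parts False y) k) l \<in> a"
          using y(2) by (simp add: sl_diff algebra_simps)
      qed
      ultimately show "z \<in> msum (mact A ` ?Zn) ?Bn" using msumI[OF imageI, of "parts True y" ?Zn "z - mact A (parts True y)" ?Bn "mact A"] by simp
    next
      assume "z \<in> msum (mact A ` ?Zn) ?Bn"
      then obtain w b where w: "w \<in> ?Zn" "b \<in> ?Bn" "z = mact A w + b" by (auto elim!: msumE)
      have "\<forall>k. \<exists>u. k < ?r \<longrightarrow> (\<forall>l\<in>idx fs. hdeg l = n \<longrightarrow> sl b k l - kd fs u l \<in> a)"
        using BcD[OF pwD[OF w(2)]] by blast
      from choice[OF this] obtain u where u: "\<forall>k. k < ?r \<longrightarrow> (\<forall>l\<in>idx fs. hdeg l = n \<longrightarrow> sl b k l - kd fs (u k) l \<in> a)" by blast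
      have slu: "sl (\<lambda>(k, l). u k l) k = u k" for k by (auto simp: sl_def fun_eq_iff)
      show "glue z 0 \<in> ?B" unfolding Bc_Cons[OF A]
      proof (intro exI[of _ "glue (\<lambda>(k, l). u k l) w"] conjI allI impI ballI; unfold parts_glue slu)
        fix k l assume kl: "k < ?r" "l \<in> idx fs" "hdeg l = n - 1"
        show "sl 0 k l + kd fs (sl w k) l \<in> a" using ZcD[OF pwD[OF w(1) kl(1)] kl(2)] kl(3) by (simp add: sl_0)
      next
        fix k l assume "k < ?r" "l \<in> idx fs" "hdeg l = n"
        then show "sl z k l - (kd fs (u k) l + sl (mact A w) k l) \<in> a" using u by (simp add: w(3) sl_add)
      qed
    qed
  next
    show "W \<subseteq> msum ((\<lambda>x. glue x 0) ` ?Zn) ?B"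
    proof
      fix x assume x: "x \<in> W"
      then have xZ: "x \<in> ?Z" and xB: "parts True x \<in> ?Bm" by (auto simp: W_def)
      obtain u where u: "\<forall>k<?r. \<forall>l\<in>idx fs. hdeg l = n - 1 \<longrightarrow> sl (parts True x) k l - kd fs (u k) l \<in> a"
        using pwBm[OF xB] by blast
      define U :: "nat \<times> (bool \<times> nat) list \<Rightarrow> 'a" where "U = (\<lambda>(k, l). u k l)"
      have slU: "sl U k = u k" for k by (auto simp: sl_def U_def fun_eq_iff)
      \<comment> \<open>The \<open>True\<close> part of \<open>x\<close> is the boundary of
        \<open>U\<close>. Subtracting from \<open>x\<close> the boundary of the chain with
        \<open>True\<close> part \<open>- U\<close> removes it and leaves \<open>z\<close> as
        \<open>False\<close> part.\<close>
      define z where "z = parts False x + mact A U"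
      have "z \<in> ?Zn"
      proof (rule pwI, rule ZcI)
        fix k l assume kl: "k < ?r" "l \<in> idx fs" "hdeg l + 1 = n"
        have dc: "dim_col A = ?r" using A by (metis carrier_matD(2))
        have 1: "kd fs (sl (parts False x) k) l + sl (mact A (parts True x)) k l \<in> a"
          using xZ[unfolded Zc_Cons[OF A]] kl by blast
        have 2: "(\<Sum>j<?r. A $$ (k, j) * (sl (parts True x) j l - kd fs (u j) l)) \<in> a"
          by (intro idl_sum[OF a] idlD(3)[OF a]) (use u kl in auto)
        have "kd fs (sl z k) l = kd fs (sl (parts False x) k) l + (\<Sum>j<?r. A $$ (k, j) * kd fs (u j) l)"
          using kl(1) by (simp add: z_def sl_add sl_mact dc lin_add[OF lin_kd] lin_sum[OF lin_kd] lin_sm[OF lin_kd] sum_fun_apply sm_apply slU)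
        also have "\<dots> = (kd fs (sl (parts False x) k) l + sl (mact A (parts True x)) k l) -
            (\<Sum>j<?r. A $$ (k, j) * (sl (parts True x) j l - kd fs (u j) l))"
          using kl(1) by (simp add: sl_mact_parts[OF A] right_diff_distrib sum_subtractf)
        also have "\<dots> \<in> a" by (rule idlD(6)[OF a 1 2])
        finally show "kd fs (sl z k) l \<in> a" .
      qed
      moreover have "x - glue z 0 \<in> ?B" unfolding Bc_Cons[OF A]
      proof (intro exI[of _ "glue 0 (- U)"] conjI allI impI ballI; unfold parts_glue lin_diff[OF lin_parts])
        fix k l assume "k < ?r" "l \<in> idx fs" "hdeg l = n - 1"
        then show "sl (parts True x - 0) k l + kd fs (sl (- U) k) l \<in> a"
          using u slU sl_diff[of 0 U k] by (simp add: sl_0 lin_minus[OF lin_kd])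
      next
        fix k l assume "k < ?r" "l \<in> idx fs" "hdeg l = n"
        then show "sl (parts False x - z) k l - (kd fs (sl 0 k) l + sl (mact A (- U)) k l) \<in> a"
          using sl_diff[of 0 "mact A U" k]
          by (simp add: z_def sl_diff sl_add sl_0 lin_0[OF lin_kd] lin_minus[OF lin_mact] idlD(1)[OF a])
      qed
      ultimately show "x \<in> msum ((\<lambda>x. glue x 0) ` ?Zn) ?B"
        using msumI[OF imageI, of z ?Zn "x - glue z 0" ?B "\<lambda>x. glue x 0"] by simp
    qed
  qed
  moreover have "hlen a (A # fs) n = len ?Z W + len W ?B"
    unfolding hlen_def by (rule len_add) (use W sZ BW WZ in auto)
  ultimately show ?thesis by (simp add: cokl_def kerl_def add.commute)
qed

section \<open>Invariance under rotation of the list\<close>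

definition sg :: "(bool \<times> nat) list \<Rightarrow> 'p::comm_ring_1" where
  "sg l = (if even (hdeg l) then 1 else - 1)"

lemma sg_simps [simp]: "sg [] = 1" "sg ((b, k) # l) = (if b then - sg l else sg l)" "sg l * sg l = 1"
  by (auto simp: sg_def)

lemma kd_append:
  "l \<in> idx fs \<Longrightarrow> kd (fs @ [A]) x (l @ [(b, k)]) = kd fs (\<lambda>l'. x (l' @ [(b, k)])) l +
    (if b then 0 else sg l * (\<Sum>j<dim_row A. A $$ (k, j) * x (l @ [(True, j)])))"
proof (induction fs arbitrary: x l)
  case Nil then show ?case by simp
next
  case (Cons C fs)
  then obtain c m l' where l: "l = (c, m) # l'" "m < dim_row C" "l' \<in> idx fs" by auto
  show ?case by (simp add: l Cons.IH[OF l(3)])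
qed

text \<open>The differential lowers the degree by one, so it anticommutes with the sign given by the
  parity of the degree.\<close>

lemma kd_sg: "l \<in> idx fs \<Longrightarrow> kd fs (\<lambda>l'. sg l' * x l') l = - sg l * kd fs x l"
proof (induction fs arbitrary: x l)
  case Nil then show ?case by simp
next
  case (Cons C fs)
  then obtain c m l' where l: "l = (c, m) # l'" "m < dim_row C" "l' \<in> idx fs" by auto
  have m: "kd fs (\<lambda>l'. - (sg l' * y l')) l' = - kd fs (\<lambda>l'. sg l' * y l') l'" for y
    using lin_minus[OF lin_kd, of fs "\<lambda>l'. sg l' * y l'"] by (simp add: fun_eq_iff fun_Compl_def)
  show ?case by (simp add: l m Cons.IH[OF l(3)] algebra_simps sum_distrib_left sum_negf)
qed

text \<open>The symmetry of the tensor product of complexes: moving the first factor to the end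
  costs the Koszul sign, which is nontrivial only if that factor has degree 1.\<close>

definition rot :: "((bool \<times> nat) list \<Rightarrow> 'p::comm_ring_1) \<Rightarrow> (bool \<times> nat) list \<Rightarrow> 'p" where
  "rot x l = (if l = [] then 0 else (if fst (last l) then sg (butlast l) else 1) * x (last l # butlast l))"

definition unrot :: "((bool \<times> nat) list \<Rightarrow> 'p::comm_ring_1) \<Rightarrow> (bool \<times> nat) list \<Rightarrow> 'p" where
  "unrot y l = (if l = [] then 0 else (if fst (hd l) then sg (tl l) else 1) * y (tl l @ [hd l]))"

lemma rot_snoc: "rot x (l @ [(b, k)]) = (if b then sg l else 1) * x ((b, k) # l)"
  by (simp add: rot_def)

lemma unrot_Cons: "unrot y ((b, k) # l) = (if b then sg l else 1) * y (l @ [(b, k)])"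
  by (simp add: unrot_def)

lemma rot_unrot: "rot (unrot y) (l @ [(b, k)]) = y (l @ [(b, k)])"
  by (simp add: rot_snoc unrot_Cons mult.assoc[symmetric])

lemma lin_rot: "lin rot"
  by (rule linI) (auto simp: fun_eq_iff rot_def sm_apply algebra_simps)

lemma idx_append: "idx (fs @ [A]) = {l @ [(b, k)] | l b k. l \<in> idx fs \<and> k < dim_row A}"
proof (induction fs)
  case Nil then show ?case by auto
next
  case (Cons C fs)
  show ?case
  proof (rule equalityI; rule subsetI)
    fix l assume "l \<in> idx ((C # fs) @ [A])"
    then obtain c m l' where l: "l = (c, m) # l'" "m < dim_row C" "l' \<in> idx (fs @ [A])" by auto
    then obtain l'' b k where "l' = l'' @ [(b, k)]" "l'' \<in> idx fs" "k < dim_row A" using Cons by auto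
    then have "l = ((c, m) # l'') @ [(b, k)]" "(c, m) # l'' \<in> idx (C # fs)" "k < dim_row A" using l by auto
    then show "l \<in> {l @ [(b, k)] | l b k. l \<in> idx (C # fs) \<and> k < dim_row A}" by blast
  next
    fix l assume "l \<in> {l @ [(b, k)] | l b k. l \<in> idx (C # fs) \<and> k < dim_row A}"
    then obtain l' b k where l: "l = l' @ [(b, k)]" "l' \<in> idx (C # fs)" "k < dim_row A" by blast
    then obtain c m l'' where l'': "l' = (c, m) # l''" "m < dim_row C" "l'' \<in> idx fs" by auto
    then have "l'' @ [(b, k)] \<in> idx (fs @ [A])" using Cons l by blast
    then show "l \<in> idx ((C # fs) @ [A])" using l l'' by simp
  qed
qed

lemma hdeg_append: "hdeg (l @ [(b, k)]) = hdeg ((b, k) # l)"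
  by (induction l) auto

text \<open>The sign that \<open>kd_append\<close> attaches to the last factor and the sign change
  of \<open>kd_sg\<close> are just those which the Koszul sign in \<open>rot\<close>
  compensates.\<close>

lemma kd_rot:
  assumes "l \<in> idx fs" "k < dim_row A"
  shows "kd (fs @ [A]) (rot x) (l @ [(b, k)]) = rot (kd (A # fs) x) (l @ [(b, k)])"
proof (cases b)
  case True
  have "kd fs (\<lambda>l'. rot x (l' @ [(b, k)])) l = kd fs (\<lambda>l'. sg l' * x ((b, k) # l')) l"
    by (simp add: rot_snoc True)
  also have "\<dots> = - sg l * kd fs (\<lambda>l'. x ((b, k) # l')) l" by (rule kd_sg[OF assms(1)])
  finally show ?thesis by (simp add: kd_append[OF assms(1)] rot_snoc True)
next
  case False
  have "sg l * (\<Sum>j<dim_row A. A $$ (k, j) * (sg l * x ((True, j) # l))) =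
     (sg l * sg l) * (\<Sum>j<dim_row A. A $$ (k, j) * x ((True, j) # l))"
    unfolding sum_distrib_left by (rule sum.cong) (simp_all only: ac_simps)
  then show ?thesis by (simp add: kd_append[OF assms(1)] rot_snoc False)
qed

lemma sg_mem: "idl a \<Longrightarrow> (if b then sg l else 1) * c \<in> a \<longleftrightarrow> c \<in> a"
  using idlD(5)[of a c] idlD(5)[of a "- c"] by (auto simp: sg_def)

lemma hlen_rotate:
  fixes a :: "'p::comm_ring_1 set"
  assumes a: "idl a"
  shows "hlen a (A # fs) n = hlen a (fs @ [A]) n"
proof -
  let ?K = "A # fs" and ?L = "fs @ [A]"
  have Z: "rot x \<in> Zc a ?L n \<longleftrightarrow> x \<in> Zc a ?K n" for x
  proof -
    have "kd ?L (rot x) (l @ [(b, k)]) \<in> a \<longleftrightarrow> kd ?K x ((b, k) # l) \<in> a" if "l \<in> idx fs" "k < dim_row A" for l b k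
      unfolding kd_rot[OF that] rot_snoc sg_mem[OF a] ..
    then have e: "l \<in> idx fs \<and> k < dim_row A \<Longrightarrow> kd ?L (rot x) (l @ [(b, k)]) \<in> a \<longleftrightarrow> kd ?K x ((b, k) # l) \<in> a" for l b k
      by blast
    show ?thesis
    proof
      assume z: "rot x \<in> Zc a ?L n"
      show "x \<in> Zc a ?K n"
      proof (rule ZcI)
        fix l assume "l \<in> idx ?K" "hdeg l + 1 = n"
        then obtain l' b k where l: "l = (b, k) # l'" "l' \<in> idx fs \<and> k < dim_row A" "hdeg ((b, k) # l') + 1 = n" by auto
        have "kd ?L (rot x) (l' @ [(b, k)]) \<in> a"
          by (rule ZcD[OF z]) (use l(2,3) in \<open>auto simp: idx_append hdeg_append\<close>)
        then show "kd ?K x l \<in> a" unfolding e[OF l(2)] l(1) .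
      qed
    next
      assume z: "x \<in> Zc a ?K n"
      show "rot x \<in> Zc a ?L n"
      proof (rule ZcI)
        fix l assume "l \<in> idx ?L" "hdeg l + 1 = n"
        then obtain l' b k where l: "l = l' @ [(b, k)]" "l' \<in> idx fs \<and> k < dim_row A" "hdeg ((b, k) # l') + 1 = n"
          unfolding idx_append by (auto simp: hdeg_append)
        have "kd ?K x ((b, k) # l') \<in> a"
          by (rule ZcD[OF z]) (use l(2,3) in auto)
        then show "kd ?L (rot x) l \<in> a" unfolding e[OF l(2), symmetric] l(1) .
      qed
    qed
  qed
  have B: "rot x \<in> Bc a ?L n" if x: "x \<in> Bc a ?K n" for x
  proof -
    obtain y where y: "\<forall>l\<in>idx ?K. hdeg l = n \<longrightarrow> x l - kd ?K y l \<in> a" using BcD[OF x] by blast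
    show ?thesis
    proof (rule BcI[where y = "rot y"])
      fix l assume "l \<in> idx ?L" "hdeg l = n"
      then obtain l' b k where l: "l = l' @ [(b, k)]" "l' \<in> idx fs" "k < dim_row A" "hdeg ((b, k) # l') = n"
        unfolding idx_append by (auto simp: hdeg_append)
      have "x ((b, k) # l') - kd ?K y ((b, k) # l') \<in> a" using y l by (auto simp del: kd.simps)
      then have "(if b then sg l' else 1) * (x ((b, k) # l') - kd ?K y ((b, k) # l')) \<in> a" unfolding sg_mem[OF a] .
      then show "rot x l - kd ?L (rot y) l \<in> a"
        unfolding l(1) kd_rot[OF l(2,3)] rot_snoc right_diff_distrib .
    qed
  qed
  have B': "x \<in> Bc a ?K n" if x: "rot x \<in> Bc a ?L n" for x
  proof -
    obtain y where y: "\<forall>l\<in>idx ?L. hdeg l = n \<longrightarrow> rot x l - kd ?L y l \<in> a" using BcD[OF x] by blast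
    show ?thesis
    proof (rule BcI[where y = "unrot y"])
      fix l assume "l \<in> idx ?K" "hdeg l = n"
      then obtain l' b k where l: "l = (b, k) # l'" "l' \<in> idx fs" "k < dim_row A" "hdeg ((b, k) # l') = n" by auto
      have i: "l' @ [(b, k)] \<in> idx ?L" using l unfolding idx_append by blast
      then have "rot x (l' @ [(b, k)]) - kd ?L y (l' @ [(b, k)]) \<in> a" using y l by (auto simp: hdeg_append)
      also have "kd ?L y (l' @ [(b, k)]) = kd ?L (rot (unrot y)) (l' @ [(b, k)])"
        by (rule kd_cong[OF i]) (auto simp: idx_append rot_unrot)
      finally have "(if b then sg l' else 1) * (x ((b, k) # l') - kd ?K (unrot y) ((b, k) # l')) \<in> a"
        unfolding kd_rot[OF l(2,3)] rot_snoc right_diff_distrib .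
      then show "x l - kd ?K (unrot y) l \<in> a" unfolding sg_mem[OF a] l(1) .
    qed
  qed
  show ?thesis unfolding hlen_def
  proof (rule len_iso[OF lin_rot submod_Zc[OF a] submod_Bc[OF a] submod_Zc[OF a] Bc_sub_Zc[OF a] Bc_sub_Zc[OF a]])
    show "rot z \<in> Zc a ?L n" if "z \<in> Zc a ?K n" for z using Z that by blast
    show "rot z \<in> Bc a ?L n \<longleftrightarrow> z \<in> Bc a ?K n" for z using B B' by blast
    show "Zc a ?L n \<subseteq> msum (rot ` Zc a ?K n) (Bc a ?L n)"
    proof
      fix y assume y: "y \<in> Zc a ?L n"
      \<comment> \<open>\<open>rot\<close> undoes \<open>unrot\<close> on nonempty lists only, so
        surjectivity is obtained modulo functions that are trivial on the index set, and these are
        boundaries.\<close>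
      have "y - rot (unrot y) \<in> base a (idx ?L)"
        by (auto simp: base_def idx_append rot_unrot idlD(1)[OF a])
      then have b: "y - rot (unrot y) \<in> Bc a ?L n" using base_Bc[OF a] by blast
      then have "rot (unrot y) \<in> Zc a ?L n"
        using Bc_sub_Zc[OF a] y submod_diff_cancel[OF submod_Zc[OF a]] by blast
      then have "unrot y \<in> Zc a ?K n" using Z by blast
      from msumI[OF imageI[OF this, of rot] b] show "y \<in> msum (rot ` Zc a ?K n) (Bc a ?L n)" by simp
    qed
  qed
qed

text \<open>Multiplication by the determinant of any factor is null-homotopic, through the adjugate
  matrix.\<close>

definition homotopy :: "'p::comm_ring_1 mat list \<Rightarrow> 'p \<Rightarrow> (((bool \<times> nat) list \<Rightarrow> 'p) \<Rightarrow> (bool \<times> nat) list \<Rightarrow> 'p) \<Rightarrow> bool" where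
  "homotopy fs c s \<longleftrightarrow> lin s \<and> (\<forall>x. \<forall>l\<in>idx fs. kd fs (s x) l + s (kd fs x) l = c * x l) \<and>
    (\<forall>a x. \<forall>l\<in>idx fs. idl a \<longrightarrow> (\<forall>l'\<in>idx fs. hdeg l' + 1 = hdeg l \<longrightarrow> x l' \<in> a) \<longrightarrow> s x l \<in> a)"

text \<open>For a cycle \<open>z\<close> the values of \<open>kd fs z\<close> one degree lower lie
  in \<open>a\<close>; by the last clause of \<open>homotopy\<close> so do those of
  \<open>s (kd fs z)\<close>, and what remains of \<open>c z\<close> is a boundary.\<close>

lemma homotopy_kills:
  assumes h: "homotopy fs c s" and a: "idl a" and z: "z \<in> Zc a fs n"
  shows "sm c z \<in> Bc a fs n"
proof (rule BcI[where y = "s z"])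
  fix l assume l: "l \<in> idx fs" "hdeg l = n"
  have "s (kd fs z) l \<in> a" using h a l ZcD[OF z] unfolding homotopy_def by blast
  moreover have "c * z l - kd fs (s z) l = s (kd fs z) l" using h l unfolding homotopy_def by (simp add: algebra_simps)
  ultimately show "sm c z l - kd fs (s z) l \<in> a" by (simp add: sm_apply)
qed

text \<open>The homotopy maps the \<open>False\<close> part to the \<open>True\<close> part by the
  adjugate. The products of \<open>A\<close> with its adjugate, in either order, give
  \<open>det A\<close> on the two parts, and the other terms cancel because the differential changes
  sign on the \<open>True\<close> part.\<close>

lemma homotopy_head:
  assumes A: "A \<in> carrier_mat (dim_row A) (dim_row A)"
  shows "homotopy (A # fs) (det A) (\<lambda>x. glue 0 (mact (adj_mat A) (parts False x)))"
proof -
  let ?r = "dim_row A" and ?s = "\<lambda>x. glue 0 (mact (adj_mat A) (parts False x))"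
  let ?C = "adj_mat A"
  have C: "?C \<in> carrier_mat ?r ?r" "dim_row ?C = ?r" "dim_col ?C = ?r"
    using adj_mat(1)[OF A] by auto
  have AC: "A * ?C = det A \<cdot>\<^sub>m 1\<^sub>m ?r" "?C * A = det A \<cdot>\<^sub>m 1\<^sub>m ?r" using adj_mat[OF A] by auto
  have lj: "lin (glue 0)" by (rule linI) (auto simp: fun_eq_iff glue_def sm_apply split: list.splits)
  have 1: "lin ?s" by (rule linI) (simp_all add: lin_add[OF lin_parts] lin_add[OF lin_mact] lin_add[OF lj] lin_sm[OF lin_parts] lin_sm[OF lin_mact] lin_sm[OF lj])
  have 2: "kd (A # fs) (?s x) l + ?s (kd (A # fs) x) l = det A * x l" if l: "l \<in> idx (A # fs)" for x l
  proof -
    obtain b k l' where l': "l = (b, k) # l'" "k < ?r" "l' \<in> idx fs" using l by auto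
    show ?thesis
    proof (cases b)
      case False
      have "kd (A # fs) (?s x) ((False, k) # l') = sl (mact A (mact ?C (parts False x))) k l'"
        unfolding kd_False[OF A l'(2)] parts_glue by (simp add: sl_0 lin_0[OF lin_kd])
      also have "\<dots> = det A * x ((False, k) # l')"
        unfolding mact_mult[OF A C(1), symmetric] AC sl_mact_smult_one[OF l'(2)] by (simp add: sm_apply sl_parts)
      finally have "kd (A # fs) (?s x) l = det A * x l" using l'(1) False by simp
      moreover have "?s y l = 0" for y using l'(1) False by (simp add: glue_def)
      ultimately show ?thesis by simp
    next
      case True
      have pF: "parts False (kd (A # fs) x) (j, l'') = kd fs (sl (parts False x) j) l'' + sl (mact A (parts True x)) j l''" if "j < ?r" for j l''
        unfolding kd_False[OF A that, symmetric] by (simp add: parts_def)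
      have "?s (kd (A # fs) x) l = (\<Sum>j<?r. ?C $$ (k, j) * parts False (kd (A # fs) x) (j, l'))"
        using l' True C by (simp add: glue_def mact_def)
      also have "\<dots> = (\<Sum>j<?r. ?C $$ (k, j) * kd fs (sl (parts False x) j) l') + (\<Sum>j<?r. ?C $$ (k, j) * sl (mact A (parts True x)) j l')"
        by (simp add: pF algebra_simps sum.distrib)
      also have "(\<Sum>j<?r. ?C $$ (k, j) * sl (mact A (parts True x)) j l') = sl (mact ?C (mact A (parts True x))) k l'"
        using l'(2) C by (simp add: sl_mact sum_fun_apply sm_apply)
      also have "\<dots> = det A * x l"
        unfolding mact_mult[OF C(1) A, symmetric] AC sl_mact_smult_one[OF l'(2)] using l'(1) True by (simp add: sm_apply sl_parts)
      also have "(\<Sum>j<?r. ?C $$ (k, j) * kd fs (sl (parts False x) j) l') = kd fs (sl (mact ?C (parts False x)) k) l'"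
        using l'(2) C by (simp add: sl_mact lin_sum[OF lin_kd] lin_sm[OF lin_kd] sum_fun_apply sm_apply)
      also have "\<dots> = - kd (A # fs) (?s x) l" using l'(1) True kd_True[of A fs "?s x" k l'] by simp
      finally have e: "?s (kd (A # fs) x) l = - kd (A # fs) (?s x) l + det A * x l" .
      show ?thesis unfolding e by (rule add_minus_cancel)
    qed
  qed
  have 3: "?s x l \<in> a" if a: "idl a" and l: "l \<in> idx (A # fs)" and x: "\<forall>l'\<in>idx (A # fs). hdeg l' + 1 = hdeg l \<longrightarrow> x l' \<in> a" for a x l
  proof -
    obtain b k l' where l': "l = (b, k) # l'" "k < ?r" "l' \<in> idx fs" using l by auto
    show ?thesis
    proof (cases b)
      case False then show ?thesis using l' idlD(1)[OF a] by (simp add: glue_def)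
    next
      case True
      have "parts False x (j, l') \<in> a" if "j < ?r" for j
        using x[rule_format, of "(False, j) # l'"] l' True that
        by (simp add: parts_def mem_idx_Cons del: idx.simps)
      then show ?thesis using l' True C by (auto simp: glue_def mact_def intro!: idl_sum[OF a] idlD(3)[OF a])
    qed
  qed
  show ?thesis unfolding homotopy_def using 1 2 3 by blast
qed

text \<open>A homotopy of the tail acts on both parts of the cone, with the sign of the differential
  on the \<open>True\<close> part. Being linear it commutes with the entries of \<open>A\<close>, so
  the terms from \<open>A\<close> cancel.\<close>

lemma homotopy_tail:
  assumes h: "homotopy fs c s"
  shows "\<exists>s'. homotopy (A # fs) c s'"
proof -
  define s' where "s' x l = (case l of [] \<Rightarrow> 0 | (b, k) # l' \<Rightarrow> if b then - s (\<lambda>l''. x ((b, k) # l'')) l' else s (\<lambda>l''. x ((b, k) # l'')) l')" for x l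
  have ls: "lin s" and sc: "\<And>x l. l \<in> idx fs \<Longrightarrow> kd fs (s x) l + s (kd fs x) l = c * x l"
    and sl: "\<And>a x l. l \<in> idx fs \<Longrightarrow> idl a \<Longrightarrow> (\<forall>l'\<in>idx fs. hdeg l' + 1 = hdeg l \<longrightarrow> x l' \<in> a) \<Longrightarrow> s x l \<in> a"
    using h unfolding homotopy_def by auto
  have e: "(\<lambda>l''. (x + y) ((b, k) # l'')) = (\<lambda>l''. x ((b, k) # l'')) + (\<lambda>l''. y ((b, k) # l''))"
    "(\<lambda>l''. sm d x ((b, k) # l'')) = sm d (\<lambda>l''. x ((b, k) # l''))" for x y :: "(bool \<times> nat) list \<Rightarrow> 'a" and b k d
    by (auto simp: fun_eq_iff sm_apply)
  have 1: "lin s'"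
  proof (rule linI)
    show "s' (x + y) = s' x + s' y" for x y
      unfolding fun_eq_iff s'_def e lin_add[OF ls] by (auto split: list.splits)
    show "s' (sm d x) = sm d (s' x)" for d x
      unfolding fun_eq_iff s'_def e lin_sm[OF ls] by (auto simp: sm_apply split: list.splits)
  qed
  have 2: "kd (A # fs) (s' x) l + s' (kd (A # fs) x) l = c * x l" if l: "l \<in> idx (A # fs)" for x l
  proof -
    obtain b k l' where l': "l = (b, k) # l'" "k < dim_row A" "l' \<in> idx fs" using l by auto
    define X where "X b k = (\<lambda>l''. x ((b, k) # l''))" for b k
    have sT: "(\<lambda>l''. s' x ((True, k) # l'')) = - s (X True k)" and sF: "(\<lambda>l''. s' x ((False, k) # l'')) = s (X False k)" for k
      by (auto simp: fun_eq_iff s'_def X_def)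
    have T: "(\<lambda>l''. kd (A # fs) x ((True, k) # l'')) = - kd fs (X True k)" for k
      by (auto simp: fun_eq_iff X_def)
    have F: "(\<lambda>l''. kd (A # fs) x ((False, k) # l'')) = kd fs (X False k) + (\<Sum>j<dim_row A. sm (A $$ (k, j)) (X True j))"
      by (auto simp: fun_eq_iff X_def sum_fun_apply sm_apply)
    show ?thesis
    proof (cases b)
      case True
      have "kd (A # fs) (s' x) l = kd fs (s (X True k)) l'" using l' True sT by (simp add: lin_minus[OF lin_kd])
      moreover have "s' (kd (A # fs) x) l = s (kd fs (X True k)) l'"
        using l' True T by (simp add: s'_def lin_minus[OF ls] del: kd.simps)
      ultimately show ?thesis using sc[OF l'(3), of "X True k"] l' True by (simp add: X_def)
    next
      case False
      have sTl: "s' x ((True, j) # l') = - s (X True j) l'" for j using sT[of j] by (simp add: fun_eq_iff)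
      have "kd (A # fs) (s' x) l = kd fs (s (X False k)) l' - (\<Sum>j<dim_row A. A $$ (k, j) * s (X True j) l')"
        using l' False sF by (simp add: sTl sum_negf)
      moreover have "s' (kd (A # fs) x) l = s (kd fs (X False k)) l' + (\<Sum>j<dim_row A. A $$ (k, j) * s (X True j) l')"
        using l' False F by (simp add: s'_def lin_add[OF ls] lin_sum[OF ls] lin_sm[OF ls] sum_fun_apply sm_apply del: kd.simps)
      ultimately show ?thesis using sc[OF l'(3), of "X False k"] l' False by (simp add: X_def)
    qed
  qed
  have 3: "s' x l \<in> a" if a: "idl a" and l: "l \<in> idx (A # fs)" and x: "\<forall>l'\<in>idx (A # fs). hdeg l' + 1 = hdeg l \<longrightarrow> x l' \<in> a" for a x l
  proof -
    obtain b k l' where l': "l = (b, k) # l'" "k < dim_row A" "l' \<in> idx fs" using l by auto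
    have "s (\<lambda>l''. x ((b, k) # l'')) l' \<in> a" by (rule sl[OF l'(3) a]) (use x l' in auto)
    then show ?thesis using l' by (cases b) (auto simp: s'_def idlD(5)[OF a])
  qed
  have "homotopy (A # fs) c s'" unfolding homotopy_def using 1 2 3 by blast
  then show ?thesis by blast
qed

lemma homotopy_det: "sq fs \<Longrightarrow> A \<in> set fs \<Longrightarrow> \<exists>s. homotopy fs (det A) s"
proof (induction fs)
  case Nil then show ?case by simp
next
  case (Cons C fs)
  have C: "C \<in> carrier_mat (dim_row C) (dim_row C)" "sq fs" using Cons.prems(1) by (simp_all add: sq_Cons)
  show ?case
  proof (cases "A = C")
    case True then show ?thesis using homotopy_head[OF C(1)] by blast
  next
    case False
    then obtain s where "homotopy fs (det A) s" using Cons.IH[OF C(2)] Cons.prems(2) by auto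
    then show ?thesis by (rule homotopy_tail)
  qed
qed

section \<open>Ideals generated by a list over a base ideal\<close>

definition adjoin :: "'p::comm_ring_1 set \<Rightarrow> 'p \<Rightarrow> 'p set" where
  "adjoin J x = {c. \<exists>e. c - e * x \<in> J}"

text \<open>The preimage in \<open>P\<close> of the ideal of \<open>P / a\<close> generated by the
  list. The recursion follows that of \<open>kd\<close>, whose image in degree 0 it describes in
  \<open>Jd_kd\<close>; the base \<open>a\<close> makes a change of the ground ring visible in
  \<open>Jd_adjoin\<close>.\<close>

fun Jd :: "'p::comm_ring_1 set \<Rightarrow> 'p list \<Rightarrow> 'p set" where
  "Jd a [] = a"
| "Jd a (d # ds) = adjoin (Jd a ds) d"

lemma idl_adjoin: assumes J: "idl J" shows "idl (adjoin J x)"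
proof -
  have "0 \<in> adjoin J x" unfolding adjoin_def mem_Collect_eq by (rule exI[of _ 0]) (simp add: idlD(1)[OF J])
  moreover have "c + c' \<in> adjoin J x" if cc: "c \<in> adjoin J x" "c' \<in> adjoin J x" for c c'
  proof -
    obtain e e' where "c - e * x \<in> J" "c' - e' * x \<in> J" using cc unfolding adjoin_def by blast
    from idlD(2)[OF J this] show ?thesis unfolding adjoin_def mem_Collect_eq
      by (intro exI[of _ "e + e'"]) (simp add: algebra_simps)
  qed
  moreover have "u * c \<in> adjoin J x" if c: "c \<in> adjoin J x" for c u
  proof -
    obtain e where "c - e * x \<in> J" using c unfolding adjoin_def by blast
    from idlD(3)[OF J this, of u] show ?thesis unfolding adjoin_def mem_Collect_eq
      by (intro exI[of _ "u * e"]) (simp add: algebra_simps)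
  qed
  ultimately show ?thesis unfolding idl_def by blast
qed

lemma adjoin_sup: "J \<subseteq> adjoin J x"
  unfolding adjoin_def by (auto intro!: exI[of _ 0])

lemma adjoin_self: "idl J \<Longrightarrow> x \<in> adjoin J x"
  unfolding adjoin_def mem_Collect_eq by (rule exI[of _ 1]) (simp add: idlD)

lemma adjoin_least: "idl K \<Longrightarrow> J \<subseteq> K \<Longrightarrow> x \<in> K \<Longrightarrow> adjoin J x \<subseteq> K"
  unfolding adjoin_def using idl_diff_cancel[of K] idlD(3)[of K x] by blast

lemma adjoin_commute: "adjoin (adjoin J x) y = adjoin (adjoin J y) x"
proof -
  have "c - e * y - f * x = c - f * x - e * y" for c e f :: 'a by simp
  then show ?thesis unfolding adjoin_def mem_Collect_eq by metis
qed

lemma adjoin_mono: "J \<subseteq> K \<Longrightarrow> adjoin J x \<subseteq> adjoin K x"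
  unfolding adjoin_def by blast

lemma idl_Jd: "idl a \<Longrightarrow> idl (Jd a ds)"
  by (induction ds) (auto simp: idl_adjoin)

lemma Jd_sup: "a \<subseteq> Jd a ds"
proof (induction ds)
  case (Cons d ds) then show ?case using adjoin_sup[of "Jd a ds" d] by simp
qed simp

lemma Jd_mem: "idl a \<Longrightarrow> d \<in> set ds \<Longrightarrow> d \<in> Jd a ds"
  using adjoin_sup[of "Jd a _"] by (induction ds) (auto simp: adjoin_self idl_Jd)

lemma Jd_least: "idl K \<Longrightarrow> a \<subseteq> K \<Longrightarrow> set ds \<subseteq> K \<Longrightarrow> Jd a ds \<subseteq> K"
  by (induction ds) (simp_all add: adjoin_least)

lemma Jd_adjoin: "Jd (adjoin a x) ds = adjoin (Jd a ds) x"
  by (induction ds) (simp_all add: adjoin_commute)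

lemma Jd_mono: "a \<subseteq> b \<Longrightarrow> Jd a ds \<subseteq> Jd b ds"
  by (induction ds) (simp_all add: adjoin_mono)

lemma Jd_snoc: "Jd a (ds @ [d]) = Jd a (d # ds)"
  by (induction ds) (simp_all add: adjoin_commute)

lemma Jd_kills:
  assumes B: "submod B" "base a I \<subseteq> B" and a: "idl a"
  shows "(\<And>d. d \<in> set ds \<Longrightarrow> sm d z \<in> B) \<Longrightarrow> c \<in> Jd a ds \<Longrightarrow> sm c z \<in> B"
proof (induction ds arbitrary: c)
  case Nil then show ?case using base_sm[OF a] B(2) by auto
next
  case (Cons d ds)
  then obtain e where e: "c - e * d \<in> Jd a ds" by (auto simp: adjoin_def)
  have "sm (c - e * d) z \<in> B" using Cons.IH[OF _ e] Cons.prems(1) by simp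
  moreover have "sm (e * d) z \<in> B" using submod_sm[OF B(1) Cons.prems(1)[of d], of e] by (simp add: sm_sm)
  moreover have "sm c z = sm (c - e * d) z + sm (e * d) z" by (simp add: sm_add_left[symmetric])
  ultimately show ?case using submod_add[OF B(1)] by metis
qed

lemma sm_sum_left: "sm (\<Sum>i\<in>I. f i) v = (\<Sum>i\<in>I. sm (f i) v)"
  by (simp add: fun_eq_iff sm_apply sum_fun_apply sum_distrib_right)

text \<open>If \<open>c\<close> kills the cokernel of \<open>A\<close> on \<open>M\<^sup>r\<close> then \<open>c\<^sup>r\<close> kills \<open>M / det A M\<close>: by
  Laplace expansion, \<open>c det N v\<close> is a combination of elements \<open>det N' w\<close> where \<open>N'\<close> arises
  from \<open>N\<close> by replacing a column by one of \<open>A\<close>. Starting from the identity matrix, all columns are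
  replaced after \<open>r\<close> steps.\<close>

lemma coker_det:
  fixes A :: "'p::comm_ring_1 mat" and Z B :: "('i \<Rightarrow> 'p) set"
  assumes A: "A \<in> carrier_mat r r" and s: "submod Z" "submod B"
    and c: "\<And>z. z \<in> pw r Z \<Longrightarrow> sm c z \<in> msum (mact A ` pw r Z) (pw r B)" and v: "v \<in> Z"
  shows "sm (c ^ r) v \<in> msum (sm (det A) ` Z) B"
proof -
  let ?T = "msum (sm (det A) ` Z) B"
  have T: "submod ?T" by (intro submod_msum submod_image lin_sm_const s)
  define G where "G t = {N. N \<in> carrier_mat r r \<and> (\<forall>j<t. \<exists>w. \<forall>i<r. N $$ (i, j) = (\<Sum>k<r. A $$ (i, k) * w k))}" for t :: nat
  \<comment> \<open>\<open>t\<close> counts the columns still to be replaced. For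
    \<open>t = r\<close> nothing is required of \<open>N\<close>, and the identity matrix gives the
    claim.\<close>
  have "t \<le> r \<Longrightarrow> N \<in> G (r - t) \<Longrightarrow> v \<in> Z \<Longrightarrow> sm (c ^ t * det N) v \<in> ?T" for t N v
  proof (induction t arbitrary: N v)
    case 0
    then have N: "N \<in> carrier_mat r r" and "\<forall>j. \<exists>w. j < r \<longrightarrow> (\<forall>i<r. N $$ (i, j) = (\<Sum>k<r. A $$ (i, k) * w k))"
      by (auto simp: G_def)
    from choice[OF this(2)] obtain w where w: "\<And>i j. j < r \<Longrightarrow> i < r \<Longrightarrow> N $$ (i, j) = (\<Sum>k<r. A $$ (i, k) * w j k)" by blast
    \<comment> \<open>All columns of \<open>N\<close> are combinations of columns of
      \<open>A\<close>, so \<open>N\<close> factors as \<open>A * C\<close> and \<open>det A\<close>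
      splits off.\<close>
    define C where "C = mat r r (\<lambda>(k, j). w j k)"
    have C: "C \<in> carrier_mat r r" by (simp add: C_def)
    have "N = A * C" by (rule eq_matI) (use N A w in \<open>auto simp: C_def scalar_prod_def lessThan_atLeast0\<close>)
    then have "sm (det N) v = sm (det A) (sm (det C) v)" by (simp add: det_mult[OF A C] sm_sm)
    then show ?case using msumI[OF imageI[OF submod_sm[OF s(1) 0(3)]] submod_0[OF s(2)], of "sm (det A)"] by simp
  next
    case (Suc t)
    define j where "j = r - Suc t"
    have j: "j < r" "r - t = Suc j" "N \<in> G j" using Suc.prems by (auto simp: j_def)
    have N: "N \<in> carrier_mat r r" using j(3) by (simp add: G_def)
    \<comment> \<open>Column \<open>j\<close> of \<open>N\<close> times \<open>v\<close>. Expanding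
      \<open>c * det N\<close> along this column involves \<open>v\<close> only through
      \<open>sm c z\<close>, which the hypothesis rewrites as \<open>A w + b\<close>: the first
      summand produces the matrices \<open>N' k\<close>, the second stays in
      \<open>B\<close>.\<close>
    define z where "z = (\<lambda>(i, x). N $$ (i, j) * v x)"
    have slz: "sl z i = sm (N $$ (i, j)) v" for i by (simp add: sl_def z_def sm_def)
    have "z \<in> pw r Z" by (rule pwI) (simp add: slz submod_sm[OF s(1) Suc.prems(3)])
    from c[OF this] obtain w b where w: "w \<in> pw r Z" "b \<in> pw r B" "sm c z = mact A w + b" by (auto elim!: msumE)
    define N' where "N' k = mat r r (\<lambda>(i, l). if l = j then A $$ (i, k) else N $$ (i, l))" for k
    have N': "N' k \<in> carrier_mat r r" for k by (simp add: N'_def)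
    have N'G: "N' k \<in> G (r - t)" if k: "k < r" for k
    proof -
      have "\<exists>w. \<forall>i<r. N' k $$ (i, l) = (\<Sum>k<r. A $$ (i, k) * w k)" if l: "l < Suc j" for l
      proof (cases "l = j")
        case True
        have "N' k $$ (i, l) = (\<Sum>k'<r. A $$ (i, k') * (if k' = k then 1 else 0))" if "i < r" for i
        proof -
          have "(\<Sum>k'<r. A $$ (i, k') * (if k' = k then 1 else 0)) = (\<Sum>k'<r. if k' = k then A $$ (i, k') else 0)"
            by (rule sum.cong) auto
          then show ?thesis using that True j k by (simp add: N'_def)
        qed
        then show ?thesis by (intro exI[of _ "\<lambda>k'. if k' = k then 1 else 0"]) simp
      next
        case False
        then have "l < j" using l by simp
        then have "\<exists>w. \<forall>i<r. N $$ (i, l) = (\<Sum>k<r. A $$ (i, k) * w k)" using j(3) by (simp add: G_def)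
        then obtain w where "\<forall>i<r. N $$ (i, l) = (\<Sum>k<r. A $$ (i, k) * w k)" ..
        then show ?thesis using False l j by (intro exI[of _ w]) (auto simp: N'_def)
      qed
      then show ?thesis using N' by (simp add: G_def j(2))
    qed
    have cof: "cofactor (N' k) i j = cofactor N i j" if "i < r" for i k
    proof -
      have "mat_delete (N' k) i j = mat_delete N i j"
        by (rule eq_matI) (use N j in \<open>auto simp: mat_delete_def N'_def\<close>)
      then show ?thesis by (simp add: cofactor_def)
    qed
    have dN: "det N = (\<Sum>i<r. N $$ (i, j) * cofactor N i j)" by (rule laplace_expansion_column[OF N j(1)])
    have dN': "det (N' k) = (\<Sum>i<r. A $$ (i, k) * cofactor N i j)" for k
      using laplace_expansion_column[OF N' j(1), of k] j by (simp add: cof) (simp add: N'_def)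
    have dc: "dim_row A = r" "dim_col A = r" using A by auto
    have "sm (c * det N) v = (\<Sum>i<r. sm (cofactor N i j) (sl (sm c z) i))"
      unfolding dN by (simp add: fun_eq_iff sm_apply sum_fun_apply sl_sm slz sum_distrib_left sum_distrib_right algebra_simps)
    also have "\<dots> = (\<Sum>i<r. sm (cofactor N i j) (\<Sum>k<r. sm (A $$ (i, k)) (sl w k))) + (\<Sum>i<r. sm (cofactor N i j) (sl b i))"
      unfolding w(3) by (simp add: sl_add sl_mact dc sm_add sum.distrib)
    also have "(\<Sum>i<r. sm (cofactor N i j) (\<Sum>k<r. sm (A $$ (i, k)) (sl w k))) = (\<Sum>k<r. sm (det (N' k)) (sl w k))"
    proof -
      have "(\<Sum>i<r. sm (cofactor N i j) (\<Sum>k<r. sm (A $$ (i, k)) (sl w k))) = (\<Sum>i<r. \<Sum>k<r. sm (cofactor N i j * A $$ (i, k)) (sl w k))"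
        by (simp add: sm_sum sm_sm)
      also have "\<dots> = (\<Sum>k<r. \<Sum>i<r. sm (cofactor N i j * A $$ (i, k)) (sl w k))" by (rule sum.swap)
      also have "\<dots> = (\<Sum>k<r. sm (det (N' k)) (sl w k))"
        unfolding dN' sm_sum_left by (simp only: mult.commute)
      finally show ?thesis .
    qed
    finally have e: "sm (c * det N) v = (\<Sum>k<r. sm (det (N' k)) (sl w k)) + (\<Sum>i<r. sm (cofactor N i j) (sl b i))" .
    have "sm (c ^ Suc t * det N) v = sm (c ^ t) (sm (c * det N) v)" by (simp add: sm_sm algebra_simps)
    also have "\<dots> = (\<Sum>k<r. sm (c ^ t * det (N' k)) (sl w k)) + sm (c ^ t) (\<Sum>i<r. sm (cofactor N i j) (sl b i))"
      unfolding e by (simp add: sm_add sm_sum sm_sm)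
    also have "\<dots> \<in> ?T"
    proof (rule submod_add[OF T])
      show "(\<Sum>k<r. sm (c ^ t * det (N' k)) (sl w k)) \<in> ?T"
      proof (rule submod_sum[OF T])
        fix k assume "k \<in> {..<r}"
        then have k: "k < r" by simp
        show "sm (c ^ t * det (N' k)) (sl w k) \<in> ?T"
          by (rule Suc.IH[OF _ N'G[OF k] pwD[OF w(1) k]]) (use Suc.prems in simp)
      qed
      have "sm (c ^ t) (\<Sum>i<r. sm (cofactor N i j) (sl b i)) \<in> B"
        by (intro submod_sm[OF s(2)] submod_sum[OF s(2)] pwD[OF w(2)]) simp
      then show "sm (c ^ t) (\<Sum>i<r. sm (cofactor N i j) (sl b i)) \<in> ?T"
        using msum_right[OF submod_image[OF lin_sm_const s(1)], of B "det A"] by blast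
    qed
    finally show ?case .
  qed
  from this[of r "1\<^sub>m r" v] show ?thesis using v by (simp add: G_def)
qed

section \<open>Koszul complexes of one-by-one matrices\<close>

definition detm :: "'p::comm_ring_1 mat \<Rightarrow> 'p mat" where
  "detm A = mat 1 1 (\<lambda>_. det A)"

lemma detm [simp]: "detm A \<in> carrier_mat 1 1" "dim_row (detm A) = 1" "det (detm A) = det A"
proof -
  show 1: "detm A \<in> carrier_mat 1 1" "dim_row (detm A) = 1" by (auto simp: detm_def)
  show "det (detm A) = det A" using det_single[of "detm A"] 1 by (simp add: detm_def)
qed

lemma detm_carrier_Suc [simp]: "detm A \<in> carrier_mat (Suc 0) (Suc 0)"
  using detm(1) by simp

lemma map_det_detm [simp]: "map (det \<circ> detm) fs = map det fs"
  by simp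

lemma sq_detm: "sq (map detm fs)"
  by (auto simp: sq_def)

definition l0 :: "nat \<Rightarrow> (bool \<times> nat) list" where
  "l0 q = replicate q (False, 0)"

lemma idx_detm_hdeg0: "l \<in> idx (map detm fs) \<Longrightarrow> hdeg l = 0 \<longleftrightarrow> l = l0 (length fs)"
proof (induction fs arbitrary: l)
  case Nil then show ?case by (simp add: l0_def)
next
  case (Cons A fs)
  then obtain b l' where l: "l = (b, 0) # l'" "l' \<in> idx (map detm fs)" by auto
  then show ?case using Cons.IH[OF l(2)] hdeg_bounds[OF l(2)] by (auto simp: l0_def)
qed

lemma l0_idx: "l0 (length fs) \<in> idx (map detm fs)"
  by (induction fs) (auto simp: l0_def)

text \<open>For one-by-one matrices \<open>l0\<close> is the only index of degree 0, and the
  differential into it is the row of determinants.\<close>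

lemma Jd_kd: "c \<in> Jd a (map det fs) \<longleftrightarrow> (\<exists>y. c - kd (map detm fs) y (l0 (length fs)) \<in> a)"
proof (induction fs arbitrary: c)
  case Nil then show ?case by (simp add: l0_def)
next
  case (Cons A fs)
  have e: "kd (map detm (A # fs)) y (l0 (length (A # fs))) =
     kd (map detm fs) (\<lambda>l. y ((False, 0) # l)) (l0 (length fs)) + det A * y ((True, 0) # l0 (length fs))" for y
    by (simp add: l0_def detm_def)
  show ?case
  proof
    assume "c \<in> Jd a (map det (A # fs))"
    then obtain u where "c - u * det A \<in> Jd a (map det fs)" by (auto simp: adjoin_def)
    then obtain y where y: "c - u * det A - kd (map detm fs) y (l0 (length fs)) \<in> a" using Cons by blast
    define y' where "y' l = (case l of [] \<Rightarrow> 0 | (b, k) # l' \<Rightarrow> if b then u else y l')" for l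
    have "c - kd (map detm (A # fs)) y' (l0 (length (A # fs))) \<in> a"
      unfolding e using y by (simp add: y'_def algebra_simps)
    then show "\<exists>y. c - kd (map detm (A # fs)) y (l0 (length (A # fs))) \<in> a" by blast
  next
    assume "\<exists>y. c - kd (map detm (A # fs)) y (l0 (length (A # fs))) \<in> a"
    then obtain y where "c - kd (map detm (A # fs)) y (l0 (length (A # fs))) \<in> a" by blast
    then have "c - y ((True, 0) # l0 (length fs)) * det A - kd (map detm fs) (\<lambda>l. y ((False, 0) # l)) (l0 (length fs)) \<in> a"
      unfolding e by (simp add: algebra_simps)
    then show "c \<in> Jd a (map det (A # fs))" using Cons by (auto simp: adjoin_def)
  qed
qed

text \<open>Functions on \<open>unit\<close> stand for the ring as a module over itself; evaluation
  at the only index of degree 0 gives the isomorphism.\<close>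

lemma hlen_zero_detm:
  fixes a :: "'p::comm_ring_1 set"
  assumes a: "idl a"
  shows "hlen a (map detm fs) 0 = len UNIV {x :: unit \<Rightarrow> 'p. x () \<in> Jd a (map det fs)}"
  unfolding hlen_def
proof (rule len_iso[where f = "\<lambda>x _. x (l0 (length fs))"])
  have J: "idl (Jd a (map det fs))" by (rule idl_Jd[OF a])
  show "lin (\<lambda>x (_::unit). x (l0 (length fs)))" by (rule linI) (auto simp: fun_eq_iff sm_apply)
  show "submod {x :: unit \<Rightarrow> 'p. x () \<in> Jd a (map det fs)}" by (rule submodI) (auto simp: sm_apply idlD[OF J])
  have Z: "Zc a (map detm fs) 0 = UNIV" using hdeg_bounds by (fastforce simp: Zc_def)
  show "UNIV \<subseteq> msum ((\<lambda>x _. x (l0 (length fs))) ` Zc a (map detm fs) 0) {x :: unit \<Rightarrow> 'p. x () \<in> Jd a (map det fs)}"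
  proof
    fix y :: "unit \<Rightarrow> 'p"
    have y: "y = (\<lambda>_. y ())" by auto
    have "(\<lambda>_. y ()) \<in> (\<lambda>x (_::unit). x (l0 (length fs))) ` Zc a (map detm fs) 0"
      unfolding Z by (rule image_eqI[where x = "\<lambda>_. y ()"]) auto
    then have "y \<in> (\<lambda>x (_::unit). x (l0 (length fs))) ` Zc a (map detm fs) 0" using y by simp
    from msumI[OF this, of 0 "{x :: unit \<Rightarrow> 'p. x () \<in> Jd a (map det fs)}"] idlD(1)[OF J]
    show "y \<in> msum ((\<lambda>x _. x (l0 (length fs))) ` Zc a (map detm fs) 0) {x :: unit \<Rightarrow> 'p. x () \<in> Jd a (map det fs)}" by simp
  qed
  fix z :: "(bool \<times> nat) list \<Rightarrow> 'p"
  have "z \<in> Bc a (map detm fs) 0 \<longleftrightarrow> (\<exists>y. z (l0 (length fs)) - kd (map detm fs) y (l0 (length fs)) \<in> a)"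
    unfolding Bc_def using idx_detm_hdeg0[of _ fs] l0_idx[of fs] by auto
  then show "(\<lambda>_. z (l0 (length fs))) \<in> {x :: unit \<Rightarrow> 'p. x () \<in> Jd a (map det fs)} \<longleftrightarrow> z \<in> Bc a (map detm fs) 0"
    by (simp add: Jd_kd)
qed (use submod_Zc[OF a] Bc_sub_Zc[OF a] in auto)

section \<open>Koszul complexes over a Noetherian local ring\<close>

context noeth_loc begin

text \<open>By \<open>colength_finite_iff_primary_dets\<close> this is finite colength of the ideal
  of determinants, the unit ideal included. The form with powers is the one that combines with
  null-homotopies.\<close>

definition primary_dets :: "'p mat list \<Rightarrow> bool" where
  "primary_dets fs \<longleftrightarrow> (\<forall>x\<in>m. \<exists>k. x ^ k \<in> Jd a (map det fs))"

lemma det_kills: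
  assumes "sq fs" "A \<in> set fs" "z \<in> Zc a fs n" shows "sm (det A) z \<in> Bc a fs n"
  using homotopy_det[OF assms(1,2)] homotopy_kills[OF _ a assms(3)] by blast

lemma Jd_det_kills:
  assumes "sq fs" "c \<in> Jd a (map det fs)" "z \<in> Zc a fs n" shows "sm c z \<in> Bc a fs n"
  by (rule Jd_kills[OF submod_Bc[OF a] base_Bc[OF a] a _ assms(2)]) (use det_kills[OF assms(1) _ assms(3)] in auto)

lemma primary_dets_tors: assumes "sq fs" "primary_dets fs" shows "tors m (Zc a fs n) (Bc a fs n)"
  unfolding tors_def using assms(2)[unfolded primary_dets_def] Jd_det_kills[OF assms(1)] by blast

text \<open>The homology of the tail need not have finite length, as the determinants of the tail
  alone need not have finite colength. They kill that homology nevertheless, so a power of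
  \<open>x\<close> acts on it as a multiple of \<open>det A\<close>.\<close>

lemma primary_dets_dtors: assumes "sq fs" "primary_dets (A # fs)" shows "dtors (Zc a fs n) (Bc a fs n) (det A)"
  unfolding dtors_def
proof
  fix x assume "x \<in> m"
  then obtain k e where ke: "x ^ k - e * det A \<in> Jd a (map det fs)" using assms(2) unfolding primary_dets_def by (auto simp: adjoin_def)
  have "sm (x ^ k) z - sm (e * det A) z \<in> Bc a fs n" if "z \<in> Zc a fs n" for z
  proof -
    have "sm (x ^ k) z - sm (e * det A) z = sm (x ^ k - e * det A) z" by (simp add: fun_eq_iff sm_apply algebra_simps)
    then show ?thesis using Jd_det_kills[OF assms(1) ke that] by simp
  qed
  then show "\<exists>k e. \<forall>z\<in>Zc a fs n. sm (x ^ k) z - sm (e * det A) z \<in> Bc a fs n" by blast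
qed

lemma hlen_finite_iff: "hlen a fs n \<noteq> \<infinity> \<longleftrightarrow> tors m (Zc a fs n) (Bc a fs n)"
  unfolding hlen_def using tors_finite_length[OF finite_idx submod_Zc[OF a] submod_Bc[OF a] base_Bc[OF a] Bc_sub_Zc[OF a]]
    finite_length_tors[OF finite_idx submod_Zc[OF a] submod_Bc[OF a] base_Bc[OF a] Bc_sub_Zc[OF a]] by blast

lemma primary_dets_hlen_finite: "sq fs \<Longrightarrow> primary_dets fs \<Longrightarrow> hlen a fs n \<noteq> \<infinity>"
  using primary_dets_tors hlen_finite_iff by blast

section \<open>Euler characteristics and finiteness of the coordinate complexes\<close>

definition chi :: "'p mat list \<Rightarrow> int" where
  "chi fs = (\<Sum>k\<le>length fs. (- 1) ^ k * int (the_enat (hlen a fs (int k))))"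

text \<open>By \<open>hlen_Cons\<close> each length is a cokernel in degree \<open>k\<close> plus a
  kernel in degree \<open>k - 1\<close>; the shift by one gives the kernels the opposite sign, and
  the two collect to \<open>eul\<close>.\<close>

lemma chi_Cons:
  assumes sq: "sq (A # fs)" and primary_dets: "primary_dets (A # fs)"
  shows "chi (A # fs) = (\<Sum>k\<le>length fs. (- 1) ^ k *
    eul (mact A) (pw (dim_row A) (Zc a fs (int k))) (pw (dim_row A) (Bc a fs (int k))))"
proof -
  have A: "A \<in> carrier_mat (dim_row A) (dim_row A)" using sq by (simp add: sq_Cons)
  let ?q = "length fs"
  define c where "c n = cokl (mact A) (pw (dim_row A) (Zc a fs n)) (pw (dim_row A) (Bc a fs n))" for n
  define h where "h n = kerl (mact A) (pw (dim_row A) (Zc a fs n)) (pw (dim_row A) (Bc a fs n))" for n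
  have hl: "hlen a (A # fs) n = c n + h (n - 1)" for n unfolding c_def h_def by (rule hlen_Cons[OF a A])
  have fin: "c n + h (n - 1) \<noteq> \<infinity>" for n using primary_dets_hlen_finite[OF sq primary_dets, of n] hl by simp
  have fc: "c n \<noteq> \<infinity>" for n using fin[of n] by (metis plus_eq_infty_iff_enat)
  have fh: "h n \<noteq> \<infinity>" for n using fin[of "n + 1"] by (metis plus_eq_infty_iff_enat add_diff_cancel_right')
  have hl': "int (the_enat (hlen a (A # fs) n)) = int (the_enat (c n)) + int (the_enat (h (n - 1)))" for n
    using fc[of n] fh[of "n - 1"] unfolding hl by auto
  have B: "Bc a fs n = UNIV" if "n < 0 \<or> n > int ?q" for n using Bc_outside[OF that] by auto
  have pU: "pw r UNIV = UNIV" for r :: nat by (auto simp: pw_def)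
  have BU: "Zc a fs n = UNIV" if "n < 0 \<or> n > int ?q" for n using B[OF that] Bc_sub_Zc[OF a, of fs n] by auto
  \<comment> \<open>Outside the degrees from 0 to \<open>length fs\<close> cycles and boundaries are
    everything, which disposes of the terms at both ends of the shifted sum.\<close>
  have h0: "h (- 1) = 0" unfolding h_def using B[of "-1"] BU[of "-1"] by (simp add: kerl_def pU)
  have c0: "c (1 + int ?q) = 0"
  proof -
    have "endo (mact A) (UNIV :: (nat \<times> (bool \<times> nat) list \<Rightarrow> 'p) set) UNIV" by (rule endoI[OF lin_mact]) auto
    then have "cokl (mact A) (UNIV :: (nat \<times> (bool \<times> nat) list \<Rightarrow> 'p) set) UNIV = 0"
      by (rule cokl_inverse[where g = "\<lambda>x. x"]) auto
    then show ?thesis unfolding c_def using B[of "1 + int ?q"] BU[of "1 + int ?q"] by (simp add: pU)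
  qed
  have "chi (A # fs) = (\<Sum>k\<le>Suc ?q. (- 1) ^ k * int (the_enat (c (int k)))) +
      (\<Sum>k\<le>Suc ?q. (- 1) ^ k * int (the_enat (h (int k - 1))))"
    unfolding chi_def hl' by (simp add: algebra_simps sum.distrib del: sum.atMost_Suc)
  also have "(\<Sum>k\<le>Suc ?q. (- 1) ^ k * int (the_enat (c (int k)))) = (\<Sum>k\<le>?q. (- 1) ^ k * int (the_enat (c (int k))))"
    using c0 by (simp add: zero_enat_def)
  also have "(\<Sum>k\<le>Suc ?q. (- 1) ^ k * int (the_enat (h (int k - 1)))) = - (\<Sum>k\<le>?q. (- 1) ^ k * int (the_enat (h (int k))))"
    using h0 by (simp add: sum.atMost_Suc_shift sum_negf zero_enat_def del: sum.atMost_Suc)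
  finally show ?thesis unfolding eul_def c_def[symmetric] h_def[symmetric]
    by (simp add: algebra_simps sum_subtractf)
qed

text \<open>By \<open>eul_det\<close> either side is the alternating sum of the Euler
  characteristics of multiplication by \<open>det A\<close> on the homology of
  \<open>fs\<close>.\<close>

lemma chi_Cons_detm:
  assumes sq: "sq (A # fs)" and primary_dets: "primary_dets (A # fs)"
  shows "chi (A # fs) = chi (detm A # fs)"
proof -
  have A: "A \<in> carrier_mat (dim_row A) (dim_row A)" and sqf: "sq fs" using sq by (simp_all add: sq_Cons)
  have sq': "sq (detm A # fs)" and prim': "primary_dets (detm A # fs)" using sqf primary_dets by (simp_all add: sq_Cons primary_dets_def)
  have e: "eul (mact C) (pw r (Zc a fs n)) (pw r (Bc a fs n)) = eul (sm (det C)) (Zc a fs n) (Bc a fs n)"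
    if "C \<in> carrier_mat r r" "det C = det A" for C r n
    by (rule eul_det[OF finite_idx submod_Zc[OF a] submod_Bc[OF a] Bc_sub_Zc[OF a] base_Bc[OF a] that(1)])
      (use primary_dets_dtors[OF sqf primary_dets] that(2) in simp)
  show ?thesis unfolding chi_Cons[OF sq primary_dets] chi_Cons[OF sq' prim'] using e[OF A] e[OF detm(1)] by simp
qed

lemma primary_dets_rotate: "primary_dets (A # fs) \<longleftrightarrow> primary_dets (fs @ [A])"
  unfolding primary_dets_def using Jd_snoc[of a "map det fs" "det A"] by simp

lemma chi_rotate: "chi (A # fs) = chi (fs @ [A])"
  unfolding chi_def using hlen_rotate[OF a] by simp

text \<open>\<open>ys\<close> accumulates the factors already rotated. Both premises survive a step,
  since \<open>detm A\<close> is square with the determinant of \<open>A\<close>.\<close>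

lemma chi_detm_append:
  "sq (xs @ ys) \<Longrightarrow> primary_dets (xs @ ys) \<Longrightarrow> chi (xs @ ys) = chi (ys @ map detm xs)"
proof (induction xs arbitrary: ys)
  case Nil then show ?case by simp
next
  case (Cons A xs)
  have 1: "sq (xs @ ys @ [detm A])" using Cons.prems(1) by (auto simp: sq_def)
  have 2: "primary_dets (xs @ ys @ [detm A])"
    using Cons.prems(2) primary_dets_rotate[of "detm A" "xs @ ys"] by (simp add: primary_dets_def)
  have "chi ((A # xs) @ ys) = chi (detm A # xs @ ys)" using chi_Cons_detm[of A "xs @ ys"] Cons.prems by simp
  also have "\<dots> = chi (xs @ ys @ [detm A])" using chi_rotate[of "detm A" "xs @ ys"] by simp
  also have "\<dots> = chi (ys @ map detm (A # xs))" using Cons.IH[OF 1 2] by simp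
  finally show ?case .
qed

theorem chi_map_detm: "sq fs \<Longrightarrow> primary_dets fs \<Longrightarrow> chi fs = chi (map detm fs)"
  using chi_detm_append[of fs "[]"] by simp

text \<open>The cokernel of \<open>A\<close> on a power of the tail's homology in degree 0 has
  finite length; \<open>coker_det\<close> converts this into the same for \<open>det A\<close>. In
  degree -1 there is no kernel to be added.\<close>

lemma hlen_zero_Cons_detm:
  assumes sq: "sq (A # fs)" and fin: "hlen a (A # fs) 0 \<noteq> \<infinity>"
  shows "hlen a (detm A # fs) 0 \<noteq> \<infinity>"
proof -
  have A: "A \<in> carrier_mat (dim_row A) (dim_row A)" using sq by (simp add: sq_Cons)
  let ?r = "dim_row A" and ?Z = "Zc a fs 0" and ?B = "Bc a fs 0"
  note sZ = submod_Zc[OF a] and sB = submod_Bc[OF a] and BZ = Bc_sub_Zc[OF a]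
  have finI: "finite ({..<k} \<times> idx fs)" for k :: nat using finite_idx[of fs] by simp
  have "cokl (mact A) (pw ?r ?Z) (pw ?r ?B) \<noteq> \<infinity>"
    using fin unfolding hlen_Cons[OF a A] by (metis plus_eq_infty_iff_enat)
  then have t: "tors m (pw ?r ?Z) (msum (mact A ` pw ?r ?Z) (pw ?r ?B))"
    unfolding cokl_def
    using finite_length_tors[OF finI submod_pw[OF sZ] endo_image(1)[OF endo_mact[OF A sZ sB BZ]] _ endo_image(2)[OF endo_mact[OF A sZ sB BZ]]]
      base_pw[OF base_Bc[OF a, of fs 0], of ?r] endo_image(3)[OF endo_mact[OF A sZ sB BZ]] by (meson order_trans)
  note e1 = endo_mact[OF detm(1)[of A] sZ[of fs 0] sB[of fs 0] BZ[of fs 0]]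
  have "tors m (pw 1 ?Z) (msum (mact (detm A) ` pw 1 ?Z) (pw 1 ?B))"
    unfolding tors_def
  proof
    fix x assume "x \<in> m"
    from torsD[OF t this] obtain k where k: "\<forall>z\<in>pw ?r ?Z. sm (x ^ k) z \<in> msum (mact A ` pw ?r ?Z) (pw ?r ?B)" ..
    show "\<exists>k. \<forall>z\<in>pw 1 ?Z. sm (x ^ k) z \<in> msum (mact (detm A) ` pw 1 ?Z) (pw 1 ?B)"
    \<comment> \<open>\<open>coker_det\<close> raises the annihilator \<open>x ^ k\<close> to the
      power of the rank.\<close>
    proof (intro exI[of _ "k * ?r"] ballI)
      fix z assume z: "z \<in> pw 1 ?Z"
      have "sm ((x ^ k) ^ ?r) (sl z 0) \<in> msum (sm (det A) ` ?Z) ?B"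
        by (rule coker_det[OF A sZ sB bspec[OF k] pwD[OF z]]) auto
      then obtain u b where u: "u \<in> ?Z" "b \<in> ?B" "sm (x ^ (k * ?r)) (sl z 0) = sm (det A) u + b"
        by (auto elim!: msumE simp: power_mult)
      define u' where "u' = (\<lambda>(j :: nat, i). u i)"
      have slu: "sl u' j = u" for j by (simp add: sl_def u'_def)
      have "u' \<in> pw 1 ?Z" by (rule pwI) (simp add: slu u(1))
      moreover have "sm (x ^ (k * ?r)) z - mact (detm A) u' \<in> pw 1 ?B"
      proof (rule pwI)
        fix j :: nat assume "j < 1"
        then have j: "j = 0" by simp
        have "sl (mact (detm A) u') 0 = sm (det A) u" by (simp add: sl_mact slu) (simp add: detm_def slu)
        then show "sl (sm (x ^ (k * ?r)) z - mact (detm A) u') j \<in> ?B" using u(2,3) by (simp add: j sl_diff sl_sm)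
      qed
      ultimately show "sm (x ^ (k * ?r)) z \<in> msum (mact (detm A) ` pw 1 ?Z) (pw 1 ?B)"
        using msumI[OF imageI, of u' "pw 1 ?Z" "sm (x ^ (k * ?r)) z - mact (detm A) u'" "pw 1 ?B" "mact (detm A)"] by simp
    qed
  qed
  moreover have "base a ({..<1} \<times> idx fs) \<subseteq> msum (mact (detm A) ` pw 1 ?Z) (pw 1 ?B)"
    using base_pw[OF base_Bc[OF a, of fs 0], of 1] endo_image(3)[OF e1] by (rule order_trans)
  ultimately have "cokl (mact (detm A)) (pw 1 ?Z) (pw 1 ?B) \<noteq> \<infinity>"
    unfolding cokl_def using tors_finite_length[OF finI submod_pw[OF sZ] endo_image(1)[OF e1] _ endo_image(2)[OF e1]] by blast
  moreover have "kerl (mact (detm A)) (pw 1 (Zc a fs (- 1))) (pw 1 (Bc a fs (- 1))) = 0"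
  proof -
    have "Bc a fs (- 1) = UNIV" using Bc_outside[of "-1" fs] by auto
    moreover have "Zc a fs (- 1) = UNIV" using calculation BZ[of fs "-1"] by auto
    ultimately show ?thesis by (simp add: kerl_def pw_def)
  qed
  ultimately show ?thesis using hlen_Cons[OF a, of "detm A" fs 0] by simp
qed

lemma hlen_zero_detm_append:
  "sq (xs @ ys) \<Longrightarrow> hlen a (xs @ ys) 0 \<noteq> \<infinity> \<Longrightarrow> hlen a (ys @ map detm xs) 0 \<noteq> \<infinity>"
proof (induction xs arbitrary: ys)
  case Nil then show ?case by simp
next
  case (Cons A xs)
  have 1: "sq (xs @ ys @ [detm A])" using Cons.prems(1) by (auto simp: sq_def)
  have "hlen a (xs @ ys @ [detm A]) 0 \<noteq> \<infinity>"
    using hlen_zero_Cons_detm[of A "xs @ ys"] Cons.prems hlen_rotate[OF a, of "detm A" "xs @ ys" 0] by simp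
  from Cons.IH[OF 1 this] show ?case by simp
qed

text \<open>Tested on the constant 1, nilpotence on the quotient of the ring becomes membership of
  powers in the ideal.\<close>

lemma colength_finite_iff_primary_dets: "len UNIV {x :: unit \<Rightarrow> 'p. x () \<in> Jd a (map det fs)} \<noteq> \<infinity> \<longleftrightarrow> primary_dets fs"
proof -
  let ?J = "{x :: unit \<Rightarrow> 'p. x () \<in> Jd a (map det fs)}"
  have J: "idl (Jd a (map det fs))" by (rule idl_Jd[OF a])
  have s: "submod ?J" by (rule submodI) (auto simp: sm_apply idlD[OF J])
  have b: "base a {()} \<subseteq> ?J" using Jd_sup[of a] by (auto simp: base_def)
  have "tors m UNIV ?J \<longleftrightarrow> primary_dets fs"
  proof
    assume t: "tors m UNIV ?J"
    show "primary_dets fs" unfolding primary_dets_def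
    proof
      fix x assume "x \<in> m"
      from torsD[OF t this] obtain k where "\<forall>z\<in>UNIV. sm (x ^ k) z \<in> ?J" ..
      then have "sm (x ^ k) (\<lambda>_. 1) \<in> ?J" by blast
      then show "\<exists>k. x ^ k \<in> Jd a (map det fs)" by (auto simp: sm_apply)
    qed
  next
    assume p: "primary_dets fs"
    show "tors m UNIV ?J" unfolding tors_def
    proof
      fix x assume "x \<in> m"
      then obtain k where "x ^ k \<in> Jd a (map det fs)" using p unfolding primary_dets_def by blast
      then show "\<exists>k. \<forall>z\<in>UNIV. sm (x ^ k) z \<in> ?J" using idlD(4)[OF J] by (intro exI[of _ k]) (auto simp: sm_apply)
    qed
  qed
  then show ?thesis
    using tors_finite_length[OF _ submod_UNIV s b] finite_length_tors[OF _ submod_UNIV s b] by auto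
qed

text \<open>Degree 0 alone decides: its finiteness passes to the complex of determinants, where the
  homology in degree 0 is the ring modulo their ideal.\<close>

theorem finite_iff_primary_dets:
  assumes "sq fs" shows "(\<forall>n. hlen a fs (int n) \<noteq> \<infinity>) \<longleftrightarrow> primary_dets fs"
proof
  assume "\<forall>n. hlen a fs (int n) \<noteq> \<infinity>"
  then have "hlen a fs 0 \<noteq> \<infinity>" by (metis of_nat_0)
  then have "hlen a (map detm fs) 0 \<noteq> \<infinity>" using hlen_zero_detm_append[of fs "[]"] assms by simp
  then show "primary_dets fs" unfolding hlen_zero_detm[OF a] colength_finite_iff_primary_dets .
qed (use primary_dets_hlen_finite[OF assms] in blast)

text \<open>A quotient ring is the same type with a larger ideal, so that an induction along a
  regular sequence can stay inside this locale.\<close>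

lemma noeth_loc_mono: assumes "idl b" "a \<subseteq> b" "b \<subseteq> m" shows "noeth_loc b m"
proof
  show "idl b" "idl m" "b \<subseteq> m" "1 \<notin> m" by (fact assms m m1)+
  show "\<exists>e. c * e - 1 \<in> b" if "c \<notin> m" for c using unit[OF that] assms(2) by blast
  show "\<exists>J\<in>S. \<forall>J'\<in>S. J \<subseteq> J' \<longrightarrow> J' = J" if "S \<noteq> {}" "\<And>J. J \<in> S \<Longrightarrow> idl J \<and> b \<subseteq> J" for S
    by (rule idl_max[OF that(1)]) (use that(2) assms(2) in blast)
qed

text \<open>Multiplication by \<open>x\<close> is injective on the homology over \<open>P / a\<close> in degree \<open>n\<close>, because
  the homology over \<open>P / (a, x)\<close> vanishes in degree \<open>n + 1\<close>, and it is nilpotent there.\<close>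

lemma cycles_are_boundaries_step:
  assumes sq: "sq fs" and x: "x \<in> m" and nzd: "\<And>c. x * c \<in> a \<Longrightarrow> c \<in> a"
    and t: "tors m (Zc a fs n) (Bc a fs n)" and H: "Zc (adjoin a x) fs (n + 1) \<subseteq> Bc (adjoin a x) fs (n + 1)"
  shows "Zc a fs n \<subseteq> Bc a fs n"
proof
  have inj: "z \<in> Bc a fs n" if xz: "sm x z \<in> Bc a fs n" for z
  proof -
    obtain y where y: "\<forall>l\<in>idx fs. hdeg l = n \<longrightarrow> x * z l - kd fs y l \<in> a" using BcD[OF xz] by (auto simp: sm_apply)
    \<comment> \<open>The differential of \<open>y\<close> is \<open>x z\<close> modulo
      \<open>a\<close>, so \<open>y\<close> is a cycle modulo \<open>x\<close>.\<close>
    have "y \<in> Zc (adjoin a x) fs (n + 1)"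
    proof (rule ZcI)
      fix l assume l: "l \<in> idx fs" "hdeg l + 1 = n + 1"
      then have "kd fs y l - x * z l \<in> a" using y idlD(5)[OF a, of "x * z l - kd fs y l"] by simp
      then show "kd fs y l \<in> adjoin a x" unfolding adjoin_def mem_Collect_eq by (intro exI[of _ "z l"]) (simp add: mult.commute)
    qed
    then obtain w where w: "\<forall>l\<in>idx fs. hdeg l = n + 1 \<longrightarrow> y l - kd fs w l \<in> adjoin a x" using H BcD by blast
    then have "\<forall>l. \<exists>e. l \<in> idx fs \<longrightarrow> hdeg l = n + 1 \<longrightarrow> y l - kd fs w l - e * x \<in> a" by (auto simp: adjoin_def)
    from choice[OF this] obtain u where u: "\<And>l. l \<in> idx fs \<Longrightarrow> hdeg l = n + 1 \<Longrightarrow> y l - kd fs w l - u l * x \<in> a" by blast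
    show ?thesis
    \<comment> \<open>In the relevant degrees \<open>y = kd w + x u\<close> modulo \<open>a\<close>;
      hence \<open>x z = kd y = x kd u\<close>, and \<open>x\<close> cancels by
      \<open>nzd\<close>.\<close>
    proof (rule BcI[where y = u])
      fix l assume l: "l \<in> idx fs" "hdeg l = n"
      have "kd fs (y - kd fs w - sm x u) l \<in> a"
        by (rule kd_mod[OF a l(1)]) (use u l(2) in \<open>simp add: sm_apply mult.commute\<close>)
      then have "kd fs y l - x * kd fs u l \<in> a" by (simp add: lin_diff[OF lin_kd] lin_sm[OF lin_kd] kd_kd sm_apply)
      moreover have "x * z l - kd fs y l \<in> a" using y l by blast
      ultimately have "(x * z l - kd fs y l) + (kd fs y l - x * kd fs u l) \<in> a" by (intro idlD(2)[OF a])
      then have "x * (z l - kd fs u l) \<in> a" by (simp add: right_diff_distrib)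
      then show "z l - kd fs u l \<in> a" by (rule nzd)
    qed
  qed
  fix z assume z: "z \<in> Zc a fs n"
  from torsD[OF t x] obtain k where k: "\<forall>z\<in>Zc a fs n. sm (x ^ k) z \<in> Bc a fs n" ..
  have "sm (x ^ j) z \<in> Bc a fs n \<Longrightarrow> z \<in> Bc a fs n" for j
  proof (induction j)
    case (Suc j)
    then have "sm x (sm (x ^ j) z) \<in> Bc a fs n" by (simp add: sm_sm)
    then show ?case using inj Suc.IH by blast
  qed simp
  then show "z \<in> Bc a fs n" using k z by blast
qed

end

text \<open>Each element of the regular sequence lowers by one the degree above which the homology
  vanishes, starting from the number of factors. The sequence need not be related to the
  determinants, which only make the homology nilpotent under \<open>m\<close>.\<close>

lemma acyclic_of_regular_sequence:
  "noeth_loc a m \<Longrightarrow> sq fs \<Longrightarrow> (\<forall>x\<in>m. \<exists>k. x ^ k \<in> Jd a (map det fs)) \<Longrightarrow> set xs \<subseteq> m \<Longrightarrow>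
   (\<And>i c. i < length xs \<Longrightarrow> xs ! i * c \<in> Jd a (take i xs) \<Longrightarrow> c \<in> Jd a (take i xs)) \<Longrightarrow>
   int (length fs) - int (length xs) < n \<Longrightarrow> Zc a fs n \<subseteq> Bc a fs n"
proof (induction xs arbitrary: a n)
  case Nil
  then show ?case using Bc_outside[of n fs] by auto
next
  case (Cons x xs)
  interpret noeth_loc a m by fact
  have x: "x \<in> m" using Cons.prems(4) by simp
  have ab: "idl (adjoin a x)" "a \<subseteq> adjoin a x" "adjoin a x \<subseteq> m"
    using idl_adjoin[OF a] adjoin_sup adjoin_least[OF m am x] by auto
  have nl: "noeth_loc (adjoin a x) m" by (rule noeth_loc_mono[OF ab])
  have pr: "\<forall>x'\<in>m. \<exists>k. x' ^ k \<in> Jd (adjoin a x) (map det fs)" using Cons.prems(3) Jd_mono[OF ab(2)] by blast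
  have rg: "c \<in> Jd (adjoin a x) (take i xs)" if "i < length xs" "xs ! i * c \<in> Jd (adjoin a x) (take i xs)" for i c
    using Cons.prems(5)[of "Suc i" c] that by (simp add: Jd_adjoin)
  have "Zc (adjoin a x) fs (n + 1) \<subseteq> Bc (adjoin a x) fs (n + 1)"
    by (rule Cons.IH[OF nl Cons.prems(2) pr _ rg]) (use Cons.prems(4,6) in auto)
  moreover have "tors m (Zc a fs n) (Bc a fs n)"
    by (rule primary_dets_tors[OF Cons.prems(2)]) (use Cons.prems(3) in \<open>simp add: primary_dets_def\<close>)
  moreover have "c \<in> a" if "x * c \<in> a" for c using Cons.prems(5)[of 0 c] that by simp
  ultimately show ?case using cycles_are_boundaries_step[OF Cons.prems(2) x] by blast
qed

context noeth_loc begin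

text \<open>Once the positive degrees vanish, the Euler characteristic is the length in degree 0,
  for \<open>fs\<close> and for \<open>map detm fs\<close> alike; so \<open>chi_map_detm\<close>
  compares these two lengths.\<close>

theorem hlen_regular:
  assumes sq: "sq fs" and primary_dets: "primary_dets fs" and xs: "set xs \<subseteq> m" "length xs = length fs"
    and reg: "\<And>i c. i < length xs \<Longrightarrow> xs ! i * c \<in> Jd a (take i xs) \<Longrightarrow> c \<in> Jd a (take i xs)"
  shows "n > 0 \<Longrightarrow> hlen a fs n = 0" "n > 0 \<Longrightarrow> hlen a (map detm fs) n = 0"
    "hlen a fs 0 = len UNIV {x :: unit \<Rightarrow> 'p. x () \<in> Jd a (map det fs)}"
proof -
  have primd: "primary_dets (map detm fs)" using primary_dets by (simp add: primary_dets_def)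
  have h0: "hlen a gs n = 0" if "n > 0" "sq gs" "primary_dets gs" "length gs = length fs" for n gs
  proof -
    have "Zc a gs n \<subseteq> Bc a gs n"
      by (rule acyclic_of_regular_sequence[OF noeth_loc_axioms that(2) that(3)[unfolded primary_dets_def] xs(1) reg]) (use that xs(2) in auto)
    then have "Zc a gs n = Bc a gs n" using Bc_sub_Zc[OF a] by (rule antisym)
    then show ?thesis unfolding hlen_def using submod_Zc[OF a] by (metis len_self)
  qed
  show "n > 0 \<Longrightarrow> hlen a fs n = 0" using h0[OF _ sq primary_dets refl] .
  show "n > 0 \<Longrightarrow> hlen a (map detm fs) n = 0" by (rule h0[OF _ sq_detm primd]) simp_all
  have c: "chi gs = int (the_enat (hlen a gs 0))" if "sq gs" "primary_dets gs" "length gs = length fs" for gs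
  proof -
    have "(\<Sum>k\<le>length gs. (- 1) ^ k * int (the_enat (hlen a gs (int k)))) = (\<Sum>k\<in>{0}. (- 1) ^ k * int (the_enat (hlen a gs (int k))))"
      by (rule sum.mono_neutral_right) (use h0[OF _ that] in \<open>auto simp: zero_enat_def\<close>)
    then show ?thesis by (simp add: chi_def)
  qed
  have "the_enat (hlen a fs 0) = the_enat (hlen a (map detm fs) 0)"
    using c[OF sq primary_dets] c[OF sq_detm primd] chi_map_detm[OF sq primary_dets] by simp
  then have "hlen a fs 0 = hlen a (map detm fs) 0"
    using primary_dets_hlen_finite[OF sq primary_dets, of 0] primary_dets_hlen_finite[OF sq_detm primd, of 0] by auto
  then show "hlen a fs 0 = len UNIV {x :: unit \<Rightarrow> 'p. x () \<in> Jd a (map det fs)}" by (simp add: hlen_zero_detm[OF a])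
qed

end

section \<open>Every commutative ring is a quotient of a ring given by a type\<close>

text \<open>The integral monoid ring of the multisets over the type of elements maps onto \<open>R\<close>. In the
  image of a multiset, elements outside the carrier are skipped.\<close>

definition mstep :: "('a, 'c) ring_scheme \<Rightarrow> 'a \<Rightarrow> 'a \<Rightarrow> 'a" where
  "mstep R x y = (if x \<in> carrier R \<and> y \<in> carrier R then x \<otimes>\<^bsub>R\<^esub> y else y)"

definition mono_val :: "('a, 'c) ring_scheme \<Rightarrow> 'a multiset \<Rightarrow> 'a" where
  "mono_val R X = fold_mset (mstep R) \<one>\<^bsub>R\<^esub> X"

text \<open>The finitely supported integer functions on multisets form the polynomial ring over the
  integers with one variable per element of the type, and this is evaluation in \<open>R\<close>;
  variables outside the carrier take the value one.\<close>

definition univ_map :: "('a, 'c) ring_scheme \<Rightarrow> ('a multiset \<Rightarrow>\<^sub>0 int) \<Rightarrow> 'a" where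
  "univ_map R p = (\<Oplus>\<^bsub>R\<^esub>X\<in>Poly_Mapping.keys p. add_pow R (Poly_Mapping.lookup p X) (mono_val R X))"

context cring begin

lemma mono_val_empty: "mono_val R {#} = \<one>"
  by (simp add: mono_val_def)

lemma mono_val_add_mset: "mono_val R (add_mset x X) = mstep R x (mono_val R X)"
proof -
  \<comment> \<open>Commutation is required on the whole type; this is why \<open>mstep\<close>
    tests both arguments for membership in the carrier.\<close>
  have "comp_fun_commute (mstep R)"
    by standard (auto simp: fun_eq_iff mstep_def m_lcomm)
  then show ?thesis by (simp add: mono_val_def comp_fun_commute.fold_mset_add_mset)
qed

lemma mono_val_closed: "mono_val R X \<in> carrier R"
  by (induction X) (auto simp: mono_val_empty mono_val_add_mset mstep_def)

lemma mono_val_add: "mono_val R (X + Y) = mono_val R X \<otimes> mono_val R Y"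
  by (induction X) (auto simp: mono_val_empty mono_val_add_mset mstep_def mono_val_closed m_assoc)

lemma term_closed: "add_pow R (k::int) (mono_val R X) \<in> carrier R"
  using mono_val_closed by simp

lemma univ_map_sup:
  assumes "finite S" "Poly_Mapping.keys p \<subseteq> S"
  shows "univ_map R p = (\<Oplus>X\<in>S. add_pow R (Poly_Mapping.lookup p X) (mono_val R X))"
  unfolding univ_map_def
  by (rule add.finprod_mono_neutral_cong_left[OF assms])
    (auto simp: in_keys_iff term_closed add_pow_def[of R "0 :: int"])

lemma univ_map_closed: "univ_map R p \<in> carrier R"
  unfolding univ_map_def by (rule finsum_closed) (use term_closed in auto)

lemma univ_map_0: "univ_map R 0 = \<zero>"
  by (simp add: univ_map_def)

lemma univ_map_add: "univ_map R (p + q) = univ_map R p \<oplus> univ_map R q"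
proof -
  let ?S = "Poly_Mapping.keys p \<union> Poly_Mapping.keys q"
  have fin: "finite ?S" by simp
  have "univ_map R (p + q) = (\<Oplus>X\<in>?S. add_pow R (Poly_Mapping.lookup (p + q) X) (mono_val R X))"
    by (rule univ_map_sup[OF fin Poly_Mapping.keys_add])
  also have "\<dots> = (\<Oplus>X\<in>?S. add_pow R (Poly_Mapping.lookup p X) (mono_val R X) \<oplus> add_pow R (Poly_Mapping.lookup q X) (mono_val R X))"
    by (rule finsum_cong') (auto simp: lookup_add add.int_pow_mult mono_val_closed term_closed)
  also have "\<dots> = (\<Oplus>X\<in>?S. add_pow R (Poly_Mapping.lookup p X) (mono_val R X)) \<oplus> (\<Oplus>X\<in>?S. add_pow R (Poly_Mapping.lookup q X) (mono_val R X))"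
    by (rule finsum_addf) (use term_closed in auto)
  also have "\<dots> = univ_map R p \<oplus> univ_map R q"
    using univ_map_sup[OF fin, of p] univ_map_sup[OF fin, of q] by simp
  finally show ?thesis .
qed

lemma univ_map_single: "univ_map R (Poly_Mapping.single X k) = add_pow R (k) (mono_val R X)"
proof -
  have "univ_map R (Poly_Mapping.single X k) = (\<Oplus>Y\<in>{X}. add_pow R (Poly_Mapping.lookup (Poly_Mapping.single X k) Y) (mono_val R Y))"
    by (rule univ_map_sup) auto
  also have "\<dots> = add_pow R (k) (mono_val R X)"
    using term_closed[of k X] by (simp add: finsum_insert)
  finally show ?thesis .
qed

lemma update_conv:
  assumes "X \<notin> Poly_Mapping.keys f" shows "Poly_Mapping.update X k f = f + Poly_Mapping.single X (k :: int)"
  by (rule poly_mapping_eqI) (use assms in \<open>auto simp: lookup_update lookup_add lookup_single in_keys_iff when_def\<close>)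

text \<open>Both sides are additive in each factor, so two inductions over \<open>update\<close>
  reduce the claim to monomials, where it is \<open>mono_val_add\<close>.\<close>

lemma univ_map_mult: "univ_map R (p * q) = univ_map R p \<otimes> univ_map R q"
proof -
  have s: "univ_map R (Poly_Mapping.single X k * q) = univ_map R (Poly_Mapping.single X k) \<otimes> univ_map R q" for X k q
  proof (induction q rule: update_induct)
    case const then show ?case by (simp add: univ_map_0 univ_map_closed)
  next
    case (update f Y l)
    have "add_pow R (k * l) (mono_val R X \<otimes> mono_val R Y) = (add_pow R (k) (mono_val R X)) \<otimes> (add_pow R (l) (mono_val R Y))"
      by (simp add: add_pow_ldistr_int add_pow_rdistr_int mono_val_closed term_closed add.int_pow_pow mult.commute)
    then have "univ_map R (Poly_Mapping.single X k * Poly_Mapping.single Y l) = univ_map R (Poly_Mapping.single X k) \<otimes> univ_map R (Poly_Mapping.single Y l)"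
      by (simp add: mult_single univ_map_single mono_val_add)
    then show ?case unfolding update_conv[OF update(1)]
      by (simp add: distrib_left univ_map_add update(3) r_distr univ_map_closed)
  qed
  show ?thesis
  proof (induction p rule: update_induct)
    case const then show ?case by (simp add: univ_map_0 univ_map_closed)
  next
    case (update f Y l)
    show ?case unfolding update_conv[OF update(1)]
      by (simp add: distrib_right univ_map_add update(3) s l_distr univ_map_closed)
  qed
qed

lemma univ_map_1: "univ_map R 1 = \<one>"
proof -
  have "(1 :: 'a multiset \<Rightarrow>\<^sub>0 int) = Poly_Mapping.single 0 1" by simp
  then show ?thesis using univ_map_single[of 0 1] by (simp add: mono_val_empty)
qed

lemma univ_map_surj: assumes "x \<in> carrier R" shows "\<exists>p. univ_map R p = x"
  using univ_map_single[of "{#x#}" 1] assms by (auto simp: mono_val_empty mono_val_add_mset mstep_def)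

end

section \<open>Modules as quotients of submodules of modules of functions\<close>

locale ring_cover = R?: cring R for R :: "('a, 'c) ring_scheme" (structure) +
  fixes pi :: "'p::comm_ring_1 \<Rightarrow> 'a"
  assumes pi_closed [simp, intro]: "pi p \<in> carrier R"
    and pi_add: "pi (p + q) = pi p \<oplus> pi q" and pi_mult: "pi (p * q) = pi p \<otimes> pi q"
    and pi_1: "pi 1 = \<one>" and pi_surj: "x \<in> carrier R \<Longrightarrow> \<exists>p. pi p = x"
begin

lemma pi_0: "pi 0 = \<zero>"
  using pi_add[of 0 0] by (metis add.r_cancel_one' add_0 pi_closed)

lemma pi_minus: "pi (- p) = \<ominus> pi p"
  using pi_add[of "- p" p] by (metis add.inv_equality add.left_inverse pi_0 pi_closed)

lemma pi_diff: "pi (p - q) = pi p \<ominus> pi q"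
  using pi_add[of p "- q"] by (simp add: pi_minus a_minus_def)

lemma pi_power: "pi (p ^ k) = pi p [^] k"
  by (induction k) (simp_all add: pi_1 pi_mult m_comm)

lemma pi_sum: "finite I \<Longrightarrow> pi (\<Sum>i\<in>I. f i) = (\<Oplus>i\<in>I. pi (f i))"
  by (induction I rule: finite_induct) (auto simp: pi_0 pi_add finsum_insert)

lemma pi_prod: "finite I \<Longrightarrow> pi (\<Prod>i\<in>I. f i) = (\<Otimes>i\<in>I. pi (f i))"
  by (induction I rule: finite_induct) (auto simp: pi_1 pi_mult finprod_insert)

definition ker :: "'p set" where "ker = {p. pi p = \<zero>}"

lemma idl_ker: "idl ker"
  unfolding idl_def ker_def by (auto simp: pi_0 pi_add pi_mult)

lemma pi_eq_iff: "pi p = pi q \<longleftrightarrow> p - q \<in> ker"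
proof -
  have "pi p = pi q \<longleftrightarrow> pi p \<ominus> pi q = \<zero>" by (simp add: r_right_minus_eq)
  then show ?thesis by (simp add: ker_def pi_diff)
qed

text \<open>The value 0 at zero makes lifting preserve supports, so finitely supported functions
  lift to finitely supported ones.\<close>

definition sec :: "'a \<Rightarrow> 'p" where "sec x = (if x = \<zero> then 0 else (SOME p. pi p = x))"

lemma pi_sec: "x \<in> carrier R \<Longrightarrow> pi (sec x) = x"
  using pi_surj someI_ex[of "\<lambda>p. pi p = x"] by (auto simp: sec_def pi_0)

lemma idl_vimage: assumes "ideal I R" shows "idl {p. pi p \<in> I}"
proof -
  interpret I: ideal I R by fact
  show ?thesis unfolding idl_def by (auto simp: pi_0 pi_add pi_mult I.I_l_closed)
qed

lemma ker_sub_vimage: assumes "ideal I R" shows "ker \<subseteq> {p. pi p \<in> I}"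
proof -
  interpret I: ideal I R by fact
  show ?thesis by (auto simp: ker_def)
qed

lemma ideal_image: assumes J: "idl J" shows "ideal (pi ` J) R"
proof (rule idealI)
  show "ring R" by (rule R.ring_axioms)
  show "subgroup (pi ` J) (add_monoid R)"
  proof (rule add.subgroupI)
    show "pi ` J \<noteq> {}" using idlD(1)[OF J] by blast
    show "\<ominus> x \<in> pi ` J" if "x \<in> pi ` J" for x using that idlD(5)[OF J] by (auto simp: pi_minus[symmetric])
    show "x \<oplus> y \<in> pi ` J" if "x \<in> pi ` J" "y \<in> pi ` J" for x y using that idlD(2)[OF J] by (auto simp: pi_add[symmetric])
  qed auto
  show "x \<otimes> y \<in> pi ` J" if y: "y \<in> pi ` J" "x \<in> carrier R" for x y
  proof -
    obtain p q where "x = pi p" "y = pi q" "q \<in> J" using y pi_surj by (metis imageE)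
    then show ?thesis using idlD(3)[OF J] by (auto simp: pi_mult[symmetric])
  qed
  show "y \<otimes> x \<in> pi ` J" if y: "y \<in> pi ` J" "x \<in> carrier R" for x y
  proof -
    obtain p q where "x = pi p" "y = pi q" "q \<in> J" using y pi_surj by (metis imageE)
    then show ?thesis using idlD(4)[OF J] by (auto simp: pi_mult[symmetric])
  qed
qed

lemma mem_image_iff: assumes "idl J" "ker \<subseteq> J" shows "pi p \<in> pi ` J \<longleftrightarrow> p \<in> J"
proof
  assume "pi p \<in> pi ` J"
  then obtain q where "q \<in> J" "pi p = pi q" by blast
  then show "p \<in> J" using idl_diff_cancel[OF assms(1), of p q] assms(2) pi_eq_iff by blast
qed blast

lemma genideal_iff: "pi p \<in> genideal R (pi ` set ds) \<longleftrightarrow> p \<in> Jd ker ds"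
proof
  have J: "idl (Jd ker ds)" by (rule idl_Jd[OF idl_ker])
  assume "pi p \<in> genideal R (pi ` set ds)"
  moreover have "genideal R (pi ` set ds) \<subseteq> pi ` Jd ker ds"
    by (rule genideal_minimal[OF ideal_image[OF J]]) (use Jd_mem[OF idl_ker] in auto)
  ultimately show "p \<in> Jd ker ds" using mem_image_iff[OF J Jd_sup] by blast
next
  assume p: "p \<in> Jd ker ds"
  have I: "ideal (genideal R (pi ` set ds)) R" by (rule genideal_ideal) auto
  have "set ds \<subseteq> {p. pi p \<in> genideal R (pi ` set ds)}" using genideal_self[of "pi ` set ds"] by auto
  from Jd_least[OF idl_vimage[OF I] ker_sub_vimage[OF I] this] p show "pi p \<in> genideal R (pi ` set ds)" by blast
qed

text \<open>Ideals of \<open>P\<close> above \<open>ker\<close> correspond to ideals of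
  \<open>R\<close>, where a nonempty chain of ideals contains its union; Zorn's lemma does the
  rest.\<close>

lemma idl_max:
  assumes N: "noetherian_ring R" and ne: "S \<noteq> {}" and S: "\<And>J. J \<in> S \<Longrightarrow> idl J \<and> ker \<subseteq> J"
  shows "\<exists>J\<in>S. \<forall>J'\<in>S. J \<subseteq> J' \<longrightarrow> J' = J"
proof -
  let ?A = "(\<lambda>J. pi ` J) ` S"
  have "\<exists>M\<in>?A. \<forall>X\<in>?A. M \<subseteq> X \<longrightarrow> X = M"
  proof (rule subset_Zorn_nonempty)
    show "?A \<noteq> {}" using ne by blast
    fix C assume C: "C \<noteq> {}" "subset.chain ?A C"
    have CA: "C \<subseteq> ?A" using C(2) by (simp add: subset.chain_def)
    have "ideal I R" if "I \<in> ?A" for I using that ideal_image S by auto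
    then have "?A \<subseteq> {I. ideal I R}" by auto
    then have "C \<subseteq> {I. ideal I R}" using CA by (rule order_trans[rotated])
    then have "subset.chain {I. ideal I R} C" using C(2) by (simp add: subset.chain_def)
    then have "\<Union>C \<in> C" by (rule noetherian_ring.ideal_chain_is_trivial[OF N C(1)])
    then show "\<Union>C \<in> ?A" by (rule subsetD[OF CA])
  qed
  then obtain J where J: "J \<in> S" "\<And>J'. J' \<in> S \<Longrightarrow> pi ` J \<subseteq> pi ` J' \<Longrightarrow> pi ` J' = pi ` J" by auto
  have "J' = J" if J': "J' \<in> S" "J \<subseteq> J'" for J'
  proof -
    have e: "pi ` J' = pi ` J" by (rule J(2)[OF J'(1) image_mono[OF J'(2)]])
    show ?thesis
    proof
      show "J' \<subseteq> J"
      proof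
        fix p assume "p \<in> J'"
        then have "pi p \<in> pi ` J" using e by blast
        then show "p \<in> J" using mem_image_iff S[OF J(1)] by blast
      qed
    qed fact
  qed
  then show ?thesis using J(1) by blast
qed

text \<open>The work lies in the invertibility outside the maximal ideal: an element
  \<open>c\<close> that is not invertible modulo \<open>ker\<close> lies in an ideal maximal among
  the proper ones above \<open>ker\<close>, and the image of that ideal in \<open>R\<close> is the
  unique maximal ideal.\<close>

lemma noeth_locI:
  assumes "noetherian_local_ring R \<mm>"
  shows "noeth_loc ker {p. pi p \<in> \<mm>}"
proof -
  have N: "noetherian_ring R" and mx: "maximalideal \<mm> R" and uniq: "\<And>J. maximalideal J R \<Longrightarrow> J = \<mm>"
    using assms by (auto simp: noetherian_local_ring_def)
  interpret M: maximalideal \<mm> R by fact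
  have im: "idl {p. pi p \<in> \<mm>}" "ker \<subseteq> {p. pi p \<in> \<mm>}" using idl_vimage ker_sub_vimage M.is_ideal by blast+
  show ?thesis
  proof
    show "idl ker" by (rule idl_ker)
    show "idl {p. pi p \<in> \<mm>}" "ker \<subseteq> {p. pi p \<in> \<mm>}" by fact+
    show "1 \<notin> {p. pi p \<in> \<mm>}" using M.one_imp_carrier M.I_notcarr by (auto simp: pi_1)
    show "\<exists>J\<in>S. \<forall>J'\<in>S. J \<subseteq> J' \<longrightarrow> J' = J" if "S \<noteq> {}" "\<And>J. J \<in> S \<Longrightarrow> idl J \<and> ker \<subseteq> J" for S
      by (rule idl_max[OF N that])
    fix c assume c: "c \<notin> {p. pi p \<in> \<mm>}"
    show "\<exists>e. c * e - 1 \<in> ker"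
    proof (rule ccontr)
      assume no: "\<nexists>e. c * e - 1 \<in> ker"
      define S where "S = {J. idl J \<and> ker \<subseteq> J \<and> c \<in> J \<and> 1 \<notin> J}"
      have "1 \<notin> adjoin ker c"
      proof
        assume "1 \<in> adjoin ker c"
        then obtain e where "1 - e * c \<in> ker" by (auto simp: adjoin_def)
        then have "c * e - 1 \<in> ker" using idlD(5)[OF idl_ker, of "1 - e * c"] by (simp add: mult.commute)
        then show False using no by blast
      qed
      then have "adjoin ker c \<in> S" unfolding S_def using idl_adjoin[OF idl_ker] adjoin_sup adjoin_self[OF idl_ker] by blast
      then have "\<exists>J\<in>S. \<forall>J'\<in>S. J \<subseteq> J' \<longrightarrow> J' = J" by (intro idl_max[OF N]) (auto simp: S_def)
      then obtain J where JS: "J \<in> S" and Jm: "\<forall>J'\<in>S. J \<subseteq> J' \<longrightarrow> J' = J" by (rule bexE)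
      have J: "idl J" "ker \<subseteq> J" "c \<in> J" "1 \<notin> J" using JS by (auto simp: S_def)
      have "maximalideal (pi ` J) R"
      proof (rule maximalidealI[OF ideal_image[OF J(1)]])
        show "carrier R \<noteq> pi ` J" using mem_image_iff[OF J(1,2), of 1] J(4) pi_closed by blast
        fix I assume I: "ideal I R" "pi ` J \<subseteq> I" "I \<subseteq> carrier R"
        let ?J = "{p. pi p \<in> I}"
        interpret I: ideal I R by fact
        show "I = pi ` J \<or> I = carrier R"
        proof (cases "\<one> \<in> I")
          case True then show ?thesis using I.one_imp_carrier by blast
        next
          case False
          have "J \<subseteq> ?J" using I(2) by blast
          moreover have "?J \<in> S" using idl_vimage[OF I(1)] ker_sub_vimage[OF I(1)] calculation J(3) False
            by (auto simp: S_def pi_1)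
          ultimately have "?J = J" using Jm by blast
          moreover have "I \<subseteq> pi ` ?J"
          proof
            fix x assume "x \<in> I"
            then obtain p where "pi p = x" using I(3) pi_surj by blast
            then show "x \<in> pi ` ?J" using \<open>x \<in> I\<close> by blast
          qed
          ultimately show ?thesis using I(2) by simp
        qed
      qed
      then have "pi ` J = \<mm>" by (rule uniq)
      then show False using J(3) c by blast
    qed
  qed
qed

text \<open>All modules are handled as images of submodules \<open>Z\<close> of modules of functions with values in
  the covering ring; the image of \<open>h\<close> is isomorphic to \<open>Z\<close> modulo the kernel of \<open>h\<close>.\<close>

definition lifted :: "('i \<Rightarrow> 'p) set \<Rightarrow> (('i \<Rightarrow> 'p) \<Rightarrow> 'm) \<Rightarrow> ('a, 'm) module \<Rightarrow> bool" where
  "lifted Z h M \<longleftrightarrow> submod Z \<and> h ` Z = carrier M \<and> h 0 = \<zero>\<^bsub>M\<^esub> \<and>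
     (\<forall>x\<in>Z. \<forall>y\<in>Z. h (x + y) = h x \<oplus>\<^bsub>M\<^esub> h y) \<and> (\<forall>p. \<forall>x\<in>Z. h (sm p x) = pi p \<odot>\<^bsub>M\<^esub> h x)"

lemma liftedD:
  assumes "lifted Z h M"
  shows "submod Z" "h ` Z = carrier M" "h 0 = \<zero>\<^bsub>M\<^esub>" "x \<in> Z \<Longrightarrow> y \<in> Z \<Longrightarrow> h (x + y) = h x \<oplus>\<^bsub>M\<^esub> h y"
    "x \<in> Z \<Longrightarrow> h (sm p x) = pi p \<odot>\<^bsub>M\<^esub> h x" "x \<in> Z \<Longrightarrow> h x \<in> carrier M"
  using assms unfolding lifted_def by blast+

text \<open>The axioms hold in the image of \<open>Z\<close> because they hold for functions.
  Quotients, free modules, tensor products and direct sums are all recognized as modules by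
  exhibiting such a cover.\<close>

lemma lifted_module:
  assumes l: "lifted Z h M" shows "module R M"
proof -
  note L = liftedD[OF l]
  have ex: "\<exists>z\<in>Z. u = h z" if "u \<in> carrier M" for u using that L(2) by blast
  have exp: "\<exists>p. u = pi p" if "u \<in> carrier R" for u using pi_surj[OF that] by blast
  show ?thesis
  proof (rule moduleI)
    show "cring R" by (rule R.is_cring)
    show "abelian_group M"
    proof (rule abelian_groupI)
      show "u \<oplus>\<^bsub>M\<^esub> v \<in> carrier M" if uv: "u \<in> carrier M" "v \<in> carrier M" for u v
      proof -
        obtain x y where xy: "x \<in> Z" "y \<in> Z" "u = h x" "v = h y" using ex uv by blast
        then show ?thesis using L(4)[OF xy(1,2)] L(6)[OF submod_add[OF L(1) xy(1,2)]] by simp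
      qed
      show "\<zero>\<^bsub>M\<^esub> \<in> carrier M" using L(3) L(6)[OF submod_0[OF L(1)]] by simp
      show "u \<oplus>\<^bsub>M\<^esub> v \<oplus>\<^bsub>M\<^esub> w = u \<oplus>\<^bsub>M\<^esub> (v \<oplus>\<^bsub>M\<^esub> w)" if uv: "u \<in> carrier M" "v \<in> carrier M" "w \<in> carrier M" for u v w
      proof -
        obtain x where x: "x \<in> Z" "u = h x" using ex[OF uv(1)] by blast
        obtain y where y: "y \<in> Z" "v = h y" using ex[OF uv(2)] by blast
        obtain z where z: "z \<in> Z" "w = h z" using ex[OF uv(3)] by blast
        show ?thesis unfolding x y z L(4)[OF x(1) y(1), symmetric] L(4)[OF y(1) z(1), symmetric]
          L(4)[OF submod_add[OF L(1) x(1) y(1)] z(1), symmetric]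
          L(4)[OF x(1) submod_add[OF L(1) y(1) z(1)], symmetric] by (simp only: add.assoc)
      qed
      show "u \<oplus>\<^bsub>M\<^esub> v = v \<oplus>\<^bsub>M\<^esub> u" if uv: "u \<in> carrier M" "v \<in> carrier M" for u v
      proof -
        obtain x where x: "x \<in> Z" "u = h x" using ex[OF uv(1)] by blast
        obtain y where y: "y \<in> Z" "v = h y" using ex[OF uv(2)] by blast
        show ?thesis unfolding x y L(4)[OF x(1) y(1), symmetric] L(4)[OF y(1) x(1), symmetric]
          by (simp only: add.commute)
      qed
      show "\<zero>\<^bsub>M\<^esub> \<oplus>\<^bsub>M\<^esub> u = u" if uv: "u \<in> carrier M" for u
      proof -
        obtain x where "x \<in> Z" "u = h x" using ex uv by blast
        then show ?thesis using L(4)[of 0 x] submod_0[OF L(1)] L(3) by simp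
      qed
      show "\<exists>v\<in>carrier M. v \<oplus>\<^bsub>M\<^esub> u = \<zero>\<^bsub>M\<^esub>" if uv: "u \<in> carrier M" for u
      proof -
        obtain x where x: "x \<in> Z" "u = h x" using ex uv by blast
        then show ?thesis using L(4)[of "- x" x] submod_minus[OF L(1) x(1)] L(3) L(6)[of "- x"]
          by (intro bexI[of _ "h (- x)"]) auto
      qed
    qed
  next
    fix c u assume c: "c \<in> carrier R" and u: "u \<in> carrier M"
    obtain p where p: "c = pi p" using exp[OF c] by blast
    obtain x where x: "x \<in> Z" "u = h x" using ex[OF u] by blast
    note px = p x
    show "c \<odot>\<^bsub>M\<^esub> u \<in> carrier M" using px(1,3) L(5)[OF px(2), of p] L(6)[OF submod_sm[OF L(1) px(2), of p]] by metis
    { fix e assume e: "e \<in> carrier R"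
      obtain q where q: "e = pi q" using exp[OF e] by blast
      show "(c \<oplus> e) \<odot>\<^bsub>M\<^esub> u = c \<odot>\<^bsub>M\<^esub> u \<oplus>\<^bsub>M\<^esub> e \<odot>\<^bsub>M\<^esub> u"
        unfolding q px(1,3) pi_add[symmetric] L(5)[OF px(2), symmetric]
          L(4)[OF submod_sm[OF L(1) px(2)] submod_sm[OF L(1) px(2)], symmetric] sm_add_left ..
      show "(c \<otimes> e) \<odot>\<^bsub>M\<^esub> u = c \<odot>\<^bsub>M\<^esub> (e \<odot>\<^bsub>M\<^esub> u)"
        unfolding q px(1,3) pi_mult[symmetric] L(5)[OF px(2), symmetric]
          L(5)[OF submod_sm[OF L(1) px(2)], symmetric] sm_sm .. }
    { fix v assume v: "v \<in> carrier M"
      obtain y where y: "y \<in> Z" "v = h y" using ex[OF v] by blast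
      show "c \<odot>\<^bsub>M\<^esub> (u \<oplus>\<^bsub>M\<^esub> v) = c \<odot>\<^bsub>M\<^esub> u \<oplus>\<^bsub>M\<^esub> c \<odot>\<^bsub>M\<^esub> v"
        unfolding px(1,3) y(2) L(4)[OF px(2) y(1), symmetric] L(5)[OF px(2), symmetric] L(5)[OF y(1), symmetric]
          L(5)[OF submod_add[OF L(1) px(2) y(1)], symmetric] sm_add
        by (rule L(4)[OF submod_sm[OF L(1) px(2)] submod_sm[OF L(1) y(1)]]) }
  next
    fix u assume "u \<in> carrier M"
    then obtain x where "x \<in> Z" "u = h x" using ex by blast
    then show "\<one> \<odot>\<^bsub>M\<^esub> u = u" using L(5)[of x 1] by (simp add: pi_1)
  qed
qed

lemma lifted_minus: assumes l: "lifted Z h M" and x: "x \<in> Z" shows "\<ominus>\<^bsub>M\<^esub> h x = h (- x)"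
proof -
  interpret M: module R M by (rule lifted_module[OF l])
  note L = liftedD[OF l]
  have "h (- x) \<oplus>\<^bsub>M\<^esub> h x = \<zero>\<^bsub>M\<^esub>" using L(4)[of "- x" x] submod_minus[OF L(1) x] x L(3) by simp
  then show ?thesis using M.minus_equality L(6)[OF x] L(6)[OF submod_minus[OF L(1) x]] by blast
qed

lemma lifted_finsum:
  assumes l: "lifted Z h M" and "finite I"
  shows "(\<And>i. i \<in> I \<Longrightarrow> f i \<in> Z) \<Longrightarrow> (\<Oplus>\<^bsub>M\<^esub>i\<in>I. h (f i)) = h (\<Sum>i\<in>I. f i)"
  using \<open>finite I\<close>
proof (induction I rule: finite_induct)
  interpret M: module R M by (rule lifted_module[OF l])
  note L = liftedD[OF l]
  case empty show ?case unfolding M.finsum_empty sum.empty L(3) ..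
next
  interpret M: module R M by (rule lifted_module[OF l])
  note L = liftedD[OF l]
  case (insert i I)
  have "(\<Oplus>\<^bsub>M\<^esub>i\<in>insert i I. h (f i)) = h (f i) \<oplus>\<^bsub>M\<^esub> (\<Oplus>\<^bsub>M\<^esub>i\<in>I. h (f i))"
    by (rule M.finsum_insert) (use insert L(6) in auto)
  also have "\<dots> = h (f i) \<oplus>\<^bsub>M\<^esub> h (\<Sum>i\<in>I. f i)" using insert by simp
  also have "\<dots> = h (f i + (\<Sum>i\<in>I. f i))" using insert submod_sum[OF L(1), of I f] by (intro L(4)[symmetric]) auto
  finally show ?case unfolding sum.insert[OF insert(1,2)] .
qed

lemma lifted_submodule:
  assumes l: "lifted Z h M" and X: "submod X" "X \<subseteq> Z"
  shows "submodule (h ` X) R M"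
proof -
  interpret M: module R M by (rule lifted_module[OF l])
  note L = liftedD[OF l]
  show ?thesis
  proof (rule M.submoduleI)
    show "h ` X \<subseteq> carrier M" using L(6) X(2) by blast
    show "\<zero>\<^bsub>M\<^esub> \<in> h ` X" using L(3) submod_0[OF X(1)] by (metis imageI)
    show "\<ominus>\<^bsub>M\<^esub> u \<in> h ` X" if "u \<in> h ` X" for u
      using that X submod_minus[OF X(1)] by (auto simp: lifted_minus[OF l] subset_iff)
    show "u \<oplus>\<^bsub>M\<^esub> v \<in> h ` X" if uv: "u \<in> h ` X" "v \<in> h ` X" for u v
    proof -
      obtain x y where xy: "x \<in> X" "y \<in> X" "u = h x" "v = h y" using uv by blast
      have "u \<oplus>\<^bsub>M\<^esub> v = h (x + y)" unfolding xy by (rule L(4)[symmetric]) (use xy X(2) in auto)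
      then show ?thesis using submod_add[OF X(1) xy(1,2)] by blast
    qed
    show "c \<odot>\<^bsub>M\<^esub> u \<in> h ` X" if c: "c \<in> carrier R" "u \<in> h ` X" for c u
    proof -
      obtain p x where px: "c = pi p" "x \<in> X" "u = h x" using c pi_surj by (metis imageE)
      have "c \<odot>\<^bsub>M\<^esub> u = h (sm p x)" unfolding px by (rule L(5)[symmetric]) (use px X(2) in auto)
      then show ?thesis using submod_sm[OF X(1) px(2)] by blast
    qed
  qed
qed

lemma lifted_vimage:
  assumes l: "lifted Z h M" and N: "submodule N R M"
  shows "submod {z \<in> Z. h z \<in> N}" "h ` {z \<in> Z. h z \<in> N} = N"
proof -
  interpret M: module R M by (rule lifted_module[OF l])
  note L = liftedD[OF l] and E = M.submoduleE[OF N]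
  have z: "\<zero>\<^bsub>M\<^esub> \<in> N"
    using subgroup.one_closed[OF submodule.axioms(1)[OF N]] by simp
  show "submod {z \<in> Z. h z \<in> N}"
  proof (rule submodI)
    show "0 \<in> {z \<in> Z. h z \<in> N}" using submod_0[OF L(1)] z unfolding mem_Collect_eq L(3) ..
    show "x + y \<in> {z \<in> Z. h z \<in> N}" if xy: "x \<in> {z \<in> Z. h z \<in> N}" "y \<in> {z \<in> Z. h z \<in> N}" for x y
    proof -
      have m: "x \<in> Z" "y \<in> Z" "h x \<in> N" "h y \<in> N" using xy by auto
      show ?thesis unfolding mem_Collect_eq L(4)[OF m(1,2)] using submod_add[OF L(1) m(1,2)] E(5)[OF m(3,4)] ..
    qed
    show "sm c x \<in> {z \<in> Z. h z \<in> N}" if x: "x \<in> {z \<in> Z. h z \<in> N}" for c x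
    proof -
      have m: "x \<in> Z" "h x \<in> N" using x by auto
      show ?thesis unfolding mem_Collect_eq L(5)[OF m(1)] using submod_sm[OF L(1) m(1)] E(4)[OF pi_closed m(2)] ..
    qed
  qed
  show "h ` {z \<in> Z. h z \<in> N} = N"
  proof (rule equalityI; rule subsetI)
    fix v assume v: "v \<in> N"
    then have "v \<in> h ` Z" using E(1) L(2) by auto
    then show "v \<in> h ` {z \<in> Z. h z \<in> N}" using v by auto
  qed auto
qed

lemma lifted_restrict:
  assumes l: "lifted Z h M" and X: "submod X" "X \<subseteq> Z" and C: "C = h ` X"
  shows "lifted X h (M\<lparr>carrier := C\<rparr>)"
proof -
  note L = liftedD[OF l] and XZ = subsetD[OF X(2)]
  show ?thesis unfolding lifted_def C
    by (intro conjI ballI allI) (use X(1) L(3) L(4)[OF XZ XZ] L(5)[OF XZ] in simp_all)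
qed

lemma lifted_comp:
  assumes l: "lifted Z h M" and g: "lin g" and Y: "submod Y" "\<And>y. y \<in> Y \<Longrightarrow> g y \<in> Z"
    and onto: "\<And>u. u \<in> carrier M \<Longrightarrow> \<exists>y\<in>Y. h (g y) = u"
  shows "lifted Y (\<lambda>y. h (g y)) M"
  unfolding lifted_def
proof (intro conjI ballI allI)
  note L = liftedD[OF l]
  show "submod Y" by fact
  show "(\<lambda>y. h (g y)) ` Y = carrier M"
  proof (rule equalityI; rule subsetI)
    fix u assume "u \<in> (\<lambda>y. h (g y)) ` Y" then show "u \<in> carrier M" using L(6) Y(2) by auto
  next
    fix u assume "u \<in> carrier M"
    from onto[OF this] obtain y where "y \<in> Y" "h (g y) = u" ..
    then show "u \<in> (\<lambda>y. h (g y)) ` Y" by auto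
  qed
  show "h (g 0) = \<zero>\<^bsub>M\<^esub>" by (simp add: lin_0[OF g] L(3))
  show "h (g (x + y)) = h (g x) \<oplus>\<^bsub>M\<^esub> h (g y)" if "x \<in> Y" "y \<in> Y" for x y
    using L(4)[OF Y(2)[OF that(1)] Y(2)[OF that(2)]] by (simp add: lin_add[OF g])
  show "h (g (sm p x)) = pi p \<odot>\<^bsub>M\<^esub> h (g x)" if "x \<in> Y" for p x
    using L(5)[OF Y(2)[OF that]] by (simp add: lin_sm[OF g])
qed

lemma coset_eq_iff:
  assumes M: "module R M" and N: "submodule N R M" and u: "u \<in> carrier M"
  shows "a_r_coset M N u = N \<longleftrightarrow> u \<in> N"
proof -
  interpret M: module R M by fact
  interpret N: additive_subgroup N M by (rule additive_subgroup.intro[OF submodule.axioms(1)[OF N]])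
  interpret S: abelian_subgroup N M by (rule abelian_subgroupI3[OF N.additive_subgroup_axioms M.abelian_group_axioms])
  show ?thesis using S.a_rcos_const S.a_rcos_self[OF u] by metis
qed

lemma lifted_quotient:
  assumes l: "lifted Z h M" and N: "submodule N R M"
  shows "lifted Z (\<lambda>z. a_r_coset M N (h z)) (quotient_module M N)"
proof -
  interpret M: module R M by (rule lifted_module[OF l])
  interpret N: additive_subgroup N M by (rule additive_subgroup.intro[OF submodule.axioms(1)[OF N]])
  interpret S: abelian_subgroup N M by (rule abelian_subgroupI3[OF N.additive_subgroup_axioms M.abelian_group_axioms])
  note L = liftedD[OF l] and E = M.submoduleE[OF N]
  show ?thesis unfolding lifted_def
  proof (intro conjI ballI allI)
    show "submod Z" by fact
    show "(\<lambda>z. a_r_coset M N (h z)) ` Z = carrier (quotient_module M N)"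
      unfolding L(2)[symmetric] quotient_module_def by (auto simp: A_RCOSETS_def' L(2)[symmetric])
    show "a_r_coset M N (h 0) = \<zero>\<^bsub>quotient_module M N\<^esub>"
      using S.a_rcos_const[OF N.zero_closed] by (simp add: L(3) quotient_module_def)
    show "a_r_coset M N (h (x + y)) = a_r_coset M N (h x) \<oplus>\<^bsub>quotient_module M N\<^esub> a_r_coset M N (h y)" if "x \<in> Z" "y \<in> Z" for x y
      using S.a_rcos_sum[OF L(6)[OF that(1)] L(6)[OF that(2)]] by (simp add: L(4)[OF that] quotient_module_def)
    show "a_r_coset M N (h (sm p x)) = pi p \<odot>\<^bsub>quotient_module M N\<^esub> a_r_coset M N (h x)" if x: "x \<in> Z" for p x
    proof -
      have hx: "h x \<in> carrier M" by (rule L(6)[OF x])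
      have "set_add M N ((\<lambda>u. pi p \<odot>\<^bsub>M\<^esub> u) ` a_r_coset M N (h x)) = a_r_coset M N (pi p \<odot>\<^bsub>M\<^esub> h x)"
      proof (rule equalityI; rule subsetI)
        fix v assume "v \<in> set_add M N ((\<lambda>u. pi p \<odot>\<^bsub>M\<^esub> u) ` a_r_coset M N (h x))"
        then obtain n n' where n: "n \<in> N" "n' \<in> N" "v = n \<oplus>\<^bsub>M\<^esub> pi p \<odot>\<^bsub>M\<^esub> (n' \<oplus>\<^bsub>M\<^esub> h x)"
          unfolding set_add_def' a_r_coset_def' by auto
        have c: "n \<in> carrier M" "n' \<in> carrier M" using n E(1) by auto
        have "v = (n \<oplus>\<^bsub>M\<^esub> pi p \<odot>\<^bsub>M\<^esub> n') \<oplus>\<^bsub>M\<^esub> pi p \<odot>\<^bsub>M\<^esub> h x"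
          using n(3) c hx by (simp add: M.smult_r_distr M.a_assoc)
        moreover have "n \<oplus>\<^bsub>M\<^esub> pi p \<odot>\<^bsub>M\<^esub> n' \<in> N" using n E by auto
        ultimately show "v \<in> a_r_coset M N (pi p \<odot>\<^bsub>M\<^esub> h x)" unfolding a_r_coset_def' by blast
      next
        fix v assume "v \<in> a_r_coset M N (pi p \<odot>\<^bsub>M\<^esub> h x)"
        then obtain n where n: "n \<in> N" "v = n \<oplus>\<^bsub>M\<^esub> pi p \<odot>\<^bsub>M\<^esub> h x" unfolding a_r_coset_def' by auto
        have "h x \<in> a_r_coset M N (h x)" by (rule S.a_rcos_self[OF hx])
        then show "v \<in> set_add M N ((\<lambda>u. pi p \<odot>\<^bsub>M\<^esub> u) ` a_r_coset M N (h x))"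
          using n unfolding set_add_def' by blast
      qed
      then show ?thesis by (simp add: L(5)[OF x] quotient_module_def)
    qed
  qed
qed

text \<open>Preimages under \<open>h\<close> match the submodules of \<open>M\<close> with the
  submodules of \<open>Z\<close> above the kernel of \<open>h\<close>, so strict chains
  correspond.\<close>

lemma lifted_length:
  assumes l: "lifted Z h M"
  shows "module_length R M = len Z {z \<in> Z. h z = \<zero>\<^bsub>M\<^esub>}"
proof -
  interpret M: module R M by (rule lifted_module[OF l])
  note L = liftedD[OF l]
  let ?B = "{z \<in> Z. h z = \<zero>\<^bsub>M\<^esub>}"
  have diff: "h (x - y) = \<zero>\<^bsub>M\<^esub>" if xy: "x \<in> Z" "y \<in> Z" "h x = h y" for x y
  proof -
    have "h (x - y) = h x \<oplus>\<^bsub>M\<^esub> h (- y)" using L(4)[OF xy(1) submod_minus[OF L(1) xy(2)]] by simp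
    also have "\<dots> = h (y - y)" using L(4)[OF xy(2) submod_minus[OF L(1) xy(2)]] xy(3) by simp
    finally show ?thesis using L(3) by simp
  qed
  have "{enat n | n. \<exists>N. (\<forall>i\<le>n. submodule (N i) R M) \<and> (\<forall>i<n. N i \<subset> N (Suc i))} = {enat k | k. ch ?B k Z}"
  proof -
    have "(\<exists>N. (\<forall>i\<le>n. submodule (N i) R M) \<and> (\<forall>i<n. N i \<subset> N (Suc i))) \<longleftrightarrow> ch ?B n Z" for n
    proof
      assume "\<exists>N. (\<forall>i\<le>n. submodule (N i) R M) \<and> (\<forall>i<n. N i \<subset> N (Suc i))"
      then obtain N where N: "\<And>i. i \<le> n \<Longrightarrow> submodule (N i) R M" "\<And>i. i < n \<Longrightarrow> N i \<subset> N (Suc i)" by blast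
      define X where "X i = {z \<in> Z. h z \<in> N i}" for i
      have X: "submod (X i)" "h ` X i = N i" if "i \<le> n" for i
        unfolding X_def using lifted_vimage[OF l N(1)[OF that]] by auto
      have "i \<le> n \<Longrightarrow> ch ?B i (X i)" for i
      proof (induction i)
        case 0
        have "\<zero>\<^bsub>M\<^esub> \<in> N 0" using subgroup.one_closed[OF submodule.axioms(1)[OF N(1)[of 0]]] by simp
        then have "?B \<subseteq> X 0" by (auto simp: X_def)
        then show ?case using X(1)[of 0] by simp
      next
        case (Suc i)
        have "X i \<subseteq> X (Suc i)" using N(2)[of i] Suc.prems by (auto simp: X_def)
        moreover have "X i \<noteq> X (Suc i)" using X(2)[of i] X(2)[of "Suc i"] N(2)[of i] Suc.prems by auto
        ultimately have "X i \<subset> X (Suc i)" by blast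
        then show ?case using Suc X(1)[OF Suc.prems] by auto
      qed
      then have "ch ?B n (X n)" by simp
      then show "ch ?B n Z" by (rule ch_up) (auto simp: X_def L(1))
    next
      have ex: "ch ?B k X \<Longrightarrow> X \<subseteq> Z \<Longrightarrow> \<exists>N. N k = h ` X \<and> (\<forall>i\<le>k. submodule (N i) R M) \<and> (\<forall>i<k. N i \<subset> N (Suc i))" for k X
      proof (induction k arbitrary: X)
        case 0
        then show ?case using lifted_submodule[OF l] by (intro exI[of _ "\<lambda>_. h ` X"]) auto
      next
        case (Suc k)
        then obtain Y where Y: "ch ?B k Y" "Y \<subset> X" "submod X" by auto
        have sY: "submod Y" "?B \<subseteq> Y" using Y(1) ch_submod ch_sub by blast+
        have YZ: "Y \<subseteq> Z" using Y(2) Suc.prems(2) by simp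
        obtain N where "N k = h ` Y \<and> (\<forall>i\<le>k. submodule (N i) R M) \<and> (\<forall>i<k. N i \<subset> N (Suc i))"
          using Suc.IH[OF Y(1) YZ] ..
        then have N: "N k = h ` Y" "\<forall>i\<le>k. submodule (N i) R M" "\<forall>i<k. N i \<subset> N (Suc i)" by simp_all
        obtain x where x: "x \<in> X" "x \<notin> Y" using Y(2) by blast
        have "h x \<notin> h ` Y"
        proof
          assume "h x \<in> h ` Y"
          then obtain y where y: "y \<in> Y" "h x = h y" by blast
          have xyZ: "x \<in> Z" "y \<in> Z" using x(1) y(1) Y(2) Suc.prems(2) by auto
          have "x - y \<in> ?B" using diff[OF xyZ y(2)] submod_diff[OF L(1) xyZ] by blast
          then have "x - y \<in> Y" using sY(2) by blast
          then show False using submod_diff_cancel[OF sY(1)] x(2) y(1) by blast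
        qed
        then have str: "h ` Y \<subset> h ` X" using Y(2) x(1) by blast
        have sX: "submodule (h ` X) R M" by (rule lifted_submodule[OF l Y(3) Suc.prems(2)])
        define N' where "N' i = (if i \<le> k then N i else h ` X)" for i
        have "\<forall>i\<le>Suc k. submodule (N' i) R M" using N(2) sX by (simp add: N'_def)
        moreover have "N' i \<subset> N' (Suc i)" if "i < Suc k" for i
          using that N(1,3) str by (cases "i = k") (auto simp: N'_def)
        moreover have "N' (Suc k) = h ` X" by (simp add: N'_def)
        ultimately have "N' (Suc k) = h ` X \<and> (\<forall>i\<le>Suc k. submodule (N' i) R M) \<and> (\<forall>i<Suc k. N' i \<subset> N' (Suc i))" by simp
        then show ?case by (rule exI[where x = N'])
      qed
      assume "ch ?B n Z"
      from ex[OF this order_refl] obtain N where "N n = h ` Z \<and> (\<forall>i\<le>n. submodule (N i) R M) \<and> (\<forall>i<n. N i \<subset> N (Suc i))" ..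
      then show "\<exists>N. (\<forall>i\<le>n. submodule (N i) R M) \<and> (\<forall>i<n. N i \<subset> N (Suc i))" by (intro exI[of _ N] conjI) simp_all
    qed
    then show ?thesis by simp
  qed
  then show ?thesis by (simp add: module_length_def len_def)
qed

end

section \<open>Tensor products of free modules in coordinates\<close>

definition delta_fun :: "'t \<Rightarrow> 't \<Rightarrow> 'p::comm_ring_1" where
  "delta_fun x = (\<lambda>y. if y = x then 1 else 0)"

definition fin_supp :: "'t set \<Rightarrow> ('t \<Rightarrow> 'p::comm_ring_1) set" where
  "fin_supp T = {X. finite {t. X t \<noteq> 0} \<and> (\<forall>t. t \<notin> T \<longrightarrow> X t = 0)}"

lemma submod_fin_supp:
  fixes T :: "'t set"
  shows "submod (fin_supp T :: ('t \<Rightarrow> 'p::comm_ring_1) set)"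
proof (rule submodI)
  show "0 \<in> fin_supp T" by (simp add: fin_supp_def)
  show "X + Y \<in> fin_supp T" if "X \<in> fin_supp T" "Y \<in> fin_supp T" for X Y :: "'t \<Rightarrow> 'p"
  proof -
    have "{t. (X + Y) t \<noteq> 0} \<subseteq> {t. X t \<noteq> 0} \<union> {t. Y t \<noteq> 0}" by auto
    then have "finite {t. (X + Y) t \<noteq> 0}" using that finite_subset unfolding fin_supp_def by blast
    then show ?thesis using that by (simp add: fin_supp_def)
  qed
  show "sm c X \<in> fin_supp T" if "X \<in> fin_supp T" for c and X :: "'t \<Rightarrow> 'p"
  proof -
    have "{t. sm c X t \<noteq> 0} \<subseteq> {t. X t \<noteq> 0}" by (auto simp: sm_apply)
    then have "finite {t. sm c X t \<noteq> 0}" using that finite_subset unfolding fin_supp_def by blast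
    then show ?thesis using that by (simp add: fin_supp_def sm_apply)
  qed
qed

lemma delta_fun_fin_supp: "x \<in> T \<Longrightarrow> delta_fun x \<in> fin_supp T"
  by (auto simp: fin_supp_def delta_fun_def)

lemma fin_supp_expand: assumes "X \<in> fin_supp T" shows "X = (\<Sum>x\<in>{x. X x \<noteq> 0}. sm (X x) (delta_fun x))"
proof
  fix t
  have "(\<Sum>x\<in>{x. X x \<noteq> 0}. X x * delta_fun x t) = (\<Sum>x\<in>{x. X x \<noteq> 0}. if x = t then X x else 0)"
    by (rule sum.cong) (auto simp: delta_fun_def)
  then show "X t = (\<Sum>x\<in>{x. X x \<noteq> 0}. sm (X x) (delta_fun x)) t"
    using assms by (simp add: sum_fun_apply sm_apply fin_supp_def)
qed

text \<open>The linear extension, to formal combinations of tuples, of the product of the forms in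
  the single entries. Such forms are used to read off the coordinates of a tensor.\<close>

definition multi_eval :: "nat \<Rightarrow> (nat \<Rightarrow> 'm \<Rightarrow> 'p) \<Rightarrow> ((nat \<Rightarrow> 'm) \<Rightarrow> 'p) \<Rightarrow> 'p::comm_ring_1" where
  "multi_eval q \<rho> X = (\<Sum>x\<in>{x. X x \<noteq> 0}. X x * (\<Prod>i<q. \<rho> i (x i)))"

lemma multi_eval_sup:
  assumes "finite S" "{x. X x \<noteq> 0} \<subseteq> S"
  shows "multi_eval q \<rho> X = (\<Sum>x\<in>S. X x * (\<Prod>i<q. \<rho> i (x i)))"
  unfolding multi_eval_def by (rule sum.mono_neutral_left) (use assms in auto)

lemma multi_eval_add: assumes "X \<in> fin_supp T" "Y \<in> fin_supp T" shows "multi_eval q \<rho> (X + Y) = multi_eval q \<rho> X + multi_eval q \<rho> Y"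
proof -
  let ?S = "{x. X x \<noteq> 0} \<union> {x. Y x \<noteq> 0}"
  have f: "finite ?S" using assms by (simp add: fin_supp_def)
  have "multi_eval q \<rho> (X + Y) = (\<Sum>x\<in>?S. (X + Y) x * (\<Prod>i<q. \<rho> i (x i)))" by (rule multi_eval_sup[OF f]) auto
  then show ?thesis using multi_eval_sup[OF f, of X] multi_eval_sup[OF f, of Y] by (simp add: algebra_simps sum.distrib)
qed

lemma multi_eval_sm: assumes "X \<in> fin_supp T" shows "multi_eval q \<rho> (sm c X) = c * multi_eval q \<rho> X"
proof -
  let ?S = "{x. X x \<noteq> 0}"
  have f: "finite ?S" using assms by (simp add: fin_supp_def)
  have "multi_eval q \<rho> (sm c X) = (\<Sum>x\<in>?S. sm c X x * (\<Prod>i<q. \<rho> i (x i)))" by (rule multi_eval_sup[OF f]) (auto simp: sm_apply)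
  then show ?thesis by (simp add: multi_eval_def sm_apply sum_distrib_left mult.assoc)
qed

lemma multi_eval_diff: assumes "X \<in> fin_supp T" "Y \<in> fin_supp T" shows "multi_eval q \<rho> (X - Y) = multi_eval q \<rho> X - multi_eval q \<rho> Y"
proof -
  have e: "X - Y = X + sm (- 1) Y" by (simp add: sm_minus_one)
  show ?thesis unfolding e multi_eval_add[OF assms(1) submod_sm[OF submod_fin_supp assms(2)]] multi_eval_sm[OF assms(2)] by simp
qed

lemma multi_eval_delta_fun:
  fixes \<rho> :: "nat \<Rightarrow> 'm \<Rightarrow> 'p::comm_ring_1"
  shows "multi_eval q \<rho> (delta_fun x) = (\<Prod>i<q. \<rho> i (x i))"
proof -
  have "{y. delta_fun x y \<noteq> (0 :: 'p)} = {x}" by (auto simp: delta_fun_def)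
  then show ?thesis by (simp add: multi_eval_def delta_fun_def)
qed

lemma multi_eval_sum: "finite I \<Longrightarrow> (\<And>t. t \<in> I \<Longrightarrow> f t \<in> fin_supp T) \<Longrightarrow> multi_eval q \<rho> (\<Sum>t\<in>I. f t) = (\<Sum>t\<in>I. multi_eval q \<rho> (f t))"
proof (induction I rule: finite_induct)
  case empty then show ?case by (simp add: multi_eval_def)
next
  case (insert t I)
  have IH: "multi_eval q \<rho> (\<Sum>t\<in>I. f t) = (\<Sum>t\<in>I. multi_eval q \<rho> (f t))" using insert by simp
  have "multi_eval q \<rho> (f t + (\<Sum>t\<in>I. f t)) = multi_eval q \<rho> (f t) + multi_eval q \<rho> (\<Sum>t\<in>I. f t)"
    by (rule multi_eval_add[OF insert.prems submod_sum[OF submod_fin_supp]]) (use insert in auto)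
  then show ?case unfolding sum.insert[OF insert(1,2)] IH .
qed

definition multi_index :: "nat \<Rightarrow> (nat \<Rightarrow> nat) \<Rightarrow> (nat \<Rightarrow> nat) set" where
  "multi_index q rk = (\<Pi>\<^sub>E i\<in>{..<q}. {..<rk i})"

lemma finite_multi_index: "finite (multi_index q rk)"
  unfolding multi_index_def by (rule finite_PiE) auto

lemma ixD: "t \<in> multi_index q rk \<Longrightarrow> i < q \<Longrightarrow> t i < rk i"
  by (auto simp: multi_index_def PiE_def Pi_def)

lemma multi_index_eqI: "s \<in> multi_index q rk \<Longrightarrow> t \<in> multi_index q rk' \<Longrightarrow> (\<And>i. i < q \<Longrightarrow> s i = t i) \<Longrightarrow> s = t"
  unfolding multi_index_def by (rule PiE_ext) auto

definition basis_tuple :: "nat \<Rightarrow> (nat \<Rightarrow> (nat \<Rightarrow> 'p::comm_ring_1) \<Rightarrow> 'm) \<Rightarrow> (nat \<Rightarrow> nat) \<Rightarrow> nat \<Rightarrow> 'm" where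
  "basis_tuple q hh t = (\<lambda>i\<in>{..<q}. hh i (delta_fun (t i)))"

definition gen :: "nat \<Rightarrow> (nat \<Rightarrow> nat) \<Rightarrow> (nat \<Rightarrow> (nat \<Rightarrow> 'p::comm_ring_1) \<Rightarrow> 'm) \<Rightarrow> ((nat \<Rightarrow> nat) \<Rightarrow> 'p) \<Rightarrow> (nat \<Rightarrow> 'm) \<Rightarrow> 'p" where
  "gen q rk hh Y = (\<Sum>t\<in>multi_index q rk. sm (Y t) (delta_fun (basis_tuple q hh t)))"

lemma lin_gen: "lin (gen q rk hh)"
proof (rule linI)
  show "gen q rk hh (x + y) = gen q rk hh x + gen q rk hh y" for x y
    unfolding gen_def plus_fun_apply sm_add_left sum.distrib ..
  show "gen q rk hh (sm c x) = sm c (gen q rk hh x)" for c x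
    unfolding gen_def sm_apply sm_sum sm_sm ..
qed

context ring_cover begin

definition fh :: "('t \<Rightarrow> 'p) \<Rightarrow> 't \<Rightarrow> 'a" where "fh X = (\<lambda>t. pi (X t))"

lemma lifted_free:
  fixes T :: "'t set"
  shows "lifted (fin_supp T) fh (free_module_on R T)"
  unfolding lifted_def
proof (intro conjI ballI allI)
  show "submod (fin_supp T :: ('t \<Rightarrow> 'p) set)" by (rule submod_fin_supp)
  show "fh ` fin_supp T = carrier (free_module_on R T)"
  proof (rule equalityI; rule subsetI)
    fix f :: "'t \<Rightarrow> 'a" assume "f \<in> fh ` fin_supp T"
    then obtain X where X: "X \<in> fin_supp T" "f = fh X" by blast
    have "{t. f t \<noteq> \<zero>} \<subseteq> {t. X t \<noteq> 0}" by (auto simp: X fh_def pi_0)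
    then have "finite {t. f t \<noteq> \<zero>}" using X(1) finite_subset unfolding fin_supp_def by blast
    then show "f \<in> carrier (free_module_on R T)" using X by (auto simp: free_module_on_def fin_supp_def fh_def pi_0)
  next
    fix f :: "'t \<Rightarrow> 'a" assume "f \<in> carrier (free_module_on R T)"
    then have f: "\<And>t. t \<in> T \<Longrightarrow> f t \<in> carrier R" "\<And>t. t \<notin> T \<Longrightarrow> f t = \<zero>" "finite {t. f t \<noteq> \<zero>}"
      by (auto simp: free_module_on_def)
    have c: "f t \<in> carrier R" for t using f(1,2) by (cases "t \<in> T") auto
    define X where "X t = sec (f t)" for t
    have "{t. X t \<noteq> 0} \<subseteq> {t. f t \<noteq> \<zero>}" by (auto simp: X_def sec_def)
    then have "finite {t. X t \<noteq> 0}" using f(3) by (rule finite_subset)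
    moreover have "X t = 0" if "t \<notin> T" for t using f(2)[OF that] by (simp add: X_def sec_def)
    ultimately have "X \<in> fin_supp T" by (simp add: fin_supp_def)
    moreover have "f = fh X" by (simp add: fun_eq_iff fh_def X_def pi_sec c)
    ultimately show "f \<in> fh ` fin_supp T" by blast
  qed
qed (simp_all add: free_module_on_def fh_def fun_eq_iff pi_0 pi_add pi_mult sm_apply)

lemma free_gen_fh: "free_gen R x = fh (delta_fun x)"
  by (simp add: fun_eq_iff free_gen_def fh_def delta_fun_def pi_0 pi_1)

lemma multi_eval_ker: assumes "X \<in> fin_supp T" "\<And>x. X x \<in> ker" shows "multi_eval q \<rho> X \<in> ker"
  unfolding multi_eval_def by (intro idl_sum[OF idl_ker] idlD(4)[OF idl_ker] assms(2))

text \<open>A linear form with values in \<open>R\<close>, given by representatives in the covering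
  ring. Chosen coordinates are linear only modulo \<open>ker\<close>, so no more can be
  asked.\<close>

definition functional :: "('a, 'm) module \<Rightarrow> ('m \<Rightarrow> 'p) \<Rightarrow> bool" where
  "functional M \<rho> \<longleftrightarrow> (\<forall>x\<in>carrier M. \<forall>y\<in>carrier M. \<rho> (x \<oplus>\<^bsub>M\<^esub> y) - (\<rho> x + \<rho> y) \<in> ker) \<and>
    (\<forall>p. \<forall>x\<in>carrier M. \<rho> (pi p \<odot>\<^bsub>M\<^esub> x) - p * \<rho> x \<in> ker)"

text \<open>Says that \<open>M i\<close> is free of rank \<open>rk i\<close>: the entries of a
  sequence from the rank on do not matter, the others matter modulo \<open>ker\<close>. Rank 0
  describes the zero module.\<close>

definition covers :: "nat \<Rightarrow> (nat \<Rightarrow> ('a, 'm) module) \<Rightarrow> (nat \<Rightarrow> nat) \<Rightarrow> (nat \<Rightarrow> (nat \<Rightarrow> 'p) \<Rightarrow> 'm) \<Rightarrow> bool" where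
  "covers q M rk hh \<longleftrightarrow> (\<forall>i<q. lifted UNIV (hh i) (M i) \<and> (\<forall>c. hh i c = \<zero>\<^bsub>M i\<^esub> \<longleftrightarrow> (\<forall>j<rk i. c j \<in> ker)))"

text \<open>A choice of preimage; for a cover as in \<open>covers\<close>, its entries below the
  rank are determined modulo \<open>ker\<close>, the others not at all.\<close>

definition coord :: "((nat \<Rightarrow> 'p) \<Rightarrow> 'm) \<Rightarrow> 'm \<Rightarrow> nat \<Rightarrow> 'p" where
  "coord h x = (SOME c. h c = x)"

lemma coversD:
  assumes "covers q M rk hh" "i < q"
  shows "lifted UNIV (hh i) (M i)" "hh i c = \<zero>\<^bsub>M i\<^esub> \<longleftrightarrow> (\<forall>j<rk i. c j \<in> ker)" "module R (M i)" "hh i c \<in> carrier (M i)"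
proof -
  show l: "lifted UNIV (hh i) (M i)" and "hh i c = \<zero>\<^bsub>M i\<^esub> \<longleftrightarrow> (\<forall>j<rk i. c j \<in> ker)"
    using assms by (auto simp: covers_def)
  show "module R (M i)" by (rule lifted_module[OF l])
  show "hh i c \<in> carrier (M i)" by (rule liftedD(6)[OF l UNIV_I])
qed

lemma lifted_diff: assumes l: "lifted Z h M" and xy: "x \<in> Z" "y \<in> Z" shows "h x = h y \<longleftrightarrow> h (x - y) = \<zero>\<^bsub>M\<^esub>"
proof -
  interpret M: module R M by (rule lifted_module[OF l])
  note L = liftedD[OF l]
  show ?thesis
  proof
    assume e: "h x = h y"
    have "h (x + - y) = h (y + - y)"
      unfolding L(4)[OF xy(1) submod_minus[OF L(1) xy(2)]] L(4)[OF xy(2) submod_minus[OF L(1) xy(2)]] e ..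
    then show "h (x - y) = \<zero>\<^bsub>M\<^esub>" unfolding add_uminus_conv_diff diff_self L(3) .
  next
    assume e: "h (x - y) = \<zero>\<^bsub>M\<^esub>"
    have "h (x - y + y) = h y" unfolding L(4)[OF submod_diff[OF L(1) xy] xy(2)] e using L(6)[OF xy(2)] by (rule M.l_zero)
    then show "h x = h y" unfolding diff_add_cancel .
  qed
qed

lemma hh_eq_iff:
  assumes c: "covers q M rk hh" and i: "i < q"
  shows "hh i x = hh i y \<longleftrightarrow> (\<forall>j<rk i. x j - y j \<in> ker)"
  using lifted_diff[OF coversD(1)[OF assms], of x y] coversD(2)[OF assms, of "x - y"] by simp

lemma hh_coord:
  assumes c: "covers q M rk hh" and i: "i < q" and x: "x \<in> carrier (M i)"
  shows "hh i (coord (hh i) x) = x"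
proof -
  have "x \<in> range (hh i)" using liftedD(2)[OF coversD(1)[OF c i]] x by simp
  then have "\<exists>c. hh i c = x" by auto
  then show ?thesis unfolding coord_def by (rule someI_ex)
qed

lemma coord_hh:
  assumes c: "covers q M rk hh" and i: "i < q" and j: "j < rk i"
  shows "coord (hh i) (hh i x) j - x j \<in> ker"
  using hh_coord[OF c i coversD(4)[OF c i, of x]] hh_eq_iff[OF c i] j by blast

lemma coord_functional:
  assumes c: "covers q M rk hh" and i: "i < q" and j: "j < rk i"
  shows "functional (M i) (\<lambda>x. coord (hh i) x j)"
  unfolding functional_def
proof (intro conjI ballI allI)
  note L = liftedD[OF coversD(1)[OF c i]]
  fix x assume x: "x \<in> carrier (M i)"
  { fix y assume y: "y \<in> carrier (M i)"
    have "x \<oplus>\<^bsub>M i\<^esub> y = hh i (coord (hh i) x + coord (hh i) y)"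
      unfolding L(4)[OF UNIV_I UNIV_I] hh_coord[OF c i x] hh_coord[OF c i y] ..
    then show "coord (hh i) (x \<oplus>\<^bsub>M i\<^esub> y) j - (coord (hh i) x j + coord (hh i) y j) \<in> ker"
      using coord_hh[OF c i j, of "coord (hh i) x + coord (hh i) y"] by simp }
  fix p
  have "pi p \<odot>\<^bsub>M i\<^esub> x = hh i (sm p (coord (hh i) x))"
    unfolding L(5)[OF UNIV_I] hh_coord[OF c i x] ..
  then show "coord (hh i) (pi p \<odot>\<^bsub>M i\<^esub> x) j - p * coord (hh i) x j \<in> ker"
    using coord_hh[OF c i j, of "sm p (coord (hh i) x)"] by (simp add: sm_apply)
qed

lemma tuples_upd: "x \<in> tuples q M \<Longrightarrow> i < q \<Longrightarrow> u \<in> carrier (M i) \<Longrightarrow> x(i := u) \<in> tuples q M"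
  by (auto simp: tuples_def PiE_def Pi_def extensional_def)

lemma tuplesD: "x \<in> tuples q M \<Longrightarrow> i < q \<Longrightarrow> x i \<in> carrier (M i)"
  by (auto simp: tuples_def PiE_def Pi_def)

lemma relation_add:
  fixes x :: "nat \<Rightarrow> 'm"
  assumes "x \<in> tuples q M" "i < q" "module R (M i)" "u \<in> carrier (M i)" "v \<in> carrier (M i)"
  shows "fh (delta_fun (x(i := u \<oplus>\<^bsub>M i\<^esub> v)) - (delta_fun (x(i := u)) + delta_fun (x(i := v)))) \<in> multilinear_relations R q M"
    "delta_fun (x(i := u \<oplus>\<^bsub>M i\<^esub> v)) - (delta_fun (x(i := u)) + delta_fun (x(i := v))) \<in> fin_supp (tuples q M)"
proof -
  interpret M: module R "M i" by fact
  let ?F = "free_module_on R (tuples q M)"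
  interpret F: module R ?F by (rule lifted_module[OF lifted_free])
  note L = liftedD[OF lifted_free[of "tuples q M"]]
  have d: "delta_fun (x(i := w)) \<in> fin_supp (tuples q M)" if "w \<in> carrier (M i)" for w
    by (rule delta_fun_fin_supp[OF tuples_upd[OF assms(1,2) that]])
  note d1 = d[OF M.a_closed[OF assms(4,5)]] and d2 = d[OF assms(4)] and d3 = d[OF assms(5)]
  note d4 = submod_add[OF submod_fin_supp d2 d3]
  let ?X = "delta_fun (x(i := u \<oplus>\<^bsub>M i\<^esub> v))" and ?Y = "delta_fun (x(i := u)) + delta_fun (x(i := v))"
  have "fh (?X + - ?Y) = fh ?X \<oplus>\<^bsub>?F\<^esub> fh (- ?Y)" by (rule L(4)[OF d1 submod_minus[OF submod_fin_supp d4]])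
  also have "\<dots> = fh ?X \<ominus>\<^bsub>?F\<^esub> (fh (delta_fun (x(i := u))) \<oplus>\<^bsub>?F\<^esub> fh (delta_fun (x(i := v))))"
    unfolding lifted_minus[OF lifted_free d4, symmetric] L(4)[OF d2 d3] a_minus_def ..
  finally have "fh (?X - ?Y) = fh ?X \<ominus>\<^bsub>?F\<^esub> (fh (delta_fun (x(i := u))) \<oplus>\<^bsub>?F\<^esub> fh (delta_fun (x(i := v))))" by (simp only: add_uminus_conv_diff)
  then show "fh (?X - ?Y) \<in> multilinear_relations R q M"
    unfolding multilinear_relations_def Let_def free_gen_fh using assms by blast
  show "?X - ?Y \<in> fin_supp (tuples q M)" by (rule submod_diff[OF submod_fin_supp d1 d4])
qed

lemma relation_smult:
  fixes x :: "nat \<Rightarrow> 'm"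
  assumes "x \<in> tuples q M" "i < q" "module R (M i)" "u \<in> carrier (M i)"
  shows "fh (delta_fun (x(i := pi p \<odot>\<^bsub>M i\<^esub> u)) - sm p (delta_fun (x(i := u)))) \<in> multilinear_relations R q M"
    "delta_fun (x(i := pi p \<odot>\<^bsub>M i\<^esub> u)) - sm p (delta_fun (x(i := u))) \<in> fin_supp (tuples q M)"
proof -
  interpret M: module R "M i" by fact
  let ?F = "free_module_on R (tuples q M)"
  interpret F: module R ?F by (rule lifted_module[OF lifted_free])
  note L = liftedD[OF lifted_free[of "tuples q M"]]
  have d: "delta_fun (x(i := w)) \<in> fin_supp (tuples q M)" if "w \<in> carrier (M i)" for w
    by (rule delta_fun_fin_supp[OF tuples_upd[OF assms(1,2) that]])
  note d1 = d[OF M.smult_closed[OF pi_closed assms(4)]] and d2 = d[OF assms(4)]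
  note d4 = submod_sm[OF submod_fin_supp d2]
  let ?X = "delta_fun (x(i := pi p \<odot>\<^bsub>M i\<^esub> u))" and ?Y = "sm p (delta_fun (x(i := u)))"
  have "fh (?X + - ?Y) = fh ?X \<oplus>\<^bsub>?F\<^esub> fh (- ?Y)" by (rule L(4)[OF d1 submod_minus[OF submod_fin_supp d4]])
  also have "\<dots> = fh ?X \<ominus>\<^bsub>?F\<^esub> pi p \<odot>\<^bsub>?F\<^esub> fh (delta_fun (x(i := u)))"
    unfolding lifted_minus[OF lifted_free d4, symmetric] L(5)[OF d2] a_minus_def ..
  finally have "fh (?X - ?Y) = fh ?X \<ominus>\<^bsub>?F\<^esub> pi p \<odot>\<^bsub>?F\<^esub> fh (delta_fun (x(i := u)))" by (simp only: add_uminus_conv_diff)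
  then show "fh (?X - ?Y) \<in> multilinear_relations R q M"
    unfolding multilinear_relations_def Let_def free_gen_fh using assms pi_closed by blast
  show "?X - ?Y \<in> fin_supp (tuples q M)" by (rule submod_diff[OF submod_fin_supp d1 d4])
qed

lemma relations_cases:
  fixes M :: "nat \<Rightarrow> ('a, 'm) module"
  assumes mod: "\<forall>i<q. module R (M i)" and f: "f \<in> multilinear_relations R q M"
  shows "(\<exists>x i u v. x \<in> tuples q M \<and> i < q \<and> u \<in> carrier (M i) \<and> v \<in> carrier (M i) \<and>
      f = fh (delta_fun (x(i := u \<oplus>\<^bsub>M i\<^esub> v)) - (delta_fun (x(i := u)) + delta_fun (x(i := v))))) \<or>
    (\<exists>x i p u. x \<in> tuples q M \<and> i < q \<and> u \<in> carrier (M i) \<and>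
      f = fh (delta_fun (x(i := pi p \<odot>\<^bsub>M i\<^esub> u)) - sm p (delta_fun (x(i := u)))))"
proof -
  let ?F = "free_module_on R (tuples q M)"
  interpret F: module R ?F by (rule lifted_module[OF lifted_free])
  note L = liftedD[OF lifted_free[of "tuples q M"]]
  have d: "delta_fun (x(i := w)) \<in> fin_supp (tuples q M)" if "x \<in> tuples q M" "i < q" "w \<in> carrier (M i)" for w i x
    by (rule delta_fun_fin_supp[OF tuples_upd[OF that]])
  consider x i u v where "x \<in> tuples q M" "i < q" "u \<in> carrier (M i)" "v \<in> carrier (M i)"
      "f = fh (delta_fun (x(i := u \<oplus>\<^bsub>M i\<^esub> v))) \<ominus>\<^bsub>?F\<^esub> (fh (delta_fun (x(i := u))) \<oplus>\<^bsub>?F\<^esub> fh (delta_fun (x(i := v))))"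
    | x i c u where "x \<in> tuples q M" "i < q" "c \<in> carrier R" "u \<in> carrier (M i)"
      "f = fh (delta_fun (x(i := c \<odot>\<^bsub>M i\<^esub> u))) \<ominus>\<^bsub>?F\<^esub> c \<odot>\<^bsub>?F\<^esub> fh (delta_fun (x(i := u)))"
    using f unfolding multilinear_relations_def Let_def free_gen_fh by blast
  then show ?thesis
  proof cases
    case 1
    interpret M: module R "M i" by (rule mod[rule_format, OF 1(2)])
    note d1 = d[OF 1(1,2) M.a_closed[OF 1(3,4)]] and d2 = d[OF 1(1,2,3)] and d3 = d[OF 1(1,2,4)]
    note d4 = submod_add[OF submod_fin_supp d2 d3]
    let ?X = "delta_fun (x(i := u \<oplus>\<^bsub>M i\<^esub> v))" and ?Y = "delta_fun (x(i := u)) + delta_fun (x(i := v))"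
    have "fh (?X + - ?Y) = fh ?X \<oplus>\<^bsub>?F\<^esub> fh (- ?Y)" by (rule L(4)[OF d1 submod_minus[OF submod_fin_supp d4]])
    also have "\<dots> = f"
      unfolding lifted_minus[OF lifted_free d4, symmetric] L(4)[OF d2 d3] 1(5) a_minus_def ..
    finally have "f = fh (?X - ?Y)" by (simp only: add_uminus_conv_diff)
    then show ?thesis using 1(1-4) by blast
  next
    case 2
    interpret M: module R "M i" by (rule mod[rule_format, OF 2(2)])
    obtain p where p: "c = pi p" using pi_surj[OF 2(3)] by blast
    note d1 = d[OF 2(1,2) M.smult_closed[OF 2(3,4)]] and d2 = d[OF 2(1,2,4)]
    note d4 = submod_sm[OF submod_fin_supp d2, of p]
    let ?X = "delta_fun (x(i := c \<odot>\<^bsub>M i\<^esub> u))" and ?Y = "sm p (delta_fun (x(i := u)))"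
    have "fh (?X + - ?Y) = fh ?X \<oplus>\<^bsub>?F\<^esub> fh (- ?Y)" by (rule L(4)[OF d1 submod_minus[OF submod_fin_supp d4]])
    also have "\<dots> = f"
      unfolding lifted_minus[OF lifted_free d4, symmetric] L(5)[OF d2] 2(5) p a_minus_def ..
    finally have "f = fh (?X - ?Y)" by (simp only: add_uminus_conv_diff)
    then show ?thesis using 2(1,2,4) unfolding p by blast
  qed
qed

lemma relations_closed:
  assumes mod: "\<forall>i<q. module R (M i)"
  shows "multilinear_relations R q M \<subseteq> carrier (free_module_on R (tuples q M))"
proof
  fix f assume f: "f \<in> multilinear_relations R q M"
  note L = liftedD(6)[OF lifted_free[of "tuples q M"]]
  from relations_cases[OF mod f] show "f \<in> carrier (free_module_on R (tuples q M))"
  proof (elim disjE exE conjE)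
    fix x i u v assume h: "x \<in> tuples q M" "i < q" "u \<in> carrier (M i)" "v \<in> carrier (M i)"
      "f = fh (delta_fun (x(i := u \<oplus>\<^bsub>M i\<^esub> v)) - (delta_fun (x(i := u)) + delta_fun (x(i := v))))"
    show ?thesis unfolding h(5) by (rule L[OF relation_add(2)[OF h(1,2) mod[rule_format, OF h(2)] h(3,4)]])
  next
    fix x i p u assume h: "x \<in> tuples q M" "i < q" "u \<in> carrier (M i)"
      "f = fh (delta_fun (x(i := pi p \<odot>\<^bsub>M i\<^esub> u)) - sm p (delta_fun (x(i := u))))"
    show ?thesis unfolding h(4) by (rule L[OF relation_smult(2)[OF h(1,2) mod[rule_format, OF h(2)] h(3)]])
  qed
qed

lemma span_submodule:
  assumes M: "module R M" and S: "S \<subseteq> carrier M"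
  shows "submodule (submodule_span R M S) R M" "S \<subseteq> submodule_span R M S"
    "submodule N R M \<Longrightarrow> S \<subseteq> N \<Longrightarrow> submodule_span R M S \<subseteq> N"
proof -
  interpret M: module R M by fact
  have c: "submodule (carrier M) R M" by (rule M.carrier_is_submodule)
  show "submodule (submodule_span R M S) R M"
  proof (rule M.submoduleI)
    show "submodule_span R M S \<subseteq> carrier M" unfolding submodule_span_def using c S by blast
    show "\<zero>\<^bsub>M\<^esub> \<in> submodule_span R M S" unfolding submodule_span_def
    proof (rule InterI)
      fix N assume "N \<in> {N. submodule N R M \<and> S \<subseteq> N}"
      then show "\<zero>\<^bsub>M\<^esub> \<in> N" using subgroup.one_closed[OF submodule.axioms(1)] by fastforce
    qed
    show "\<ominus>\<^bsub>M\<^esub> u \<in> submodule_span R M S" if "u \<in> submodule_span R M S" for u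
      unfolding submodule_span_def
    proof (rule InterI)
      fix N assume N: "N \<in> {N. submodule N R M \<and> S \<subseteq> N}"
      then have "u \<in> N" using that unfolding submodule_span_def by blast
      then show "\<ominus>\<^bsub>M\<^esub> u \<in> N" using M.submoduleE(3) N by blast
    qed
    show "u \<oplus>\<^bsub>M\<^esub> v \<in> submodule_span R M S" if uv: "u \<in> submodule_span R M S" "v \<in> submodule_span R M S" for u v
      unfolding submodule_span_def
    proof (rule InterI)
      fix N assume N: "N \<in> {N. submodule N R M \<and> S \<subseteq> N}"
      then have "u \<in> N" "v \<in> N" using uv unfolding submodule_span_def by blast+
      then show "u \<oplus>\<^bsub>M\<^esub> v \<in> N" using M.submoduleE(5) N by blast
    qed
    show "c \<odot>\<^bsub>M\<^esub> u \<in> submodule_span R M S" if cu: "c \<in> carrier R" "u \<in> submodule_span R M S" for c u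
      unfolding submodule_span_def
    proof (rule InterI)
      fix N assume N: "N \<in> {N. submodule N R M \<and> S \<subseteq> N}"
      then have "u \<in> N" using cu unfolding submodule_span_def by blast
      then show "c \<odot>\<^bsub>M\<^esub> u \<in> N" using M.submoduleE(4) N cu(1) by blast
    qed
  qed
  show "S \<subseteq> submodule_span R M S" unfolding submodule_span_def by blast
  show "submodule N R M \<Longrightarrow> S \<subseteq> N \<Longrightarrow> submodule_span R M S \<subseteq> N" unfolding submodule_span_def by blast
qed

text \<open>The elements of the covering ring's free module on the tuples that become zero in the tensor
  product.\<close>

definition tensor_rels :: "nat \<Rightarrow> (nat \<Rightarrow> ('a, 'm) module) \<Rightarrow> ((nat \<Rightarrow> 'm) \<Rightarrow> 'p) set" where
  "tensor_rels q M = {X \<in> fin_supp (tuples q M). fh X \<in> tensor_kernel R q M}"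

lemma tensor_kernel_submodule:
  assumes mod: "\<forall>i<q. module R (M i)"
  shows "submodule (tensor_kernel R q M) R (free_module_on R (tuples q M))"
  unfolding tensor_kernel_def by (rule span_submodule(1)[OF lifted_module[OF lifted_free] relations_closed[OF mod]])

lemma submod_tensor_rels: assumes "\<forall>i<q. module R (M i)" shows "submod (tensor_rels q M)"
  unfolding tensor_rels_def by (rule lifted_vimage(1)[OF lifted_free tensor_kernel_submodule[OF assms]])

lemma relation_tensor_rels:
  assumes mod: "\<forall>i<q. module R (M i)" and x: "x \<in> tuples q M" "i < q" "u \<in> carrier (M i)"
  shows "v \<in> carrier (M i) \<Longrightarrow> delta_fun (x(i := u \<oplus>\<^bsub>M i\<^esub> v)) - (delta_fun (x(i := u)) + delta_fun (x(i := v))) \<in> tensor_rels q M"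
    "delta_fun (x(i := pi p \<odot>\<^bsub>M i\<^esub> u)) - sm p (delta_fun (x(i := u))) \<in> tensor_rels q M"
proof -
  have s: "multilinear_relations R q M \<subseteq> tensor_kernel R q M"
    unfolding tensor_kernel_def by (rule span_submodule(2)[OF lifted_module[OF lifted_free] relations_closed[OF mod]])
  show "v \<in> carrier (M i) \<Longrightarrow> delta_fun (x(i := u \<oplus>\<^bsub>M i\<^esub> v)) - (delta_fun (x(i := u)) + delta_fun (x(i := v))) \<in> tensor_rels q M"
    unfolding tensor_rels_def using relation_add[OF x(1,2) mod[rule_format, OF x(2)] x(3)] s by blast
  show "delta_fun (x(i := pi p \<odot>\<^bsub>M i\<^esub> u)) - sm p (delta_fun (x(i := u))) \<in> tensor_rels q M"
    unfolding tensor_rels_def using relation_smult[OF x(1,2) mod[rule_format, OF x(2)] x(3)] s by blast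
qed

lemma prod_upd: "i < q \<Longrightarrow> (\<Prod>k<q. \<rho> k ((x(i := w)) k)) = \<rho> i w * (\<Prod>k\<in>{..<q} - {i}. \<rho> k (x k))" for \<rho> :: "nat \<Rightarrow> 'm \<Rightarrow> 'p"
  by (subst prod.remove[of _ i]) (auto intro!: prod.cong)

text \<open>A product of linear forms is multilinear modulo \<open>ker\<close>, so it vanishes on
  the relations and on the submodule they span: it descends to the tensor product.\<close>

lemma multi_eval_tensor_rels:
  fixes M :: "nat \<Rightarrow> ('a, 'm) module"
  assumes mod: "\<forall>i<q. module R (M i)" and fn: "\<And>i. i < q \<Longrightarrow> functional (M i) (\<rho> i)" and X: "X \<in> tensor_rels q M"
  shows "multi_eval q \<rho> X \<in> ker"
proof -
  let ?T = "tuples q M"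
  define W where "W = {X \<in> fin_supp ?T. multi_eval q \<rho> X \<in> ker}"
  have W: "submod W"
  proof (rule submodI)
    show "0 \<in> W" unfolding W_def using submod_0[OF submod_fin_supp] idlD(1)[OF idl_ker] by (simp add: multi_eval_def)
    show "x + y \<in> W" if xy: "x \<in> W" "y \<in> W" for x y
    proof -
      have m: "x \<in> fin_supp ?T" "y \<in> fin_supp ?T" "multi_eval q \<rho> x \<in> ker" "multi_eval q \<rho> y \<in> ker" using xy by (auto simp: W_def)
      show ?thesis unfolding W_def mem_Collect_eq multi_eval_add[OF m(1,2)] using submod_add[OF submod_fin_supp m(1,2)] idlD(2)[OF idl_ker m(3,4)] ..
    qed
    show "sm c x \<in> W" if x: "x \<in> W" for c x
    proof -
      have m: "x \<in> fin_supp ?T" "multi_eval q \<rho> x \<in> ker" using x by (auto simp: W_def)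
      show ?thesis unfolding W_def mem_Collect_eq multi_eval_sm[OF m(1)] using submod_sm[OF submod_fin_supp m(1)] idlD(3)[OF idl_ker m(2)] ..
    qed
  qed
  have WT: "W \<subseteq> fin_supp ?T" by (auto simp: W_def)
  have "multilinear_relations R q M \<subseteq> fh ` W"
  proof
    fix f assume f: "f \<in> multilinear_relations R q M"
    have d: "delta_fun (x(i := w)) \<in> fin_supp ?T" if "x \<in> ?T" "i < q" "w \<in> carrier (M i)" for w i x
      by (rule delta_fun_fin_supp[OF tuples_upd[OF that]])
    from relations_cases[OF mod f] show "f \<in> fh ` W"
    proof (elim disjE exE conjE)
      fix x i u v assume h: "x \<in> ?T" "i < q" "u \<in> carrier (M i)" "v \<in> carrier (M i)"
        "f = fh (delta_fun (x(i := u \<oplus>\<^bsub>M i\<^esub> v)) - (delta_fun (x(i := u)) + delta_fun (x(i := v))))"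
      interpret M: module R "M i" by (rule mod[rule_format, OF h(2)])
      note d1 = d[OF h(1,2) M.a_closed[OF h(3,4)]] and d2 = d[OF h(1,2,3)] and d3 = d[OF h(1,2,4)]
      let ?X = "delta_fun (x(i := u \<oplus>\<^bsub>M i\<^esub> v)) - (delta_fun (x(i := u)) + delta_fun (x(i := v)))"
      have "multi_eval q \<rho> ?X = (\<rho> i (u \<oplus>\<^bsub>M i\<^esub> v) - (\<rho> i u + \<rho> i v)) * (\<Prod>k\<in>{..<q} - {i}. \<rho> k (x k))"
        unfolding multi_eval_diff[OF d1 submod_add[OF submod_fin_supp d2 d3]] multi_eval_add[OF d2 d3] multi_eval_delta_fun prod_upd[OF h(2)]
        by (simp add: algebra_simps)
      also have "\<dots> \<in> ker" by (rule idlD(4)[OF idl_ker]) (use fn[OF h(2)] h(3,4) in \<open>simp add: functional_def\<close>)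
      finally have "?X \<in> W" using relation_add(2)[OF h(1,2) mod[rule_format, OF h(2)] h(3,4)] unfolding W_def by blast
      then show ?thesis unfolding h(5) by blast
    next
      fix x i p u assume h: "x \<in> ?T" "i < q" "u \<in> carrier (M i)"
        "f = fh (delta_fun (x(i := pi p \<odot>\<^bsub>M i\<^esub> u)) - sm p (delta_fun (x(i := u))))"
      interpret M: module R "M i" by (rule mod[rule_format, OF h(2)])
      note d1 = d[OF h(1,2) M.smult_closed[OF pi_closed h(3)]] and d2 = d[OF h(1,2,3)]
      let ?X = "delta_fun (x(i := pi p \<odot>\<^bsub>M i\<^esub> u)) - sm p (delta_fun (x(i := u)))"
      have "multi_eval q \<rho> ?X = (\<rho> i (pi p \<odot>\<^bsub>M i\<^esub> u) - p * \<rho> i u) * (\<Prod>k\<in>{..<q} - {i}. \<rho> k (x k))"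
        unfolding multi_eval_diff[OF d1 submod_sm[OF submod_fin_supp d2]] multi_eval_sm[OF d2] multi_eval_delta_fun prod_upd[OF h(2)]
        by (simp add: algebra_simps)
      also have "\<dots> \<in> ker" by (rule idlD(4)[OF idl_ker]) (use fn[OF h(2)] h(3) in \<open>simp add: functional_def\<close>)
      finally have "?X \<in> W" using relation_smult(2)[OF h(1,2) mod[rule_format, OF h(2)] h(3)] unfolding W_def by blast
      then show ?thesis unfolding h(4) by blast
    qed
  qed
  then have "tensor_kernel R q M \<subseteq> fh ` W" unfolding tensor_kernel_def
    by (rule span_submodule(3)[OF lifted_module[OF lifted_free] relations_closed[OF mod] lifted_submodule[OF lifted_free W WT]])
  \<comment> \<open>\<open>X\<close> and \<open>X'\<close> have the same image over
    \<open>R\<close>, so they differ by values in \<open>ker\<close>, and the form takes a value in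
    \<open>ker\<close> on the difference.\<close>
  then obtain X' where X': "X' \<in> W" "fh X = fh X'" using X by (auto simp: tensor_rels_def)
  have XT: "X \<in> fin_supp ?T" "X' \<in> fin_supp ?T" "multi_eval q \<rho> X' \<in> ker" using X X' by (auto simp: tensor_rels_def W_def)
  have "pi (X t) = pi (X' t)" for t using X'(2) by (simp add: fh_def fun_eq_iff)
  then have "(X - X') t \<in> ker" for t using pi_eq_iff[of "X t" "X' t"] by simp
  then have "multi_eval q \<rho> (X - X') \<in> ker" by (rule multi_eval_ker[OF submod_diff[OF submod_fin_supp XT(1,2)]])
  then show ?thesis using idl_diff_cancel[OF idl_ker] XT(3) unfolding multi_eval_diff[OF XT(1,2)] by blast
qed

definition tensor_cover :: "nat \<Rightarrow> (nat \<Rightarrow> ('a, 'm) module) \<Rightarrow> (nat \<Rightarrow> nat) \<Rightarrow> (nat \<Rightarrow> (nat \<Rightarrow> 'p) \<Rightarrow> 'm) \<Rightarrow> ((nat \<Rightarrow> nat) \<Rightarrow> 'p) \<Rightarrow> ((nat \<Rightarrow> 'm) \<Rightarrow> 'a) set" where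
  "tensor_cover q M rk hh Y = a_r_coset (free_module_on R (tuples q M)) (tensor_kernel R q M) (fh (gen q rk hh Y))"

lemma basis_tuple_tuples: "covers q M rk hh \<Longrightarrow> basis_tuple q hh t \<in> tuples q M"
  by (auto simp: basis_tuple_def tuples_def coversD(4))

lemma gen_fin_supp: assumes "covers q M rk hh" shows "gen q rk hh Y \<in> fin_supp (tuples q M)"
  unfolding gen_def by (intro submod_sum[OF submod_fin_supp] submod_sm[OF submod_fin_supp] delta_fun_fin_supp basis_tuple_tuples[OF assms])

lemma gen_delta_fun: assumes "t \<in> multi_index q rk" shows "gen q rk hh (delta_fun t) = delta_fun (basis_tuple q hh t)"
proof -
  have "gen q rk hh (delta_fun t) = (\<Sum>s\<in>multi_index q rk. if s = t then delta_fun (basis_tuple q hh s) else 0)"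
    unfolding gen_def by (rule sum.cong[OF refl]) (simp add: delta_fun_def[of t])
  also have "\<dots> = delta_fun (basis_tuple q hh t)" using assms finite_multi_index[of q rk] by (subst sum.delta) auto
  finally show ?thesis .
qed

lemma multi_eval_gen:
  assumes "covers q M rk hh"
  shows "multi_eval q \<rho> (gen q rk hh Y) = (\<Sum>t\<in>multi_index q rk. Y t * (\<Prod>i<q. \<rho> i (hh i (delta_fun (t i)))))"
proof -
  note d = delta_fun_fin_supp[OF basis_tuple_tuples[OF assms]]
  have "multi_eval q \<rho> (gen q rk hh Y) = (\<Sum>t\<in>multi_index q rk. multi_eval q \<rho> (sm (Y t) (delta_fun (basis_tuple q hh t))))"
    unfolding gen_def by (rule multi_eval_sum[OF finite_multi_index submod_sm[OF submod_fin_supp d]])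
  also have "\<dots> = (\<Sum>t\<in>multi_index q rk. Y t * (\<Prod>i<q. \<rho> i (hh i (delta_fun (t i)))))"
    unfolding multi_eval_sm[OF d] multi_eval_delta_fun by (intro sum.cong refl arg_cong2[where f = "(*)"] prod.cong) (auto simp: basis_tuple_def)
  finally show ?thesis .
qed

text \<open>Two nested inductions: the outer one over the number \<open>j\<close> of leading entries
  that may be arbitrary, all later ones being basis vectors; the inner one over the number of terms
  taken from the basis expansion of entry \<open>j\<close>.\<close>

lemma delta_fun_spanned:
  fixes M :: "nat \<Rightarrow> ('a, 'm) module"
  assumes c: "covers q M rk hh"
  shows "j \<le> q \<Longrightarrow> x \<in> tuples q M \<Longrightarrow> (\<And>i. j \<le> i \<Longrightarrow> i < q \<Longrightarrow> \<exists>k<rk i. x i = hh i (delta_fun k)) \<Longrightarrow>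
    \<exists>Y. delta_fun x - gen q rk hh Y \<in> tensor_rels q M"
proof (induction j arbitrary: x)
  case 0
  then have "\<forall>i. \<exists>k. i < q \<longrightarrow> k < rk i \<and> x i = hh i (delta_fun k)" by blast
  from choice[OF this] obtain t where t: "\<And>i. i < q \<Longrightarrow> t i < rk i \<and> x i = hh i (delta_fun (t i))" by blast
  define t' where "t' = (\<lambda>i\<in>{..<q}. t i)"
  have t': "t' \<in> multi_index q rk" using t by (auto simp: t'_def multi_index_def)
  have "basis_tuple q hh t' = x"
  proof
    fix i show "basis_tuple q hh t' i = x i"
      using t[of i] "0.prems"(2) by (cases "i < q") (auto simp: basis_tuple_def t'_def tuples_def PiE_def extensional_def)
  qed
  then have "delta_fun x = gen q rk hh (delta_fun t')" using gen_delta_fun[OF t'] by metis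
  then have "delta_fun x - gen q rk hh (delta_fun t') = 0" by simp
  moreover have "0 \<in> tensor_rels q M" by (rule submod_0[OF submod_tensor_rels]) (use coversD(3)[OF c] in blast)
  ultimately show ?case by metis
next
  case (Suc j)
  note outer = Suc.IH and xt = Suc.prems(2) and xb = Suc.prems(3)
  have mod: "\<forall>i<q. module R (M i)" using coversD(3)[OF c] by blast
  have jq: "j < q" using Suc.prems(1) by simp
  note L = liftedD[OF coversD(1)[OF c jq]]
  note tensor_rels = submod_tensor_rels[OF mod]
  define e where "e = coord (hh j) (x j)"
  define w where "w n = (\<Sum>k<n. sm (e k) (delta_fun k))" for n :: nat
  have wc: "w n k = (if k < n then e k else 0)" for n k
  proof -
    have "w n k = (\<Sum>k'<n. if k' = k then e k' else 0)"
      unfolding w_def sum_fun_apply sm_apply by (rule sum.cong) (auto simp: delta_fun_def)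
    then show ?thesis by simp
  qed
  have xj: "x j = hh j (w (rk j))"
  proof -
    have "hh j e = x j" unfolding e_def by (rule hh_coord[OF c jq tuplesD[OF Suc.prems(2) jq]])
    moreover have "hh j e = hh j (w (rk j))" unfolding hh_eq_iff[OF c jq] using idlD(1)[OF idl_ker] by (simp add: wc)
    ultimately show ?thesis by simp
  qed
  have step: "n \<le> rk j \<Longrightarrow> \<exists>Y. delta_fun (x(j := hh j (w n))) - gen q rk hh Y \<in> tensor_rels q M" for n
  proof (induction n)
    case 0
    \<comment> \<open>The zero entry is written as 0 times \<open>x j\<close>, so that the relation
      for scalars makes a tuple with a zero entry vanish.\<close>
    have "hh j (w 0) = pi 0 \<odot>\<^bsub>M j\<^esub> x j"
    proof -
      have "hh j (w 0) = \<zero>\<^bsub>M j\<^esub>" using coversD(2)[OF c jq, of "w 0"] idlD(1)[OF idl_ker] by (simp add: wc)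
      moreover have "pi 0 \<odot>\<^bsub>M j\<^esub> x j = hh j (sm 0 (w (rk j)))" unfolding xj by (rule L(5)[OF UNIV_I, symmetric])
      moreover have "hh j (sm 0 (w (rk j))) = \<zero>\<^bsub>M j\<^esub>" unfolding sm_zero by (rule L(3))
      ultimately show ?thesis by simp
    qed
    then have "delta_fun (x(j := hh j (w 0))) - sm 0 (delta_fun (x(j := x j))) \<in> tensor_rels q M"
      using relation_tensor_rels(2)[OF mod xt jq tuplesD[OF xt jq], of 0] by metis
    then have "delta_fun (x(j := hh j (w 0))) - gen q rk hh 0 \<in> tensor_rels q M" unfolding sm_zero lin_0[OF lin_gen] .
    then show ?case by blast
  next
    case (Suc n)
    then have "n \<le> rk j" by simp
    from Suc.IH[OF this] obtain Y where Y: "delta_fun (x(j := hh j (w n))) - gen q rk hh Y \<in> tensor_rels q M" ..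
    let ?u = "hh j (w n)" and ?b = "hh j (delta_fun n)"
    have "\<exists>Y. delta_fun (x(j := ?b)) - gen q rk hh Y \<in> tensor_rels q M"
    proof (rule outer)
      show "j \<le> q" using jq by simp
      show "x(j := ?b) \<in> tuples q M" by (rule tuples_upd[OF xt jq coversD(4)[OF c jq]])
      fix i assume i: "j \<le> i" "i < q"
      show "\<exists>k<rk i. (x(j := ?b)) i = hh i (delta_fun k)"
      proof (cases "i = j")
        case True then show ?thesis using \<open>Suc n \<le> rk j\<close> by (intro exI[of _ n]) auto
      next
        case False then show ?thesis using xb[of i] i by auto
      qed
    qed
    then obtain Y' where Y': "delta_fun (x(j := ?b)) - gen q rk hh Y' \<in> tensor_rels q M" by blast
    let ?v = "pi (e n) \<odot>\<^bsub>M j\<^esub> ?b"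
    have vc: "?v \<in> carrier (M j)" using module.smult_closed[OF mod[rule_format, OF jq] pi_closed coversD(4)[OF c jq]] .
    have ws: "hh j (w (Suc n)) = ?u \<oplus>\<^bsub>M j\<^esub> ?v"
    proof -
      have "w (Suc n) = w n + sm (e n) (delta_fun n)" unfolding w_def by (rule sum.lessThan_Suc)
      then show ?thesis using L(4)[OF UNIV_I UNIV_I, of "w n" "sm (e n) (delta_fun n)"] L(5)[OF UNIV_I, of "e n" "delta_fun n"] by metis
    qed
    have r1: "delta_fun (x(j := ?u \<oplus>\<^bsub>M j\<^esub> ?v)) - (delta_fun (x(j := ?u)) + delta_fun (x(j := ?v))) \<in> tensor_rels q M"
      by (rule relation_tensor_rels(1)[OF mod xt jq coversD(4)[OF c jq] vc])
    have r2: "delta_fun (x(j := ?v)) - sm (e n) (delta_fun (x(j := ?b))) \<in> tensor_rels q M"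
      by (rule relation_tensor_rels(2)[OF mod xt jq coversD(4)[OF c jq]])
    let ?Y = "Y + sm (e n) Y'"
    have "delta_fun (x(j := hh j (w (Suc n)))) - gen q rk hh ?Y =
       ((delta_fun (x(j := ?u \<oplus>\<^bsub>M j\<^esub> ?v)) - (delta_fun (x(j := ?u)) + delta_fun (x(j := ?v)))) +
        (delta_fun (x(j := ?v)) - sm (e n) (delta_fun (x(j := ?b))))) +
       ((delta_fun (x(j := ?u)) - gen q rk hh Y) + sm (e n) (delta_fun (x(j := ?b)) - gen q rk hh Y'))"
      unfolding ws lin_add[OF lin_gen] lin_sm[OF lin_gen] sm_diff by (simp only: diff_conv_add_uminus minus_add_distrib minus_minus ac_simps) (simp add: algebra_simps)
    also have "\<dots> \<in> tensor_rels q M"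
      by (intro submod_add[OF tensor_rels] submod_sm[OF tensor_rels] r1 r2 Y Y')
    finally show ?case by blast
  qed
  have e: "x(j := hh j (w (rk j))) = x" using xj by (metis fun_upd_triv)
  from step[OF order_refl] show ?case unfolding e .
qed

lemma fin_supp_spanned:
  assumes c: "covers q M rk hh" and X: "X \<in> fin_supp (tuples q M)"
  shows "\<exists>Y. X - gen q rk hh Y \<in> tensor_rels q M"
proof -
  have mod: "\<forall>i<q. module R (M i)" using coversD(3)[OF c] by blast
  note tensor_rels = submod_tensor_rels[OF mod]
  have "\<exists>Y. delta_fun x - gen q rk hh Y \<in> tensor_rels q M" if "X x \<noteq> 0" for x
    by (rule delta_fun_spanned[OF c order_refl]) (use X that in \<open>auto simp: fin_supp_def\<close>)
  then have "\<forall>x. \<exists>Y. X x \<noteq> 0 \<longrightarrow> delta_fun x - gen q rk hh Y \<in> tensor_rels q M" by blast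
  from choice[OF this] obtain Y where Y: "\<And>x. X x \<noteq> 0 \<Longrightarrow> delta_fun x - gen q rk hh (Y x) \<in> tensor_rels q M" by blast
  let ?S = "{x. X x \<noteq> 0}"
  have "(\<Sum>x\<in>?S. sm (X x) (delta_fun x - gen q rk hh (Y x))) \<in> tensor_rels q M"
    by (rule submod_sum[OF tensor_rels], rule submod_sm[OF tensor_rels], rule Y) simp
  also have "(\<Sum>x\<in>?S. sm (X x) (delta_fun x - gen q rk hh (Y x))) = X - gen q rk hh (\<Sum>x\<in>?S. sm (X x) (Y x))"
    unfolding sm_diff sum_subtractf lin_sum[OF lin_gen] lin_sm[OF lin_gen] fin_supp_expand[OF X, symmetric] ..
  finally show ?thesis by blast
qed

lemma coset_cong:
  assumes mod: "\<forall>i<q. module R (M i)" and X: "X \<in> fin_supp (tuples q M)" "X' \<in> fin_supp (tuples q M)"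
  shows "a_r_coset (free_module_on R (tuples q M)) (tensor_kernel R q M) (fh X) =
      a_r_coset (free_module_on R (tuples q M)) (tensor_kernel R q M) (fh X') \<longleftrightarrow> X - X' \<in> tensor_rels q M"
proof -
  note l = lifted_quotient[OF lifted_free tensor_kernel_submodule[OF mod]]
  have d: "X - X' \<in> fin_supp (tuples q M)" by (rule submod_diff[OF submod_fin_supp X])
  have "\<zero>\<^bsub>quotient_module (free_module_on R (tuples q M)) (tensor_kernel R q M)\<^esub> = tensor_kernel R q M"
    by (simp add: quotient_module_def)
  then show ?thesis
    using lifted_diff[OF l X] coset_eq_iff[OF lifted_module[OF lifted_free] tensor_kernel_submodule[OF mod] liftedD(6)[OF lifted_free d]] d
    by (simp add: tensor_rels_def)
qed

lemma lifted_tensor_cover: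
  assumes c: "covers q M rk hh"
  shows "lifted UNIV (tensor_cover q M rk hh) (tensor_product R q M)"
proof -
  have mod: "\<forall>i<q. module R (M i)" using coversD(3)[OF c] by blast
  note l = lifted_quotient[OF lifted_free tensor_kernel_submodule[OF mod]]
  have "lifted UNIV (\<lambda>Y. a_r_coset (free_module_on R (tuples q M)) (tensor_kernel R q M) (fh (gen q rk hh Y)))
      (quotient_module (free_module_on R (tuples q M)) (tensor_kernel R q M))"
  proof (rule lifted_comp[OF l lin_gen submod_UNIV gen_fin_supp[OF c]])
    fix u assume "u \<in> carrier (quotient_module (free_module_on R (tuples q M)) (tensor_kernel R q M))"
    then obtain X where X: "X \<in> fin_supp (tuples q M)" "u = a_r_coset (free_module_on R (tuples q M)) (tensor_kernel R q M) (fh X)"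
      using liftedD(2)[OF l] by blast
    from fin_supp_spanned[OF c X(1)] obtain Y where "X - gen q rk hh Y \<in> tensor_rels q M" ..
    then show "\<exists>Y\<in>UNIV. a_r_coset (free_module_on R (tuples q M)) (tensor_kernel R q M) (fh (gen q rk hh Y)) = u"
      using coset_cong[OF mod X(1) gen_fin_supp[OF c]] X(2) by blast
  qed
  then show ?thesis unfolding tensor_cover_def tensor_product_def .
qed

lemma prod_ker:
  assumes "finite I" "\<And>i. i \<in> I \<Longrightarrow> f i - g i \<in> ker" shows "(\<Prod>i\<in>I. f i) - (\<Prod>i\<in>I. g i) \<in> ker"
proof -
  have "pi (\<Prod>i\<in>I. f i) = pi (\<Prod>i\<in>I. g i)"
    unfolding pi_prod[OF assms(1)] by (rule finprod_cong') (use assms(2) pi_eq_iff in auto)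
  then show ?thesis by (simp add: pi_eq_iff)
qed

lemma prod_delta_fun:
  assumes "s \<in> multi_index q rk" "t \<in> multi_index q rk'"
  shows "(\<Prod>i<q. delta_fun (t i) (s i)) = (if s = t then 1 else 0 :: 'p)"
proof (cases "s = t")
  case False
  then obtain i where "i < q" "s i \<noteq> t i" using multi_index_eqI[OF assms] by blast
  then have "(\<Prod>i<q. delta_fun (t i) (s i)) = (0 :: 'p)" by (intro prod_zero) (auto simp: delta_fun_def)
  then show ?thesis using False by simp
qed (simp add: delta_fun_def)

text \<open>The product of the coordinate forms chosen by \<open>s\<close> is an element of the dual
  basis, so it extracts the coefficient at \<open>s\<close>.\<close>

lemma multi_eval_coord_gen:
  assumes c: "covers q M rk hh" and s: "s \<in> multi_index q rk"
  shows "multi_eval q (\<lambda>i x. coord (hh i) x (s i)) (gen q rk hh Y) - Y s \<in> ker"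
proof -
  have e: "Y s = (\<Sum>t\<in>multi_index q rk. Y t * (\<Prod>i<q. delta_fun (t i) (s i)))"
  proof -
    have "(\<Sum>t\<in>multi_index q rk. Y t * (\<Prod>i<q. delta_fun (t i) (s i))) = (\<Sum>t\<in>multi_index q rk. if t = s then Y t else 0)"
      by (rule sum.cong[OF refl]) (use prod_delta_fun[OF s] in auto)
    then show ?thesis using s finite_multi_index[of q rk] by simp
  qed
  have "(\<Sum>t\<in>multi_index q rk. Y t * ((\<Prod>i<q. coord (hh i) (hh i (delta_fun (t i))) (s i)) - (\<Prod>i<q. delta_fun (t i) (s i)))) \<in> ker"
    by (intro idl_sum[OF idl_ker] idlD(3)[OF idl_ker] prod_ker) (use coord_hh[OF c] ixD[OF s] in auto)
  then show ?thesis by (subst e) (simp add: multi_eval_gen[OF c] right_diff_distrib sum_subtractf)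
qed

lemma multi_eval_coord_tensor_rels:
  assumes c: "covers q M rk hh" and s: "s \<in> multi_index q rk" and X: "X \<in> tensor_rels q M"
  shows "multi_eval q (\<lambda>i x. coord (hh i) x (s i)) X \<in> ker"
  by (rule multi_eval_tensor_rels[OF _ coord_functional[OF c _ ixD[OF s]] X]) (use coversD(3)[OF c] in auto)

text \<open>The dual forms separate the basis tensors, which gives independence; conversely,
  coefficients in \<open>ker\<close> are zero already in the free module over
  \<open>R\<close>.\<close>

lemma tensor_cover_eq_iff:
  assumes c: "covers q M rk hh"
  shows "tensor_cover q M rk hh Y = tensor_cover q M rk hh Y' \<longleftrightarrow> (\<forall>t\<in>multi_index q rk. Y t - Y' t \<in> ker)"
proof -
  have mod: "\<forall>i<q. module R (M i)" using coversD(3)[OF c] by blast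
  have "tensor_cover q M rk hh Y = tensor_cover q M rk hh Y' \<longleftrightarrow> gen q rk hh (Y - Y') \<in> tensor_rels q M"
    unfolding tensor_cover_def coset_cong[OF mod gen_fin_supp[OF c] gen_fin_supp[OF c]] lin_diff[OF lin_gen] ..
  also have "\<dots> \<longleftrightarrow> (\<forall>t\<in>multi_index q rk. (Y - Y') t \<in> ker)"
  proof
    assume g: "gen q rk hh (Y - Y') \<in> tensor_rels q M"
    show "\<forall>t\<in>multi_index q rk. (Y - Y') t \<in> ker"
    proof
      fix t assume t: "t \<in> multi_index q rk"
      show "(Y - Y') t \<in> ker"
        using idl_diff_cancel[OF idl_ker multi_eval_coord_gen[OF c t]] multi_eval_coord_tensor_rels[OF c t g] by blast
    qed
  next
    assume k: "\<forall>t\<in>multi_index q rk. (Y - Y') t \<in> ker"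
    have "fh (gen q rk hh (Y - Y')) = fh 0"
    proof
      fix x
      have "gen q rk hh (Y - Y') x \<in> ker"
        unfolding gen_def sum_fun_apply sm_apply using k by (intro idl_sum[OF idl_ker] idlD(4)[OF idl_ker]) auto
      then show "fh (gen q rk hh (Y - Y')) x = fh 0 x" by (simp add: fh_def ker_def pi_0)
    qed
    moreover have "fh 0 \<in> tensor_kernel R q M"
      using submod_0[OF submod_tensor_rels[OF mod]] by (simp add: tensor_rels_def)
    ultimately show "gen q rk hh (Y - Y') \<in> tensor_rels q M" using gen_fin_supp[OF c] by (simp add: tensor_rels_def)
  qed
  finally show ?thesis by simp
qed

lemma pure_tensor_tensor_cover:
  assumes c: "covers q M rk hh" and y: "y \<in> tuples q M"
  shows "pure_tensor R q M y = tensor_cover q M rk hh (\<lambda>s. \<Prod>i<q. coord (hh i) (y i) (s i))"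
proof -
  have mod: "\<forall>i<q. module R (M i)" using coversD(3)[OF c] by blast
  from fin_supp_spanned[OF c delta_fun_fin_supp[OF y]] obtain Y where Y: "delta_fun y - gen q rk hh Y \<in> tensor_rels q M" ..
  then have "pure_tensor R q M y = tensor_cover q M rk hh Y"
    unfolding pure_tensor_def tensor_cover_def free_gen_fh using coset_cong[OF mod delta_fun_fin_supp[OF y] gen_fin_supp[OF c]] by blast
  moreover have "tensor_cover q M rk hh Y = tensor_cover q M rk hh (\<lambda>s. \<Prod>i<q. coord (hh i) (y i) (s i))"
    unfolding tensor_cover_eq_iff[OF c]
  proof
    fix s assume s: "s \<in> multi_index q rk"
    have 1: "multi_eval q (\<lambda>i x. coord (hh i) x (s i)) (gen q rk hh Y) - Y s \<in> ker" by (rule multi_eval_coord_gen[OF c s])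
    have 2: "(\<Prod>i<q. coord (hh i) (y i) (s i)) - multi_eval q (\<lambda>i x. coord (hh i) x (s i)) (gen q rk hh Y) \<in> ker"
      using multi_eval_coord_tensor_rels[OF c s Y] unfolding multi_eval_diff[OF delta_fun_fin_supp[OF y] gen_fin_supp[OF c]] multi_eval_delta_fun .
    from idlD(5)[OF idl_ker idlD(2)[OF idl_ker 2 1]] show "Y s - (\<Prod>i<q. coord (hh i) (y i) (s i)) \<in> ker" by simp
  qed
  ultimately show ?thesis by simp
qed

lemma functional_comp:
  assumes f: "f \<in> linear_maps R M N" and \<rho>: "functional N \<rho>" shows "functional M (\<lambda>x. \<rho> (f x))"
  using assms unfolding functional_def linear_maps_def by (auto simp: Pi_iff)

text \<open>\<open>tensor_lift\<close> takes the only element of the image of a coset, so the linear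
  extension has to be shown constant on the coset. Its target coordinates are given by the
  coordinate forms composed with the maps, and these respect \<open>tensor_rels\<close>.\<close>

lemma tensor_map_tensor_cover:
  assumes c: "covers q M rk hh" and d: "covers q N rk' hh'"
    and \<psi>: "\<And>i. i < q \<Longrightarrow> \<psi> i \<in> linear_maps R (M i) (N i)"
  shows "tensor_map R q N \<psi> (tensor_cover q M rk hh Y) =
    tensor_cover q N rk' hh' (\<lambda>s. \<Sum>t\<in>multi_index q rk. Y t * (\<Prod>i<q. coord (hh' i) (\<psi> i (hh i (delta_fun (t i)))) (s i)))"
proof -
  have mod: "\<forall>i<q. module R (M i)" using coversD(3)[OF c] by blast
  let ?F = "free_module_on R (tuples q M)" and ?K = "tensor_kernel R q M"
  interpret F: module R ?F by (rule lifted_module[OF lifted_free])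
  interpret K: additive_subgroup ?K ?F
    by (rule additive_subgroup.intro[OF submodule.axioms(1)[OF tensor_kernel_submodule[OF mod]]])
  interpret S: abelian_subgroup ?K ?F by (rule abelian_subgroupI3[OF K.additive_subgroup_axioms F.abelian_group_axioms])
  define \<rho> where "\<rho> s i x = coord (hh' i) (\<psi> i x) (s i)" for s :: "nat \<Rightarrow> nat" and i x
  let ?g = "\<lambda>x. pure_tensor R q N (\<lambda>i\<in>{..<q}. \<psi> i (x i))"
  let ?LE = "\<lambda>f. \<Oplus>\<^bsub>tensor_product R q N\<^esub>x\<in>{x. f x \<noteq> \<zero>}. f x \<odot>\<^bsub>tensor_product R q N\<^esub> ?g x"
  note LN = lifted_tensor_cover[OF d]
  have LE: "?LE f = tensor_cover q N rk' hh' (\<lambda>s. multi_eval q (\<rho> s) (gen q rk hh Y))" if f: "f \<in> tensor_cover q M rk hh Y" for f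
  proof -
    have hTs: "tensor_cover q M rk hh Y \<subseteq> carrier ?F"
      unfolding tensor_cover_def using F.a_r_coset_subset_G[OF K.a_subset liftedD(6)[OF lifted_free gen_fin_supp[OF c]]] .
    then have fc: "f \<in> carrier ?F" using f by blast
    define X where "X x = sec (f x)" for x
    have fR: "f x \<in> carrier R" for x using fc by (cases "x \<in> tuples q M") (auto simp: free_module_on_def)
    have fX: "f x = pi (X x)" for x by (simp add: X_def pi_sec fR)
    \<comment> \<open>As \<open>sec\<close> sends zero to 0, the lift has the same support, and both
      sums range over the same tuples.\<close>
    have supp: "{x. f x \<noteq> \<zero>} = {x. X x \<noteq> 0}"
    proof (rule equalityI; rule subsetI)
      fix x assume "x \<in> {x. f x \<noteq> \<zero>}" then show "x \<in> {x. X x \<noteq> 0}" using fX[of x] by (auto simp: pi_0)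
    next
      fix x assume "x \<in> {x. X x \<noteq> 0}" then show "x \<in> {x. f x \<noteq> \<zero>}" by (auto simp: X_def sec_def)
    qed
    have fin: "finite {x. X x \<noteq> 0}" using fc unfolding supp[symmetric] by (simp add: free_module_on_def)
    have XT: "x \<in> tuples q M" if "X x \<noteq> 0" for x
    proof -
      have "f x \<noteq> \<zero>" using that supp by blast
      then show ?thesis using fc by (auto simp: free_module_on_def)
    qed
    have X: "X \<in> fin_supp (tuples q M)" using fin XT by (auto simp: fin_supp_def)
    have fhX: "f = fh X" by (simp add: fun_eq_iff fh_def fX)
    have "?LE f = (\<Oplus>\<^bsub>tensor_product R q N\<^esub>x\<in>{x. X x \<noteq> 0}. tensor_cover q N rk' hh' (sm (X x) (\<lambda>s. \<Prod>i<q. \<rho> s i (x i))))"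
      unfolding supp
    proof (rule abelian_monoid.finsum_cong')
      interpret T: module R "tensor_product R q N" by (rule lifted_module[OF LN])
      show "abelian_monoid (tensor_product R q N)" by (rule T.abelian_monoid_axioms)
      show "(\<lambda>x. tensor_cover q N rk' hh' (sm (X x) (\<lambda>s. \<Prod>i<q. \<rho> s i (x i)))) \<in> {x. X x \<noteq> 0} \<rightarrow> carrier (tensor_product R q N)"
        using liftedD(6)[OF LN UNIV_I] by blast
      fix x assume "x \<in> {x. X x \<noteq> 0}"
      then have x: "x \<in> tuples q M" using XT by blast
      have "\<psi> i (x i) \<in> carrier (N i)" if "i < q" for i
        using \<psi>[OF that] tuplesD[OF x that] by (auto simp: linear_maps_def)
      then have t: "(\<lambda>i\<in>{..<q}. \<psi> i (x i)) \<in> tuples q N" by (auto simp: tuples_def)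
      have "?g x = tensor_cover q N rk' hh' (\<lambda>s. \<Prod>i<q. \<rho> s i (x i))"
        unfolding pure_tensor_tensor_cover[OF d t] \<rho>_def by simp
      then show "f x \<odot>\<^bsub>tensor_product R q N\<^esub> ?g x = tensor_cover q N rk' hh' (sm (X x) (\<lambda>s. \<Prod>i<q. \<rho> s i (x i)))"
        using liftedD(5)[OF LN UNIV_I, of "X x" "\<lambda>s. \<Prod>i<q. \<rho> s i (x i)"] fX[of x] by simp
    qed simp
    also have "\<dots> = tensor_cover q N rk' hh' (\<Sum>x\<in>{x. X x \<noteq> 0}. sm (X x) (\<lambda>s. \<Prod>i<q. \<rho> s i (x i)))"
      by (rule lifted_finsum[OF LN fin UNIV_I])
    also have "(\<Sum>x\<in>{x. X x \<noteq> 0}. sm (X x) (\<lambda>s. \<Prod>i<q. \<rho> s i (x i))) = (\<lambda>s. multi_eval q (\<rho> s) X)"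
      by (simp add: fun_eq_iff sum_fun_apply sm_apply multi_eval_def)
    also have "tensor_cover q N rk' hh' (\<lambda>s. multi_eval q (\<rho> s) X) = tensor_cover q N rk' hh' (\<lambda>s. multi_eval q (\<rho> s) (gen q rk hh Y))"
      unfolding tensor_cover_eq_iff[OF d]
    proof
      fix s assume s: "s \<in> multi_index q rk'"
      have "f \<in> a_r_coset ?F ?K (fh (gen q rk hh Y))" using f by (simp add: tensor_cover_def)
      from F.a_repr_independence[OF this liftedD(6)[OF lifted_free gen_fin_supp[OF c]] submodule.axioms(1)[OF tensor_kernel_submodule[OF mod]]]
      have "a_r_coset ?F ?K (fh (gen q rk hh Y)) = a_r_coset ?F ?K (fh X)" unfolding fhX .
      then have hX: "X - gen q rk hh Y \<in> tensor_rels q M" using coset_cong[OF mod X gen_fin_supp[OF c, of Y]] by metis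
      have "multi_eval q (\<rho> s) (X - gen q rk hh Y) \<in> ker"
      proof (rule multi_eval_tensor_rels[OF mod _ hX])
        fix i assume i: "i < q"
        show "functional (M i) (\<rho> s i)" unfolding \<rho>_def
          by (rule functional_comp[OF \<psi>[OF i] coord_functional[OF d i ixD[OF s i]]])
      qed
      then show "multi_eval q (\<rho> s) X - multi_eval q (\<rho> s) (gen q rk hh Y) \<in> ker" unfolding multi_eval_diff[OF X gen_fin_supp[OF c]] .
    qed
    finally show ?thesis .
  qed
  have ne: "fh (gen q rk hh Y) \<in> tensor_cover q M rk hh Y"
    unfolding tensor_cover_def by (rule S.a_rcos_self[OF liftedD(6)[OF lifted_free gen_fin_supp[OF c]]])
  have "?LE ` tensor_cover q M rk hh Y = {tensor_cover q N rk' hh' (\<lambda>s. multi_eval q (\<rho> s) (gen q rk hh Y))}"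
    using LE ne by (auto intro!: image_eqI[OF _ ne])
  then have "tensor_map R q N \<psi> (tensor_cover q M rk hh Y) = tensor_cover q N rk' hh' (\<lambda>s. multi_eval q (\<rho> s) (gen q rk hh Y))"
    unfolding tensor_map_def tensor_lift_def by simp
  then show ?thesis unfolding multi_eval_gen[OF c] \<rho>_def .
qed

end

section \<open>Koszul complexes in coordinates\<close>

text \<open>Unrolls the recursion into the shape of the boundary in \<open>tensor_complex\<close>:
  the sign of the i-th term counts the earlier factors of degree 1.\<close>

lemma kd_closed_form:
  "l \<in> idx fs \<Longrightarrow> kd fs x l = (\<Sum>i<length fs. if fst (l ! i) then 0
     else (- 1) ^ (\<Sum>k<i. if fst (l ! k) then 1 else 0) *
       (\<Sum>j<dim_row (fs ! i). fs ! i $$ (snd (l ! i), j) * x (l[i := (True, j)])))"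
proof (induction fs arbitrary: l x)
  case Nil then show ?case by simp
next
  case (Cons A fs)
  then obtain b k l' where l: "l = (b, k) # l'" "k < dim_row A" "l' \<in> idx fs" by auto
  have IH: "kd fs (\<lambda>l''. x ((b, k) # l'')) l' = (\<Sum>i<length fs. if fst (l' ! i) then 0
     else (- 1) ^ (\<Sum>k<i. if fst (l' ! k) then 1 else 0) *
       (\<Sum>j<dim_row (fs ! i). fs ! i $$ (snd (l' ! i), j) * x ((b, k) # l'[i := (True, j)])))"
    by (rule Cons.IH[OF l(3)])
  have e: "(if fst (l' ! i) then 0 else (- 1) ^ ((if b then 1 else 0) + (\<Sum>k<i. if fst (l' ! k) then 1 else 0)) * u) =
     (if b then - 1 else 1) * (if fst (l' ! i) then 0 else (- 1) ^ (\<Sum>k<i. if fst (l' ! k) then 1 else 0) * u)" for i and u :: 'a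
    by auto
  let ?u = "\<lambda>i. \<Sum>j<dim_row (fs ! i). fs ! i $$ (snd (l' ! i), j) * x ((b, k) # l'[i := (True, j)])"
  have "(\<Sum>i<length (A # fs). if fst (l ! i) then 0 else (- 1) ^ (\<Sum>k<i. if fst (l ! k) then 1 else 0) *
       (\<Sum>j<dim_row ((A # fs) ! i). (A # fs) ! i $$ (snd (l ! i), j) * x (l[i := (True, j)]))) =
     (if b then 0 else \<Sum>j<dim_row A. A $$ (k, j) * x ((True, j) # l')) +
     (\<Sum>i<length fs. if fst (l' ! i) then 0 else (- 1) ^ ((if b then 1 else 0) + (\<Sum>k<i. if fst (l' ! k) then 1 else 0)) * ?u i)"
    unfolding l(1) by (simp add: sum.lessThan_Suc_shift del: sum.lessThan_Suc power_Suc cong: if_cong)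
  also have "\<dots> = kd (A # fs) x l"
    unfolding e sum_distrib_left[symmetric] IH[symmetric] l(1) by simp
  finally show ?case by (rule sym)
qed

lemma mem_idx_iff: "l \<in> idx fs \<longleftrightarrow> length l = length fs \<and> (\<forall>i<length fs. snd (l ! i) < dim_row (fs ! i))"
proof (induction fs arbitrary: l)
  case Nil then show ?case by simp
next
  case (Cons A fs)
  show ?case
  proof (cases l)
    case Nil then show ?thesis by simp
  next
    case (Cons h l')
    obtain b k where h: "h = (b, k)" by (cases h)
    show ?thesis unfolding Cons h mem_idx_Cons Cons.IH by (auto simp: All_less_Suc2)
  qed
qed

lemma hdeg_sum: "hdeg l = (\<Sum>i<length l. if fst (l ! i) then 1 else 0)"
proof (induction l)
  case (Cons h l)
  then show ?case by (cases h) (simp add: sum.lessThan_Suc_shift del: sum.lessThan_Suc)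
qed simp

text \<open>Joins a multidegree and a multi-index into one list. Testing for degree 1 loses nothing,
  as multidegrees with a larger entry will have no multi-indices
  (\<open>multi_index_rJ\<close>).\<close>

definition enc :: "nat \<Rightarrow> (nat \<Rightarrow> nat) \<Rightarrow> (nat \<Rightarrow> nat) \<Rightarrow> (bool \<times> nat) list" where
  "enc q J t = map (\<lambda>i. (J i = 1, t i)) [0..<q]"

lemma enc_nth: "i < q \<Longrightarrow> enc q J t ! i = (J i = 1, t i)" and length_enc: "length (enc q J t) = q"
  by (simp_all add: enc_def)

definition enc_degrees :: "nat \<Rightarrow> (bool \<times> nat) list \<Rightarrow> nat \<Rightarrow> nat" where
  "enc_degrees q l = (\<lambda>i\<in>{..<q}. if fst (l ! i) then 1 else 0)"

definition enc_coords :: "nat \<Rightarrow> (bool \<times> nat) list \<Rightarrow> nat \<Rightarrow> nat" where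
  "enc_coords q l = (\<lambda>i\<in>{..<q}. snd (l ! i))"

lemma (in ring_cover) lifted_zero_submodule:
  assumes "module R M" shows "lifted UNIV (\<lambda>_. \<zero>\<^bsub>M\<^esub>) (zero_submodule M)"
proof -
  interpret M: module R M by fact
  show ?thesis unfolding lifted_def zero_submodule_def by auto
qed

text \<open>The matrices represent the endomorphisms only modulo \<open>ker\<close>, so the locale
  also fits the complex on the determinants, with the matrices \<open>detm\<close>.\<close>

locale koszul_cover = ring_cover R pi for R :: "('a, 'c) ring_scheme" (structure) and pi :: "'p::comm_ring_1 \<Rightarrow> 'a" +
  fixes q :: nat and F :: "nat \<Rightarrow> ('a, 'm) module" and \<phi> :: "nat \<Rightarrow> 'm \<Rightarrow> 'm" and rk :: "nat \<Rightarrow> nat"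
    and hF :: "nat \<Rightarrow> (nat \<Rightarrow> 'p) \<Rightarrow> 'm" and Am :: "nat \<Rightarrow> 'p mat"
  assumes cov: "covers q F rk hF" and lin: "i < q \<Longrightarrow> \<phi> i \<in> linear_maps R (F i) (F i)"
    and Am: "i < q \<Longrightarrow> Am i \<in> carrier_mat (rk i) (rk i)"
    and Am_coord: "i < q \<Longrightarrow> s < rk i \<Longrightarrow> t < rk i \<Longrightarrow> Am i $$ (s, t) - coord (hF i) (\<phi> i (hF i (delta_fun t))) s \<in> ker"
begin

definition "fs = map Am [0..<q]"
definition "MJ J i = obj (koszul1 (F i) (\<phi> i)) (J i)" for J :: "nat \<Rightarrow> nat" and i
text \<open>Above degree 1 the factor is the zero module. Rank 0 leaves no multi-indices there, so
  such summands need no separate theory.\<close>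

definition "rJ J i = (if J i \<le> 1 then rk i else 0)" for J :: "nat \<Rightarrow> nat" and i
definition "hJ J i = (if J i \<le> 1 then hF i else (\<lambda>_. \<zero>\<^bsub>F i\<^esub>))" for J :: "nat \<Rightarrow> nat" and i
definition "hTJ J = tensor_cover q (MJ J) (rJ J) (hJ J)"
text \<open>Covers degree \<open>n\<close> of the complex by functions on all lists; values at lists
  of other degrees are ignored, just as in \<open>Zc\<close> and \<open>Bc\<close>.\<close>

definition "Th n X = (\<lambda>J\<in>multidegrees q n. hTJ J (\<lambda>t. X (enc q J t)))"
definition "K = koszul R q F \<phi>"

lemma covJ: "covers q (MJ J) (rJ J) (hJ J)"
  unfolding covers_def
proof (intro allI impI)
  fix i assume i: "i < q"
  note c = coversD[OF cov i]
  show "lifted UNIV (hJ J i) (MJ J i) \<and> (\<forall>c. hJ J i c = \<zero>\<^bsub>MJ J i\<^esub> \<longleftrightarrow> (\<forall>j<rJ J i. c j \<in> ker))"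
  proof (cases "J i \<le> 1")
    case True
    then show ?thesis using c(1,2) by (simp add: MJ_def rJ_def hJ_def koszul1_def)
  next
    case False
    have "lifted UNIV (\<lambda>_. \<zero>\<^bsub>F i\<^esub>) (zero_submodule (F i))"
      by (rule lifted_zero_submodule[OF c(3)])
    then show ?thesis using False by (simp add: MJ_def rJ_def hJ_def koszul1_def zero_submodule_def)
  qed
qed

lemma lifted_hTJ: "lifted UNIV (hTJ J) (tensor_product R q (MJ J))"
  unfolding hTJ_def by (rule lifted_tensor_cover[OF covJ])

lemma hTJ_eq_iff: "hTJ J Y = hTJ J Y' \<longleftrightarrow> (\<forall>t\<in>multi_index q (rJ J). Y t - Y' t \<in> ker)"
  unfolding hTJ_def by (rule tensor_cover_eq_iff[OF covJ])

lemma obj_K: "obj K n = direct_sum_module (multidegrees q n) (\<lambda>J. tensor_product R q (MJ J))"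
  by (simp add: K_def koszul_def tensor_complex_def Let_def MJ_def[abs_def])

lemma multi_index_rJ: assumes "t \<in> multi_index q (rJ J)" "i < q" shows "J i \<le> 1" "t i < rk i" "J i = 1 \<or> J i = 0"
  using ixD[OF assms] by (auto simp: rJ_def split: if_splits)

lemma enc_degrees_enc: assumes "J \<in> multidegrees q n" "t \<in> multi_index q (rJ J)" shows "enc_degrees q (enc q J t) = J"
proof
  fix i show "enc_degrees q (enc q J t) i = J i"
    using multi_index_rJ[OF assms(2), of i] assms(1)
    by (cases "i < q") (auto simp: enc_degrees_def enc_nth multidegrees_def PiE_def extensional_def)
qed

lemma enc_coords_enc: assumes "t \<in> multi_index q rr" shows "enc_coords q (enc q J t) = t"
proof
  fix i show "enc_coords q (enc q J t) i = t i"
    using assms by (cases "i < q") (auto simp: enc_coords_def enc_nth multi_index_def PiE_def extensional_def)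
qed

lemma length_fs: "length fs = q" and fs_nth: "i < q \<Longrightarrow> fs ! i = Am i"
  by (simp_all add: fs_def)

lemma sq_fs: "sq fs"
  unfolding sq_def fs_def
proof
  fix A assume "A \<in> set (map Am [0..<q])"
  then obtain i where "i < q" "A = Am i" by auto
  then show "A \<in> carrier_mat (dim_row A) (dim_row A)" using Am[of i] carrier_matD(1)[OF Am[of i]] by simp
qed

lemma fs_row: "i < q \<Longrightarrow> dim_row (fs ! i) = rk i"
  using Am[of i] by (simp add: fs_nth)

lemma enc_idx: assumes "t \<in> multi_index q (rJ J)" shows "enc q J t \<in> idx fs"
  using multi_index_rJ(2)[OF assms] by (simp add: mem_idx_iff length_fs length_enc enc_nth fs_row)

lemma enc_hdeg:
  assumes "J \<in> multidegrees q n" "t \<in> multi_index q (rJ J)" shows "hdeg (enc q J t) = int n"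
proof -
  have "hdeg (enc q J t) = (\<Sum>i<q. if fst (enc q J t ! i) then 1 else 0)" by (simp add: hdeg_sum length_enc)
  also have "\<dots> = (\<Sum>i<q. int (J i))"
    by (rule sum.cong[OF refl]) (use multi_index_rJ(3)[OF assms(2)] in \<open>auto simp: enc_nth\<close>)
  also have "\<dots> = int n" using assms(1) by (simp add: multidegrees_def of_nat_sum[symmetric])
  finally show ?thesis .
qed

lemma idx_enc:
  assumes "l \<in> idx fs" "hdeg l = int n"
  shows "enc_degrees q l \<in> multidegrees q n" "enc_coords q l \<in> multi_index q (rJ (enc_degrees q l))" "enc q (enc_degrees q l) (enc_coords q l) = l"
proof -
  have l: "length l = q" "\<And>i. i < q \<Longrightarrow> snd (l ! i) < rk i" using assms(1) by (auto simp: mem_idx_iff length_fs fs_row)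
  have "int (\<Sum>i<q. enc_degrees q l i) = (\<Sum>i<q. if fst (l ! i) then 1 else 0)"
    unfolding of_nat_sum by (rule sum.cong) (auto simp: enc_degrees_def)
  then have "int (\<Sum>i<q. enc_degrees q l i) = int n" using assms(2) by (simp add: hdeg_sum l(1))
  then have "(\<Sum>i<q. enc_degrees q l i) = n" by (simp only: of_nat_eq_iff)
  then show "enc_degrees q l \<in> multidegrees q n" by (simp add: multidegrees_def) (simp add: enc_degrees_def)
  show "enc_coords q l \<in> multi_index q (rJ (enc_degrees q l))" using l(2) by (auto simp: enc_coords_def multi_index_def rJ_def enc_degrees_def)
  show "enc q (enc_degrees q l) (enc_coords q l) = l"
    by (rule nth_equalityI) (auto simp: length_enc l(1) enc_nth enc_degrees_def enc_coords_def prod_eq_iff)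
qed

lemma Th_eq_iff: "Th n X = Th n X' \<longleftrightarrow> (\<forall>l\<in>idx fs. hdeg l = int n \<longrightarrow> X l - X' l \<in> ker)"
proof -
  have "Th n X = Th n X' \<longleftrightarrow> (\<forall>J\<in>multidegrees q n. hTJ J (\<lambda>t. X (enc q J t)) = hTJ J (\<lambda>t. X' (enc q J t)))"
    unfolding Th_def fun_eq_iff restrict_def by auto
  also have "\<dots> \<longleftrightarrow> (\<forall>J\<in>multidegrees q n. \<forall>t\<in>multi_index q (rJ J). X (enc q J t) - X' (enc q J t) \<in> ker)"
    unfolding hTJ_eq_iff ..
  also have "\<dots> \<longleftrightarrow> (\<forall>l\<in>idx fs. hdeg l = int n \<longrightarrow> X l - X' l \<in> ker)"
  proof (intro iffI ballI impI)
    fix l assume h: "\<forall>J\<in>multidegrees q n. \<forall>t\<in>multi_index q (rJ J). X (enc q J t) - X' (enc q J t) \<in> ker"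
      and l: "l \<in> idx fs" "hdeg l = int n"
    show "X l - X' l \<in> ker" using h[rule_format, OF idx_enc(1,2)[OF l]] unfolding idx_enc(3)[OF l] .
  next
    fix J t assume h: "\<forall>l\<in>idx fs. hdeg l = int n \<longrightarrow> X l - X' l \<in> ker" and J: "J \<in> multidegrees q n" "t \<in> multi_index q (rJ J)"
    show "X (enc q J t) - X' (enc q J t) \<in> ker" using h[rule_format, OF enc_idx[OF J(2)] enc_hdeg[OF J]] .
  qed
  finally show ?thesis .
qed

lemma lifted_Th: "lifted UNIV (Th n) (obj K n)"
  unfolding lifted_def
proof (intro conjI ballI allI)
  note L = liftedD[OF lifted_hTJ]
  show "submod (UNIV :: ((bool \<times> nat) list \<Rightarrow> 'p) set)" by simp
  show "Th n ` UNIV = carrier (obj K n)"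
  proof (rule equalityI; rule subsetI)
    fix u assume "u \<in> Th n ` UNIV"
    then obtain X where "u = Th n X" by blast
    then show "u \<in> carrier (obj K n)" unfolding obj_K direct_sum_module_def Th_def using L(6)[OF UNIV_I] by auto
  next
    fix u assume "u \<in> carrier (obj K n)"
    then have u: "u \<in> (\<Pi>\<^sub>E J\<in>multidegrees q n. carrier (tensor_product R q (MJ J)))" by (simp add: obj_K direct_sum_module_def)
    have "\<forall>J. \<exists>Y. J \<in> multidegrees q n \<longrightarrow> hTJ J Y = u J"
    proof
      fix J show "\<exists>Y. J \<in> multidegrees q n \<longrightarrow> hTJ J Y = u J"
      proof (cases "J \<in> multidegrees q n")
        case True
        then have "u J \<in> range (hTJ J)" using u L(2)[of J] by auto
        then show ?thesis by auto
      qed simp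
    qed
    from choice[OF this] obtain Y where Y: "\<And>J. J \<in> multidegrees q n \<Longrightarrow> hTJ J (Y J) = u J" by blast
    define X where "X l = Y (enc_degrees q l) (enc_coords q l)" for l
    have "Th n X J = u J" for J
    proof (cases "J \<in> multidegrees q n")
      case True
      have "hTJ J (\<lambda>t. X (enc q J t)) = hTJ J (Y J)"
        unfolding hTJ_eq_iff by (simp add: X_def enc_degrees_enc[OF True] enc_coords_enc idlD(1)[OF idl_ker])
      then show ?thesis using True Y[OF True] by (simp add: Th_def)
    next
      case False then show ?thesis using u by (auto simp: Th_def PiE_def extensional_def)
    qed
    then have "Th n X = u" by (rule ext)
    then show "u \<in> Th n ` UNIV" by blast
  qed
  show "Th n 0 = \<zero>\<^bsub>obj K n\<^esub>"
  proof -
    have z: "(\<lambda>t. (0 :: (bool \<times> nat) list \<Rightarrow> 'p) (enc q J t)) = 0" for J by (simp add: fun_eq_iff)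
    show ?thesis unfolding Th_def obj_K direct_sum_module_def z L(3) by simp
  qed
  show "Th n (X + Y) = Th n X \<oplus>\<^bsub>obj K n\<^esub> Th n Y" for X Y
  proof -
    have z: "(\<lambda>t. (X + Y) (enc q J t)) = (\<lambda>t. X (enc q J t)) + (\<lambda>t. Y (enc q J t))" for J by (simp add: fun_eq_iff)
    show ?thesis unfolding Th_def obj_K direct_sum_module_def z L(4)[OF UNIV_I UNIV_I] by (auto simp: fun_eq_iff)
  qed
  show "Th n (sm p X) = pi p \<odot>\<^bsub>obj K n\<^esub> Th n X" for p X
  proof -
    have z: "(\<lambda>t. sm p X (enc q J t)) = sm p (\<lambda>t. X (enc q J t))" for J by (simp add: fun_eq_iff sm_apply)
    show ?thesis unfolding Th_def obj_K direct_sum_module_def z L(5)[OF UNIV_I] by (auto simp: fun_eq_iff)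
  qed
qed

lemma bdry_linear:
  assumes "k < q"
  shows "(if k = i then bdry (koszul1 (F i) (\<phi> i)) (J i) else (\<lambda>y. y)) \<in> linear_maps R (MJ (J(i := Suc (J i))) k) (MJ J k)"
proof -
  show ?thesis
  proof (cases "k = i")
    case False then show ?thesis by (auto simp: linear_maps_def MJ_def)
  next
    case True
    interpret M: module R "F i" using coversD(3)[OF cov assms] True by simp
    consider "J i = 0" | "J i = 1" | "J i \<ge> 2" by linarith
    then show ?thesis
    proof cases
      case 1 then show ?thesis using True lin[OF assms] by (simp add: MJ_def koszul1_def)
    next
      case 2 then show ?thesis using True by (auto simp: linear_maps_def MJ_def koszul1_def zero_submodule_def)
    next
      case 3 then show ?thesis using True by (auto simp: linear_maps_def MJ_def koszul1_def zero_submodule_def)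
    qed
  qed
qed

lemma upd_multidegrees:
  assumes "J \<in> multidegrees q n" "i < q" shows "J(i := Suc (J i)) \<in> multidegrees q (Suc n)"
proof -
  have "(\<Sum>k<q. (J(i := Suc (J i))) k) = Suc (J i) + (\<Sum>k\<in>{..<q} - {i}. J k)"
    using assms(2) by (subst sum.remove[of _ i]) (auto intro!: sum.cong)
  also have "\<dots> = Suc (\<Sum>k<q. J k)" using assms(2) by (subst (2) sum.remove[of _ i]) auto
  finally show ?thesis using assms by (auto simp: multidegrees_def PiE_def extensional_def)
qed

text \<open>In the i-th summand the other factors are identities. Up to \<open>ker\<close> only the
  multi-indices that differ from \<open>s\<close> at most at \<open>i\<close> contribute, with a row
  of the matrix as coefficients.\<close>

lemma component_mod:
  assumes s: "s \<in> multi_index q (rJ J)" and i: "i < q"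
  shows "(\<Sum>t\<in>multi_index q (rJ (J(i := Suc (J i)))). X (enc q (J(i := Suc (J i))) t) *
      (\<Prod>k<q. coord (hJ J k) ((if k = i then bdry (koszul1 (F i) (\<phi> i)) (J i) else (\<lambda>y. y)) (hJ (J(i := Suc (J i))) k (delta_fun (t k)))) (s k))) -
    (if fst (enc q J s ! i) then 0 else \<Sum>j<dim_row (fs ! i). fs ! i $$ (snd (enc q J s ! i), j) * X ((enc q J s)[i := (True, j)])) \<in> ker"
    (is "?G - ?H \<in> ker")
proof -
  let ?J = "J(i := Suc (J i))"
  consider "J i = 1" | "J i = 0" using multi_index_rJ(3)[OF s i] by (elim disjE)
  then show ?thesis
  proof cases
    \<comment> \<open>A factor of degree 1 could only be reached from degree 2, where there are no
      indices.\<close>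
    case 1
    have "multi_index q (rJ ?J) = {}"
    proof (rule ccontr)
      assume "multi_index q (rJ ?J) \<noteq> {}"
      then obtain t where "t \<in> multi_index q (rJ ?J)" by blast
      from multi_index_rJ(1)[OF this i] show False using 1 by simp
    qed
    then show ?thesis using 1 i by (simp add: enc_nth idlD(1)[OF idl_ker])
  next
    case 2
    define g where "g t k = (if k = i then Am i $$ (s i, t i) else delta_fun (t k) (s k))" for t :: "nat \<Rightarrow> nat" and k
    have rr: "rJ ?J k = rk k" if "k < q" for k using multi_index_rJ(1)[OF s that] 2 by (simp add: rJ_def)
    have 1: "(\<Prod>k<q. coord (hJ J k) ((if k = i then bdry (koszul1 (F i) (\<phi> i)) (J i) else (\<lambda>y. y)) (hJ ?J k (delta_fun (t k)))) (s k)) - (\<Prod>k<q. g t k) \<in> ker"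
      if t: "t \<in> multi_index q (rJ ?J)" for t
    proof (rule prod_ker)
      fix k assume "k \<in> {..<q}"
      then have k: "k < q" by simp
      have sk: "s k < rk k" "t k < rk k" using multi_index_rJ(2)[OF s k] multi_index_rJ(2)[OF t k] by auto
      have hh: "hJ J k = hF k" "hJ ?J k = hF k" using multi_index_rJ(1)[OF s k] multi_index_rJ(1)[OF t k] by (auto simp: hJ_def)
      show "coord (hJ J k) ((if k = i then bdry (koszul1 (F i) (\<phi> i)) (J i) else (\<lambda>y. y)) (hJ ?J k (delta_fun (t k)))) (s k) - g t k \<in> ker"
      proof (cases "k = i")
        case True
        then show ?thesis using idlD(5)[OF idl_ker Am_coord[OF k sk]] 2 hh by (simp add: g_def koszul1_def)
      next
        case False
        then show ?thesis using coord_hh[OF cov k sk(1), of "delta_fun (t k)"] by (simp add: hh g_def)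
      qed
    qed simp
    have "?G - (\<Sum>t\<in>multi_index q (rJ ?J). X (enc q ?J t) * (\<Prod>k<q. g t k)) =
      (\<Sum>t\<in>multi_index q (rJ ?J). X (enc q ?J t) * ((\<Prod>k<q. coord (hJ J k) ((if k = i then bdry (koszul1 (F i) (\<phi> i)) (J i) else (\<lambda>y. y)) (hJ ?J k (delta_fun (t k)))) (s k)) - (\<Prod>k<q. g t k)))"
      by (simp only: sum_subtractf right_diff_distrib)
    also have "\<dots> \<in> ker" by (rule idl_sum[OF idl_ker], rule idlD(3)[OF idl_ker], rule 1)
    finally have 3: "?G - (\<Sum>t\<in>multi_index q (rJ ?J). X (enc q ?J t) * (\<Prod>k<q. g t k)) \<in> ker" .
    let ?im = "(\<lambda>j. s(i := j)) ` {..<rk i}"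
    have im: "?im \<subseteq> multi_index q (rJ ?J)"
      using s i rr multi_index_rJ(2)[OF s] by (auto simp: multi_index_def PiE_def Pi_def extensional_def)
    have z: "(\<Prod>k<q. g t k) = 0" if t: "t \<in> multi_index q (rJ ?J) - ?im" for t
    proof -
      have "t \<noteq> s(i := t i)" using t multi_index_rJ(2)[of t ?J i] i by blast
      then obtain k where k: "t k \<noteq> (s(i := t i)) k" by blast
      have "k < q"
      proof (rule ccontr)
        assume "\<not> k < q"
        then have "t k = undefined" "s k = undefined" using t s by (auto simp: multi_index_def PiE_def extensional_def)
        then show False using k \<open>\<not> k < q\<close> i by auto
      qed
      moreover have "g t k = 0" using k by (auto simp: g_def delta_fun_def split: if_splits)
      ultimately show ?thesis by (intro prod_zero) auto
    qed
    have "(\<Sum>t\<in>multi_index q (rJ ?J). X (enc q ?J t) * (\<Prod>k<q. g t k)) = (\<Sum>t\<in>?im. X (enc q ?J t) * (\<Prod>k<q. g t k))"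
      by (rule sum.mono_neutral_right[OF finite_multi_index im]) (use z in auto)
    also have "\<dots> = (\<Sum>j<rk i. X (enc q ?J (s(i := j))) * (\<Prod>k<q. g (s(i := j)) k))"
    proof (subst sum.reindex)
      show "inj_on (\<lambda>j. s(i := j)) {..<rk i}" by (rule inj_onI) (metis fun_upd_same)
    qed simp
    also have "\<dots> = (\<Sum>j<rk i. Am i $$ (s i, j) * X ((enc q J s)[i := (True, j)]))"
    proof (rule sum.cong[OF refl])
      fix j
      have "(\<Prod>k<q. g (s(i := j)) k) = Am i $$ (s i, j) * (\<Prod>k\<in>{..<q} - {i}. 1)"
        using i by (subst prod.remove[of _ i]) (auto simp: g_def delta_fun_def intro!: prod.cong)
      moreover have "enc q ?J (s(i := j)) = (enc q J s)[i := (True, j)]"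
        by (rule nth_equalityI) (auto simp: length_enc enc_nth 2 nth_list_update)
      ultimately show "X (enc q ?J (s(i := j))) * (\<Prod>k<q. g (s(i := j)) k) = Am i $$ (s i, j) * X ((enc q J s)[i := (True, j)])"
        by (simp add: mult.commute)
    qed
    also have "\<dots> = ?H" using 2 i by (simp add: enc_nth fs_row) (simp add: fs_nth)
    finally show ?thesis using 3 by simp
  qed
qed

text \<open>Makes the covers \<open>Th\<close> a chain map, surjective in every degree, which is why
  homology can be computed with \<open>kd\<close>.\<close>

lemma bdry_Th: "bdry K n (Th (Suc n) X) = Th n (kd fs X)"
proof
  fix J
  show "bdry K n (Th (Suc n) X) J = Th n (kd fs X) J"
  proof (cases "J \<in> multidegrees q n")
    case False
    then show ?thesis by (simp add: K_def koszul_def tensor_complex_def Let_def Th_def)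
  next
    case True
    let ?T = "tensor_product R q (MJ J)"
    let ?\<psi> = "\<lambda>i k. if k = i then bdry (koszul1 (F i) (\<phi> i)) (J i) else (\<lambda>y. y)"
    define G where "G i s = (\<Sum>t\<in>multi_index q (rJ (J(i := Suc (J i)))). X (enc q (J(i := Suc (J i))) t) *
      (\<Prod>k<q. coord (hJ J k) (?\<psi> i k (hJ (J(i := Suc (J i))) k (delta_fun (t k)))) (s k)))" for i and s :: "nat \<Rightarrow> nat"
    note LT = lifted_hTJ[of J]
    interpret T: module R ?T by (rule lifted_module[OF LT])
    have "bdry K n (Th (Suc n) X) J = (\<Oplus>\<^bsub>?T\<^esub>i\<in>{..<q}. ((\<ominus> \<one>) [^] (\<Sum>k<i. J k)) \<odot>\<^bsub>?T\<^esub>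
        tensor_map R q (MJ J) (?\<psi> i) (Th (Suc n) X (J(i := Suc (J i)))))"
      using True by (simp add: K_def koszul_def tensor_complex_def Let_def MJ_def[abs_def])
    also have "\<dots> = (\<Oplus>\<^bsub>?T\<^esub>i\<in>{..<q}. hTJ J (sm ((- 1) ^ (\<Sum>k<i. J k)) (G i)))"
    proof (rule T.finsum_cong')
      show "(\<lambda>i. hTJ J (sm ((- 1) ^ (\<Sum>k<i. J k)) (G i))) \<in> {..<q} \<rightarrow> carrier ?T"
        using liftedD(6)[OF LT UNIV_I] by blast
      fix i assume "i \<in> {..<q}"
      then have i: "i < q" by simp
      let ?J = "J(i := Suc (J i))"
      have "Th (Suc n) X ?J = hTJ ?J (\<lambda>t. X (enc q ?J t))"
        using upd_multidegrees[OF True i] by (simp add: Th_def)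
      then have "tensor_map R q (MJ J) (?\<psi> i) (Th (Suc n) X ?J) = hTJ J (G i)"
        unfolding hTJ_def G_def[abs_def] using tensor_map_tensor_cover[OF covJ[of ?J] covJ[of J] bdry_linear] by metis
      moreover have "pi ((- 1) ^ (\<Sum>k<i. J k)) = (\<ominus> \<one>) [^] (\<Sum>k<i. J k)" by (simp add: pi_power pi_minus pi_1)
      ultimately show "((\<ominus> \<one>) [^] (\<Sum>k<i. J k)) \<odot>\<^bsub>?T\<^esub> tensor_map R q (MJ J) (?\<psi> i) (Th (Suc n) X ?J) =
          hTJ J (sm ((- 1) ^ (\<Sum>k<i. J k)) (G i))"
        using liftedD(5)[OF LT UNIV_I, of "(- 1) ^ (\<Sum>k<i. J k)" "G i"] by simp
    qed simp
    also have "\<dots> = hTJ J (\<Sum>i<q. sm ((- 1) ^ (\<Sum>k<i. J k)) (G i))"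
      by (rule lifted_finsum[OF LT _ UNIV_I]) simp
    also have "\<dots> = hTJ J (\<lambda>t. kd fs X (enc q J t))"
      unfolding hTJ_eq_iff
    proof
      fix s assume s: "s \<in> multi_index q (rJ J)"
      let ?H = "\<lambda>i. if fst (enc q J s ! i) then 0 else \<Sum>j<dim_row (fs ! i). fs ! i $$ (snd (enc q J s ! i), j) * X ((enc q J s)[i := (True, j)])"
      have "kd fs X (enc q J s) = (\<Sum>i<q. (- 1) ^ (\<Sum>k<i. J k) * ?H i)"
        unfolding kd_closed_form[OF enc_idx[OF s]] length_fs
      proof (rule sum.cong[OF refl])
        fix i assume i: "i \<in> {..<q}"
        have "(\<Sum>k<i. if fst (enc q J s ! k) then 1 else 0) = (\<Sum>k<i. J k)"
        proof (rule sum.cong[OF refl])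
          fix k assume "k \<in> {..<i}"
          then have "k < q" using i by simp
          then show "(if fst (enc q J s ! k) then 1 else 0) = J k" using multi_index_rJ(3)[OF s, of k] by (auto simp: enc_nth)
        qed
        then show "(if fst (enc q J s ! i) then 0 else (- 1) ^ (\<Sum>k<i. if fst (enc q J s ! k) then 1 else 0) *
            (\<Sum>j<dim_row (fs ! i). fs ! i $$ (snd (enc q J s ! i), j) * X ((enc q J s)[i := (True, j)]))) = (- 1) ^ (\<Sum>k<i. J k) * ?H i"
          by simp
      qed
      then have "(\<Sum>i<q. sm ((- 1) ^ (\<Sum>k<i. J k)) (G i)) s - kd fs X (enc q J s) = (\<Sum>i<q. (- 1) ^ (\<Sum>k<i. J k) * (G i s - ?H i))"
        by (simp only: sum_fun_apply sm_apply right_diff_distrib sum_subtractf)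
      also have "\<dots> \<in> ker"
      proof (rule idl_sum[OF idl_ker], rule idlD(3)[OF idl_ker])
        fix i assume "i \<in> {..<q}"
        then show "G i s - ?H i \<in> ker" unfolding G_def using component_mod[OF s] by simp
      qed
      finally show "(\<Sum>i<q. sm ((- 1) ^ (\<Sum>k<i. J k)) (G i)) s - kd fs X (enc q J s) \<in> ker" .
    qed
    finally show ?thesis using True by (simp add: Th_def)
  qed
qed

lemma cycles_K: "cycles K n = Th n ` Zc ker fs (int n)"
proof (cases n)
  case 0
  have "Zc ker fs 0 = UNIV" using hdeg_bounds by (fastforce simp: Zc_def)
  then show ?thesis using liftedD(2)[OF lifted_Th[of 0]] by (simp add: 0)
next
  case (Suc k)
  have e: "bdry K k (Th (Suc k) X) = \<zero>\<^bsub>obj K k\<^esub> \<longleftrightarrow> X \<in> Zc ker fs (int (Suc k))" for X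
  proof -
    have "bdry K k (Th (Suc k) X) = \<zero>\<^bsub>obj K k\<^esub> \<longleftrightarrow> Th k (kd fs X) = Th k 0"
      unfolding bdry_Th liftedD(3)[OF lifted_Th] ..
    then show ?thesis unfolding Th_eq_iff by (simp add: Zc_def add.commute)
  qed
  show ?thesis unfolding Suc cycles.simps liftedD(2)[OF lifted_Th[of "Suc k"], symmetric] using e by auto
qed

lemma boundaries_K: "boundaries K n = Th n ` range (kd fs)"
  unfolding boundaries_def liftedD(2)[OF lifted_Th[of "Suc n"], symmetric] image_image bdry_Th ..

text \<open>Since \<open>Th\<close> is onto and \<open>Th_eq_iff\<close> describes its kernel, a
  cycle has trivial class exactly if it agrees with some \<open>kd fs y\<close> modulo
  \<open>ker\<close> in degree \<open>n\<close>, that is, if it lies in \<open>Bc\<close>.\<close>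

lemma homology_K:
  shows "lifted (Zc ker fs (int n)) (\<lambda>z. a_r_coset ((obj K n)\<lparr>carrier := cycles K n\<rparr>) (boundaries K n) (Th n z)) (homology K n)"
    and "module_length R (homology K n) = hlen ker fs (int n)"
proof -
  let ?Z = "Zc ker fs (int n)" and ?B = "Bc ker fs (int n)"
  let ?M = "(obj K n)\<lparr>carrier := cycles K n\<rparr>" and ?N = "boundaries K n"
  note sZ = submod_Zc[OF idl_ker]
  have lM: "lifted ?Z (Th n) ?M" by (rule lifted_restrict[OF lifted_Th sZ _ cycles_K]) simp
  have rZ: "range (kd fs) \<subseteq> ?Z" using idlD(1)[OF idl_ker] by (auto simp: Zc_def kd_kd)
  have N: "submodule ?N R ?M"
    unfolding boundaries_K by (rule lifted_submodule[OF lM submod_image[OF lin_kd submod_UNIV] rZ])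
  show l: "lifted ?Z (\<lambda>z. a_r_coset ?M ?N (Th n z)) (homology K n)"
    unfolding homology_def by (rule lifted_quotient[OF lM N])
  have "{z \<in> ?Z. a_r_coset ?M ?N (Th n z) = \<zero>\<^bsub>homology K n\<^esub>} = ?B"
  proof -
    have e: "a_r_coset ?M ?N (Th n z) = \<zero>\<^bsub>homology K n\<^esub> \<longleftrightarrow> z \<in> ?B" if "z \<in> ?Z" for z
    proof -
      have "Th n z \<in> ?N \<longleftrightarrow> (\<exists>y. Th n z = Th n (kd fs y))" unfolding boundaries_K by auto
      also have "\<dots> \<longleftrightarrow> z \<in> ?B" unfolding Th_eq_iff by (simp add: Bc_def)
      finally show ?thesis
        using coset_eq_iff[OF lifted_module[OF lM] N liftedD(6)[OF lM that]] by (simp add: homology_def quotient_module_def)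
    qed
    show ?thesis using e Bc_sub_Zc[OF idl_ker, of fs "int n"] by auto
  qed
  then show "module_length R (homology K n) = hlen ker fs (int n)"
    using lifted_length[OF l] by (simp add: hlen_def)
qed

lemma homology_trivial: assumes "hlen ker fs (int n) = 0" shows "carrier (homology K n) = {\<zero>\<^bsub>homology K n\<^esub>}"
proof -
  note l = homology_K(1)[of n] and L = liftedD[OF homology_K(1)[of n]]
  let ?h = "\<lambda>z. a_r_coset ((obj K n)\<lparr>carrier := cycles K n\<rparr>) (boundaries K n) (Th n z)"
  have Z: "{z \<in> Zc ker fs (int n). ?h z = \<zero>\<^bsub>homology K n\<^esub>} = ?h -` {\<zero>\<^bsub>homology K n\<^esub>} \<inter> Zc ker fs (int n)" by auto
  have "len (Zc ker fs (int n)) {z \<in> Zc ker fs (int n). ?h z = \<zero>\<^bsub>homology K n\<^esub>} = 0"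
    using lifted_length[OF l] homology_K(2)[of n] assms by simp
  moreover have "submod {z \<in> Zc ker fs (int n). ?h z = \<zero>\<^bsub>homology K n\<^esub>}"
  proof -
    interpret H: module R "homology K n" by (rule lifted_module[OF l])
    have "submodule {\<zero>\<^bsub>homology K n\<^esub>} R (homology K n)" by (rule H.submoduleI) auto
    from lifted_vimage(1)[OF l this] show ?thesis by simp
  qed
  ultimately have "Zc ker fs (int n) = {z \<in> Zc ker fs (int n). ?h z = \<zero>\<^bsub>homology K n\<^esub>}"
    using len_eq_0_iff[OF L(1)] by auto
  then have "?h z = \<zero>\<^bsub>homology K n\<^esub>" if "z \<in> Zc ker fs (int n)" for z using that by blast
  then have "carrier (homology K n) \<subseteq> {\<zero>\<^bsub>homology K n\<^esub>}" unfolding L(2)[symmetric] by blast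
  moreover have "\<zero>\<^bsub>homology K n\<^esub> \<in> carrier (homology K n)" using L(3) L(6)[OF submod_0[OF L(1)]] by simp
  ultimately show ?thesis by blast
qed

lemma euler_char_K: "euler_char R K = (\<Sum>k\<le>q. (- 1) ^ k * int (the_enat (hlen ker fs (int k))))"
proof -
  have "{n. hlen ker fs (int n) \<noteq> 0} \<subseteq> {..q}"
    using hlen_outside[OF idl_ker, of _ fs] by (force simp: length_fs not_le[symmetric])
  then have "(\<Sum>n | hlen ker fs (int n) \<noteq> 0. (- 1) ^ n * int (the_enat (hlen ker fs (int n)))) =
      (\<Sum>k\<le>q. (- 1) ^ k * int (the_enat (hlen ker fs (int k))))"
    by (intro sum.mono_neutral_left) (auto simp: zero_enat_def)
  then show ?thesis by (simp add: euler_char_def homology_K(2))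
qed

end

section \<open>Bases and determinants\<close>

context ring_cover begin

definition basis_map :: "('a, 'm) module \<Rightarrow> nat \<Rightarrow> (nat \<Rightarrow> 'm) \<Rightarrow> (nat \<Rightarrow> 'p) \<Rightarrow> 'm" where
  "basis_map M r b c = (\<Oplus>\<^bsub>M\<^esub>j\<in>{..<r}. pi (c j) \<odot>\<^bsub>M\<^esub> b j)"

lemma basis_map_cover:
  assumes M: "module R M" and B: "module_basis R M r b"
  shows "lifted UNIV (basis_map M r b) M"
    "basis_map M r b c = \<zero>\<^bsub>M\<^esub> \<longleftrightarrow> (\<forall>j<r. c j \<in> ker)"
    "t < r \<Longrightarrow> basis_map M r b (delta_fun t) = b t"
    "x \<in> carrier M \<Longrightarrow> j < r \<Longrightarrow> coordinates R M r b x j = pi (coord (basis_map M r b) x j)"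
proof -
  interpret M: module R M by fact
  let ?h = "basis_map M r b"
  have b: "b j \<in> carrier M" if "j < r" for j using B that by (auto simp: module_basis_def)
  have uniq: "\<And>x. x \<in> carrier M \<Longrightarrow> \<exists>!c. c \<in> {..<r} \<rightarrow>\<^sub>E carrier R \<and> x = (\<Oplus>\<^bsub>M\<^esub>j\<in>{..<r}. c j \<odot>\<^bsub>M\<^esub> b j)"
    using B by (auto simp: module_basis_def)
  have cl: "(\<lambda>j. pi (c j) \<odot>\<^bsub>M\<^esub> b j) \<in> {..<r} \<rightarrow> carrier M" for c using b by auto
  have hc: "?h c \<in> carrier M" for c unfolding basis_map_def by (rule M.finsum_closed[OF cl])
  have eqI: "?h c = (\<Oplus>\<^bsub>M\<^esub>j\<in>{..<r}. e j \<odot>\<^bsub>M\<^esub> b j)" if "\<And>j. j < r \<Longrightarrow> e j = pi (c j)" for c e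
    unfolding basis_map_def by (rule M.finsum_cong'[OF refl]) (use that b in auto)
  have z: "?h c = \<zero>\<^bsub>M\<^esub>" if "\<forall>j<r. c j \<in> ker" for c
  proof -
    have "?h c = (\<Oplus>\<^bsub>M\<^esub>j\<in>{..<r}. \<zero>\<^bsub>M\<^esub>)"
      unfolding basis_map_def by (rule M.finsum_cong'[OF refl]) (use that b in \<open>auto simp: ker_def\<close>)
    then show ?thesis by simp
  qed
  have rep: "?h c = (\<Oplus>\<^bsub>M\<^esub>j\<in>{..<r}. (\<lambda>j\<in>{..<r}. pi (c j)) j \<odot>\<^bsub>M\<^esub> b j)" "(\<lambda>j\<in>{..<r}. pi (c j)) \<in> {..<r} \<rightarrow>\<^sub>E carrier R" for c
    by (rule eqI) auto
  have co: "coordinates R M r b (?h c) = (\<lambda>j\<in>{..<r}. pi (c j))" for c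
    unfolding coordinates_def by (rule the1_equality[OF uniq[OF hc]], rule conjI, rule rep(2), rule rep(1))
  show l: "lifted UNIV ?h M"
    unfolding lifted_def
  proof (intro conjI ballI allI)
    show "submod (UNIV :: (nat \<Rightarrow> 'p) set)" by simp
    show "?h ` UNIV = carrier M"
    proof (rule equalityI; rule subsetI)
      fix x assume "x \<in> ?h ` UNIV" then show "x \<in> carrier M" using hc by auto
    next
      fix x assume "x \<in> carrier M"
      from ex1_implies_ex[OF uniq[OF this]] obtain c
        where c: "c \<in> {..<r} \<rightarrow>\<^sub>E carrier R \<and> x = (\<Oplus>\<^bsub>M\<^esub>j\<in>{..<r}. c j \<odot>\<^bsub>M\<^esub> b j)" ..
      have "c j \<in> carrier R" if "j < r" for j using PiE_mem[OF conjunct1[OF c]] that by simp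
      then have "?h (\<lambda>j. sec (c j)) = (\<Oplus>\<^bsub>M\<^esub>j\<in>{..<r}. c j \<odot>\<^bsub>M\<^esub> b j)"
        by (intro eqI pi_sec[symmetric])
      then have "?h (\<lambda>j. sec (c j)) = x" using conjunct2[OF c] by (rule trans[OF _ sym])
      then show "x \<in> ?h ` UNIV" by blast
    qed
    show "?h 0 = \<zero>\<^bsub>M\<^esub>" by (rule z) (simp add: idlD(1)[OF idl_ker])
    show "?h (c + e) = ?h c \<oplus>\<^bsub>M\<^esub> ?h e" for c e
    proof -
      have "?h (c + e) = (\<Oplus>\<^bsub>M\<^esub>j\<in>{..<r}. pi (c j) \<odot>\<^bsub>M\<^esub> b j \<oplus>\<^bsub>M\<^esub> pi (e j) \<odot>\<^bsub>M\<^esub> b j)"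
        unfolding basis_map_def by (rule M.finsum_cong'[OF refl]) (use b in \<open>auto simp: pi_add M.smult_l_distr\<close>)
      also have "\<dots> = ?h c \<oplus>\<^bsub>M\<^esub> ?h e" unfolding basis_map_def by (rule M.finsum_addf[OF cl cl])
      finally show ?thesis .
    qed
    show "?h (sm p c) = pi p \<odot>\<^bsub>M\<^esub> ?h c" for p c
    proof -
      have "?h (sm p c) = (\<Oplus>\<^bsub>M\<^esub>j\<in>{..<r}. pi p \<odot>\<^bsub>M\<^esub> (pi (c j) \<odot>\<^bsub>M\<^esub> b j))"
        unfolding basis_map_def by (rule M.finsum_cong'[OF refl]) (use b in \<open>auto simp: sm_apply pi_mult M.smult_assoc1\<close>)
      also have "\<dots> = pi p \<odot>\<^bsub>M\<^esub> ?h c" unfolding basis_map_def by (rule M.finsum_smult_ldistr[OF _ pi_closed cl, symmetric]) simp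
      finally show ?thesis .
    qed
  qed
  show "?h c = \<zero>\<^bsub>M\<^esub> \<longleftrightarrow> (\<forall>j<r. c j \<in> ker)"
  proof
    assume h: "?h c = \<zero>\<^bsub>M\<^esub>"
    have "?h c = ?h (\<lambda>_. 0)" unfolding h by (rule z[symmetric]) (simp add: idlD(1)[OF idl_ker])
    then have "(\<lambda>j\<in>{..<r}. pi (c j)) = (\<lambda>j\<in>{..<r}. pi 0)"
      using co[of c] co[of "\<lambda>_. 0"] by simp
    then have "pi (c j) = pi 0" if "j < r" for j using that by (auto dest!: fun_cong[where x = j])
    then show "\<forall>j<r. c j \<in> ker" by (simp add: ker_def pi_0)
  qed (rule z)
  show "?h (delta_fun t) = b t" if t: "t < r"
  proof -
    have "?h (delta_fun t) = (\<Oplus>\<^bsub>M\<^esub>j\<in>{..<r}. if t = j then b j else \<zero>\<^bsub>M\<^esub>)"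
      unfolding basis_map_def by (rule M.finsum_cong'[OF refl]) (use b in \<open>auto simp: delta_fun_def pi_1 pi_0\<close>)
    also have "\<dots> = b t" by (rule M.finsum_singleton) (use t b in auto)
    finally show ?thesis .
  qed
  show "coordinates R M r b x j = pi (coord ?h x j)" if x: "x \<in> carrier M" and j: "j < r"
  proof -
    have "x \<in> range ?h" using liftedD(2)[OF l] x by simp
    then have "\<exists>c. ?h c = x" by auto
    then have "?h (coord ?h x) = x" unfolding coord_def by (rule someI_ex)
    then have "coordinates R M r b x = (\<lambda>j\<in>{..<r}. pi (coord ?h x j))" using co[of "coord ?h x"] by simp
    then show ?thesis using j by simp
  qed
qed

text \<open>\<open>pi\<close> is a ring homomorphism and passes through the Leibniz formula.\<close>

lemma matrix_det_pi:
  assumes "\<And>s t. s < r \<Longrightarrow> t < r \<Longrightarrow> A s t = pi (m s t)"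
  shows "matrix_det R r A = pi (det (mat r r (\<lambda>(s, t). m s t)))"
proof -
  let ?P = "{p. p permutes {0..<r}}" and ?m = "mat r r (\<lambda>(s, t). m s t)"
  have fin: "finite ?P" by (rule finite_permutations) simp
  have sg: "pi (of_int (sign p)) = (if evenperm p then \<one> else \<ominus> \<one>)" for p :: "nat \<Rightarrow> nat"
    by (simp add: sign_def pi_1 pi_minus)
  have "pi (det ?m) = pi (\<Sum>p\<in>?P. of_int (sign p) * (\<Prod>i = 0..<r. ?m $$ (i, p i)))"
    by (subst det_def'[of _ r]) auto
  also have "\<dots> = (\<Oplus>p\<in>?P. pi (of_int (sign p) * (\<Prod>i = 0..<r. ?m $$ (i, p i))))" by (rule pi_sum[OF fin])
  also have "\<dots> = (\<Oplus>p\<in>?P. (if evenperm p then \<one> else \<ominus> \<one>) \<otimes> (\<Otimes>i\<in>{..<r}. A i (p i)))"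
  proof (rule finsum_cong'[OF refl])
    show "(\<lambda>p. (if evenperm p then \<one> else \<ominus> \<one>) \<otimes> (\<Otimes>i\<in>{..<r}. A i (p i))) \<in> ?P \<rightarrow> carrier R"
    proof
      fix p assume p: "p \<in> ?P"
      have "p i < r" if "i < r" for i using permutes_in_image[of p "{0..<r}" i] p that by auto
      then have "(\<lambda>i. A i (p i)) \<in> {..<r} \<rightarrow> carrier R" using assms by auto
      then show "(if evenperm p then \<one> else \<ominus> \<one>) \<otimes> (\<Otimes>i\<in>{..<r}. A i (p i)) \<in> carrier R" by auto
    qed
    fix p assume p: "p \<in> ?P"
    have pr: "p i < r" if "i < r" for i using permutes_in_image[of p "{0..<r}" i] p that by auto
    have "pi (\<Prod>i = 0..<r. ?m $$ (i, p i)) = (\<Otimes>i\<in>{0..<r}. pi (?m $$ (i, p i)))" by (rule pi_prod) simp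
    also have "\<dots> = (\<Otimes>i\<in>{..<r}. A i (p i))"
      by (rule finprod_cong') (use pr assms in \<open>auto simp: lessThan_atLeast0\<close>)
    finally show "pi (of_int (sign p) * (\<Prod>i = 0..<r. ?m $$ (i, p i))) = (if evenperm p then \<one> else \<ominus> \<one>) \<otimes> (\<Otimes>i\<in>{..<r}. A i (p i))"
      by (simp only: pi_mult sg)
  qed
  finally show ?thesis by (simp add: matrix_det_def lessThan_atLeast0)
qed

lemma lifted_ring: "lifted UNIV (\<lambda>x :: unit \<Rightarrow> 'p. pi (x ())) (ring_as_module R)"
  unfolding lifted_def
proof (intro conjI ballI allI)
  show "range (\<lambda>x :: unit \<Rightarrow> 'p. pi (x ())) = carrier (ring_as_module R)"
  proof (rule equalityI; rule subsetI)
    fix u assume "u \<in> carrier (ring_as_module R)"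
    then obtain p where "u = pi p" using pi_surj[of u] by (auto simp: ring_as_module_def)
    then show "u \<in> range (\<lambda>x :: unit \<Rightarrow> 'p. pi (x ()))" by (intro image_eqI[where x = "\<lambda>_. p"]) auto
  qed (auto simp: ring_as_module_def)
qed (auto simp: ring_as_module_def pi_0 pi_add pi_mult sm_apply)

lemma length_quotient_by_ideal:
  assumes I: "ideal I R"
  shows "module_length R (quotient_by_ideal R I) = len UNIV {x :: unit \<Rightarrow> 'p. pi (x ()) \<in> I}"
proof -
  let ?h = "\<lambda>x :: unit \<Rightarrow> 'p. pi (x ())"
  interpret I: ideal I R by fact
  note J = idl_vimage[OF I]
  have s: "submod {x. ?h x \<in> I}" by (rule submodI) (use idlD[OF J] in \<open>auto simp: sm_apply\<close>)
  have "?h ` {x. ?h x \<in> I} = I"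
  proof (rule equalityI; rule subsetI)
    fix u assume u: "u \<in> I"
    then obtain p where "u = pi p" using pi_surj[of u] I.a_Hcarr by blast
    then show "u \<in> ?h ` {x. ?h x \<in> I}" using u by (intro image_eqI[where x = "\<lambda>_. p"]) auto
  qed auto
  then have N: "submodule I R (ring_as_module R)" using lifted_submodule[OF lifted_ring s] by simp
  note l = lifted_quotient[OF lifted_ring N]
  have "{z \<in> UNIV. a_r_coset (ring_as_module R) I (?h z) = \<zero>\<^bsub>quotient_module (ring_as_module R) I\<^esub>} = {x. ?h x \<in> I}"
    using coset_eq_iff[OF lifted_module[OF lifted_ring] N liftedD(6)[OF lifted_ring UNIV_I]]
    by (auto simp: quotient_module_def)
  then show ?thesis using lifted_length[OF l] by (simp add: quotient_by_ideal_def)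
qed

text \<open>By \<open>genideal_iff\<close> the ideals \<open>Jd ker\<close> are the preimages of the
  ideals generated in \<open>R\<close>, so regularity carries over to lifts.\<close>

lemma regular_sequence_lift:
  assumes "regular_sequence R xs"
  shows "i < length (map sec xs) \<Longrightarrow> map sec xs ! i * c \<in> Jd ker (take i (map sec xs)) \<Longrightarrow> c \<in> Jd ker (take i (map sec xs))"
proof -
  assume i: "i < length (map sec xs)" and c: "map sec xs ! i * c \<in> Jd ker (take i (map sec xs))"
  have xs: "x \<in> carrier R" if "x \<in> set xs" for x using assms that by (auto simp: regular_sequence_def)
  have e: "pi ` set (take i (map sec xs)) = set (take i xs)"
    using xs in_set_takeD[of _ i xs] by (force simp: take_map pi_sec image_image)
  have "pi (map sec xs ! i * c) \<in> genideal R (set (take i xs))" using c genideal_iff e by metis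
  moreover have "pi (map sec xs ! i * c) = xs ! i \<otimes> pi c" using i xs by (simp add: pi_mult pi_sec)
  ultimately have "pi c \<in> genideal R (set (take i xs))" using assms i by (auto simp: regular_sequence_def)
  then show "c \<in> Jd ker (take i (map sec xs))" using genideal_iff e by metis
qed

end

text \<open>A finite supremum of a nonempty set in \<open>enat\<close> is a maximum, and
  \<open>d > 0\<close> excludes the empty set, whose supremum is 0.\<close>

lemma depth_attained:
  assumes "depth R \<mm> = enat d" "d > 0"
  shows "\<exists>xs. length xs = d \<and> regular_sequence R xs \<and> set xs \<subseteq> \<mm>"
proof -
  let ?S = "{enat (length xs) | xs. regular_sequence R xs \<and> set xs \<subseteq> \<mm>}"
  have "?S \<noteq> {} \<and> finite ?S"
    using assms unfolding depth_def Sup_enat_def by (auto split: if_splits simp: zero_enat_def)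
  then have "Sup ?S = Max ?S" and "Max ?S \<in> ?S" by (simp_all only: Sup_enat_def Max_in if_False if_True simp_thms)
  then have "enat d \<in> ?S" using assms(1) unfolding depth_def by metis
  then show ?thesis by auto
qed

theorem theorem21:
  fixes R :: "('a, 'c) ring_scheme"
    and \<mm> :: "'a set"
    and d q :: nat
    and F :: "nat \<Rightarrow> ('a, 'm) module"
    and r :: "nat \<Rightarrow> nat"
    and \<phi> :: "nat \<Rightarrow> 'm \<Rightarrow> 'm"
  assumes "noetherian_local_ring R \<mm>"
    and "krull_dim R = enat d" and "d > 0"
    and "infinite (carrier (R Quot \<mm>))"
    and "\<And>i. i < q \<Longrightarrow> r i \<ge> 1"
    and "\<And>i. i < q \<Longrightarrow> free_module_of_rank R (F i) (r i)"
    and "\<And>i. i < q \<Longrightarrow> \<phi> i \<in> linear_maps R (F i) (F i)"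
  shows "let \<delta> = (\<lambda>i. endo_det R (F i) (\<phi> i));
             I = genideal R (\<delta> ` {..<q});
             K = koszul R q F \<phi>;
             K' = koszul_elements R q \<delta>
         in (finite_length_homology R K \<longleftrightarrow> finite_colength R I) \<and>
            (finite_colength R I \<longrightarrow> euler_char R K = euler_char R K') \<and>
            (finite_colength R I \<and> cohen_macaulay_local R \<mm> \<and> q = d \<longrightarrow>
               acyclic_complex K \<and> acyclic_complex K' \<and>
               module_length R (homology K 0) = module_length R (quotient_by_ideal R I))"
proof -
  have cr: "cring R" using assms(1) by (simp add: noetherian_local_ring_def)
  interpret cring R by (rule cr)
  interpret ring_cover R "univ_map R"
    by unfold_locales (auto simp: univ_map_closed univ_map_add univ_map_mult univ_map_1 univ_map_surj)
  let ?pi = "univ_map R"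
  define \<delta> where "\<delta> i = endo_det R (F i) (\<phi> i)" for i
  \<comment> \<open>The same choice as inside \<open>endo_det\<close>, so that its determinant is
    taken with respect to this very basis.\<close>
  define rb where "rb i = (SOME (r, b). module_basis R (F i) r b)" for i
  define rk where "rk i = fst (rb i)" for i
  define b where "b i = snd (rb i)" for i
  define hF where "hF i = basis_map (F i) (rk i) (b i)" for i
  define Am where "Am i = mat (rk i) (rk i) (\<lambda>(s, t). coord (hF i) (\<phi> i (hF i (delta_fun t))) s)" for i
  have mod: "module R (F i)" if "i < q" for i using assms(6)[OF that] by (simp add: free_module_of_rank_def)
  have B: "module_basis R (F i) (rk i) (b i)" if i: "i < q" for i
  proof -
    obtain c where "module_basis R (F i) (r i) c" using assms(6)[OF i] by (auto simp: free_module_of_rank_def)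
    then have "case (r i, c) of (r, b) \<Rightarrow> module_basis R (F i) r b" by simp
    then have "case rb i of (r, b) \<Rightarrow> module_basis R (F i) r b" unfolding rb_def by (rule someI)
    then show ?thesis by (simp add: rk_def b_def case_prod_beta)
  qed
  have cov: "covers q F rk hF"
    unfolding covers_def hF_def using basis_map_cover(1,2)[OF mod B] by blast
  interpret k1: koszul_cover R "univ_map R" q F \<phi> rk hF Am
  proof
    show "covers q F rk hF" by (rule cov)
    show "\<phi> i \<in> linear_maps R (F i) (F i)" if "i < q" for i by (rule assms(7)[OF that])
    show "Am i \<in> carrier_mat (rk i) (rk i)" for i by (simp add: Am_def)
    show "Am i $$ (s, t) - coord (hF i) (\<phi> i (hF i (delta_fun t))) s \<in> ker" if "s < rk i" "t < rk i" for i s t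
      using that idlD(1)[OF idl_ker] by (simp add: Am_def)
  qed
  have \<delta>: "\<delta> i = ?pi (det (Am i))" if i: "i < q" for i
  proof -
    have "\<delta> i = matrix_det R (rk i) (\<lambda>s t. coordinates R (F i) (rk i) (b i) (\<phi> i (b i t)) s)"
      unfolding \<delta>_def endo_det_def rb_def[symmetric] by (simp add: rk_def b_def case_prod_beta)
    also have "\<dots> = ?pi (det (Am i))"
      unfolding Am_def
    proof (rule matrix_det_pi)
      fix s t assume st: "s < rk i" "t < rk i"
      have basis_tuple: "b i t = hF i (delta_fun t)" unfolding hF_def by (rule basis_map_cover(3)[OF mod[OF i] B[OF i] st(2), symmetric])
      have "hF i (delta_fun t) \<in> carrier (F i)" by (rule coversD(4)[OF cov i])
      then have "\<phi> i (b i t) \<in> carrier (F i)" using assms(7)[OF i] by (auto simp: basis_tuple linear_maps_def)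
      from basis_map_cover(4)[OF mod[OF i] B[OF i] this st(1)]
      show "coordinates R (F i) (rk i) (b i) (\<phi> i (b i t)) s = ?pi (coord (hF i) (\<phi> i (hF i (delta_fun t))) s)"
        by (simp add: hF_def[symmetric] basis_tuple)
    qed
    finally show ?thesis .
  qed
  define h1 where "h1 i c = ?pi (c 0)" for i :: nat and c :: "nat \<Rightarrow> ('a multiset \<Rightarrow>\<^sub>0 int)"
  have surj: "\<exists>y\<in>UNIV. ?pi (y (0::nat)) = u" if "u \<in> carrier (ring_as_module R)" for u
  proof -
    have "u \<in> carrier R" using that by (simp add: ring_as_module_def)
    then obtain p where "?pi p = u" using pi_surj by blast
    then show ?thesis by (intro bexI[of _ "\<lambda>_. p"]) auto
  qed
  have l1: "lifted UNIV (h1 i) (ring_as_module R)" for i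
    unfolding h1_def
    by (rule lifted_comp[OF lifted_ring, where g = "\<lambda>c _. c 0"])
      (use surj in \<open>auto intro!: linI simp: fun_eq_iff sm_apply\<close>)
  have cov1: "covers q (\<lambda>_. ring_as_module R) (\<lambda>_. 1) h1"
    unfolding covers_def using l1 by (auto simp: h1_def ker_def ring_as_module_def)
  \<comment> \<open>The complex on the determinants is the case of rank one; its list of matrices is
    \<open>map detm\<close> of the first list, the form that the comparison theorems
    require.\<close>
  interpret k2: koszul_cover R "univ_map R" q "\<lambda>_. ring_as_module R" "\<lambda>i x. \<delta> i \<otimes>\<^bsub>R\<^esub> x" "\<lambda>_. 1" h1 "\<lambda>i. detm (Am i)"
  proof
    show "covers q (\<lambda>_. ring_as_module R) (\<lambda>_. 1) h1" by (rule cov1)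
    show "(\<lambda>x. \<delta> i \<otimes>\<^bsub>R\<^esub> x) \<in> linear_maps R (ring_as_module R) (ring_as_module R)" if "i < q" for i
      using \<delta>[OF that] pi_closed by (auto simp: linear_maps_def ring_as_module_def r_distr m_lcomm)
    show "detm (Am i) \<in> carrier_mat 1 1" for i by simp
    show "detm (Am i) $$ (s, t) - coord (h1 i) (\<delta> i \<otimes>\<^bsub>R\<^esub> h1 i (delta_fun t)) s \<in> ker" if h: "i < q" "s < 1" "t < 1" for i s t
    proof -
      have st: "s = 0" "t = 0" using h by auto
      have "\<delta> i \<otimes>\<^bsub>R\<^esub> h1 i (delta_fun 0) = h1 i (\<lambda>_. det (Am i))" using \<delta>[OF h(1)] by (simp add: h1_def delta_fun_def pi_1)
      then have "coord (h1 i) (\<delta> i \<otimes>\<^bsub>R\<^esub> h1 i (delta_fun 0)) 0 - det (Am i) \<in> ker"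
        using coord_hh[OF cov1 h(1), of 0 "\<lambda>_. det (Am i)"] by simp
      from idlD(5)[OF idl_ker this] show ?thesis by (simp add: st detm_def)
    qed
  qed
  let ?m = "{p. ?pi p \<in> \<mm>}"
  interpret N: noeth_loc ker ?m by (rule noeth_locI[OF assms(1)])
  have fs2: "k2.fs = map detm k1.fs" by (simp add: k1.fs_def k2.fs_def)
  have KK: "koszul_elements R q \<delta> = k2.K" by (simp add: koszul_elements_def k2.K_def)
  define I where "I = genideal R (\<delta> ` {..<q})"
  have Jd: "?pi p \<in> I \<longleftrightarrow> p \<in> Jd ker (map det k1.fs)" for p
  proof -
    have "\<delta> ` {..<q} = ?pi ` set (map det k1.fs)"
      using \<delta> by (force simp: k1.fs_def image_image)
    then show ?thesis unfolding I_def using genideal_iff[of p "map det k1.fs"] by simp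
  qed
  have "\<delta> ` {..<q} \<subseteq> carrier R" using \<delta> pi_closed by auto
  then have I: "ideal I R" unfolding I_def by (rule genideal_ideal)
  have lenI: "module_length R (quotient_by_ideal R I) = len UNIV {x :: unit \<Rightarrow> _. x () \<in> Jd ker (map det k1.fs)}"
    unfolding length_quotient_by_ideal[OF I] Jd ..
  have colen: "finite_colength R I \<longleftrightarrow> N.primary_dets k1.fs"
    unfolding finite_colength_def finite_length_def lenI N.colength_finite_iff_primary_dets[symmetric] by simp
  have 1: "finite_length_homology R k1.K \<longleftrightarrow> finite_colength R I"
    unfolding finite_length_homology_def finite_length_def k1.homology_K(2) colen N.finite_iff_primary_dets[OF k1.sq_fs, symmetric] by simp
  have 2: "euler_char R k1.K = euler_char R k2.K" if "finite_colength R I"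
    using N.chi_map_detm[OF k1.sq_fs] that unfolding colen k1.euler_char_K k2.euler_char_K fs2 N.chi_def
    by (simp add: k1.length_fs)
  have 3: "acyclic_complex k1.K \<and> acyclic_complex k2.K \<and> module_length R (homology k1.K 0) = module_length R (quotient_by_ideal R I)"
    if h: "finite_colength R I" "cohen_macaulay_local R \<mm>" "q = d"
  proof -
    \<comment> \<open>The Cohen-Macaulay property and \<open>q = d\<close> provide a regular
      sequence with as many elements as there are endomorphisms.\<close>
    have "depth R \<mm> = enat d" using h(2) assms(2) by (simp add: cohen_macaulay_local_def)
    from depth_attained[OF this assms(3)] obtain xs where xs: "length xs = d" "regular_sequence R xs" "set xs \<subseteq> \<mm>" by blast
    have c: "x \<in> carrier R" if "x \<in> set xs" for x using xs(2) that by (auto simp: regular_sequence_def)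
    have m: "set (map sec xs) \<subseteq> ?m" using xs(3) c by (auto simp: pi_sec)
    have len: "length (map sec xs) = length k1.fs" unfolding length_map xs(1) k1.length_fs by (rule h(3)[symmetric])
    note reg = N.hlen_regular[OF k1.sq_fs h(1)[unfolded colen] m len regular_sequence_lift[OF xs(2)]]
    show ?thesis
      unfolding acyclic_complex_def using k1.homology_trivial k2.homology_trivial reg k1.homology_K(2)[of 0]
      by (simp add: fs2 lenI)
  qed
  show ?thesis
    unfolding Let_def \<delta>_def[symmetric] I_def[symmetric] KK k1.K_def[symmetric] using 1 2 3 by blast
qed

end
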